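(* Let $T$ be a finite tree with a unique vertex of maximal degree. Then the following are equivalent. 1. There is a (countable) strongly universal $T$-free graph. 2. There is a (countable) weakly universal $T$-free graph. 3. $T$ is a path or a near-path.
   Context: All graphs are simple, undirected, and finite or countably infinite ("countable"). A graph $G$ is $T$-free if it contains no (not necessarily induced) subgraph isomorphic to $T$. A countable $T$-free graph $G$ is weakly universal if every countable $T$-free graph is isomorphic to a subgraph of $G$; it is strongly universal if every countable $T$-free graph is isomorphic to an induced subgraph of $G$. A near-path is a tree which is not a path, but which is obtained from a path by attaching one edge with one additional vertex to a vertex of the path. *)

theory Defs
  imports "Graph_Theory.Graph_Theory" "HOL-Library.Countable_Set"
begin

text \<open>
  A simple undirected graph is a symmetric loop-free digraph without parallel arcs, i.e. the locale
  predicate \<^const>\<open>pair_bidirected_digraph\<close>: each undirected edge is represented by its two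
  orientations. This allows infinite graphs (\<^const>\<open>pair_graph\<close> adds finiteness) and the null
  graph; the latter is the only countable graph that does not contain the one-vertex tree.
  The coercion \<^const>\<open>with_proj\<close> is inserted silently below.
\<close>

definition countable_graph :: "'a pair_pre_digraph \<Rightarrow> bool" where
  "countable_graph G \<longleftrightarrow> pair_bidirected_digraph G \<and> countable (pverts G)"

definition embeds :: "'a pair_pre_digraph \<Rightarrow> 'b pair_pre_digraph \<Rightarrow> bool" where
  "embeds H G \<longleftrightarrow> (\<exists>K :: 'b pair_pre_digraph. subgraph K G \<and> digraph_iso H K)"

definition induced_embeds :: "'a pair_pre_digraph \<Rightarrow> 'b pair_pre_digraph \<Rightarrow> bool" where
  "induced_embeds H G \<longleftrightarrow> (\<exists>K :: 'b pair_pre_digraph. induced_subgraph K G \<and> digraph_iso H K)"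

definition countable_free :: "'a pair_pre_digraph \<Rightarrow> 'b pair_pre_digraph \<Rightarrow> bool" where
  "countable_free T G \<longleftrightarrow> countable_graph G \<and> \<not> embeds T G"

text \<open>
  Universality quantifies over the graphs whose vertices are natural numbers, and every countable
  graph has an isomorphic copy of this form; the lemmas at the end derive the property for
  graphs over an arbitrary vertex type.
\<close>

definition weakly_universal :: "'a pair_pre_digraph \<Rightarrow> 'b pair_pre_digraph \<Rightarrow> bool" where
  "weakly_universal T U \<longleftrightarrow>
     countable_free T U \<and> (\<forall>G :: nat pair_pre_digraph. countable_free T G \<longrightarrow> embeds G U)"

definition strongly_universal :: "'a pair_pre_digraph \<Rightarrow> 'b pair_pre_digraph \<Rightarrow> bool" where
  "strongly_universal T U \<longleftrightarrow>
     countable_free T U \<and> (\<forall>G :: nat pair_pre_digraph. countable_free T G \<longrightarrow> induced_embeds G U)"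

text \<open>
  The predicate \<^const>\<open>tree\<close> is about digraphs and fails for every symmetric digraph with an arc,
  because traversing an edge back and forth is a directed cycle of length 2. The cycles of an
  undirected graph are the directed cycles of length at least 3.
\<close>

definition finite_tree :: "'a pair_pre_digraph \<Rightarrow> bool" where
  "finite_tree T \<longleftrightarrow>
     pair_graph T \<and> connected T \<and> \<not> (\<exists>p. pre_digraph.cycle T p \<and> 3 \<le> length p)"

definition standard_path :: "nat \<Rightarrow> nat pair_pre_digraph" where
  "standard_path n =
     \<lparr>pverts = {..<n}, parcs = {(i, j). i < n \<and> j < n \<and> (j = Suc i \<or> i = Suc j)}\<rparr>"

definition is_path :: "'a pair_pre_digraph \<Rightarrow> bool" where
  "is_path T \<longleftrightarrow> (\<exists>n\<ge>1. digraph_iso T (standard_path n))"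

definition attach_leaf :: "'a pair_pre_digraph \<Rightarrow> 'a \<Rightarrow> 'a \<Rightarrow> 'a pair_pre_digraph" where
  "attach_leaf P v w = \<lparr>pverts = insert w (pverts P), parcs = parcs P \<union> {(v, w), (w, v)}\<rparr>"

definition is_near_path :: "'a pair_pre_digraph \<Rightarrow> bool" where
  "is_near_path T \<longleftrightarrow> finite_tree T \<and> \<not> is_path T \<and>
     (\<exists>P v w. is_path P \<and> v \<in> pverts P \<and> w \<notin> pverts P \<and> T = attach_leaf P v w)"

definition max_degree_vertex :: "'a pair_pre_digraph \<Rightarrow> 'a \<Rightarrow> bool" where
  "max_degree_vertex T v \<longleftrightarrow>
     v \<in> pverts T \<and> (\<forall>w \<in> pverts T. out_degree T w \<le> out_degree T v)"

lemma digraph_iso_iff_map: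
  fixes H :: "'a pair_pre_digraph" and K :: "'b pair_pre_digraph"
  assumes H: "pair_wf_digraph H"
  shows "digraph_iso H K \<longleftrightarrow>
    (\<exists>f. inj_on f (pverts H) \<and> K = \<lparr>pverts = f ` pverts H, parcs = map_prod f f ` parcs H\<rparr>)"
proof
  assume "digraph_iso H K"
  then obtain h where h: "pre_digraph.digraph_isomorphism (with_proj H) h"
    and K: "with_proj K = app_iso h (with_proj H)"
    by (auto simp: digraph_iso_def)
  let ?f = "iso_verts h"
  have ht: "iso_tail h = fst" "iso_head h = snd" and KV: "pverts K = ?f ` pverts H"
    and KE: "parcs K = iso_arcs h ` parcs H"
    using K by (auto simp: with_proj_def app_iso_def)
  have "iso_arcs h e = map_prod ?f ?f e" if "e \<in> parcs H" for e
    using h that by (auto simp: pre_digraph.digraph_isomorphism_def ht prod_eq_iff)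
  then have "parcs K = map_prod ?f ?f ` parcs H"
    using KE by (metis image_cong)
  moreover have "inj_on ?f (pverts H)"
    using h by (auto simp: pre_digraph.digraph_isomorphism_def)
  ultimately show "\<exists>f. inj_on f (pverts H) \<and>
      K = \<lparr>pverts = f ` pverts H, parcs = map_prod f f ` parcs H\<rparr>"
    using KV by (intro exI[of _ ?f]) simp
next
  assume "\<exists>f. inj_on f (pverts H) \<and>
      K = \<lparr>pverts = f ` pverts H, parcs = map_prod f f ` parcs H\<rparr>"
  then obtain f where f: "inj_on f (pverts H)"
    and K: "K = \<lparr>pverts = f ` pverts H, parcs = map_prod f f ` parcs H\<rparr>" by blast
  let ?h = "\<lparr>iso_verts = f, iso_arcs = map_prod f f, iso_head = snd, iso_tail = fst\<rparr>"
  have sub: "parcs H \<subseteq> pverts H \<times> pverts H"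
    using pair_wf_digraph.wellformed'[OF H] by auto
  have "inj_on (map_prod f f) (parcs H)"
    using map_prod_inj_on[OF f f] sub by (rule inj_on_subset)
  then have "pre_digraph.digraph_isomorphism (with_proj H) ?h"
    using f H by (simp add: pre_digraph.digraph_isomorphism_def wf_digraph_wp_iff)
  moreover have "with_proj K = app_iso ?h (with_proj H)"
    by (simp add: K with_proj_def app_iso_def)
  ultimately show "digraph_iso H K"
    by (auto simp: digraph_iso_def)
qed

lemma embeds_iff_map:
  fixes H :: "'a pair_pre_digraph" and G :: "'b pair_pre_digraph"
  assumes H: "pair_wf_digraph H" and G: "pair_wf_digraph G"
  shows "embeds H G \<longleftrightarrow> (\<exists>f. inj_on f (pverts H) \<and> f ` pverts H \<subseteq> pverts G \<and>
           (\<forall>u v. (u, v) \<in> parcs H \<longrightarrow> (f u, f v) \<in> parcs G))"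
proof
  assume "embeds H G"
  then obtain K :: "'b pair_pre_digraph" and f where "subgraph K G" "inj_on f (pverts H)"
    "K = \<lparr>pverts = f ` pverts H, parcs = map_prod f f ` parcs H\<rparr>"
    unfolding embeds_def digraph_iso_iff_map[OF H] by blast
  then show "\<exists>f. inj_on f (pverts H) \<and> f ` pverts H \<subseteq> pverts G \<and>
      (\<forall>u v. (u, v) \<in> parcs H \<longrightarrow> (f u, f v) \<in> parcs G)"
    by (intro exI[of _ f]) (auto simp: subgraph_def)
next
  assume "\<exists>f. inj_on f (pverts H) \<and> f ` pverts H \<subseteq> pverts G \<and>
      (\<forall>u v. (u, v) \<in> parcs H \<longrightarrow> (f u, f v) \<in> parcs G)"
  then obtain f where f: "inj_on f (pverts H)" "f ` pverts H \<subseteq> pverts G"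
    "\<And>u v. (u, v) \<in> parcs H \<Longrightarrow> (f u, f v) \<in> parcs G" by blast
  let ?K = "\<lparr>pverts = f ` pverts H, parcs = map_prod f f ` parcs H\<rparr>"
  have "pair_wf_digraph ?K"
    using pair_wf_digraph.wellformed'[OF H] by unfold_locales auto
  then have "subgraph ?K G"
    using f G by (auto simp: subgraph_def wf_digraph_wp_iff)
  then show "embeds H G"
    using f(1) unfolding embeds_def digraph_iso_iff_map[OF H] by blast
qed

lemma induced_embeds_iff_map:
  fixes H :: "'a pair_pre_digraph" and G :: "'b pair_pre_digraph"
  assumes H: "pair_wf_digraph H" and G: "pair_wf_digraph G"
  shows "induced_embeds H G \<longleftrightarrow> (\<exists>f. inj_on f (pverts H) \<and> f ` pverts H \<subseteq> pverts G \<and>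
           (\<forall>u\<in>pverts H. \<forall>v\<in>pverts H. (u, v) \<in> parcs H \<longleftrightarrow> (f u, f v) \<in> parcs G))"
proof
  assume "induced_embeds H G"
  then obtain K :: "'b pair_pre_digraph" and f where K: "induced_subgraph K G"
    and f: "inj_on f (pverts H)"
    and Keq: "K = \<lparr>pverts = f ` pverts H, parcs = map_prod f f ` parcs H\<rparr>"
    unfolding induced_embeds_def digraph_iso_iff_map[OF H] by blast
  have arcs: "map_prod f f ` parcs H = {e \<in> parcs G. fst e \<in> f ` pverts H \<and> snd e \<in> f ` pverts H}"
    and verts: "f ` pverts H \<subseteq> pverts G"
    using K by (simp_all add: induced_subgraph_def subgraph_def Keq)
  have "(u, v) \<in> parcs H \<longleftrightarrow> (f u, f v) \<in> parcs G" if uv: "u \<in> pverts H" "v \<in> pverts H" for u v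
  proof
    assume "(u, v) \<in> parcs H"
    then have "(f u, f v) \<in> map_prod f f ` parcs H" by force
    then show "(f u, f v) \<in> parcs G" unfolding arcs by simp
  next
    assume "(f u, f v) \<in> parcs G"
    then have "(f u, f v) \<in> map_prod f f ` parcs H" using uv unfolding arcs by simp
    then obtain a b where ab: "(a, b) \<in> parcs H" "f u = f a" "f v = f b" by auto
    then show "(u, v) \<in> parcs H"
      using f uv pair_wf_digraph.wellformed'[OF H ab(1)] by (auto dest: inj_onD)
  qed
  then show "\<exists>f. inj_on f (pverts H) \<and> f ` pverts H \<subseteq> pverts G \<and>
      (\<forall>u\<in>pverts H. \<forall>v\<in>pverts H. (u, v) \<in> parcs H \<longleftrightarrow> (f u, f v) \<in> parcs G)"
    using f verts by blast
next
  assume "\<exists>f. inj_on f (pverts H) \<and> f ` pverts H \<subseteq> pverts G \<and>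
      (\<forall>u\<in>pverts H. \<forall>v\<in>pverts H. (u, v) \<in> parcs H \<longleftrightarrow> (f u, f v) \<in> parcs G)"
  then obtain f where f: "inj_on f (pverts H)" "f ` pverts H \<subseteq> pverts G"
    "\<And>u v. u \<in> pverts H \<Longrightarrow> v \<in> pverts H \<Longrightarrow> (u, v) \<in> parcs H \<longleftrightarrow> (f u, f v) \<in> parcs G"
    by blast
  note wf = pair_wf_digraph.wellformed'[OF H]
  let ?K = "\<lparr>pverts = f ` pverts H, parcs = map_prod f f ` parcs H\<rparr>"
  have "pair_wf_digraph ?K"
    using wf by unfold_locales auto
  moreover have sub: "(f u, f v) \<in> parcs G" if "(u, v) \<in> parcs H" for u v
    using f(3) wf[OF that] that by blast
  ultimately have "subgraph ?K G"
    using f(2) G by (auto simp: subgraph_def wf_digraph_wp_iff)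
  moreover have "map_prod f f ` parcs H =
      {e \<in> parcs G. fst e \<in> f ` pverts H \<and> snd e \<in> f ` pverts H}" (is "?L = ?R")
  proof (intro equalityI subsetI)
    fix e assume "e \<in> ?L"
    then obtain u v where "(u, v) \<in> parcs H" "e = (f u, f v)" by auto
    then show "e \<in> ?R" using sub wf by auto
  next
    fix e assume "e \<in> ?R"
    then obtain u v where uv: "u \<in> pverts H" "v \<in> pverts H" "e = (f u, f v)" "e \<in> parcs G"
      by (cases e) auto
    then have "(u, v) \<in> parcs H" using f(3) by blast
    then show "e \<in> ?L" using uv(3) by force
  qed
  ultimately have "induced_subgraph ?K G"
    by (simp add: induced_subgraph_def)
  then show "induced_embeds H G"
    using f(1) unfolding induced_embeds_def digraph_iso_iff_map[OF H] by blast
qed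

lemma countable_graph_wf: "countable_graph G \<Longrightarrow> pair_wf_digraph G"
  by (simp add: countable_graph_def pair_bidirected_digraph_def pair_sym_digraph_def)

lemma countable_free_nat_copy:
  fixes T :: "'a pair_pre_digraph" and G :: "'b pair_pre_digraph"
  assumes T: "pair_wf_digraph T" and G: "countable_free T G"
  obtains f where "inj_on f (pverts G)" and
    "countable_free T (\<lparr>pverts = f ` pverts G, parcs = map_prod f f ` parcs G\<rparr> :: nat pair_pre_digraph)"
proof -
  have cG: "countable_graph G" and bG: "pair_bidirected_digraph G" and nG: "\<not> embeds T G"
    using G by (auto simp: countable_free_def countable_graph_def)
  note wG = countable_graph_wf[OF cG]
  note ends = pair_wf_digraph.wellformed'[OF wG]
  obtain f :: "'b \<Rightarrow> nat" where f: "inj_on f (pverts G)"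
    using cG by (auto simp: countable_graph_def countable_def)
  let ?G = "\<lparr>pverts = f ` pverts G, parcs = map_prod f f ` parcs G\<rparr>"
  have wf: "pair_wf_digraph ?G"
    using ends by unfold_locales auto
  have sym: "sym (parcs G)" and loopfree: "\<And>u. (u, u) \<notin> parcs G"
    using bG by (auto simp: pair_bidirected_digraph_def pair_sym_digraph_def
        pair_sym_digraph_axioms_def symmetric_def pair_loopfree_digraph_def
        pair_loopfree_digraph_axioms_def)
  have "symmetric ?G"
    using sym by (fastforce simp: symmetric_def sym_def)
  moreover have "fst e \<noteq> snd e" if e: "e \<in> parcs ?G" for e
  proof -
    obtain x y where xy: "(x, y) \<in> parcs G" "e = (f x, f y)" using e by auto
    then have "x \<noteq> y" using loopfree by blast
    then show ?thesis using xy ends[OF xy(1)] f by (simp add: inj_on_eq_iff)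
  qed
  ultimately have "pair_bidirected_digraph ?G"
    using wf by (simp add: pair_bidirected_digraph_def pair_sym_digraph_def
        pair_sym_digraph_axioms_def pair_loopfree_digraph_def pair_loopfree_digraph_axioms_def)
  then have "countable_graph ?G"
    by (simp add: countable_graph_def countable_subset)
  moreover have "\<not> embeds T ?G"
  proof
    assume "embeds T ?G"
    then obtain g where g: "inj_on g (pverts T)" "g ` pverts T \<subseteq> f ` pverts G"
      "\<And>u v. (u, v) \<in> parcs T \<Longrightarrow> (g u, g v) \<in> map_prod f f ` parcs G"
      unfolding embeds_iff_map[OF T wf] by auto
    let ?i = "the_inv_into (pverts G) f"
    have "inj_on (?i \<circ> g) (pverts T)"
      using g(1,2) inj_on_the_inv_into[OF f] by (meson comp_inj_on inj_on_subset)
    moreover have "(?i \<circ> g) ` pverts T \<subseteq> pverts G"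
      using g(2) the_inv_into_into[OF f] by fastforce
    moreover have "((?i \<circ> g) u, (?i \<circ> g) v) \<in> parcs G" if uv: "(u, v) \<in> parcs T" for u v
    proof -
      obtain a b where ab: "(a, b) \<in> parcs G" "g u = f a" "g v = f b"
        using g(3)[OF uv] by auto
      then show ?thesis using ends[OF ab(1)] f by (simp add: the_inv_into_f_f)
    qed
    ultimately show False
      using nG unfolding embeds_iff_map[OF T wG] by blast
  qed
  ultimately show thesis
    using f that by (simp add: countable_free_def)
qed

lemma weakly_universal_any_type:
  fixes G :: "'c pair_pre_digraph"
  assumes T: "pair_wf_digraph T" and U: "weakly_universal T U" and G: "countable_free T G"
  shows "embeds G U"
proof -
  obtain f where f: "inj_on f (pverts G)" and free:
    "countable_free T (\<lparr>pverts = f ` pverts G, parcs = map_prod f f ` parcs G\<rparr> :: nat pair_pre_digraph)"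
      (is "countable_free T ?G")
    using countable_free_nat_copy[OF T G] by blast
  have wf: "pair_wf_digraph ?G" "pair_wf_digraph U" "pair_wf_digraph G"
    using free U G by (auto simp: weakly_universal_def countable_free_def intro: countable_graph_wf)
  have "embeds ?G U" using U free by (simp add: weakly_universal_def)
  then obtain g where g: "inj_on g (f ` pverts G)" "g ` f ` pverts G \<subseteq> pverts U"
    "\<And>u v. (u, v) \<in> map_prod f f ` parcs G \<Longrightarrow> (g u, g v) \<in> parcs U"
    unfolding embeds_iff_map[OF wf(1,2)] by auto
  have "inj_on (g \<circ> f) (pverts G)" using f g(1) by (rule comp_inj_on)
  moreover have "((g \<circ> f) u, (g \<circ> f) v) \<in> parcs U" if "(u, v) \<in> parcs G" for u v
    using g(3)[of "f u" "f v"] that by force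
  ultimately show ?thesis
    using g(2) unfolding embeds_iff_map[OF wf(3,2)]
    by (intro exI[of _ "g \<circ> f"]) (auto simp: image_comp)
qed

lemma strongly_universal_any_type:
  fixes G :: "'c pair_pre_digraph"
  assumes T: "pair_wf_digraph T" and U: "strongly_universal T U" and G: "countable_free T G"
  shows "induced_embeds G U"
proof -
  obtain f where f: "inj_on f (pverts G)" and free:
    "countable_free T (\<lparr>pverts = f ` pverts G, parcs = map_prod f f ` parcs G\<rparr> :: nat pair_pre_digraph)"
      (is "countable_free T ?G")
    using countable_free_nat_copy[OF T G] by blast
  have wf: "pair_wf_digraph ?G" "pair_wf_digraph U" "pair_wf_digraph G"
    using free U G by (auto simp: strongly_universal_def countable_free_def intro: countable_graph_wf)
  have "induced_embeds ?G U" using U free by (simp add: strongly_universal_def)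
  then obtain g where g: "inj_on g (f ` pverts G)" "g ` f ` pverts G \<subseteq> pverts U"
    "\<And>u v. u \<in> f ` pverts G \<Longrightarrow> v \<in> f ` pverts G \<Longrightarrow>
       (u, v) \<in> map_prod f f ` parcs G \<longleftrightarrow> (g u, g v) \<in> parcs U"
    unfolding induced_embeds_iff_map[OF wf(1,2)] pair_pre_digraph.select_convs by metis
  have "inj_on (g \<circ> f) (pverts G)" using f g(1) by (rule comp_inj_on)
  moreover have "(u, v) \<in> parcs G \<longleftrightarrow> ((g \<circ> f) u, (g \<circ> f) v) \<in> parcs U"
    if uv: "u \<in> pverts G" "v \<in> pverts G" for u v
  proof -
    have "(f u, f v) \<in> map_prod f f ` parcs G \<longleftrightarrow> (u, v) \<in> parcs G"
    proof
      assume "(f u, f v) \<in> map_prod f f ` parcs G"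
      then obtain a b where ab: "(a, b) \<in> parcs G" "f u = f a" "f v = f b" by auto
      then show "(u, v) \<in> parcs G"
        using f uv pair_wf_digraph.wellformed'[OF wf(3) ab(1)] by (auto dest: inj_onD)
    qed force
    then show ?thesis using g(3)[of "f u" "f v"] uv by simp
  qed
  ultimately show ?thesis
    using g(2) unfolding induced_embeds_iff_map[OF wf(3,2)]
    by (intro exI[of _ "g \<circ> f"]) (auto simp: image_comp)
qed

end

theory Submission
  imports Defs "HOL-Library.FuncSet" "HOL-Library.Nat_Bijection"
begin

text \<open>
  \<^bold>\<open>Existence.\<close> In a connected graph without a given near-path, a vertex deep inside a long path
  has no neighbours except its two neighbours on the path. Hence such a graph is a two-way infinite
  path, or a one-way infinite path with a graph of bounded tree-depth hanging at its end, or a finite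
  set of vertices together with a graph of bounded tree-depth. For fixed bounds, the graphs of
  bounded tree-depth are covered by finitely many graphs that have no new small induced subgraphs:
  choose a root in each component, delete it, and replace every component type that occurs at least
  \<open>m\<close> times by infinitely many copies of it. So countably many \<open>T\<close>-free graphs contain all connected
  \<open>T\<close>-free graphs, and their disjoint union, with every part repeated infinitely often, is strongly
  universal.

  \<^bold>\<open>Nonexistence.\<close> If the leaves of \<open>T\<close> are deleted and no leaf is adjacent to the root, then the
  vertices of infinite degree in a universal graph for \<open>T\<close> induce a universal graph for the smaller
  tree, because infinitely many leaves can be attached to every vertex. Repeating this, it remains to
  treat two cases. If the root has degree \<open>k + 1 \<ge> 4\<close> and is adjacent to a leaf, then every connected
  \<open>k\<close>-regular graph of large girth must be a component of \<open>U\<close>: one extra edge would complete a copy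
  of \<open>T\<close>. There are uncountably many such graphs up to isomorphism, since a set of cycle lengths can be
  prescribed. If the root has degree 3, all legs have length at least 2, and one has length exactly 2,
  then one-way infinite chains of two kinds of blocks are \<open>T\<close>-free, and their images in \<open>U\<close> are
  rigid: the image of the initial segment determines the sequence of blocks.
\<close>

text \<open>Freeness only concerns subgraphs with at most |T| vertices, so a graph may be enlarged
  as long as no new small induced subgraph arises. This reduces uncountably many connected graphs to
  countably many saturated ones, and the embeddings come out induced. Nonexistence is a counting
  argument: every set of natural numbers is coded in a connected T-free graph, and finitely many
  vertices of a countable U would determine the set. The obstacle is that an embedding into U need
  not be induced; the graphs are arranged so that a harmful extra edge completes a copy of T.
  Uniqueness of the vertex of maximal degree k + 1 enters here: the other vertices have degree at
  most k and fit into a k-regular graph, and only the root uses the extra edge. For k = 2 the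
  connected regular graphs are the cycles and the two-way infinite path, only countably many;
  therefore degree 3 needs the chains. If leaves were deleted until a root of degree 3 had a leaf as
  a neighbour, a near-path would result, for which a universal graph exists; so deletion stops at a
  leg of length exactly 2.\<close>

definition sgr :: "'a set \<Rightarrow> ('a \<Rightarrow> 'a \<Rightarrow> bool) \<Rightarrow> bool" where
  "sgr V E \<longleftrightarrow> (\<forall>u v. E u v \<longrightarrow> u \<in> V \<and> v \<in> V \<and> u \<noteq> v \<and> E v u)"

definition emb :: "'a set \<Rightarrow> ('a \<Rightarrow> 'a \<Rightarrow> bool) \<Rightarrow> 'b set \<Rightarrow> ('b \<Rightarrow> 'b \<Rightarrow> bool) \<Rightarrow> ('a \<Rightarrow> 'b) \<Rightarrow> bool" where
  "emb V E V' E' f \<longleftrightarrow> inj_on f V \<and> f ` V \<subseteq> V' \<and> (\<forall>u v. E u v \<longrightarrow> E' (f u) (f v))"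

definition iemb :: "'a set \<Rightarrow> ('a \<Rightarrow> 'a \<Rightarrow> bool) \<Rightarrow> 'b set \<Rightarrow> ('b \<Rightarrow> 'b \<Rightarrow> bool) \<Rightarrow> ('a \<Rightarrow> 'b) \<Rightarrow> bool" where
  "iemb V E V' E' f \<longleftrightarrow> inj_on f V \<and> f ` V \<subseteq> V' \<and> (\<forall>u\<in>V. \<forall>v\<in>V. E u v \<longleftrightarrow> E' (f u) (f v))"

definition free :: "'a set \<Rightarrow> ('a \<Rightarrow> 'a \<Rightarrow> bool) \<Rightarrow> 'b set \<Rightarrow> ('b \<Rightarrow> 'b \<Rightarrow> bool) \<Rightarrow> bool" where
  "free VT ET V E \<longleftrightarrow> sgr V E \<and> (\<nexists>f. emb VT ET V E f)"

definition wuniv :: "'a set \<Rightarrow> ('a \<Rightarrow> 'a \<Rightarrow> bool) \<Rightarrow> nat set \<Rightarrow> (nat \<Rightarrow> nat \<Rightarrow> bool) \<Rightarrow> bool" where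
  "wuniv VT ET V E \<longleftrightarrow> free VT ET V E \<and>
     (\<forall>(V' :: nat set) E'. free VT ET V' E' \<longrightarrow> (\<exists>f. emb V' E' V E f))"

definition suniv :: "'a set \<Rightarrow> ('a \<Rightarrow> 'a \<Rightarrow> bool) \<Rightarrow> nat set \<Rightarrow> (nat \<Rightarrow> nat \<Rightarrow> bool) \<Rightarrow> bool" where
  "suniv VT ET V E \<longleftrightarrow> free VT ET V E \<and>
     (\<forall>(V' :: nat set) E'. free VT ET V' E' \<longrightarrow> (\<exists>f. iemb V' E' V E f))"

lemma sgrD: "sgr V E \<Longrightarrow> E u v \<Longrightarrow> u \<in> V \<and> v \<in> V \<and> u \<noteq> v \<and> E v u"
  by (auto simp: sgr_def)

lemma sgr_sym: "sgr V E \<Longrightarrow> E u v \<longleftrightarrow> E v u"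
  by (auto simp: sgr_def)

lemma emb_comp:
  assumes "emb V1 E1 V2 E2 f" "emb V2 E2 V3 E3 g"
  shows "emb V1 E1 V3 E3 (g \<circ> f)"
  using assms unfolding emb_def
  by (auto intro: comp_inj_on inj_on_subset simp: image_subset_iff)

lemma iemb_comp:
  assumes "iemb V1 E1 V2 E2 f" "iemb V2 E2 V3 E3 g"
  shows "iemb V1 E1 V3 E3 (g \<circ> f)"
  using assms unfolding iemb_def
  by (auto intro: comp_inj_on inj_on_subset simp: image_subset_iff)

lemma iemb_imp_emb: "sgr V E \<Longrightarrow> iemb V E V' E' f \<Longrightarrow> emb V E V' E' f"
  unfolding iemb_def emb_def sgr_def by blast

text \<open>The constructions below live on sums and products of countable types, whereas
  universality speaks of graphs on \<open>nat\<close>. The copy is confined to the range of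
  \<open>to_nat\<close>, because \<open>from_nat\<close> is a left inverse only and has arbitrary
  values elsewhere.\<close>

lemma nat_copy:
  fixes V :: "'c::countable set"
  assumes "sgr V E"
  obtains V' :: "nat set" and E' where "sgr V' E'" "iemb V E V' E' to_nat" "iemb V' E' V E from_nat"
proof
  let ?V = "to_nat ` V" and ?E = "\<lambda>a b. a \<in> range (to_nat :: 'c \<Rightarrow> nat) \<and> b \<in> range (to_nat :: 'c \<Rightarrow> nat) \<and> E (from_nat a) (from_nat b)"
  show "sgr ?V ?E"
    using assms unfolding sgr_def by force
  show "iemb V E ?V ?E to_nat"
    unfolding iemb_def by (auto simp: inj_on_def)
  show "iemb ?V ?E V E from_nat"
    unfolding iemb_def by (auto simp: inj_on_def)
qed

lemma wuniv_any:
  fixes V' :: "'c::countable set"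
  assumes U: "wuniv VT ET V E" and G: "free VT ET V' E'"
  obtains f where "emb V' E' V E f"
proof -
  have sg: "sgr V' E'" using G by (simp add: free_def)
  obtain V2 :: "nat set" and E2 where c: "sgr V2 E2" "iemb V' E' V2 E2 to_nat" "iemb V2 E2 V' E' from_nat"
    using nat_copy[OF sg] by blast
  have "free VT ET V2 E2"
    using G c emb_comp iemb_imp_emb unfolding free_def by metis
  then obtain g where "emb V2 E2 V E g" using U unfolding wuniv_def by blast
  then show thesis using that emb_comp iemb_imp_emb[OF sg c(2)] by blast
qed

lemma suniv_any:
  fixes U :: "'c::countable set"
  assumes "free VT ET U EU"
    and "\<And>(V' :: nat set) E'. free VT ET V' E' \<Longrightarrow> \<exists>f. iemb V' E' U EU f"
  shows "\<exists>V E. suniv VT ET V E"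
proof -
  have sg: "sgr U EU" using assms by (simp add: free_def)
  obtain V2 :: "nat set" and E2 where c: "sgr V2 E2" "iemb U EU V2 E2 to_nat" "iemb V2 E2 U EU from_nat"
    using nat_copy[OF sg] by blast
  have "free VT ET V2 E2"
    using assms(1) c emb_comp iemb_imp_emb unfolding free_def by metis
  moreover have "\<exists>f. iemb V' E' V2 E2 f" if "free VT ET V' E'" for V' :: "nat set" and E'
    using assms(2)[OF that] c(2) iemb_comp by blast
  ultimately show ?thesis unfolding suniv_def by blast
qed

section \<open>Rooted trees and the deletion of leaves\<close>

text \<open>The last conjunct replaces acyclicity: every edge joins a vertex to its parent, and the
  depth \<open>dp\<close> strictly decreases along parents. This allows recursion from the root, and
  deletion of leaves preserves it with the same \<open>par\<close> and \<open>dp\<close>.\<close>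

definition rtree :: "'a set \<Rightarrow> ('a \<Rightarrow> 'a \<Rightarrow> bool) \<Rightarrow> 'a \<Rightarrow> ('a \<Rightarrow> 'a) \<Rightarrow> ('a \<Rightarrow> nat) \<Rightarrow> bool" where
  "rtree V E x par dp \<longleftrightarrow> finite V \<and> sgr V E \<and> x \<in> V \<and> (\<forall>z\<in>V. dp z = 0 \<longleftrightarrow> z = x) \<and>
     (\<forall>z\<in>V - {x}. E z (par z) \<and> dp z = Suc (dp (par z))) \<and>
     (\<forall>z w. E z w \<longrightarrow> (z \<noteq> x \<and> w = par z) \<or> (w \<noteq> x \<and> z = par w))"

definition deg :: "('a \<Rightarrow> 'a \<Rightarrow> bool) \<Rightarrow> 'a \<Rightarrow> nat" where
  "deg E z = card {w. E z w}"

lemma rtreeD: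
  assumes "rtree V E x par dp"
  shows "finite V" "sgr V E" "x \<in> V" "dp x = 0"
    "\<And>z. z \<in> V \<Longrightarrow> dp z = 0 \<longleftrightarrow> z = x"
    "\<And>z. z \<in> V \<Longrightarrow> z \<noteq> x \<Longrightarrow> E z (par z) \<and> E (par z) z \<and> par z \<in> V \<and> dp z = Suc (dp (par z)) \<and> par z \<noteq> z"
    "\<And>z w. E z w \<Longrightarrow> (z \<noteq> x \<and> w = par z) \<or> (w \<noteq> x \<and> z = par w)"
  using assms unfolding rtree_def sgr_def by auto

lemma sgr_finite_nbrs: "sgr V E \<Longrightarrow> finite V \<Longrightarrow> finite {w. E z w}"
  by (rule finite_subset[of _ V]) (auto simp: sgr_def)

lemma rtree_induct [consumes 2, case_names root step]:
  assumes T: "rtree V E x par dp" and "z \<in> V"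
    and "P x" and "\<And>z. z \<in> V \<Longrightarrow> z \<noteq> x \<Longrightarrow> P (par z) \<Longrightarrow> P z"
  shows "P z"
  using \<open>z \<in> V\<close>
proof (induction "dp z" arbitrary: z)
  case 0
  then show ?case using rtreeD(5)[OF T] assms(3) by auto
next
  case (Suc n)
  then have "z \<noteq> x" using rtreeD(4)[OF T] by auto
  then show ?case using Suc rtreeD(6)[OF T Suc.prems] assms(4) by auto
qed

lemma rtree_deg_nonroot:
  assumes T: "rtree V E x par dp" and z: "z \<in> V" "z \<noteq> x"
  shows "{w. E z w} = insert (par z) {w \<in> V. w \<noteq> x \<and> par w = z}"
    and "deg E z = Suc (card {w \<in> V. w \<noteq> x \<and> par w = z})"
proof -
  note [simp] = sgrD[OF rtreeD(2)[OF T]]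
  show *: "{w. E z w} = insert (par z) {w \<in> V. w \<noteq> x \<and> par w = z}"
    using rtreeD(6,7)[OF T] z sgrD[OF rtreeD(2)[OF T]] by auto
  have "par z \<notin> {w \<in> V. w \<noteq> x \<and> par w = z}"
  proof
    assume "par z \<in> {w \<in> V. w \<noteq> x \<and> par w = z}"
    then have "dp (par z) = Suc (dp z)" "dp z = Suc (dp (par z))"
      using rtreeD(6)[OF T, of "par z"] rtreeD(6)[OF T, of z] z by auto
    then show False by simp
  qed
  then show "deg E z = Suc (card {w \<in> V. w \<noteq> x \<and> par w = z})"
    unfolding deg_def * using rtreeD(1)[OF T] by simp
qed

lemma rtree_root_nbrs:
  assumes T: "rtree V E x par dp"
  shows "{w. E x w} = {w \<in> V. w \<noteq> x \<and> par w = x}"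
  using rtreeD(6,7)[OF T] sgrD[OF rtreeD(2)[OF T]] by auto

lemma rtree_dp1:
  assumes T: "rtree V E x par dp" and z: "z \<in> V"
  shows "dp z = 1 \<longleftrightarrow> E x z"
proof
  assume *: "dp z = 1"
  then have "z \<noteq> x" using rtreeD(4)[OF T] by auto
  then have "dp (par z) = 0" "par z \<in> V" "E (par z) z" using * rtreeD(6)[OF T z] by auto
  then show "E x z" using rtreeD(5)[OF T] by auto
next
  assume "E x z"
  then have "z \<noteq> x" "par z = x" using rtree_root_nbrs[OF T] by auto
  then show "dp z = 1" using rtreeD(4)[OF T] rtreeD(6)[OF T z] by auto
qed

lemma inj_choice_infinite:
  assumes "finite L" "\<And>z. z \<in> L \<Longrightarrow> infinite (A z)" "finite F"
  shows "\<exists>g. inj_on g L \<and> (\<forall>z\<in>L. g z \<in> A z - F)"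
  using assms
proof (induction L)
  case (insert z L)
  then obtain g where g: "inj_on g L" "\<forall>z\<in>L. g z \<in> A z - F" by blast
  have "infinite (A z - (F \<union> g ` L))" using insert by simp
  then obtain a where a: "a \<in> A z - (F \<union> g ` L)" using infinite_imp_nonempty by blast
  then show ?case
    using g insert.hyps by (intro exI[of _ "g(z := a)"]) (auto simp: inj_on_def)
qed auto

text \<open>The hypothesis \<open>inner\<close> makes attached pendant vertices harmless: a vertex
  with two neighbours cannot be mapped to one of them, so a copy of the tree in the enlarged graph
  has its pruned part in the original graph.\<close>

lemma prune_universal:
  assumes sg: "sgr VT ET" and fin: "finite VT" and LV: "L \<subseteq> VT"
    and leaf: "\<And>z w. z \<in> L \<Longrightarrow> ET z w \<Longrightarrow> w = nb z"
    and nb: "\<And>z. z \<in> L \<Longrightarrow> nb z \<in> VT - L"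
    and inner: "\<And>z. z \<in> VT - L \<Longrightarrow> \<exists>a b. a \<noteq> b \<and> ET z a \<and> ET z b"
    and U: "wuniv VT ET U EU"
  shows "\<exists>U' EU'. wuniv (VT - L) (\<lambda>a b. ET a b \<and> a \<notin> L \<and> b \<notin> L) U' EU'"
proof -
  let ?ET = "\<lambda>a b. ET a b \<and> a \<notin> L \<and> b \<notin> L"
  let ?I = "{u \<in> U. infinite {w. EU u w}}"
  let ?EI = "\<lambda>a b. EU a b \<and> a \<in> ?I \<and> b \<in> ?I"
  have sU: "sgr U EU" and nU: "\<And>f. \<not> emb VT ET U EU f"
    using U by (auto simp: wuniv_def free_def)
  have "\<not> emb (VT - L) ?ET ?I ?EI f" for f
  proof
    assume f: "emb (VT - L) ?ET ?I ?EI f"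
    then have fI: "\<And>z. z \<in> VT - L \<Longrightarrow> f z \<in> ?I" by (auto simp: emb_def)
    \<comment> \<open>\<open>L\<close> and the image of \<open>f\<close> are finite, while every
      available neighbourhood is infinite, so the leaves find distinct places outside the
      image.\<close>
    have "\<exists>g. inj_on g L \<and> (\<forall>z\<in>L. g z \<in> {w. EU (f (nb z)) w} - f ` (VT - L))"
      using fI nb fin LV finite_subset by (intro inj_choice_infinite) blast+
    then obtain g where g: "inj_on g L" "\<And>z. z \<in> L \<Longrightarrow> EU (f (nb z)) (g z)"
      "\<And>z. z \<in> L \<Longrightarrow> g z \<notin> f ` (VT - L)" by auto
    let ?h = "\<lambda>z. if z \<in> L then g z else f z"
    have "inj_on ?h VT"
    proof (rule inj_onI)
      fix a b assume ab: "a \<in> VT" "b \<in> VT" "?h a = ?h b"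
      have fi: "inj_on f (VT - L)" using f by (simp add: emb_def)
      have no: "g c \<noteq> f d" if "c \<in> L" "d \<in> VT" "d \<notin> L" for c d
        using g(3)[OF that(1)] that by blast
      show "a = b"
        using ab no[of a b] no[of b a] g(1) fi
        by (cases "a \<in> L"; cases "b \<in> L") (auto dest: inj_onD)
    qed
    moreover have "?h ` VT \<subseteq> U"
      using fI sgrD[OF sU g(2)] by auto
    moreover have "EU (?h u) (?h v)" if uv: "ET u v" for u v
    proof -
      have vu: "ET v u" "u \<in> VT" "v \<in> VT" using sgrD[OF sg uv] by auto
      consider "u \<in> L" | "u \<notin> L" "v \<in> L" | "u \<notin> L" "v \<notin> L" by blast
      then show ?thesis
      proof cases
        case 1
        then have "v = nb u" "v \<notin> L" using leaf[OF 1 uv] nb[OF 1] by auto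
        then show ?thesis using g(2)[OF 1] 1 sgr_sym[OF sU] by auto
      next
        case 2
        then show ?thesis using g(2)[OF 2(2)] leaf[OF 2(2) vu(1)] by auto
      next
        case 3
        then show ?thesis using f uv by (auto simp: emb_def)
      qed
    qed
    ultimately have "emb VT ET U EU ?h" by (simp add: emb_def)
    then show False using nU by blast
  qed
  then have "free (VT - L) ?ET ?I ?EI"
    using sU by (auto simp: free_def sgr_def)
  moreover have "\<exists>f. emb V' E' ?I ?EI f" if G: "free (VT - L) ?ET V' E'" for V' :: "nat set" and E'
  proof -
    have sG: "sgr V' E'" and nG: "\<And>f. \<not> emb (VT - L) ?ET V' E' f"
      using G by (auto simp: free_def)
    \<comment> \<open>\<open>(v, 0)\<close> stands for \<open>v\<close>, and the pairs
      \<open>(v, Suc i)\<close> are infinitely many pendant vertices at it.\<close>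
    let ?V = "V' \<times> (UNIV :: nat set)"
    let ?E = "\<lambda>p q. fst p \<in> V' \<and> fst q \<in> V' \<and> (snd p = 0 \<and> snd q = 0 \<and> E' (fst p) (fst q) \<or>
        fst p = fst q \<and> (snd p = 0) \<noteq> (snd q = 0))"
    have "sgr ?V ?E" using sG by (auto simp: sgr_def)
    moreover have "\<not> emb VT ET ?V ?E f" for f
    proof
      assume f: "emb VT ET ?V ?E f"
      have inj: "inj_on f VT" and fE: "\<And>u v. ET u v \<Longrightarrow> ?E (f u) (f v)" using f by (auto simp: emb_def)
      have 0: "snd (f z) = 0" if z: "z \<in> VT - L" for z
      proof (rule ccontr)
        assume *: "snd (f z) \<noteq> 0"
        obtain a b where ab: "a \<noteq> b" "ET z a" "ET z b" using inner[OF z] by blast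
        have "f a = (fst (f z), 0)" "f b = (fst (f z), 0)"
          using * fE[OF ab(2)] fE[OF ab(3)] by (simp_all add: prod_eq_iff)
        then have "f a = f b" by simp
        then show False
          using inj ab sgrD[OF sg ab(2)] sgrD[OF sg ab(3)] by (auto dest: inj_onD)
      qed
      have "emb (VT - L) ?ET V' E' (fst \<circ> f)"
        unfolding emb_def
      proof (intro conjI allI impI)
        show "inj_on (fst \<circ> f) (VT - L)"
        proof (rule inj_onI)
          fix a b assume ab: "a \<in> VT - L" "b \<in> VT - L" "(fst \<circ> f) a = (fst \<circ> f) b"
          then have "f a = f b" using 0 by (simp add: prod_eq_iff)
          then show "a = b" using inj ab by (auto dest: inj_onD)
        qed
        show "(fst \<circ> f) ` (VT - L) \<subseteq> V'" using f by (force simp: emb_def)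
        show "E' ((fst \<circ> f) u) ((fst \<circ> f) v)" if "ET u v \<and> u \<notin> L \<and> v \<notin> L" for u v
          using fE[of u v] that 0[of u] 0[of v] sgrD[OF sg, of u v] by auto
      qed
      then show False using nG by blast
    qed
    ultimately have "free VT ET ?V ?E" by (simp add: free_def)
    then obtain f where f: "emb ?V ?E U EU f" using wuniv_any[OF U] by blast
    have fE: "EU (f p) (f q)" if "?E p q" for p q using f that unfolding emb_def by blast
    have inj: "inj_on f ?V" and fU: "f ` ?V \<subseteq> U" using f by (auto simp: emb_def)
    have fI: "f (v, 0) \<in> ?I" if v: "v \<in> V'" for v
    proof -
      have "inj (\<lambda>i. f (v, Suc i))"
        using inj v by (auto simp: inj_on_def)
      moreover have "range (\<lambda>i. f (v, Suc i)) \<subseteq> {w. EU (f (v, 0)) w}"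
        using fE v by auto
      ultimately have "infinite {w. EU (f (v, 0)) w}"
        using infinite_iff_countable_subset by blast
      then show ?thesis using fU v by auto
    qed
    have "emb V' E' ?I ?EI (\<lambda>v. f (v, 0))"
      unfolding emb_def
    proof (intro conjI allI impI)
      show "inj_on (\<lambda>v. f (v, 0)) V'"
      proof (rule inj_onI)
        fix a b assume "a \<in> V'" "b \<in> V'" "f (a, 0) = f (b, 0)"
        then have "(a, 0 :: nat) = (b, 0)" by (intro inj_onD[OF inj]) auto
        then show "a = b" by simp
      qed
      show "(\<lambda>v. f (v, 0)) ` V' \<subseteq> ?I" using fI by blast
      show "EU (f (u, 0)) (f (v, 0))" if "E' u v" for u v
        using fE[of "(u,0)" "(v,0)"] that sgrD[OF sG that] by simp
      show "f (u, 0) \<in> ?I" "f (v, 0) \<in> ?I" if "E' u v" for u v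
        using fI sgrD[OF sG that] by auto
    qed
    then show ?thesis by blast
  qed
  ultimately show ?thesis unfolding wuniv_def by blast
qed

definition leaves :: "'a set \<Rightarrow> ('a \<Rightarrow> 'a \<Rightarrow> bool) \<Rightarrow> 'a set" where
  "leaves V E = {z \<in> V. deg E z \<le> 1}"

definition prune :: "'a set \<Rightarrow> ('a \<Rightarrow> 'a \<Rightarrow> bool) \<Rightarrow> 'a \<Rightarrow> 'a \<Rightarrow> bool" where
  "prune V E = (\<lambda>a b. E a b \<and> a \<notin> leaves V E \<and> b \<notin> leaves V E)"

lemma leaves_iff:
  assumes T: "rtree V E x par dp" and d: "deg E x \<ge> 2" and z: "z \<in> V"
  shows "z \<in> leaves V E \<longleftrightarrow> z \<noteq> x \<and> \<not> (\<exists>w\<in>V. w \<noteq> x \<and> par w = z)"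
proof (cases "z = x")
  case True
  then show ?thesis using d by (auto simp: leaves_def)
next
  case False
  have "finite {w \<in> V. w \<noteq> x \<and> par w = z}" using rtreeD(1)[OF T] by simp
  then have "deg E z \<le> 1 \<longleftrightarrow> {w \<in> V. w \<noteq> x \<and> par w = z} = {}"
    using rtree_deg_nonroot(2)[OF T z False] by simp
  then show ?thesis using False z by (auto simp: leaves_def)
qed

lemma rtree_prune:
  assumes T: "rtree V E x par dp" and d: "deg E x \<ge> 2"
  shows "rtree (V - leaves V E) (prune V E) x par dp"
proof -
  have par: "par z \<notin> leaves V E" if "z \<in> V" "z \<noteq> x" for z
    using leaves_iff[OF T d, of "par z"] rtreeD(6)[OF T that] that by auto
  have x: "x \<notin> leaves V E" using leaves_iff[OF T d rtreeD(3)[OF T]] by simp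
  have "sgr (V - leaves V E) (prune V E)"
    using rtreeD(2)[OF T] by (auto simp: sgr_def prune_def)
  then show ?thesis
    unfolding rtree_def using par x rtreeD[OF T] by (auto simp: prune_def)
qed

lemma prune_wuniv:
  assumes T: "rtree V E x par dp" and d: "deg E x \<ge> 2" and U: "wuniv V E U EU"
  shows "\<exists>U' EU'. wuniv (V - leaves V E) (prune V E) U' EU'"
  unfolding prune_def
proof (rule prune_universal[OF rtreeD(2,1)[OF T], where nb = par, OF _ _ _ _ U])
  show "leaves V E \<subseteq> V" by (auto simp: leaves_def)
  show "w = par z" if "z \<in> leaves V E" "E z w" for z w
    using that rtreeD(7)[OF T that(2)] leaves_iff[OF T d, of z] sgrD[OF rtreeD(2)[OF T] that(2)] by auto
  show "par z \<in> V - leaves V E" if "z \<in> leaves V E" for z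
    using that leaves_iff[OF T d, of z] leaves_iff[OF T d, of "par z"] rtreeD(6)[OF T, of z]
    by (auto simp: leaves_def)
  show "\<exists>a b. a \<noteq> b \<and> E z a \<and> E z b" if "z \<in> V - leaves V E" for z
  proof -
    have "card {w. E z w} \<ge> 2" using that by (auto simp: leaves_def deg_def)
    then obtain B where "B \<subseteq> {w. E z w}" "card B = 2" "finite B" by (metis obtain_subset_with_card_n)
    then show ?thesis unfolding card_2_iff by blast
  qed
qed

section \<open>Graphs of bounded tree-depth\<close>

definition liemb :: "'a set \<Rightarrow> ('a \<Rightarrow> 'a \<Rightarrow> bool) \<Rightarrow> ('a \<Rightarrow> nat) \<Rightarrow>
    'b set \<Rightarrow> ('b \<Rightarrow> 'b \<Rightarrow> bool) \<Rightarrow> ('b \<Rightarrow> nat) \<Rightarrow> ('a \<Rightarrow> 'b) \<Rightarrow> bool" where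
  "liemb V E l V' E' l' f \<longleftrightarrow> iemb V E V' E' f \<and> (\<forall>u\<in>V. l' (f u) = l u)"

text \<open>
  The second graph contains the first one as an induced labelled subgraph and has, conversely, no new
  induced labelled subgraphs on at most \<open>m\<close> vertices.
\<close>

definition sat :: "nat \<Rightarrow> 'a set \<Rightarrow> ('a \<Rightarrow> 'a \<Rightarrow> bool) \<Rightarrow> ('a \<Rightarrow> nat) \<Rightarrow>
    'b set \<Rightarrow> ('b \<Rightarrow> 'b \<Rightarrow> bool) \<Rightarrow> ('b \<Rightarrow> nat) \<Rightarrow> bool" where
  "sat m V E l V' E' l' \<longleftrightarrow> (\<exists>f. liemb V E l V' E' l' f) \<and>
     (\<forall>A\<subseteq>V'. finite A \<longrightarrow> card A \<le> m \<longrightarrow> (\<exists>g. liemb A E' l' V E l g))"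

text \<open>
  The function \<open>c\<close> maps every vertex to the chosen root of its part, where a part is a union of
  components.
\<close>

primrec tree_depth_le :: "nat \<Rightarrow> 'a set \<Rightarrow> ('a \<Rightarrow> 'a \<Rightarrow> bool) \<Rightarrow> bool" where
  "tree_depth_le 0 V E \<longleftrightarrow> V = {}"
| "tree_depth_le (Suc k) V E \<longleftrightarrow> (\<exists>c. (\<forall>v\<in>V. c v \<in> V \<and> c (c v) = c v) \<and>
     (\<forall>u\<in>V. \<forall>v\<in>V. E u v \<longrightarrow> c u = c v) \<and>
     (\<forall>r\<in>V. c r = r \<longrightarrow> tree_depth_le k ({v \<in> V. c v = r} - {r}) E))"

lemma liemb_comp:
  "liemb V1 E1 l1 V2 E2 l2 f \<Longrightarrow> liemb V2 E2 l2 V3 E3 l3 g \<Longrightarrow> liemb V1 E1 l1 V3 E3 l3 (g \<circ> f)"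
  unfolding liemb_def using iemb_comp[of V1 E1 V2 E2 f V3 E3 g] by (auto simp: iemb_def)

text \<open>The induction step below produces graphs on a product type; they are copied to
  \<open>nat\<close>, so that all families live on the same type. The copy inherits
  \<open>sat\<close> because it is isomorphic to the original including the labels.\<close>

lemma sat_nat_copy:
  fixes V :: "'c::countable set"
  assumes sg: "sgr V E"
  obtains V' :: "nat set" and E' l' where "sgr V' E'"
    "\<And>(V0 :: nat set) E0 l0. sat m V0 E0 l0 V E l \<Longrightarrow> sat m V0 E0 l0 V' E' l'"
proof -
  obtain V2 :: "nat set" and E2 where c: "sgr V2 E2" "iemb V E V2 E2 to_nat" "iemb V2 E2 V E from_nat"
    using nat_copy[OF sg] by blast
  let ?l = "l \<circ> from_nat"
  have 1: "liemb V E l V2 E2 ?l to_nat" using c by (simp add: liemb_def)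
  have 2: "liemb A E2 ?l (from_nat ` A) E l from_nat" if "A \<subseteq> V2" for A
    using c(3) that unfolding liemb_def iemb_def by (auto intro: inj_on_subset)
  have "sat m V0 E0 l0 V2 E2 ?l" if s: "sat m V0 E0 l0 V E l" for V0 :: "nat set" and E0 l0
    unfolding sat_def
  proof (intro conjI allI impI)
    show "\<exists>f. liemb V0 E0 l0 V2 E2 ?l f" using s liemb_comp[OF _ 1] unfolding sat_def by blast
    fix A assume A: "A \<subseteq> V2" "finite A" "card A \<le> m"
    have "from_nat ` A \<subseteq> V" using A(1) c(3) by (auto simp: iemb_def)
    moreover have "card ((from_nat :: nat \<Rightarrow> 'c) ` A) \<le> m" using A card_image_le le_trans by blast
    ultimately obtain g where "liemb (from_nat ` A) E l V0 E0 l0 g"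
      using s A(2) unfolding sat_def by blast
    then show "\<exists>g. liemb A E2 ?l V0 E0 l0 g" using liemb_comp[OF 2[OF A(1)]] by blast
  qed
  then show thesis using that c(1) by blast
qed

lemma inj_into_large:
  assumes "finite A" "finite B \<Longrightarrow> card A \<le> card B"
  shows "\<exists>f. inj_on f A \<and> f ` A \<subseteq> B"
proof (cases "finite B")
  case True
  then show ?thesis using card_le_inj[OF assms(1) True] assms(2) by blast
next
  case False
  then obtain C where "C \<subseteq> B" "finite C" "card C = card A"
    using infinite_arbitrarily_large by blast
  then show ?thesis using card_le_inj[OF assms(1), of C] by (metis order_refl subset_trans)
qed

context
  fixes n m :: nat and FV :: "nat \<Rightarrow> nat set" and FE :: "nat \<Rightarrow> nat \<Rightarrow> nat \<Rightarrow> bool"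
    and Fl :: "nat \<Rightarrow> nat \<Rightarrow> nat" and L :: nat
  assumes sgF: "\<And>j. j < n \<Longrightarrow> sgr (FV j) (FE j)"
begin

text \<open>
  A part has as its type the label of its root and the index of a member of the finite family that
  replaces the part without its root; there are \<open>\<mu> t\<close> copies of type \<open>t\<close>, where \<open>\<mu> t = m\<close> stands for
  infinitely many. In the vertex \<open>(t, i, w)\<close>, \<open>i\<close> is the number of the copy, and \<open>w = None\<close> is the
  root. The parity of a label in the family records adjacency to the root.
\<close>

definition TT :: "(nat \<times> nat) set" where "TT = {..<L} \<times> {..<n}"

definition GV :: "(nat \<times> nat \<Rightarrow> nat) \<Rightarrow> ((nat \<times> nat) \<times> nat \<times> nat option) set" where
  "GV \<mu> = {(t, i, w). t \<in> TT \<and> (i < \<mu> t \<or> \<mu> t = m) \<and> (\<forall>a. w = Some a \<longrightarrow> a \<in> FV (snd t))}"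

fun adj :: "nat \<Rightarrow> nat option \<Rightarrow> nat option \<Rightarrow> bool" where
  "adj j None None = False"
| "adj j None (Some b) = odd (Fl j b)"
| "adj j (Some a) None = odd (Fl j a)"
| "adj j (Some a) (Some b) = FE j a b"

definition GE :: "(nat \<times> nat \<Rightarrow> nat) \<Rightarrow> (nat \<times> nat) \<times> nat \<times> nat option \<Rightarrow> (nat \<times> nat) \<times> nat \<times> nat option \<Rightarrow> bool" where
  "GE \<mu> p q \<longleftrightarrow> p \<in> GV \<mu> \<and> q \<in> GV \<mu> \<and> fst p = fst q \<and> fst (snd p) = fst (snd q) \<and>
     adj (snd (fst p)) (snd (snd p)) (snd (snd q))"

fun Gl :: "(nat \<times> nat) \<times> nat \<times> nat option \<Rightarrow> nat" where
  "Gl (t, i, None) = fst t"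
| "Gl (t, i, Some w) = Fl (snd t) w div 2"

lemma sgr_GE: "sgr (GV \<mu>) (GE \<mu>)"
proof -
  have "adj j b a \<and> a \<noteq> b" if "adj j a b" "j < n" for j a b
  proof (cases a; cases b)
    fix a' b' assume ab: "a = Some a'" "b = Some b'"
    then have "FE j a' b'" using that by simp
    from sgrD[OF sgF[OF that(2)] this] show ?thesis using ab by simp
  qed (use that in auto)
  moreover have "snd (fst p) < n" if "p \<in> GV \<mu>" for p using that by (auto simp: GV_def TT_def)
  ultimately show ?thesis unfolding sgr_def GE_def by metis
qed

text \<open>A set of at most \<open>m\<close> vertices meets at most \<open>m\<close> copies of each
  type. So if a type occurs at least \<open>m\<close> times among the parts, infinitely many copies
  of it show nothing new to such a set: the copies that it meets can be assigned to distinct parts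
  of the same type, and inside a copy the assumption \<open>IH\<close> provides the map. The labels
  in \<open>IH\<close> are doubled to make room for the adjacency to the deleted root.\<close>

lemma sat_step:
  fixes V :: "nat set"
  assumes sym: "\<And>u v. E u v \<Longrightarrow> E v u" and irr: "\<And>u. \<not> E u u"
    and lV: "l ` V \<subseteq> {..<L}"
    and c: "\<And>v. v \<in> V \<Longrightarrow> c v \<in> V \<and> c (c v) = c v" "\<And>u v. u \<in> V \<Longrightarrow> v \<in> V \<Longrightarrow> E u v \<Longrightarrow> c u = c v"
    and IH: "\<And>r. r \<in> V \<Longrightarrow> c r = r \<Longrightarrow> \<exists>j<n. sat m ({v \<in> V. c v = r} - {r}) E
        (\<lambda>v. 2 * l v + (if E v r then 1 else 0)) (FV j) (FE j) (Fl j)"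
  shows "\<exists>\<mu>\<in>TT \<rightarrow>\<^sub>E {..m}. sat m V E l (GV \<mu>) (GE \<mu>) Gl"
proof -
  define R where "R = {r \<in> V. c r = r}"
  define P where "P = (\<lambda>r. {v \<in> V. c v = r} - {r})"
  define lab where "lab = (\<lambda>r v. 2 * l v + (if E v r then 1 else 0))"
  have "\<forall>r\<in>R. \<exists>j<n. sat m (P r) E (lab r) (FV j) (FE j) (Fl j)"
    using IH unfolding R_def P_def lab_def by blast
  then obtain J where J: "\<And>r. r \<in> R \<Longrightarrow> J r < n"
    "\<And>r. r \<in> R \<Longrightarrow> sat m (P r) E (lab r) (FV (J r)) (FE (J r)) (Fl (J r))" by metis
  then have "\<forall>r\<in>R. \<exists>f. liemb (P r) E (lab r) (FV (J r)) (FE (J r)) (Fl (J r)) f"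
    unfolding sat_def by blast
  then obtain \<phi> where \<phi>: "\<And>r. r \<in> R \<Longrightarrow> liemb (P r) E (lab r) (FV (J r)) (FE (J r)) (Fl (J r)) (\<phi> r)" by metis
  define \<tau> where "\<tau> = (\<lambda>r. (l r, J r))"
  have \<tau>fs: "l r = fst (\<tau> r)" "J r = snd (\<tau> r)" for r by (simp_all add: \<tau>_def)
  have \<tau>T: "\<tau> r \<in> TT" if "r \<in> R" for r using that J lV by (auto simp: \<tau>_def TT_def R_def)
  define Q where "Q = (\<lambda>t. {r \<in> R. \<tau> r = t})"
  \<comment> \<open>Multiplicities below \<open>m\<close> are kept; all others, finite or infinite,
    become the value \<open>m\<close>. This leaves finitely many functions
    \<open>\<mu>\<close>.\<close>
  define \<mu> where "\<mu> = restrict (\<lambda>t. if finite (Q t) \<and> card (Q t) < m then card (Q t) else m) TT"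
  have \<mu>M: "\<mu> \<in> TT \<rightarrow>\<^sub>E {..m}" by (auto simp: \<mu>_def)
  \<comment> \<open>For \<open>\<mu> t = m\<close> every natural number is a copy number, so a root
    serves as its own number.\<close>
  have "\<exists>e. inj_on e (Q t) \<and> (\<forall>r\<in>Q t. e r < \<mu> t \<or> \<mu> t = m)" if "t \<in> TT" for t
  proof (cases "\<mu> t = m")
    case True
    then show ?thesis by (intro exI[of _ id]) auto
  next
    case False
    then have "finite (Q t)" "\<mu> t = card (Q t)" using that by (auto simp: \<mu>_def split: if_splits)
    then obtain e where "bij_betw e (Q t) {0..<\<mu> t}" using ex_bij_betw_finite_nat by metis
    then show ?thesis unfolding bij_betw_def by (intro exI[of _ e]) auto
  qed
  then obtain e where e: "\<And>t. t \<in> TT \<Longrightarrow> inj_on (e t) (Q t)"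
    "\<And>t r. t \<in> TT \<Longrightarrow> r \<in> Q t \<Longrightarrow> e t r < \<mu> t \<or> \<mu> t = m" by metis
  have cR: "c v \<in> R" if "v \<in> V" for v using c that by (auto simp: R_def)
  have vP: "v \<in> P (c v)" if "v \<in> V" "c v \<noteq> v" for v using that by (auto simp: P_def)
  define f where "f = (\<lambda>v. (\<tau> (c v), e (\<tau> (c v)) (c v), if c v = v then None else Some (\<phi> (c v) v)))"
  have fc: "c u = c v" if "u \<in> V" "v \<in> V" "fst (f u) = fst (f v)" "fst (snd (f u)) = fst (snd (f v))" for u v
  proof -
    have *: "\<tau> (c u) = \<tau> (c v)" using that by (simp add: f_def)
    then have "e (\<tau> (c u)) (c u) = e (\<tau> (c u)) (c v)" using that by (simp add: f_def)
    moreover have "c u \<in> Q (\<tau> (c u))" "c v \<in> Q (\<tau> (c u))" using * cR that by (auto simp: Q_def)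
    ultimately show ?thesis using e(1)[OF \<tau>T[OF cR[OF that(1)]]] by (auto dest: inj_onD)
  qed
  have fV: "f v \<in> GV \<mu>" if "v \<in> V" for v
  proof -
    have "c v \<in> Q (\<tau> (c v))" using cR[OF that] by (simp add: Q_def)
    moreover have "\<phi> (c v) v \<in> FV (J (c v))" if "c v \<noteq> v"
      using \<phi>[OF cR[OF \<open>v \<in> V\<close>]] vP[OF \<open>v \<in> V\<close> that] by (auto simp: liemb_def iemb_def)
    ultimately show ?thesis
      using e(2) \<tau>T[OF cR[OF that]] by (auto simp: f_def GV_def \<tau>_def)
  qed
  have "liemb V E l (GV \<mu>) (GE \<mu>) Gl f"
    unfolding liemb_def iemb_def
  proof (intro conjI ballI)
    show "inj_on f V"
    proof (rule inj_onI)
      fix u v assume uv: "u \<in> V" "v \<in> V" "f u = f v"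
      then have cc: "c u = c v" using fc[of u v] by metis
      have o: "(if c u = u then None else Some (\<phi> (c u) u)) = (if c v = v then None else Some (\<phi> (c v) v))"
        using uv(3) by (simp add: f_def)
      show "u = v"
      proof (cases "c u = u")
        case True
        then have "c v = v" using o by (cases "c v = v") simp_all
        then show ?thesis using cc True by metis
      next
        case False
        then have v: "c v \<noteq> v" "\<phi> (c u) u = \<phi> (c v) v" using o by (cases "c v = v"; simp)+
        have "inj_on (\<phi> (c u)) (P (c u))" using \<phi>[OF cR[OF uv(1)]] by (simp add: liemb_def iemb_def)
        moreover have "u \<in> P (c u)" "v \<in> P (c u)" using vP[OF uv(1) False] vP[OF uv(2) v(1)] cc by metis+
        ultimately show ?thesis using v(2) cc by (metis inj_onD)
      qed
    qed
    show "f ` V \<subseteq> GV \<mu>" using fV by blast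
    show "Gl (f u) = l u" if "u \<in> V" for u
    proof (cases "c u = u")
      case True
      then show ?thesis by (simp add: f_def \<tau>_def)
    next
      case False
      then have "Fl (J (c u)) (\<phi> (c u) u) = lab (c u) u"
        using \<phi>[OF cR[OF that]] vP[OF that False] by (simp add: liemb_def)
      then show ?thesis using False by (simp add: f_def \<tau>_def lab_def)
    qed
    show "E u v \<longleftrightarrow> GE \<mu> (f u) (f v)" if uv: "u \<in> V" "v \<in> V" for u v
    proof (cases "c u = c v")
      case False
      then show ?thesis using c(2)[of u v] fc[of u v] uv by (auto simp: GE_def)
    next
      case True
      define r where "r = c u"
      have r: "c u = r" "c v = r" "r \<in> R" using True cR[OF uv(1)] by (auto simp: r_def)
      note p = \<phi>[OF r(3), unfolded liemb_def iemb_def]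
      have P: "w \<in> P r \<and> snd (snd (f w)) = Some (\<phi> r w) \<and> Fl (J r) (\<phi> r w) = lab r w"
        if "w \<in> V" "c w = r" "w \<noteq> r" for w
        using p vP[OF that(1)] that by (auto simp: f_def)
      have N: "snd (snd (f w)) = None" if "w = r" for w
        using that r(3) by (simp add: f_def R_def)
      have "adj (J r) (snd (snd (f u))) (snd (snd (f v))) \<longleftrightarrow> E u v"
      proof (cases "u = r"; cases "v = r")
        assume "u = r" "v = r"
        then show ?thesis using irr N by simp
      next
        assume *: "u = r" "v \<noteq> r"
        then have "E u v \<longleftrightarrow> E v r" using sym by metis
        then show ?thesis using * N[of u] P[OF uv(2) r(2)] by (simp add: lab_def)
      next
        assume *: "u \<noteq> r" "v = r"
        then show ?thesis using N[of v] P[OF uv(1) r(1)] by (simp add: lab_def)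
      next
        assume *: "u \<noteq> r" "v \<noteq> r"
        then show ?thesis using p P[OF uv(1) r(1)] P[OF uv(2) r(2)] by simp
      qed
      then show ?thesis using r fV[OF uv(1)] fV[OF uv(2)] by (simp add: GE_def f_def \<tau>_def)
    qed
  qed
  moreover have "\<exists>g. liemb A (GE \<mu>) Gl V E l g" if A: "A \<subseteq> GV \<mu>" "finite A" "card A \<le> m" for A
  proof -
    define I where "I = (\<lambda>t. {i. \<exists>w. (t, i, w) \<in> A})"
    have I: "I t = (fst \<circ> snd) ` {p \<in> A. fst p = t}" for t by (force simp: I_def)
    have cI: "finite (I t)" "card (I t) \<le> m" for t
    proof -
      have "finite {p \<in> A. fst p = t}" using A(2) by simp
      then show "finite (I t)" unfolding I by simp
      have "card (I t) \<le> card {p \<in> A. fst p = t}" unfolding I using A(2) by (intro card_image_le) simp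
      also have "\<dots> \<le> card A" using A(2) by (intro card_mono) auto
      finally show "card (I t) \<le> m" using A(3) by simp
    qed
    have IT: "t \<in> TT" "i < \<mu> t \<or> \<mu> t = m" if "i \<in> I t" for t i
      using that A(1) by (auto simp: I_def GV_def)
    \<comment> \<open>If \<open>Q t\<close> has fewer than \<open>m\<close> elements, only as many
      copies exist; otherwise it has enough roots for the at most \<open>m\<close> copies that
      \<open>A\<close> meets.\<close>
    have "\<exists>\<rho>. inj_on \<rho> (I t) \<and> \<rho> ` I t \<subseteq> Q t" for t
    proof (rule inj_into_large[OF cI(1)])
      assume fin: "finite (Q t)"
      show "card (I t) \<le> card (Q t)"
      proof (cases "I t = {}")
        case False
        then have t: "t \<in> TT" using IT by blast
        show ?thesis
        proof (cases "card (Q t) < m")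
          case True
          then have *: "\<mu> t = card (Q t)" using t fin by (simp add: \<mu>_def)
          then have "I t \<subseteq> {..<card (Q t)}" using IT(2) True by fastforce
          then show ?thesis using card_mono[of "{..<card (Q t)}" "I t"] by simp
        next
          case False
          then show ?thesis using cI(2)[of t] by simp
        qed
      qed simp
    qed
    then obtain \<rho> where \<rho>: "\<And>t. inj_on (\<rho> t) (I t)" "\<And>t i. i \<in> I t \<Longrightarrow> \<rho> t i \<in> Q t" by (metis image_subset_iff)
    define B where "B = (\<lambda>t i. {w. (t, i, Some w) \<in> A})"
    have ex: "\<exists>g. liemb (B t i) (FE (snd t)) (Fl (snd t)) (P (\<rho> t i)) E (lab (\<rho> t i)) g" if i: "i \<in> I t" for t i
    proof -
      have im: "(\<lambda>w. (t, i, Some w)) ` B t i \<subseteq> A" by (auto simp: B_def)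
      have ij: "inj_on (\<lambda>w. (t, i, Some w)) (B t i)" by (auto simp: inj_on_def)
      have "finite (B t i)" by (rule inj_on_finite[OF ij im A(2)])
      moreover have "card (B t i) \<le> m" using card_inj_on_le[OF ij im A(2)] A(3) by simp
      moreover have "B t i \<subseteq> FV (snd t)" using A(1) by (auto simp: B_def GV_def)
      moreover have "\<rho> t i \<in> R" "J (\<rho> t i) = snd t" using \<rho>(2)[OF i] \<tau>fs(2)[of "\<rho> t i"] by (simp_all add: Q_def)
      ultimately show ?thesis using J(2)[of "\<rho> t i"] unfolding sat_def by simp
    qed
    define \<gamma> where "\<gamma> = (\<lambda>t i. SOME g. liemb (B t i) (FE (snd t)) (Fl (snd t)) (P (\<rho> t i)) E (lab (\<rho> t i)) g)"
    have \<gamma>: "liemb (B t i) (FE (snd t)) (Fl (snd t)) (P (\<rho> t i)) E (lab (\<rho> t i)) (\<gamma> t i)"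
      if "i \<in> I t" for t i unfolding \<gamma>_def by (rule someI_ex[OF ex[OF that]])
    define g where "g = (\<lambda>(t, i, w). case w of None \<Rightarrow> \<rho> t i | Some a \<Rightarrow> \<gamma> t i a)"
    have gN: "g (t, i, None) = \<rho> t i" and gS: "g (t, i, Some a) = \<gamma> t i a" for t i a by (simp_all add: g_def)
    have inI: "i \<in> I t" if "(t, i, w) \<in> A" for t i w using that by (auto simp: I_def)
    have \<rho>R: "\<rho> t i \<in> R" "\<rho> t i \<in> V" "c (\<rho> t i) = \<rho> t i" "\<tau> (\<rho> t i) = t" "l (\<rho> t i) = fst t"
      if "i \<in> I t" for t i
      using \<rho>(2)[OF that] \<tau>fs(1)[of "\<rho> t i"] by (simp_all add: Q_def R_def)
    have \<gamma>P: "\<gamma> t i a \<in> P (\<rho> t i)" if "(t, i, Some a) \<in> A" for t i a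
      using \<gamma>[OF inI[OF that]] that by (auto simp: liemb_def iemb_def B_def)
    have gV: "g (t, i, w) \<in> V \<and> c (g (t, i, w)) = \<rho> t i \<and> (g (t, i, w) = \<rho> t i \<longleftrightarrow> w = None)"
      if p: "(t, i, w) \<in> A" for t i w
      using \<rho>R[OF inI[OF p]] \<gamma>P p by (cases w) (auto simp: gN gS P_def)
    have gc: "t = t' \<and> i = i'" if "(t, i, w) \<in> A" "(t', i', w') \<in> A" "c (g (t, i, w)) = c (g (t', i', w'))" for t i w t' i' w'
    proof -
      have *: "\<rho> t i = \<rho> t' i'" using gV that by metis
      then have "t = t'" using \<rho>R(4)[OF inI[OF that(1)]] \<rho>R(4)[OF inI[OF that(2)]] by simp
      then show ?thesis using * \<rho>(1) inI that by (metis inj_onD)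
    qed
    have "liemb A (GE \<mu>) Gl V E l g"
      unfolding liemb_def iemb_def
    proof (intro conjI ballI)
      show "inj_on g A"
      proof (rule inj_onI)
        fix p q assume pq: "p \<in> A" "q \<in> A" "g p = g q"
        obtain t i w t' i' w' where p: "p = (t, i, w)" "q = (t', i', w')" by (cases p, cases q) auto
        have eq: "t = t'" "i = i'" using gc[of t i w t' i' w'] pq p by auto
        have "w = None \<longleftrightarrow> w' = None" using gV[of t i w] gV[of t i w'] pq p eq by metis
        moreover have "a = b" if "w = Some a" "w' = Some b" for a b
          using \<gamma>[OF inI[of t i w]] pq p eq that by (auto simp: liemb_def iemb_def B_def gS dest: inj_onD)
        ultimately have "w = w'" by (metis option.exhaust)
        then show "p = q" using p eq by simp
      qed
      show "g ` A \<subseteq> V" using gV by auto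
      show "l (g p) = Gl p" if "p \<in> A" for p
      proof -
        obtain t i w where p: "p = (t, i, w)" by (cases p) auto
        show ?thesis
        proof (cases w)
          case None
          then show ?thesis using \<rho>R[OF inI] that p by (simp add: gN)
        next
          case (Some a)
          then have "lab (\<rho> t i) (\<gamma> t i a) = Fl (snd t) a"
            using \<gamma>[OF inI[of t i w]] that p by (auto simp: liemb_def B_def)
          then show ?thesis using p Some by (auto simp: gS lab_def split: if_splits)
        qed
      qed
      show "GE \<mu> p q \<longleftrightarrow> E (g p) (g q)" if pq: "p \<in> A" "q \<in> A" for p q
      proof -
        obtain t i w t' i' w' where p: "p = (t, i, w)" "q = (t', i', w')" by (cases p, cases q) auto
        show ?thesis
        proof (cases "t = t' \<and> i = i'")
          case False
          then have "c (g p) \<noteq> c (g q)" using gc[of t i w t' i' w'] pq p by blast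
          moreover have "g p \<in> V" "g q \<in> V" using gV[of t i w] gV[of t' i' w'] pq p by simp_all
          ultimately have "\<not> E (g p) (g q)" using c(2) by blast
          then show ?thesis using False p by (auto simp: GE_def)
        next
          case True
          have i: "i \<in> I t" using inI[of t i w] pq p by simp
          note g = \<gamma>[of i t, unfolded liemb_def iemb_def]
          have "adj (snd t) w w' \<longleftrightarrow> E (g p) (g q)"
          proof (cases w; cases w')
            assume "w = None" "w' = None"
            then show ?thesis using irr p True by simp
          next
            fix b assume w: "w = None" "w' = Some b"
            then have *: "lab (\<rho> t i) (\<gamma> t i b) = Fl (snd t) b" using g[OF i] pq p True by (auto simp: B_def)
            have "odd (lab (\<rho> t i) (\<gamma> t i b)) \<longleftrightarrow> E (\<gamma> t i b) (\<rho> t i)" by (simp add: lab_def)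
            then show ?thesis using w * p True sym by (auto simp: gN gS)
          next
            fix a assume w: "w = Some a" "w' = None"
            then have *: "lab (\<rho> t i) (\<gamma> t i a) = Fl (snd t) a" using g[OF i] pq p True by (auto simp: B_def)
            have "odd (lab (\<rho> t i) (\<gamma> t i a)) \<longleftrightarrow> E (\<gamma> t i a) (\<rho> t i)" by (simp add: lab_def)
            then show ?thesis using w * p True by (auto simp: gN gS)
          next
            fix a b assume "w = Some a" "w' = Some b"
            then show ?thesis using g[OF i] pq p True by (auto simp: gS B_def)
          qed
          then show ?thesis using True p pq A(1) by (auto simp: GE_def)
        qed
      qed
    qed
    then show ?thesis by blast
  qed
  ultimately show ?thesis using \<mu>M unfolding sat_def by blast
qed

end

definition sat_fam :: "nat \<Rightarrow> nat \<Rightarrow> nat \<Rightarrow> (nat set \<times> (nat \<Rightarrow> nat \<Rightarrow> bool) \<times> (nat \<Rightarrow> nat)) set \<Rightarrow> bool" where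
  "sat_fam m L k F \<longleftrightarrow> finite F \<and> (\<forall>p\<in>F. sgr (fst p) (fst (snd p))) \<and>
     (\<forall>(V :: nat set) E l. (\<forall>u v. E u v \<longrightarrow> E v u) \<longrightarrow> (\<forall>u. \<not> E u u) \<longrightarrow> l ` V \<subseteq> {..<L} \<longrightarrow> tree_depth_le k V E \<longrightarrow>
        (\<exists>p\<in>F. sat m V E l (fst p) (fst (snd p)) (snd (snd p))))"

lemma sat_famD:
  fixes V :: "nat set"
  assumes "sat_fam m L k F" "\<forall>u v. E u v \<longrightarrow> E v u" "\<forall>u. \<not> E u u" "l ` V \<subseteq> {..<L}" "tree_depth_le k V E"
  shows "\<exists>p\<in>F. sat m V E l (fst p) (fst (snd p)) (snd (snd p))"
  using assms(1)[unfolded sat_fam_def, THEN conjunct2, THEN conjunct2, rule_format,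
      OF assms(2)[rule_format] assms(3)[rule_format] assms(4,5)] .

text \<open>Induction on the tree-depth with \<open>L\<close> general, because deleting the roots
  doubles the number of labels. Finiteness survives since \<open>\<mu>\<close> takes values in
  \<open>{..m}\<close> and there are finitely many types.\<close>

theorem sat_family: "\<exists>F. sat_fam m L k F"
proof (induction k arbitrary: L)
  case 0
  have "sat_fam m L 0 {({}, \<lambda>_ _. False, \<lambda>_. 0)}"
    by (auto simp: sat_fam_def sgr_def sat_def liemb_def iemb_def)
  then show ?case by blast
next
  case (Suc k)
  obtain F where FF: "sat_fam m (2 * L) k F" using Suc.IH[of "2 * L"] by blast
  then have F: "finite F" "\<And>p. p \<in> F \<Longrightarrow> sgr (fst p) (fst (snd p))" by (auto simp: sat_fam_def)
  obtain h where h: "bij_betw h {0..<card F} F" using ex_bij_betw_nat_finite[OF F(1)] by blast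
  define n where "n = card F"
  define FV where "FV = (\<lambda>j. fst (h j))"
  define FE where "FE = (\<lambda>j. fst (snd (h j)))"
  define Fl where "Fl = (\<lambda>j. snd (snd (h j)))"
  have hF: "h j \<in> F" if "j < n" for j using that h by (auto simp: bij_betw_def n_def)
  have sgF: "sgr (FV j) (FE j)" if "j < n" for j
    using F(2)[OF hF[OF that]] by (simp add: FV_def FE_def)
  have Fj: "\<exists>j<n. sat m V E l (FV j) (FE j) (Fl j)"
    if asm: "\<forall>u v. E u v \<longrightarrow> E v u" "\<forall>u. \<not> E u u" "l ` V \<subseteq> {..<2 * L}" "tree_depth_le k V E" for V :: "nat set" and E l
  proof -
    obtain p where p: "p \<in> F" "sat m V E l (fst p) (fst (snd p)) (snd (snd p))"
      using sat_famD[OF FF asm] by (rule bexE)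
    have "p \<in> h ` {0..<n}" using h p(1) by (simp add: bij_betw_def n_def)
    then obtain j where "j < n" "h j = p" by auto
    then show ?thesis using p(2) by (intro exI[of _ j]) (simp add: FV_def FE_def Fl_def)
  qed
  let ?M = "TT n L \<rightarrow>\<^sub>E {..m}"
  have "\<exists>p. sgr (fst p :: nat set) (fst (snd p)) \<and> (\<forall>(V0 :: nat set) E0 l0.
      sat m V0 E0 l0 (GV n m FV L \<mu>) (GE n m FV FE Fl L \<mu>) (Gl Fl) \<longrightarrow>
      sat m V0 E0 l0 (fst p) (fst (snd p)) (snd (snd p)))" for \<mu>
  proof -
    obtain V' :: "nat set" and E' l' where "sgr V' E'" "\<And>(V0 :: nat set) E0 l0.
      sat m V0 E0 l0 (GV n m FV L \<mu>) (GE n m FV FE Fl L \<mu>) (Gl Fl) \<Longrightarrow> sat m V0 E0 l0 V' E' l'"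
      by (rule sat_nat_copy[where V = "GV n m FV L \<mu>" and E = "GE n m FV FE Fl L \<mu>" and m = m and l = "Gl Fl",
            OF sgr_GE[OF sgF]]) (assumption, rule that, assumption, blast)
    then show ?thesis by (intro exI[of _ "(V', E', l')"]) simp
  qed
  then have "\<forall>\<mu>. \<exists>p. sgr (fst p :: nat set) (fst (snd p)) \<and> (\<forall>(V0 :: nat set) E0 l0.
      sat m V0 E0 l0 (GV n m FV L \<mu>) (GE n m FV FE Fl L \<mu>) (Gl Fl) \<longrightarrow>
      sat m V0 E0 l0 (fst p) (fst (snd p)) (snd (snd p)))" by (rule allI)
  from choice[OF this] obtain C where C0: "\<forall>\<mu>. sgr (fst (C \<mu>) :: nat set) (fst (snd (C \<mu>))) \<and>
      (\<forall>(V0 :: nat set) E0 l0. sat m V0 E0 l0 (GV n m FV L \<mu>) (GE n m FV FE Fl L \<mu>) (Gl Fl) \<longrightarrow>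
      sat m V0 E0 l0 (fst (C \<mu>)) (fst (snd (C \<mu>))) (snd (snd (C \<mu>))))" by (rule exE)
  note C = C0[THEN spec, THEN conjunct1] C0[THEN spec, THEN conjunct2, rule_format]
  have "finite ?M" by (intro finite_PiE) (simp_all add: TT_def[OF sgF])
  moreover have main: "\<exists>p\<in>C ` ?M. sat m V E l (fst p) (fst (snd p)) (snd (snd p))"
    if a: "\<forall>u v. E u v \<longrightarrow> E v u" "\<forall>u. \<not> E u u" "l ` V \<subseteq> {..<L}" "tree_depth_le (Suc k) V E" for V :: "nat set" and E l
  proof -
    obtain c where c0: "\<forall>v\<in>V. c v \<in> V \<and> c (c v) = c v" "\<forall>u\<in>V. \<forall>v\<in>V. E u v \<longrightarrow> c u = c v"
      "\<forall>r\<in>V. c r = r \<longrightarrow> tree_depth_le k ({v \<in> V. c v = r} - {r}) E"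
      using a(4) unfolding tree_depth_le.simps by (elim exE conjE) (rule that)
    note c = c0(1)[rule_format] c0(2)[rule_format] c0(3)[rule_format]
    have lab: "2 * l v + (if E v r then 1 else 0) < 2 * L" if "v \<in> V" for v r
    proof -
      have "l v < L" using a(3) that by auto
      then show ?thesis by simp
    qed
    have "\<exists>j<n. sat m ({v \<in> V. c v = r} - {r}) E
        (\<lambda>v. 2 * l v + (if E v r then 1 else 0)) (FV j) (FE j) (Fl j)" if "r \<in> V" "c r = r" for r
      using lab by (intro Fj[OF a(1,2) _ c(3)[OF that]]) auto
    note IH = this
    have "\<exists>\<mu>\<in>?M. sat m V E l (GV n m FV L \<mu>) (GE n m FV FE Fl L \<mu>) (Gl Fl)"
    proof (rule sat_step[where c = c])
      show "sgr (FV j) (FE j)" if "j < n" for j using sgF[OF that] .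
      show "E v u" if "E u v" for u v using a(1) that by blast
      show "\<not> E u u" for u using a(2) by blast
      show "l ` V \<subseteq> {..<L}" by (rule a(3))
      show "c v \<in> V \<and> c (c v) = c v" if "v \<in> V" for v using c(1)[OF that] .
      show "c u = c v" if "u \<in> V" "v \<in> V" "E u v" for u v using c(2)[OF that] .
      show "\<exists>j<n. sat m ({v \<in> V. c v = r} - {r}) E
        (\<lambda>v. 2 * l v + (if E v r then 1 else 0)) (FV j) (FE j) (Fl j)" if "r \<in> V" "c r = r" for r
        using IH[OF that] .
    qed
    then obtain \<mu> where \<mu>: "\<mu> \<in> ?M" "sat m V E l (GV n m FV L \<mu>) (GE n m FV FE Fl L \<mu>) (Gl Fl)"
      by (rule bexE)
    show ?thesis using C(2)[OF \<mu>(2)] \<mu>(1) by (intro bexI[of _ "C \<mu>"]) simp_all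
  qed
  ultimately have "sat_fam m L (Suc k) (C ` ?M)"
    unfolding sat_fam_def by (intro conjI ballI allI impI main finite_imageI) (auto simp: C(1) simp del: tree_depth_le.simps)
  then show ?case by blast
qed

section \<open>Universal graphs from skeletons\<close>

text \<open>The null graph is connected in this sense.\<close>

definition conn :: "'a set \<Rightarrow> ('a \<Rightarrow> 'a \<Rightarrow> bool) \<Rightarrow> bool" where
  "conn V E \<longleftrightarrow> (\<forall>X. X \<subseteq> V \<longrightarrow> X \<noteq> {} \<longrightarrow> (\<forall>u\<in>X. \<forall>v. E u v \<longrightarrow> v \<in> X) \<longrightarrow> X = V)"

lemma connD: "conn V E \<Longrightarrow> X \<subseteq> V \<Longrightarrow> X \<noteq> {} \<Longrightarrow> (\<And>u v. u \<in> X \<Longrightarrow> E u v \<Longrightarrow> v \<in> X) \<Longrightarrow> X = V"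
  unfolding conn_def by blast

definition unionE :: "'i set \<Rightarrow> ('i \<Rightarrow> 'w \<Rightarrow> 'w \<Rightarrow> bool) \<Rightarrow> 'i \<times> 'w \<Rightarrow> 'i \<times> 'w \<Rightarrow> bool" where
  "unionE I EW p q \<longleftrightarrow> fst p \<in> I \<and> fst p = fst q \<and> EW (fst p) (snd p) (snd q)"

text \<open>A connected tree cannot be spread over several parts: the vertices mapped into the part
  of a fixed vertex are closed under adjacency.\<close>

lemma union_free:
  assumes T: "conn VT ET" "VT \<noteq> {}" "sgr VT ET" and W: "\<And>i. i \<in> I \<Longrightarrow> free VT ET (W i) (EW i)"
  shows "free VT ET (Sigma I W) (unionE I EW)"
proof -
  have "sgr (Sigma I W) (unionE I EW)"
    using W by (fastforce simp: sgr_def unionE_def free_def)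
  moreover have False if f: "emb VT ET (Sigma I W) (unionE I EW) f" for f
  proof -
    obtain u0 where u0: "u0 \<in> VT" using T(2) by blast
    let ?X = "{u \<in> VT. fst (f u) = fst (f u0)}"
    have fE: "unionE I EW (f u) (f v)" if "ET u v" for u v using f that by (simp add: emb_def)
    have X: "?X = VT"
    proof (rule connD[OF T(1)])
      show "v \<in> ?X" if "u \<in> ?X" "ET u v" for u v
        using that fE[OF that(2)] sgrD[OF T(3) that(2)] by (simp add: unionE_def)
    qed (use u0 in auto)
    let ?i = "fst (f u0)"
    have fi: "fst (f u) = ?i" if "u \<in> VT" for u using X that by blast
    have i: "?i \<in> I" using f u0 by (auto simp: emb_def)
    have "emb VT ET (W ?i) (EW ?i) (snd \<circ> f)"
      unfolding emb_def
    proof (intro conjI allI impI)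
      show "inj_on (snd \<circ> f) VT"
      proof (rule inj_onI)
        fix a b assume "a \<in> VT" "b \<in> VT" "(snd \<circ> f) a = (snd \<circ> f) b"
        then have "f a = f b" using fi[of a] fi[of b] by (simp add: prod_eq_iff)
        then show "a = b" using f \<open>a \<in> VT\<close> \<open>b \<in> VT\<close> by (auto simp: emb_def dest: inj_onD)
      qed
      show "(snd \<circ> f) ` VT \<subseteq> W ?i"
      proof (rule image_subsetI)
        fix u assume u: "u \<in> VT"
        then have "f u \<in> Sigma I W" using f by (auto simp: emb_def)
        then show "(snd \<circ> f) u \<in> W ?i" using fi[OF u] by auto
      qed
      show "EW ?i ((snd \<circ> f) u) ((snd \<circ> f) v)" if "ET u v" for u v
        using fE[OF that, unfolded unionE_def] fi[of u] sgrD[OF T(3) that] by (metis comp_apply)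
    qed
    then show False using W[OF i] by (auto simp: free_def)
  qed
  ultimately show ?thesis unfolding free_def by blast
qed

definition comp_rep :: "(nat \<Rightarrow> nat \<Rightarrow> bool) \<Rightarrow> nat \<Rightarrow> nat" where
  "comp_rep E v = (LEAST w. E\<^sup>*\<^sup>* v w)"

lemma comp_rep:
  assumes "sgr V E"
  shows comp_rep_reach: "E\<^sup>*\<^sup>* v (comp_rep E v)"
    and comp_rep_edge: "E u v \<Longrightarrow> comp_rep E u = comp_rep E v"
    and comp_rep_eq: "comp_rep E u = comp_rep E v \<Longrightarrow> E\<^sup>*\<^sup>* u v"
proof -
  show reach: "E\<^sup>*\<^sup>* v (comp_rep E v)" for v
    unfolding comp_rep_def by (rule LeastI[of _ v]) simp
  have sym: "E\<^sup>*\<^sup>* b a" if "E\<^sup>*\<^sup>* a b" for a b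
    using that by induction (auto intro: converse_rtranclp_into_rtranclp dest: sgrD[OF assms])
  show "comp_rep E u = comp_rep E v" if "E u v"
  proof -
    have "E\<^sup>*\<^sup>* u w \<longleftrightarrow> E\<^sup>*\<^sup>* v w" for w
      using that sgrD[OF assms that] by (meson converse_rtranclp_into_rtranclp)
    then show ?thesis by (simp add: comp_rep_def)
  qed
  show "E\<^sup>*\<^sup>* u v" if "comp_rep E u = comp_rep E v"
    using reach[of u] sym[OF reach[of v]] that by (metis rtranclp_trans)
qed

lemma comp_conn:
  assumes sg: "sgr V E"
  defines "C \<equiv> \<lambda>r. {v \<in> V. comp_rep E v = r}"
  shows "conn (C r) (\<lambda>u v. E u v \<and> u \<in> C r \<and> v \<in> C r)"
  unfolding conn_def
proof (intro allI impI)
  fix X assume X: "X \<subseteq> C r" "X \<noteq> {}" "\<forall>u\<in>X. \<forall>v. E u v \<and> u \<in> C r \<and> v \<in> C r \<longrightarrow> v \<in> X"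
  have step: "v \<in> X" if "u \<in> X" "E u v" for u v
    using X that sgrD[OF sg that(2)] comp_rep_edge[OF sg that(2)] by (auto simp: C_def)
  obtain x where x: "x \<in> X" using X by blast
  have "y \<in> X" if "E\<^sup>*\<^sup>* x y" for y using that x by induction (auto intro: step)
  moreover have "E\<^sup>*\<^sup>* x y" if "y \<in> C r" for y
    using comp_rep_eq[OF sg, of x y] that x X(1) by (auto simp: C_def)
  ultimately show "X = C r" using X(1) by blast
qed

lemma sub_free:
  assumes "free VT ET V E" "C \<subseteq> V"
  shows "free VT ET C (\<lambda>u v. E u v \<and> u \<in> C \<and> v \<in> C)"
proof -
  have "emb VT ET V E f" if "emb VT ET C (\<lambda>u v. E u v \<and> u \<in> C \<and> v \<in> C) f" for f
    using that assms(2) by (auto simp: emb_def)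
  then show ?thesis using assms by (auto simp: free_def sgr_def)
qed

text \<open>Every part is repeated once for each natural number, and a component uses the copy
  numbered by its representative. So components that are embedded in the same part do not
  collide.\<close>

theorem strongly_universal_from_parts:
  fixes W :: "'i::countable \<Rightarrow> 'w::countable set" and VT :: "'a set"
  assumes T: "conn VT ET" "VT \<noteq> {}" "sgr VT ET"
    and W: "\<And>i. i \<in> I \<Longrightarrow> free VT ET (W i) (EW i)"
    and cover: "\<And>(V :: nat set) E. V \<noteq> {} \<Longrightarrow> conn V E \<Longrightarrow> free VT ET V E \<Longrightarrow> \<exists>i\<in>I. \<exists>f. iemb V E (W i) (EW i) f"
  shows "\<exists>U EU. suniv VT ET U EU"
proof (rule suniv_any)
  let ?I = "I \<times> (UNIV :: nat set)"
  let ?U = "Sigma ?I (\<lambda>p. W (fst p))"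
  let ?E = "unionE ?I (\<lambda>p. EW (fst p))"
  show "free VT ET ?U ?E"
    using W by (intro union_free[OF T]) auto
  show "\<exists>f. iemb V E ?U ?E f" if fr: "free VT ET V E" for V :: "nat set" and E
  proof -
    have sg: "sgr V E" using fr by (simp add: free_def)
    let ?rep = "comp_rep E"
    let ?C = "\<lambda>r. {v \<in> V. ?rep v = r}"
    let ?EC = "\<lambda>r u v. E u v \<and> u \<in> ?C r \<and> v \<in> ?C r"
    have "\<exists>p. fst p \<in> I \<and> iemb (?C r) (?EC r) (W (fst p)) (EW (fst p)) (snd p)" if "r \<in> ?rep ` V" for r
    proof -
      have "?C r \<noteq> {}" using that by auto
      moreover have "free VT ET (?C r) (?EC r)" by (rule sub_free[OF fr]) auto
      ultimately obtain i f where "i \<in> I" "iemb (?C r) (?EC r) (W i) (EW i) f"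
        using cover[of "?C r" "?EC r"] comp_conn[OF sg, of r] by blast
      then show ?thesis by (intro exI[of _ "(i, f)"]) simp
    qed
    then have "\<forall>r\<in>?rep ` V. \<exists>p. fst p \<in> I \<and> iemb (?C r) (?EC r) (W (fst p)) (EW (fst p)) (snd p)" by (rule ballI)
    from bchoice[OF this] obtain c where
      c: "\<forall>r\<in>?rep ` V. fst (c r) \<in> I \<and> iemb (?C r) (?EC r) (W (fst (c r))) (EW (fst (c r))) (snd (c r))"
      by (rule exE)
    have cI: "fst (c (?rep v)) \<in> I"
      and cE: "iemb (?C (?rep v)) (?EC (?rep v)) (W (fst (c (?rep v)))) (EW (fst (c (?rep v)))) (snd (c (?rep v)))"
      if "v \<in> V" for v using c that by blast+
    define f where "f = (\<lambda>v. ((fst (c (?rep v)), ?rep v), snd (c (?rep v)) v))"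
    have "iemb V E ?U ?E f"
      unfolding iemb_def
    proof (intro conjI ballI)
      show "inj_on f V"
      proof (rule inj_onI)
        fix u v assume uv: "u \<in> V" "v \<in> V" "f u = f v"
        then have r: "?rep v = ?rep u" by (simp add: f_def)
        have "inj_on (snd (c (?rep u))) (?C (?rep u))" using cE[OF uv(1)] by (simp add: iemb_def)
        moreover have "snd (c (?rep u)) u = snd (c (?rep u)) v" using uv(3) r by (simp add: f_def)
        ultimately show "u = v" using uv(1,2) r by (auto dest: inj_onD)
      qed
      show "f ` V \<subseteq> ?U"
      proof (rule image_subsetI)
        fix v assume v: "v \<in> V"
        then have "snd (c (?rep v)) v \<in> W (fst (c (?rep v)))" using cE[OF v] by (auto simp: iemb_def)
        then show "f v \<in> ?U" using cI[OF v] by (simp add: f_def)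
      qed
      show "E u v \<longleftrightarrow> ?E (f u) (f v)" if uv: "u \<in> V" "v \<in> V" for u v
      proof (cases "?rep v = ?rep u")
        case True
        then have "v \<in> ?C (?rep u)" "u \<in> ?C (?rep u)" using uv by auto
        then have "E u v \<longleftrightarrow> EW (fst (c (?rep u))) (snd (c (?rep u)) u) (snd (c (?rep u)) v)"
          using cE[OF uv(1)] unfolding iemb_def by blast
        then show ?thesis using True cI[OF uv(1)] by (simp add: unionE_def f_def)
      next
        case False
        then show ?thesis using comp_rep_edge[OF sg, of u v] by (auto simp: unionE_def f_def)
      qed
    qed
    then show ?thesis by blast
  qed
qed

text \<open>
  The skeleton \<open>ES\<close> and the graph \<open>E\<close> are joined according to the labels: a vertex with label \<open>l\<close> is
  adjacent to the skeleton vertices in \<open>Nb l\<close>.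
\<close>

fun glue0 :: "(int \<Rightarrow> int \<Rightarrow> bool) \<Rightarrow> (nat \<Rightarrow> int set) \<Rightarrow> (nat \<Rightarrow> nat \<Rightarrow> bool) \<Rightarrow> (nat \<Rightarrow> nat) \<Rightarrow>
    int + nat \<Rightarrow> int + nat \<Rightarrow> bool" where
  "glue0 ES Nb E l (Inl s) (Inl t) = ES s t"
| "glue0 ES Nb E l (Inr u) (Inr v) = E u v"
| "glue0 ES Nb E l (Inl s) (Inr v) = (s \<in> Nb (l v))"
| "glue0 ES Nb E l (Inr v) (Inl s) = (s \<in> Nb (l v))"

definition glue :: "int set \<Rightarrow> (int \<Rightarrow> int \<Rightarrow> bool) \<Rightarrow> (nat \<Rightarrow> int set) \<Rightarrow> nat set \<Rightarrow> (nat \<Rightarrow> nat \<Rightarrow> bool) \<Rightarrow>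
    (nat \<Rightarrow> nat) \<Rightarrow> int + nat \<Rightarrow> int + nat \<Rightarrow> bool" where
  "glue S ES Nb V E l p q \<longleftrightarrow> p \<in> S <+> V \<and> q \<in> S <+> V \<and> glue0 ES Nb E l p q"

lemma sgr_glue:
  assumes "sgr S ES" "sgr V E"
  shows "sgr (S <+> V) (glue S ES Nb V E l)"
proof -
  have "glue0 ES Nb E l q p \<and> p \<noteq> q" if "glue0 ES Nb E l p q" for p q
    using that sgrD[OF assms(1)] sgrD[OF assms(2)] by (cases p; cases q) force+
  then show ?thesis unfolding sgr_def glue_def by blast
qed

lemma iemb_glue:
  assumes g: "liemb A E l V' E' l' g" and A: "A \<subseteq> V"
  shows "iemb (S <+> A) (glue S ES Nb V E l) (S <+> V') (glue S ES Nb V' E' l') (map_sum id g)"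
proof -
  have gi: "inj_on g A" "g ` A \<subseteq> V'" and gE: "\<And>u v. u \<in> A \<Longrightarrow> v \<in> A \<Longrightarrow> E u v \<longleftrightarrow> E' (g u) (g v)"
    and gl: "\<And>u. u \<in> A \<Longrightarrow> l' (g u) = l u"
    using g by (auto simp: liemb_def iemb_def)
  have mem: "map_sum id g p \<in> S <+> V'" if "p \<in> S <+> A" for p
    using that gi(2) by auto
  have "glue0 ES Nb E l p q \<longleftrightarrow> glue0 ES Nb E' l' (map_sum id g p) (map_sum id g q)"
    if "p \<in> S <+> A" "q \<in> S <+> A" for p q
    using that gE gl by (cases p; cases q) auto
  moreover have "inj_on (map_sum id g) (S <+> A)"
  proof (rule inj_onI)
    fix p q assume "p \<in> S <+> A" "q \<in> S <+> A" "map_sum id g p = map_sum id g q"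
    then show "p = q" using gi(1) by (cases p; cases q) (auto dest: inj_onD)
  qed
  moreover have "p \<in> S <+> V" if "p \<in> S <+> A" for p using that A by auto
  ultimately show ?thesis unfolding iemb_def glue_def using mem by (simp add: image_subset_iff)
qed

text \<open>A copy of the tree has at most \<open>card VT\<close> vertices outside the skeleton, and
  this set can be mapped back to the old graph. Labels are preserved, hence so is the adjacency to
  the skeleton, which itself stays fixed.\<close>

lemma glue_sat:
  assumes T: "finite VT" "sgr VT ET" and s: "sat (card VT) V E l V' E' l'"
    and sg: "sgr S ES" "sgr V' E'"
    and fr: "free VT ET (S <+> V) (glue S ES Nb V E l)"
  shows "free VT ET (S <+> V') (glue S ES Nb V' E' l')"
    and "\<exists>f. iemb (S <+> V) (glue S ES Nb V E l) (S <+> V') (glue S ES Nb V' E' l') f"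
proof -
  show "\<exists>f. iemb (S <+> V) (glue S ES Nb V E l) (S <+> V') (glue S ES Nb V' E' l') f"
    using s iemb_glue[of V E l V' E' l' _ V S ES Nb] unfolding sat_def by blast
  have False if f: "emb VT ET (S <+> V') (glue S ES Nb V' E' l') f" for f
  proof -
    let ?A = "{v. Inr v \<in> f ` VT}"
    have "Inr ` ?A \<subseteq> f ` VT" by auto
    then have fin: "finite ?A" "card ?A \<le> card (f ` VT)"
      using T(1) inj_on_finite[of Inr ?A "f ` VT"] card_inj_on_le[of Inr ?A "f ` VT"] by auto
    have AV: "?A \<subseteq> V'"
    proof
      fix v assume "v \<in> ?A"
      then have "Inr v \<in> S <+> V'" using f by (auto simp: emb_def)
      then show "v \<in> V'" by auto
    qed
    have "card ?A \<le> card VT" using fin(2) card_image_le[OF T(1), of f] by simp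
    then obtain g where g: "liemb ?A E' l' V E l g"
      using s fin(1) AV unfolding sat_def by blast
    have h: "iemb (S <+> ?A) (glue S ES Nb V' E' l') (S <+> V) (glue S ES Nb V E l) (map_sum id g)"
      by (rule iemb_glue[OF g AV])
    have fm: "f u \<in> S <+> ?A" if "u \<in> VT" for u
    proof (cases "f u")
      case (Inl s)
      have "f u \<in> S <+> V'" using f that by (auto simp: emb_def)
      then show ?thesis using Inl by auto
    next
      case (Inr v)
      have "Inr v \<in> f ` VT" using that by (metis Inr imageI)
      then show ?thesis using Inr by auto
    qed
    have "emb VT ET (S <+> V) (glue S ES Nb V E l) (map_sum id g \<circ> f)"
      unfolding emb_def
    proof (intro conjI allI impI)
      have "inj_on f VT" "inj_on (map_sum id g) (f ` VT)"
        using f h fm by (auto simp: emb_def iemb_def intro: inj_on_subset)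
      then show "inj_on (map_sum id g \<circ> f) VT" by (rule comp_inj_on)
      show "(map_sum id g \<circ> f) ` VT \<subseteq> S <+> V"
      proof (rule image_subsetI)
        fix u assume "u \<in> VT"
        from fm[OF this] show "(map_sum id g \<circ> f) u \<in> S <+> V"
          using h unfolding iemb_def by (simp add: image_subset_iff)
      qed
      show "glue S ES Nb V E l ((map_sum id g \<circ> f) u) ((map_sum id g \<circ> f) v)" if "ET u v" for u v
      proof -
        have "glue S ES Nb V' E' l' (f u) (f v)" using f that by (simp add: emb_def)
        then show ?thesis using h fm[of u] fm[of v] sgrD[OF T(2) that] unfolding iemb_def by simp
      qed
    qed
    then show False using fr by (auto simp: free_def)
  qed
  then show "free VT ET (S <+> V') (glue S ES Nb V' E' l')"
    using sgr_glue[OF sg] unfolding free_def by blast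
qed

text \<open>There are countably many skeletons, and by \<open>sat_family\<close> finitely many
  saturated graphs suffice for each. The parts are those glued graphs that happen to be free of the
  tree; \<open>glue_sat\<close> shows that every graph described by a skeleton embeds in one of
  them.\<close>

theorem suniv_from_skeletons:
  fixes S :: "'i::countable \<Rightarrow> int set" and VT :: "'a set"
  assumes T: "conn VT ET" "VT \<noteq> {}" "sgr VT ET" "finite VT"
    and sk: "\<And>i. sgr (S i) (ES i)"
    and cover: "\<And>(V :: nat set) E. V \<noteq> {} \<Longrightarrow> conn V E \<Longrightarrow> free VT ET V E \<Longrightarrow>
      \<exists>i B EB lB f. sgr B EB \<and> lB ` B \<subseteq> {..<L i} \<and> tree_depth_le (k i) B EB \<and>
        free VT ET (S i <+> B) (glue (S i) (ES i) (Nb i) B EB lB) \<and>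
        iemb V E (S i <+> B) (glue (S i) (ES i) (Nb i) B EB lB) f"
  shows "\<exists>U EU. suniv VT ET U EU"
proof -
  let ?m = "card VT"
  have "\<forall>i. \<exists>F. sat_fam ?m (L i) (k i) F" using sat_family by blast
  from choice[OF this] obtain F where F: "\<forall>i. sat_fam ?m (L i) (k i) (F i)" by (rule exE)
  have "\<forall>i. \<exists>h. bij_betw h {0..<card (F i)} (F i)"
    using F ex_bij_betw_nat_finite unfolding sat_fam_def by blast
  from choice[OF this] obtain h where h: "\<forall>i. bij_betw (h i) {0..<card (F i)} (F i)" by (rule exE)
  let ?V = "\<lambda>p. fst (h (fst p) (snd p))"
  let ?E = "\<lambda>p. fst (snd (h (fst p) (snd p)))"
  let ?l = "\<lambda>p. snd (snd (h (fst p) (snd p)))"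
  let ?W = "\<lambda>p. S (fst p) <+> ?V p"
  let ?EW = "\<lambda>p. glue (S (fst p)) (ES (fst p)) (Nb (fst p)) (?V p) (?E p) (?l p)"
  let ?I = "{p. snd p < card (F (fst p)) \<and> free VT ET (?W p) (?EW p)}"
  show ?thesis
  proof (rule strongly_universal_from_parts[OF T(1-3), where I = ?I and W = ?W and EW = ?EW])
    show "free VT ET (?W p) (?EW p)" if "p \<in> ?I" for p using that by blast
    show "\<exists>p\<in>?I. \<exists>f. iemb V E (?W p) (?EW p) f"
      if VE: "V \<noteq> {}" "conn V E" "free VT ET V E" for V :: "nat set" and E
    proof -
      obtain i B EB lB f where B: "sgr B EB" "lB ` B \<subseteq> {..<L i}" "tree_depth_le (k i) B EB"
        "free VT ET (S i <+> B) (glue (S i) (ES i) (Nb i) B EB lB)"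
        "iemb V E (S i <+> B) (glue (S i) (ES i) (Nb i) B EB lB) f"
        using cover[OF VE] by (elim exE conjE) (rule that)
      have sym: "\<forall>u v. EB u v \<longrightarrow> EB v u" "\<forall>u. \<not> EB u u" using B(1) by (auto simp: sgr_def)
      obtain q where q: "q \<in> F i" "sat ?m B EB lB (fst q) (fst (snd q)) (snd (snd q))"
        using sat_famD[OF spec[OF F, of i] sym B(2,3)] by (rule bexE)
      have "q \<in> h i ` {0..<card (F i)}" using h q(1) by (simp add: bij_betw_def)
      then obtain j where j: "j < card (F i)" "h i j = q" by auto
      have sgq: "sgr (fst q) (fst (snd q))" using F q(1) unfolding sat_fam_def by blast
      note gs = glue_sat[OF T(4,3) q(2) sk sgq B(4)]
      obtain g where "iemb (S i <+> B) (glue (S i) (ES i) (Nb i) B EB lB) (?W (i, j)) (?EW (i, j)) g"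
        using gs(2) j by auto
      then have "iemb V E (?W (i, j)) (?EW (i, j)) (g \<circ> f)" by (rule iemb_comp[OF B(5)])
      moreover have "(i, j) \<in> ?I" using gs(1) j by simp
      ultimately show ?thesis by blast
    qed
  qed
qed

lemma tree_depth_le_cong:
  "(\<And>u v. u \<in> V \<Longrightarrow> v \<in> V \<Longrightarrow> E u v \<longleftrightarrow> E' u v) \<Longrightarrow> tree_depth_le k V E \<Longrightarrow> tree_depth_le k V E'"
proof (induction k arbitrary: V)
  case (Suc k)
  obtain c where c: "\<forall>v\<in>V. c v \<in> V \<and> c (c v) = c v" "\<forall>u\<in>V. \<forall>v\<in>V. E u v \<longrightarrow> c u = c v"
      "\<forall>r\<in>V. c r = r \<longrightarrow> tree_depth_le k ({v \<in> V. c v = r} - {r}) E"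
    using Suc.prems(2) unfolding tree_depth_le.simps by (elim exE conjE) (rule that)
  have "tree_depth_le k ({v \<in> V. c v = r} - {r}) E'" if "r \<in> V" "c r = r" for r
    using c(3) that by (intro Suc.IH[OF Suc.prems(1)]) auto
  then show ?case using c(1,2) Suc.prems(1) unfolding tree_depth_le.simps by (intro exI[of _ c]) blast
qed simp

text \<open>\<open>S0\<close> is carried to the skeleton by \<open>\<sigma>\<close>, the other
  vertices stay where they are, and \<open>l\<close> remembers the neighbours in \<open>S0\<close>.
  The resulting bijection is an isomorphism, so freeness transfers as well.\<close>

lemma glue_decomp:
  fixes V S0 :: "nat set"
  assumes V: "sgr V E" "S0 \<subseteq> V" and \<sigma>: "bij_betw \<sigma> S0 S" and ES: "sgr S ES"
    and EE: "\<And>u v. u \<in> S0 \<Longrightarrow> v \<in> S0 \<Longrightarrow> E u v \<longleftrightarrow> ES (\<sigma> u) (\<sigma> v)"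
    and El: "\<And>u v. u \<in> S0 \<Longrightarrow> v \<in> V - S0 \<Longrightarrow> E u v \<longleftrightarrow> \<sigma> u \<in> Nb (l v)"
    and fr: "free VT ET V E" and td: "tree_depth_le k (V - S0) E" and lB: "l ` (V - S0) \<subseteq> {..<L}"
  shows "\<exists>B EB lB f. sgr B EB \<and> lB ` B \<subseteq> {..<L} \<and> tree_depth_le k B EB \<and>
        free VT ET (S <+> B) (glue S ES Nb B EB lB) \<and> iemb V E (S <+> B) (glue S ES Nb B EB lB) f"
proof -
  let ?B = "V - S0"
  let ?EB = "\<lambda>u v. E u v \<and> u \<in> ?B \<and> v \<in> ?B"
  let ?G = "glue S ES Nb ?B ?EB l"
  define f where "f = (\<lambda>v. if v \<in> S0 then Inl (\<sigma> v) else Inr v)"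
  have sB: "sgr ?B ?EB" using V(1) by (auto simp: sgr_def)
  have inj\<sigma>: "inj_on \<sigma> S0" and \<sigma>S: "\<And>u. u \<in> S0 \<Longrightarrow> \<sigma> u \<in> S" using \<sigma> by (auto simp: bij_betw_def)
  have inj: "inj_on f V"
  proof (rule inj_onI)
    fix u v assume "u \<in> V" "v \<in> V" "f u = f v"
    then show "u = v" using inj\<sigma> by (cases "u \<in> S0"; cases "v \<in> S0") (auto simp: f_def dest: inj_onD)
  qed
  have img: "f ` V = S <+> ?B"
  proof
    show "f ` V \<subseteq> S <+> ?B" using \<sigma>S by (auto simp: f_def)
    show "S <+> ?B \<subseteq> f ` V"
    proof
      fix p assume p: "p \<in> S <+> ?B"
      show "p \<in> f ` V"
      proof (cases p)
        case (Inl s)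
        then have "s \<in> \<sigma> ` S0" using p \<sigma> by (auto simp: bij_betw_def)
        then obtain u where "u \<in> S0" "s = \<sigma> u" by blast
        then show ?thesis using Inl V(2) by (intro image_eqI[of _ _ u]) (auto simp: f_def)
      next
        case (Inr v)
        then show ?thesis using p by (intro image_eqI[of _ _ v]) (auto simp: f_def)
      qed
    qed
  qed
  have Ef: "E u v \<longleftrightarrow> ?G (f u) (f v)" if uv: "u \<in> V" "v \<in> V" for u v
  proof -
    have "f u \<in> S <+> ?B" "f v \<in> S <+> ?B" using img uv by blast+
    moreover have "E u v \<longleftrightarrow> glue0 ES Nb ?EB l (f u) (f v)"
    proof (cases "u \<in> S0"; cases "v \<in> S0")
      assume "u \<notin> S0" "v \<in> S0"
      then show ?thesis using El[of v u] sgr_sym[OF V(1), of u v] uv by (simp add: f_def)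
    qed (use EE[of u v] El[of u v] uv in \<open>simp_all add: f_def\<close>)
    ultimately show ?thesis by (simp add: glue_def)
  qed
  have ie: "iemb V E (S <+> ?B) ?G f" using inj img Ef by (simp add: iemb_def)
  have "\<not> emb VT ET (S <+> ?B) ?G g" for g
  proof
    assume g: "emb VT ET (S <+> ?B) ?G g"
    let ?i = "inv_into V f"
    have "emb (S <+> ?B) ?G V E ?i"
      unfolding emb_def
    proof (intro conjI allI impI)
      show "inj_on ?i (S <+> ?B)" using img by (metis inj_on_inv_into order_refl)
      show "?i ` (S <+> ?B) \<subseteq> V" using img by (metis image_subsetI inv_into_into)
      show "E (?i p) (?i q)" if "?G p q" for p q
      proof -
        have "p \<in> f ` V" "q \<in> f ` V" using that img by (simp_all add: glue_def)
        then show ?thesis using Ef[of "?i p" "?i q"] that by (simp add: f_inv_into_f inv_into_into)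
      qed
    qed
    then show False using emb_comp[OF g] fr by (auto simp: free_def)
  qed
  then have "free VT ET (S <+> ?B) ?G" using sgr_glue[OF ES sB] by (simp add: free_def)
  moreover have "tree_depth_le k ?B ?EB" using td by (rule tree_depth_le_cong[rotated]) auto
  ultimately show ?thesis using sB lB ie by blast
qed

text \<open>
  A skeleton is a finite graph on \<open>n\<close> vertices with edge set coded by \<open>e\<close>, the one-way infinite path
  or the two-way infinite path; \<open>k\<close> bounds the tree-depth of what is attached to it. For finite
  skeletons a label codes a set of neighbours; to a one-way path vertices are attached at \<open>0\<close> only.
\<close>

type_synonym skel = "nat \<times> nat \<times> nat + nat + unit"

fun skS :: "skel \<Rightarrow> int set" where
  "skS (Inl (n, e, k)) = int ` {..<n}"
| "skS (Inr (Inl k)) = {0..}"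
| "skS (Inr (Inr u)) = UNIV"

fun skE :: "skel \<Rightarrow> int \<Rightarrow> int \<Rightarrow> bool" where
  "skE (Inl (n, e, k)) s t \<longleftrightarrow> s \<in> int ` {..<n} \<and> t \<in> int ` {..<n} \<and> s \<noteq> t \<and>
     (prod_encode (nat s, nat t) \<in> set_decode e \<or> prod_encode (nat t, nat s) \<in> set_decode e)"
| "skE (Inr (Inl k)) s t \<longleftrightarrow> 0 \<le> s \<and> 0 \<le> t \<and> \<bar>s - t\<bar> = 1"
| "skE (Inr (Inr u)) s t \<longleftrightarrow> \<bar>s - t\<bar> = 1"

fun skN :: "skel \<Rightarrow> nat \<Rightarrow> int set" where
  "skN (Inl p) l = int ` set_decode l"
| "skN (Inr q) l = (if l = 0 then {} else {0})"

fun skL :: "skel \<Rightarrow> nat" where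
  "skL (Inl (n, e, k)) = 2 ^ n"
| "skL (Inr q) = 2"

fun skk :: "skel \<Rightarrow> nat" where
  "skk (Inl (n, e, k)) = k"
| "skk (Inr (Inl k)) = k"
| "skk (Inr (Inr u)) = 0"

lemma sgr_sk: "sgr (skS i) (skE i)"
proof (cases i)
  case (Inl p)
  then show ?thesis by (cases p) (auto simp: sgr_def)
next
  case (Inr q)
  then show ?thesis by (cases q) (auto simp: sgr_def)
qed

lemma set_encode_bound: "A \<subseteq> {..<n} \<Longrightarrow> set_encode A < 2 ^ n"
proof -
  assume A: "A \<subseteq> {..<n}"
  have "set_encode A \<le> (\<Sum>i<n. 2 ^ i)" unfolding set_encode_def using A by (intro sum_mono2) auto
  also have "\<dots> < (2 :: nat) ^ n" by (induction n) auto
  finally show ?thesis .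
qed

text \<open>The three alternatives correspond to the three kinds of skeleton. These are countably
  many, because a finite skeleton is given by its size, its coded edges and a depth bound, and an
  infinite one by a depth bound at most.\<close>

theorem suniv_from_structure:
  fixes VT :: "'a set"
  assumes T: "conn VT ET" "VT \<noteq> {}" "sgr VT ET" "finite VT"
    and str: "\<And>(V :: nat set) E. V \<noteq> {} \<Longrightarrow> conn V E \<Longrightarrow> free VT ET V E \<Longrightarrow>
      (\<exists>S0 k. finite S0 \<and> S0 \<subseteq> V \<and> tree_depth_le k (V - S0) E) \<or>
      (\<exists>(f :: nat \<Rightarrow> nat) k a. inj f \<and> range f \<subseteq> V \<and> (\<forall>i j. E (f i) (f j) \<longleftrightarrow> i = Suc j \<or> j = Suc i) \<and>
          (\<forall>v\<in>V - range f. \<forall>i. E (f i) v \<longleftrightarrow> i = 0 \<and> v = a) \<and> tree_depth_le k (V - range f) E) \<or>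
      (\<exists>h :: int \<Rightarrow> nat. bij_betw h UNIV V \<and> (\<forall>s t. E (h s) (h t) \<longleftrightarrow> \<bar>s - t\<bar> = 1))"
  shows "\<exists>U EU. suniv VT ET U EU"
proof (rule suniv_from_skeletons[OF T sgr_sk, where L = skL and k = skk and Nb = skN])
  fix V :: "nat set" and E
  assume VE: "V \<noteq> {}" "conn V E" "free VT ET V E"
  have sg: "sgr V E" using VE(3) by (simp add: free_def)
  from str[OF VE]
  show "\<exists>i B EB lB f. sgr B EB \<and> lB ` B \<subseteq> {..<skL i} \<and> tree_depth_le (skk i) B EB \<and>
        free VT ET (skS i <+> B) (glue (skS i) (skE i) (skN i) B EB lB) \<and>
        iemb V E (skS i <+> B) (glue (skS i) (skE i) (skN i) B EB lB) f"
  proof (elim disjE exE conjE)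
    fix S0 k assume fin: "finite S0" "S0 \<subseteq> V" "tree_depth_le k (V - S0) E"
    define n where "n = card S0"
    obtain \<rho> where \<rho>: "bij_betw \<rho> S0 {0..<n}" using ex_bij_betw_finite_nat[OF fin(1)] n_def by blast
    define D where "D = (\<lambda>(u, v). prod_encode (\<rho> u, \<rho> v)) ` {p \<in> S0 \<times> S0. E (fst p) (snd p)}"
    define e where "e = set_encode D"
    have "finite D" unfolding D_def using fin(1) by simp
    then have De: "set_decode e = D" by (simp add: e_def)
    let ?i = "Inl (n, e, k) :: skel"
    \<comment> \<open>The label codes the set of positions of the neighbours in \<open>S0\<close> as
      a binary number, hence it is below \<open>2 ^ n\<close>.\<close>
    define l where "l = (\<lambda>v. set_encode (\<rho> ` {u \<in> S0. E u v}))"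
    have \<rho>n: "\<rho> u < n" if "u \<in> S0" for u using that \<rho> by (auto simp: bij_betw_def)
    have \<rho>inj: "u = v" if "u \<in> S0" "v \<in> S0" "\<rho> u = \<rho> v" for u v using that \<rho> by (auto simp: bij_betw_def dest: inj_onD)
    have De_iff: "prod_encode (\<rho> u, \<rho> v) \<in> set_decode e \<longleftrightarrow> E u v" if uv: "u \<in> S0" "v \<in> S0" for u v
    proof
      assume "prod_encode (\<rho> u, \<rho> v) \<in> set_decode e"
      then obtain a b where "a \<in> S0" "b \<in> S0" "E a b" "\<rho> u = \<rho> a" "\<rho> v = \<rho> b"
        unfolding De D_def by (auto simp: prod_encode_eq)
      then show "E u v" using \<rho>inj uv by metis
    next
      assume "E u v"
      then show "prod_encode (\<rho> u, \<rho> v) \<in> set_decode e" unfolding De D_def using uv by force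
    qed
    have "\<exists>B EB lB f. sgr B EB \<and> lB ` B \<subseteq> {..<skL ?i} \<and> tree_depth_le (skk ?i) B EB \<and>
        free VT ET (skS ?i <+> B) (glue (skS ?i) (skE ?i) (skN ?i) B EB lB) \<and>
        iemb V E (skS ?i <+> B) (glue (skS ?i) (skE ?i) (skN ?i) B EB lB) f"
    proof (rule glue_decomp[OF sg fin(2) _ sgr_sk _ _ VE(3), where \<sigma> = "int \<circ> \<rho>" and l = l])
      have "bij_betw int {0..<n} (int ` {0..<n})" by (simp add: bij_betw_def)
      from bij_betw_trans[OF \<rho> this] show "bij_betw (int \<circ> \<rho>) S0 (skS ?i)" by (simp add: lessThan_atLeast0)
      show "E u v \<longleftrightarrow> skE ?i ((int \<circ> \<rho>) u) ((int \<circ> \<rho>) v)" if uv: "u \<in> S0" "v \<in> S0" for u v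
        using De_iff[OF uv] De_iff[OF uv(2,1)] sgrD[OF sg, of u v] sgrD[OF sg, of v u] \<rho>n[OF uv(1)] \<rho>n[OF uv(2)] \<rho>inj[OF uv]
        by auto
      show "E u v \<longleftrightarrow> (int \<circ> \<rho>) u \<in> skN ?i (l v)" if uv: "u \<in> S0" "v \<in> V - S0" for u v
      proof -
        have "set_decode (l v) = \<rho> ` {u \<in> S0. E u v}" unfolding l_def using fin(1) by simp
        then show ?thesis using uv \<rho>inj by (auto simp: image_iff)
      qed
      show "tree_depth_le (skk ?i) (V - S0) E" using fin(3) by simp
      have "l v < 2 ^ n" for v unfolding l_def using \<rho>n by (intro set_encode_bound) auto
      then show "l ` (V - S0) \<subseteq> {..<skL ?i}" by auto
    qed
    then show ?thesis by (rule exI)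
  next
    fix f :: "nat \<Rightarrow> nat" and k a
    assume ray: "inj f" "range f \<subseteq> V" "\<forall>i j. E (f i) (f j) \<longleftrightarrow> i = Suc j \<or> j = Suc i"
      "\<forall>v\<in>V - range f. \<forall>i. E (f i) v \<longleftrightarrow> i = 0 \<and> v = a" "tree_depth_le k (V - range f) E"
    let ?i = "Inr (Inl k) :: skel"
    let ?g = "inv_into UNIV f"
    have g: "?g (f i) = i" for i using ray(1) by simp
    have "\<exists>B EB lB f. sgr B EB \<and> lB ` B \<subseteq> {..<skL ?i} \<and> tree_depth_le (skk ?i) B EB \<and>
        free VT ET (skS ?i <+> B) (glue (skS ?i) (skE ?i) (skN ?i) B EB lB) \<and>
        iemb V E (skS ?i <+> B) (glue (skS ?i) (skE ?i) (skN ?i) B EB lB) f"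
    proof (rule glue_decomp[OF sg ray(2) _ sgr_sk _ _ VE(3), where \<sigma> = "int \<circ> ?g" and l = "\<lambda>v. if v = a then 1 else 0"])
      have "inj_on (int \<circ> ?g) (range f)" using g by (auto simp: inj_on_def)
      moreover have "(int \<circ> ?g) ` range f = {0..}"
      proof
        show "(int \<circ> ?g) ` range f \<subseteq> {0..}" by auto
        show "{0..} \<subseteq> (int \<circ> ?g) ` range f"
        proof
          fix s :: int assume "s \<in> {0..}"
          then have "s = (int \<circ> ?g) (f (nat s))" using g by simp
          then show "s \<in> (int \<circ> ?g) ` range f" by blast
        qed
      qed
      ultimately show "bij_betw (int \<circ> ?g) (range f) (skS ?i)" by (simp add: bij_betw_def)
      show "E u v \<longleftrightarrow> skE ?i ((int \<circ> ?g) u) ((int \<circ> ?g) v)" if uv: "u \<in> range f" "v \<in> range f" for u v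
        using uv g ray(3) by auto
      show "E u v \<longleftrightarrow> (int \<circ> ?g) u \<in> skN ?i (if v = a then 1 else 0)" if uv: "u \<in> range f" "v \<in> V - range f" for u v
        using uv g ray(4) by auto
      show "tree_depth_le (skk ?i) (V - range f) E" using ray(5) by simp
    qed auto
    then show ?thesis by (rule exI)
  next
    fix h :: "int \<Rightarrow> nat"
    assume line: "bij_betw h UNIV V" "\<forall>s t. E (h s) (h t) \<longleftrightarrow> \<bar>s - t\<bar> = 1"
    let ?i = "Inr (Inr ()) :: skel"
    let ?g = "inv_into UNIV h"
    have inj: "inj h" and img: "range h = V" using line(1) by (auto simp: bij_betw_def)
    have g: "?g (h i) = i" for i using inj by simp
    have "\<exists>B EB lB f. sgr B EB \<and> lB ` B \<subseteq> {..<skL ?i} \<and> tree_depth_le (skk ?i) B EB \<and>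
        free VT ET (skS ?i <+> B) (glue (skS ?i) (skE ?i) (skN ?i) B EB lB) \<and>
        iemb V E (skS ?i <+> B) (glue (skS ?i) (skE ?i) (skN ?i) B EB lB) f"
    proof (rule glue_decomp[OF sg subset_refl _ sgr_sk _ _ VE(3), where \<sigma> = ?g and l = "\<lambda>v. 0"])
      show "bij_betw ?g V (skS ?i)" using bij_betw_inv_into[OF line(1)] by simp
      show "E u v \<longleftrightarrow> skE ?i (?g u) (?g v)" if uv: "u \<in> V" "v \<in> V" for u v
        using uv g line(2) img by auto
    qed auto
    then show ?thesis by (rule exI)
  qed
qed

section \<open>Graphs in which deep path vertices have degree two\<close>

definition pathl :: "'a set \<Rightarrow> ('a \<Rightarrow> 'a \<Rightarrow> bool) \<Rightarrow> 'a list \<Rightarrow> bool" where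
  "pathl V E xs \<longleftrightarrow> distinct xs \<and> successively E xs \<and> set xs \<subseteq> V"

lemma pathl_mono: "pathl V E xs \<Longrightarrow> V \<subseteq> W \<Longrightarrow> pathl W E xs"
  by (auto simp: pathl_def)

lemma pathl_append:
  "pathl V E (xs @ ys) \<longleftrightarrow> pathl V E xs \<and> pathl V E ys \<and> set xs \<inter> set ys = {} \<and>
     (xs = [] \<or> ys = [] \<or> E (last xs) (hd ys))"
  by (auto simp: pathl_def successively_append_iff)

lemma pathl_rev:
  assumes "sgr V' E" shows "pathl V E (rev xs) \<longleftrightarrow> pathl V E xs"
proof -
  have "(\<lambda>x y. E y x) = E" using sgr_sym[OF assms] by blast
  then have "successively (\<lambda>x y. E y x) xs \<longleftrightarrow> successively E xs" by metis
  then show ?thesis by (simp add: pathl_def)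
qed

lemma pathl_nth:
  assumes "pathl V E xs"
  shows "Suc i < length xs \<Longrightarrow> E (xs ! i) (xs ! Suc i)"
    and "i < length xs \<Longrightarrow> j < length xs \<Longrightarrow> xs ! i = xs ! j \<longleftrightarrow> i = j"
    and "i < length xs \<Longrightarrow> xs ! i \<in> V"
  using assms by (auto simp: pathl_def successively_conv_nth nth_eq_iff_index_eq subsetD)

text \<open>After deletion of the root \<open>r\<close>, every vertex left in its part is connected
  there to a neighbour \<open>u\<close> of \<open>r\<close>, and a path starting at \<open>u\<close>
  can be prolonged by \<open>r\<close>. So the bound on the paths from the chosen vertex drops by
  one with each deletion.\<close>

lemma tree_depth_le_rooted:
  assumes sym: "\<And>u v. E u v \<Longrightarrow> E v u"
  shows "(\<And>v. v \<in> V \<Longrightarrow> \<exists>r\<in>V. (\<lambda>a b. E a b \<and> a \<in> V \<and> b \<in> V)\<^sup>*\<^sup>* v r \<and>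
      (\<forall>xs. pathl V E (r # xs) \<longrightarrow> length xs < n)) \<Longrightarrow> tree_depth_le n V E"
proof (induction n arbitrary: V)
  case 0
  have False if v: "v \<in> V" for v
  proof -
    obtain r where "r \<in> V" "\<forall>xs. pathl V E (r # xs) \<longrightarrow> length xs < 0" using 0[OF v] by blast
    moreover from this have "pathl V E [r]" by (simp add: pathl_def)
    ultimately show False by blast
  qed
  then show ?case by auto
next
  case (Suc n)
  let ?R = "\<lambda>V a b. E a b \<and> a \<in> V \<and> b \<in> V"
  define P where "P = (\<lambda>v r. r \<in> V \<and> (?R V)\<^sup>*\<^sup>* v r \<and> (\<forall>xs. pathl V E (r # xs) \<longrightarrow> length xs < Suc n))"
  \<comment> \<open>\<open>P v\<close> depends only on the component of \<open>v\<close>, so the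
    choice is constant on components.\<close>
  define c where "c = (\<lambda>v. SOME r. P v r)"
  have Pc: "P v (c v)" if "v \<in> V" for v
    unfolding c_def using Suc.prems[OF that] by (intro someI_ex[of "P v"]) (auto simp: P_def)
  have symR: "(?R V)\<^sup>*\<^sup>* b a" if "(?R V)\<^sup>*\<^sup>* a b" for a b
    using that by induction (auto intro: converse_rtranclp_into_rtranclp dest: sym)
  have eq: "c u = c v" if "(?R V)\<^sup>*\<^sup>* u v" for u v
  proof -
    have "(?R V)\<^sup>*\<^sup>* u r \<longleftrightarrow> (?R V)\<^sup>*\<^sup>* v r" for r
      using rtranclp_trans[OF that, of r] rtranclp_trans[OF symR[OF that], of r] by blast
    then have "P u = P v" unfolding P_def by (intro ext) simp
    then show ?thesis by (simp add: c_def)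
  qed
  have c1: "c v \<in> V \<and> c (c v) = c v" if "v \<in> V" for v
    using Pc[OF that] eq[of v "c v"] by (simp add: P_def)
  have c2: "c u = c v" if "u \<in> V" "v \<in> V" "E u v" for u v
    using that by (intro eq) auto
  have "tree_depth_le n ({v \<in> V. c v = r} - {r}) E" if r: "r \<in> V" "c r = r" for r
  proof (rule Suc.IH)
    let ?W = "{v \<in> V. c v = r} - {r}"
    fix v assume v: "v \<in> ?W"
    have vr: "(?R V)\<^sup>*\<^sup>* v r" using Pc[of v] v by (auto simp: P_def)
    \<comment> \<open>Otherwise the vertices reachable from \<open>v\<close> would never leave the
      part without \<open>r\<close>, although \<open>r\<close> is reachable.\<close>
    have "\<exists>u. (?R ?W)\<^sup>*\<^sup>* v u \<and> E u r"
    proof (rule ccontr)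
      assume no: "\<not> ?thesis"
      have "(?R ?W)\<^sup>*\<^sup>* v u \<and> u \<in> ?W" if "(?R V)\<^sup>*\<^sup>* v u" for u
        using that
      proof induction
        case base
        then show ?case using v by simp
      next
        case (step y z)
        have "z \<noteq> r" using no step by blast
        moreover have "c z = r" using c2[of y z] step by auto
        ultimately have "z \<in> ?W" using step by auto
        then show ?case using step by (auto intro: rtranclp.rtrancl_into_rtrancl)
      qed
      from this[OF vr] show False by simp
    qed
    then obtain u where u: "(?R ?W)\<^sup>*\<^sup>* v u" "E u r" by blast
    have uW: "u \<in> ?W" using u(1) v by (induction) auto
    have "length xs < n" if xs: "pathl ?W E (u # xs)" for xs
    proof -
      have "pathl V E (r # u # xs)" using xs sym[OF u(2)] r by (auto simp: pathl_def)
      moreover have "P r r" using Pc[OF r(1)] r(2) by simp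
      ultimately have "length (u # xs) < Suc n" unfolding P_def by blast
      then show ?thesis by simp
    qed
    then show "\<exists>r'\<in>?W. (?R ?W)\<^sup>*\<^sup>* v r' \<and> (\<forall>xs. pathl ?W E (r' # xs) \<longrightarrow> length xs < n)"
      using u uW by blast
  qed
  note td = this
  show ?case
    unfolding tree_depth_le.simps
  proof (intro exI[of _ c] conjI ballI impI)
    show "c v \<in> V" "c (c v) = c v" if "v \<in> V" for v using c1[OF that] by blast+
  qed (rule c2 td; assumption)+
qed

lemma bounded_tree_depth_le:
  assumes "\<And>u v. E u v \<Longrightarrow> E v u" "\<And>xs. pathl V E xs \<Longrightarrow> length xs \<le> n"
  shows "tree_depth_le n V E"
  using assms(1)
proof (rule tree_depth_le_rooted)
  fix v assume "v \<in> V"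
  moreover have "length xs < n" if "pathl V E (v # xs)" for xs using assms(2)[OF that] by simp
  ultimately show "\<exists>r\<in>V. (\<lambda>a b. E a b \<and> a \<in> V \<and> b \<in> V)\<^sup>*\<^sup>* v r \<and> (\<forall>xs. pathl V E (r # xs) \<longrightarrow> length xs < n)"
    by blast
qed

text \<open>A path that meets \<open>A\<close> only in its first vertex is followed until it first
  hits \<open>q\<close>, and then the longer half of \<open>q\<close> is taken. This accounts for
  the factor two.\<close>

lemma connect_paths:
  assumes sg: "sgr V E" and cn: "conn V E" and A: "A \<subseteq> V" "A \<noteq> {}"
    and q: "pathl (V - A) E q" "q \<noteq> []"
  obtains z rs where "z \<in> A" "pathl V E (z # rs)" "set rs \<subseteq> V - A" "length q \<le> 2 * length rs"
proof -
  obtain z0 where z0: "z0 \<in> A" using A by blast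
  have "{u \<in> V. E\<^sup>*\<^sup>* z0 u} = V"
  proof (rule connD[OF cn])
    show "v \<in> {u \<in> V. E\<^sup>*\<^sup>* z0 u}" if "u \<in> {u \<in> V. E\<^sup>*\<^sup>* z0 u}" "E u v" for u v
      using that sgrD[OF sg that(2)] by auto
  qed (use z0 A in auto)
  moreover have "hd q \<in> V" using q by (cases q) (auto simp: pathl_def)
  ultimately have "E\<^sup>*\<^sup>* z0 (hd q)" by blast
  \<comment> \<open>Whenever the walk returns to \<open>A\<close>, the path is started anew there;
    whenever it returns to the path, the path is cut back.\<close>
  moreover have "\<exists>z\<in>A. \<exists>ms. pathl V E (z # ms) \<and> last (z # ms) = u \<and> set ms \<subseteq> V - A" if "E\<^sup>*\<^sup>* z0 u" for u
    using that
  proof induction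
    case base
    have "pathl V E [z0]" using z0 A by (auto simp: pathl_def)
    then show ?case using z0 by (intro bexI[of _ z0] exI[of _ "[]"]) auto
  next
    case (step u u')
    then obtain z ms where z: "z \<in> A" "pathl V E (z # ms)" "last (z # ms) = u" "set ms \<subseteq> V - A" by blast
    have u': "u' \<in> V" using sgrD[OF sg step(2)] by simp
    consider "u' \<in> A" | "u' \<in> set ms" | "u' \<notin> A" "u' \<notin> set ms" by blast
    then show ?case
    proof cases
      case 1
      then have "pathl V E [u']" using u' by (simp add: pathl_def)
      then show ?thesis using 1 by (intro bexI[of _ u'] exI[of _ "[]"]) auto
    next
      case 2
      then obtain m1 m2 where m: "ms = m1 @ u' # m2" by (meson split_list)
      have "pathl V E ((z # m1 @ [u']) @ m2)" using z(2) m by simp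
      then have "pathl V E (z # m1 @ [u'])" unfolding pathl_append by blast
      then show ?thesis using z m by (intro bexI[of _ z] exI[of _ "m1 @ [u']"]) auto
    next
      case 3
      have "pathl V E ((z # ms) @ [u'])"
        unfolding pathl_append using z 3 step(2) u' by (auto simp: pathl_def)
      then show ?thesis using z 3 u' by (intro bexI[of _ z] exI[of _ "ms @ [u']"]) auto
    qed
  qed
  ultimately obtain z ms where z: "z \<in> A" "pathl V E (z # ms)" "last (z # ms) = hd q" "set ms \<subseteq> V - A" by blast
  have "hd q \<in> set q" "hd q \<notin> A" using q by (cases q; auto simp: pathl_def)+
  then have "ms \<noteq> []" using z(1,3) by auto
  then have "hd q \<in> set ms" using z(3) last_in_set[of ms] by simp
  then have "\<exists>a\<in>set ms. a \<in> set q" using hd_in_set[OF q(2)] by blast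
  then obtain m1 a m2 where m: "ms = m1 @ a # m2" "a \<in> set q" "\<forall>y\<in>set m1. y \<notin> set q"
    using split_list_first_prop[of ms "\<lambda>a. a \<in> set q"] by blast
  obtain q1 q2 where q12: "q = q1 @ a # q2" using m(2) by (meson split_list)
  have za: "pathl V E (z # m1 @ [a])"
  proof -
    have "pathl V E ((z # m1 @ [a]) @ m2)" using z(2) m by simp
    then show ?thesis unfolding pathl_append by blast
  qed
  have zq: "z \<notin> set q" using z(1) q by (auto simp: pathl_def)
  have ext: "pathl V E ((z # m1 @ [a]) @ t)" if "pathl V E (a # t)" "set t \<subseteq> set q" for t
    unfolding pathl_append
  proof (intro conjI)
    show "pathl V E (z # m1 @ [a])" by (rule za)
    show "pathl V E t" using that(1) by (cases t) (auto simp: pathl_def)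
    show "set (z # m1 @ [a]) \<inter> set t = {}" using that zq m(3) by (auto simp: pathl_def)
    show "z # m1 @ [a] = [] \<or> t = [] \<or> E (last (z # m1 @ [a])) (hd t)"
      using that(1) by (cases t) (auto simp: pathl_def)
  qed
  have qV: "pathl V E q" using pathl_mono[OF q(1), of V] by auto
  have m1: "set m1 \<subseteq> V - A" "a \<in> V - A" "set q \<subseteq> V - A" using z(4) m(1) q by (auto simp: pathl_def)
  show thesis
  proof (cases "length q1 \<le> length q2")
    case True
    have "pathl V E (a # q2)" using qV unfolding q12 pathl_append by blast
    from ext[OF this] have "pathl V E (z # m1 @ a # q2)" using q12 by auto
    then show ?thesis using that[OF z(1), of "m1 @ a # q2"] m1 q12 True by auto
  next
    case False
    have "pathl V E ((q1 @ [a]) @ q2)" using qV q12 by simp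
    then have "pathl V E (q1 @ [a])" unfolding pathl_append by blast
    then have "pathl V E (rev (q1 @ [a]))" using pathl_rev[OF sg] by blast
    then have "pathl V E (a # rev q1)" by simp
    from ext[OF this] have "pathl V E (z # m1 @ a # rev q1)" using q12 by auto
    then show ?thesis using that[OF z(1), of "m1 @ a # rev q1"] m1 q12 False by auto
  qed
qed

context
  fixes V :: "'a set" and E :: "'a \<Rightarrow> 'a \<Rightarrow> bool" and c :: nat
  assumes sg: "sgr V E" and cn: "conn V E" and c: "c \<ge> 1"
    and DEG: "\<And>xs i w. pathl V E xs \<Longrightarrow> c \<le> i \<Longrightarrow> i + c < length xs \<Longrightarrow> E (xs ! i) w \<Longrightarrow>
        w = xs ! (i - 1) \<or> w = xs ! Suc i"
begin

text \<open>A deep vertex has no neighbour besides the two on the path, so the edge from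
  \<open>m1\<close> to \<open>m2\<close> determines how every long path continues, except within
  distance \<open>c\<close> of its end. The paths agree on longer and longer initial segments, and
  the limit is read off diagonally.\<close>

lemma ray_limit:
  assumes "\<And>n. \<exists>as bs. pathl V E (as @ m1 # m2 # bs) \<and> c \<le> length as \<and> n \<le> length bs \<and> set bs \<subseteq> W"
  shows "\<exists>g :: nat \<Rightarrow> 'a. inj g \<and> range g \<subseteq> V \<and> g 0 = m1 \<and> g 1 = m2 \<and> (\<forall>i. g (i + 2) \<in> W) \<and>
     (\<forall>i. E (g i) (g (Suc i))) \<and> (\<forall>i w. E (g (Suc i)) w \<longrightarrow> w = g i \<or> w = g (Suc (Suc i)))"
proof -
  have "\<forall>n. \<exists>p. pathl V E (fst p @ m1 # m2 # snd p) \<and> c \<le> length (fst p) \<and> n \<le> length (snd p) \<and> set (snd p) \<subseteq> W"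
    using assms by (metis fst_conv snd_conv)
  from choice[OF this] obtain p where
    p: "\<forall>n. pathl V E (fst (p n) @ m1 # m2 # snd (p n)) \<and> c \<le> length (fst (p n)) \<and> n \<le> length (snd (p n)) \<and> set (snd (p n)) \<subseteq> W"
    by (rule exE)
  define ys where "ys = (\<lambda>n. m1 # m2 # snd (p n))"
  have ysp: "pathl V E (ys n)" and yl: "n + 2 \<le> length (ys n)" for n
    using p pathl_append[of V E "fst (p n)" "ys n"] by (auto simp: ys_def)
  have nb: "w = ys n ! i \<or> w = ys n ! Suc (Suc i)" if "Suc i + c < length (ys n)" "E (ys n ! Suc i) w" for n i w
  proof -
    let ?a = "fst (p n)"
    have P: "pathl V E (?a @ ys n)" "c \<le> length ?a" using p by (simp_all add: ys_def)
    have nth: "(?a @ ys n) ! (length ?a + j) = ys n ! j" for j by simp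
    show ?thesis
      using DEG[OF P(1), of "length ?a + Suc i" w] nth[of "Suc i"] nth[of i] nth[of "Suc (Suc i)"] that P(2)
      by simp
  qed
  \<comment> \<open>Two consecutive vertices determine the next one, as the only other neighbour of
    the second.\<close>
  have agree: "ys n ! i = ys m ! i" if "i + c \<le> n" "i + c \<le> m" for i n m
    using that
  proof (induction i rule: less_induct)
    case (less i)
    consider "i = 0" | "i = 1" | j where "i = Suc (Suc j)" by (metis One_nat_def not0_implies_Suc)
    then show ?case
    proof cases
      case 3
      have 1: "ys n ! Suc j = ys m ! Suc j" "ys n ! j = ys m ! j" using less 3 by auto
      have "E (ys m ! Suc j) (ys m ! i)" using pathl_nth(1)[OF ysp, of "Suc j" m] yl[of m] less.prems 3 by simp
      then have "ys m ! i = ys n ! j \<or> ys m ! i = ys n ! i"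
        using nb[of j n "ys m ! i"] yl[of n] less.prems 3 1 by auto
      moreover have "ys m ! i \<noteq> ys m ! j" using pathl_nth(2)[OF ysp, of i m j] yl[of m] less.prems 3 by simp
      ultimately show ?thesis using 1 by metis
    qed (auto simp: ys_def)
  qed
  define g where "g = (\<lambda>i. ys (i + c) ! i)"
  have gy: "g i = ys n ! i" if "i + c \<le> n" for i n using agree[of i "i + c" n] that by (simp add: g_def)
  have "inj g"
  proof (rule injI)
    fix i j assume "g i = g j"
    then have "ys (i + j + c) ! i = ys (i + j + c) ! j" using gy[of i "i + j + c"] gy[of j "i + j + c"] by simp
    then show "i = j" using pathl_nth(2)[OF ysp, of i "i + j + c" j] yl[of "i + j + c"] by simp
  qed
  moreover have "range g \<subseteq> V"
  proof
    fix v assume "v \<in> range g"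
    then obtain i where "v = g i" by blast
    then show "v \<in> V" using pathl_nth(3)[OF ysp, of i "i + c"] yl[of "i + c"] by (simp add: g_def)
  qed
  moreover have "g 0 = m1" "g 1 = m2" by (simp_all add: g_def ys_def)
  moreover have "g (i + 2) \<in> W" for i
  proof -
    have "snd (p (i + 2 + c)) ! i \<in> set (snd (p (i + 2 + c)))"
      using p[THEN spec, of "i + 2 + c"] by (intro nth_mem) simp
    then show ?thesis using p[THEN spec, of "i + 2 + c"] by (auto simp: g_def ys_def)
  qed
  moreover have "E (g i) (g (Suc i))" for i
    using gy[of i "Suc i + c"] gy[of "Suc i" "Suc i + c"] pathl_nth(1)[OF ysp, of i "Suc i + c"] yl[of "Suc i + c"] by simp
  moreover have "w = g i \<or> w = g (Suc (Suc i))" if "E (g (Suc i)) w" for i w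
    using gy[of i "i + 2 + c"] gy[of "Suc i" "i + 2 + c"] gy[of "Suc (Suc i)" "i + 2 + c"] nb[of i "i + 2 + c" w] yl[of "i + 2 + c"] that
    by simp
  ultimately show ?thesis by (intro exI[of _ g]) blast
qed

text \<open>A path is maintained whose fixed edge from \<open>m1\<close> to \<open>m2\<close> stays
  deep. Off this path there are again long paths, and one of them is connected to it; the connection
  must be at a vertex within distance \<open>c\<close> of an end, as deeper vertices have no further
  neighbours. Exchanging this end for the new piece makes the path longer, so one side of the fixed
  edge is unbounded and \<open>ray_limit\<close> applies.\<close>

lemma ray_if_robust:
  assumes rob: "\<And>S n. finite S \<Longrightarrow> S \<subseteq> V \<Longrightarrow> \<exists>xs. pathl (V - S) E xs \<and> n \<le> length xs"
  shows "\<exists>g :: nat \<Rightarrow> 'a. inj g \<and> range g \<subseteq> V \<and> (\<forall>i. E (g i) (g (Suc i)))"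
proof -
  obtain xs where xs: "pathl V E xs" "2 * c + 2 \<le> length xs" using rob[of "{}" "2 * c + 2"] by auto
  define m1 where "m1 = xs ! c"
  define m2 where "m2 = xs ! Suc c"
  have xs0: "xs = take c xs @ m1 # m2 # drop (c + 2) xs"
    using xs(2) id_take_nth_drop[of c xs] Cons_nth_drop_Suc[of "Suc c" xs] by (simp add: m1_def m2_def)
  have ext: "\<exists>as bs. pathl V E (as @ m1 # m2 # bs) \<and> c \<le> length as \<and> c \<le> length bs \<and> n \<le> length as + length bs" for n
  proof (induction n)
    case 0
    have "c \<le> length (take c xs)" "c \<le> length (drop (c + 2) xs)" using xs(2) by simp_all
    then show ?case using xs(1) xs0 by (intro exI[of _ "take c xs"] exI[of _ "drop (c + 2) xs"]) simp
  next
    case (Suc n)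
    then obtain as bs where P: "pathl V E (as @ m1 # m2 # bs)" "c \<le> length as" "c \<le> length bs" by blast
    let ?P = "as @ m1 # m2 # bs"
    have AV: "set ?P \<subseteq> V" using P(1) by (simp add: pathl_def)
    \<comment> \<open>Connecting loses a factor two; at least \<open>n + c + 1\<close> vertices
      remain, enough both for the depth \<open>c\<close> and for the length
      \<open>Suc n\<close>.\<close>
    obtain q where q: "pathl (V - set ?P) E q" "2 * (n + c + 1) \<le> length q"
      using rob[OF finite_set AV, of "2 * (n + c + 1)"] by blast
    have "set ?P \<noteq> {}" "q \<noteq> []" using q(2) by auto
    then obtain z rs where z: "z \<in> set ?P" "pathl V E (z # rs)" "set rs \<subseteq> V - set ?P" "length q \<le> 2 * length rs"
      using connect_paths[OF sg cn AV _ q(1)] by metis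
    have lr: "n + c + 1 \<le> length rs" using z(4) q(2) by simp
    then have rs: "rs \<noteq> []" by auto
    then have Ez: "E z (hd rs)" "hd rs \<notin> set ?P" using z(2,3) by (cases rs; auto simp: pathl_def)+
    have prs: "pathl V E rs" using z(2) rs by (cases rs) (auto simp: pathl_def)
    obtain i where i: "i < length ?P" "?P ! i = z" using z(1) by (metis in_set_conv_nth)
    have "\<not> (c \<le> i \<and> i + c < length ?P)"
    proof
      assume a: "c \<le> i \<and> i + c < length ?P"
      then have "hd rs = ?P ! (i - 1) \<or> hd rs = ?P ! Suc i" using DEG[OF P(1), of i "hd rs"] Ez(1) i by simp
      moreover have "i - 1 < length ?P" "Suc i < length ?P" using a c by auto
      ultimately show False using Ez(2) nth_mem by metis
    qed
    then consider "i < c" | "length ?P \<le> i + c" by linarith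
    then show ?case
    proof cases
      case 1
      let ?a = "rev rs @ drop i as"
      have dr: "drop i ?P = drop i as @ m1 # m2 # bs" using 1 P(2) by simp
      have "?P = take i ?P @ drop i ?P" by (rule append_take_drop_id[symmetric])
      then have pd: "pathl V E (drop i ?P)" using P(1) pathl_append by metis
      have hd: "hd (drop i ?P) = z" using hd_drop_conv_nth[OF i(1)] i(2) by (rule trans)
      have "pathl V E (rev rs @ drop i ?P)"
        unfolding pathl_append
      proof (intro conjI)
        show "pathl V E (rev rs)" using prs pathl_rev[OF sg] by blast
        show "set (rev rs) \<inter> set (drop i ?P) = {}" using z(3) set_drop_subset[of i ?P] by auto
        show "rev rs = [] \<or> drop i ?P = [] \<or> E (last (rev rs)) (hd (drop i ?P))"
          using Ez(1) sgr_sym[OF sg] hd rs by (simp add: last_rev)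
      qed (rule pd)
      then have "pathl V E (?a @ m1 # m2 # bs)" using dr by simp
      moreover have "c \<le> length ?a" "Suc n \<le> length ?a + length bs" using lr by simp_all
      ultimately show ?thesis using P(3) by blast
    next
      case 2
      have i2: "length as + 2 \<le> i" using 2 P(3) by simp
      let ?b = "take (Suc i - length as - 2) bs @ rs"
      have tk: "take (Suc i) ?P = as @ m1 # m2 # take (Suc i - length as - 2) bs"
        using i2 by (simp add: take_Cons' Suc_diff_le)
      have "?P = take (Suc i) ?P @ drop (Suc i) ?P" by (rule append_take_drop_id[symmetric])
      then have pt: "pathl V E (take (Suc i) ?P)" using P(1) pathl_append by metis
      have last: "last (take (Suc i) ?P) = z" using take_Suc_conv_app_nth[OF i(1)] i(2) by (metis last_snoc)
      have "pathl V E (take (Suc i) ?P @ rs)"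
        unfolding pathl_append
      proof (intro conjI)
        show "set (take (Suc i) ?P) \<inter> set rs = {}" using z(3) set_take_subset[of "Suc i" ?P] by auto
        show "take (Suc i) ?P = [] \<or> rs = [] \<or> E (last (take (Suc i) ?P)) (hd rs)"
          using Ez(1) last by simp
      qed (rule pt prs)+
      then have "pathl V E (as @ m1 # m2 # ?b)" by (simp only: tk append_assoc append_Cons)
      moreover have "c \<le> length ?b" "Suc n \<le> length as + length ?b" using lr by simp_all
      ultimately show ?thesis using P(2) by blast
    qed
  qed
  define R where "R = (\<lambda>as bs. pathl V E (as @ m1 # m2 # bs) \<and> c \<le> length as \<and> c \<le> length bs)"
  have R: "\<exists>as bs. R as bs \<and> (n \<le> length as \<or> n \<le> length bs)" for n
  proof -
    obtain as bs where ab: "R as bs" "2 * n \<le> length as + length bs" using ext[of "2 * n"] unfolding R_def by blast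
    then have "n \<le> length as \<or> n \<le> length bs" by linarith
    then show ?thesis using ab(1) by blast
  qed
  have "(\<forall>n. \<exists>as bs. R as bs \<and> n \<le> length bs) \<or> (\<forall>n. \<exists>as bs. R as bs \<and> n \<le> length as)"
  proof (rule ccontr)
    assume "\<not> ?thesis"
    then obtain n1 n2 where n: "\<And>as bs. R as bs \<Longrightarrow> length bs < n1" "\<And>as bs. R as bs \<Longrightarrow> length as < n2"
      by (metis not_le)
    obtain as bs where ab: "R as bs" "n1 + n2 \<le> length as \<or> n1 + n2 \<le> length bs" using R by blast
    then show False using n(1)[OF ab(1)] n(2)[OF ab(1)] by linarith
  qed
  then show ?thesis
  proof
    assume a: "\<forall>n. \<exists>as bs. R as bs \<and> n \<le> length bs"
    have "\<exists>as bs. pathl V E (as @ m1 # m2 # bs) \<and> c \<le> length as \<and> n \<le> length bs \<and> set bs \<subseteq> UNIV" for n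
      using a unfolding R_def by blast
    from ray_limit[OF this] show ?thesis by blast
  next
    assume a: "\<forall>n. \<exists>as bs. R as bs \<and> n \<le> length as"
    have "\<exists>as bs. pathl V E (as @ m2 # m1 # bs) \<and> c \<le> length as \<and> n \<le> length bs \<and> set bs \<subseteq> UNIV" for n
    proof -
      obtain as bs where ab: "R as bs" "n \<le> length as" using a by blast
      then have "pathl V E (rev (as @ m1 # m2 # bs))" using pathl_rev[OF sg] unfolding R_def by blast
      then show ?thesis using ab unfolding R_def by (intro exI[of _ "rev bs"] exI[of _ "rev as"]) simp
    qed
    from ray_limit[OF this] show ?thesis by blast
  qed
qed

lemma ray_pathl:
  fixes f :: "nat \<Rightarrow> 'a"
  assumes "inj f" "range f \<subseteq> V" "\<And>i. E (f i) (f (Suc i))"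
  shows "pathl V E (map f [m..<n])"
  using assms by (auto simp: pathl_def distinct_map successively_conv_nth intro: inj_on_subset)

text \<open>A tail \<open>F\<close> of the ray is attached to the rest by one edge only. If the
  paths in the rest are bounded, this is a ray with a remainder of bounded tree-depth. Otherwise
  long paths leave from \<open>a\<close> away from \<open>F\<close>, a second ray arises from them,
  and the two rays form a set closed under adjacency, which is everything by connectedness.\<close>

lemma structure_ray:
  fixes f :: "nat \<Rightarrow> 'a"
  assumes f: "inj f" "range f \<subseteq> V" "\<And>i. E (f i) (f (Suc i))"
  shows "(\<exists>(f :: nat \<Rightarrow> 'a) k a. inj f \<and> range f \<subseteq> V \<and> (\<forall>i j. E (f i) (f j) \<longleftrightarrow> i = Suc j \<or> j = Suc i) \<and>
          (\<forall>v\<in>V - range f. \<forall>i. E (f i) v \<longleftrightarrow> i = 0 \<and> v = a) \<and> tree_depth_le k (V - range f) E) \<or>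
      (\<exists>h :: int \<Rightarrow> 'a. bij_betw h UNIV V \<and> (\<forall>s t. E (h s) (h t) \<longleftrightarrow> \<bar>s - t\<bar> = 1))"
proof -
  have sym: "E u v \<Longrightarrow> E v u" for u v using sgr_sym[OF sg] by blast
  have nbf: "w = f (j - 1) \<or> w = f (Suc j)" if "c \<le> j" "E (f j) w" for j w
    using DEG[OF ray_pathl[OF f, of 0 "j + c + 1"], of j w] that c by (simp del: upt_Suc)
  \<comment> \<open>The first \<open>c + 1\<close> vertices are dropped, so that even
    \<open>F 0\<close> is deep; \<open>a\<close> is its only neighbour outside
    \<open>F\<close>.\<close>
  define F where "F = (\<lambda>i. f (Suc (c + i)))"
  define a where "a = f c"
  have "inj F" unfolding F_def by (rule injI) (auto dest: injD[OF f(1)])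
  moreover have "range F \<subseteq> V" using f(2) by (auto simp: F_def)
  moreover have "E (F i) (F (Suc i))" for i using f(3)[of "Suc (c + i)"] by (simp add: F_def)
  ultimately have F: "inj F" "range F \<subseteq> V" "\<And>i. E (F i) (F (Suc i))" by blast+
  have aF: "a \<noteq> F i" for i using injD[OF f(1), of c "Suc (c + i)"] by (auto simp: a_def F_def)
  have aV: "a \<in> V" and E0: "E (F 0) a" using f(2) sym[OF f(3)[of c]] by (auto simp: a_def F_def)
  have nb0: "w = a \<or> w = F 1" if "E (F 0) w" for w using nbf[of "Suc c" w] that by (simp add: F_def a_def)
  have nbS: "w = F i \<or> w = F (Suc (Suc i))" if "E (F (Suc i)) w" for i w
    using nbf[of "Suc (c + Suc i)" w] that by (simp add: F_def)
  have exact: "E (F i) (F j) \<longleftrightarrow> i = Suc j \<or> j = Suc i" for i j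
  proof
    assume "E (F i) (F j)"
    then show "i = Suc j \<or> j = Suc i"
      using nb0[of "F j"] nbS[of "i - 1" "F j"] F(1) aF[of j] by (cases i) (auto simp: inj_eq)
  next
    assume "i = Suc j \<or> j = Suc i"
    then show "E (F i) (F j)" using F(3) sym by blast
  qed
  have attach: "E (F i) v \<longleftrightarrow> i = 0 \<and> v = a" if "v \<notin> range F" for v i
    using nb0[of v] nbS[of "i - 1" v] that E0 by (cases i) auto
  show ?thesis
  proof (cases "\<exists>n. \<forall>xs. pathl (V - range F) E xs \<longrightarrow> length xs \<le> n")
    case True
    then obtain n where "\<And>xs. pathl (V - range F) E xs \<Longrightarrow> length xs \<le> n" by blast
    from bounded_tree_depth_le[OF sym this] have "tree_depth_le n (V - range F) E" .
    then show ?thesis using F(1,2) exact attach by (intro disjI1 exI[of _ F] exI[of _ n] exI[of _ a]) simp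
  next
    case False
    let ?A = "range F \<union> {a}"
    have av: "\<exists>xs. pathl (V - ?A) E xs \<and> n \<le> length xs" for n
    proof -
      obtain xs where xs: "pathl (V - range F) E xs" "2 * n < length xs" using False by (metis not_le)
      show ?thesis
      proof (cases "a \<in> set xs")
        case True
        then obtain x1 x2 where x: "xs = x1 @ a # x2" by (meson split_list)
        then have "pathl (V - ?A) E x1" "pathl (V - ?A) E x2"
          using xs(1) by (auto simp: pathl_def successively_append_iff successively_Cons)
        moreover have "n \<le> length x1 \<or> n \<le> length x2" using xs(2) x by simp linarith
        ultimately show ?thesis by blast
      next
        case False
        then have "pathl (V - ?A) E xs" using xs(1) by (auto simp: pathl_def)
        then show ?thesis using xs(2) by (intro exI[of _ xs]) simp
      qed
    qed
    have "\<exists>as bs. pathl V E (as @ F 0 # a # bs) \<and> c \<le> length as \<and> n \<le> length bs \<and> set bs \<subseteq> V - ?A" for n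
    proof -
      obtain q where q: "pathl (V - ?A) E q" "2 * n + 1 \<le> length q" using av by blast
      have "?A \<subseteq> V" "?A \<noteq> {}" "q \<noteq> []" using F(2) aV q(2) by auto
      then obtain z rs where z: "z \<in> ?A" "pathl V E (z # rs)" "set rs \<subseteq> V - ?A" "length q \<le> 2 * length rs"
        using connect_paths[OF sg cn _ _ q(1)] by metis
      have rs: "rs \<noteq> []" using z(4) q(2) by auto
      then have "E z (hd rs)" "hd rs \<notin> ?A" using z(2,3) by (cases rs; auto simp: pathl_def)+
      then have "z = a" using attach z(1) by blast
      \<comment> \<open>The reversed beginning of \<open>F\<close> provides the \<open>c\<close>
        vertices that \<open>ray_limit\<close> requires before the edge from \<open>F 0\<close> to
        \<open>a\<close>.\<close>
      let ?as = "map F (rev [1..<Suc c])"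
      have eq: "rev (map F [0..<Suc c]) = ?as @ [F 0]" by (simp add: rev_map upt_conv_Cons del: upt_Suc)
      have "pathl V E (rev (map F [0..<Suc c]))" using ray_pathl[OF F] pathl_rev[OF sg] by blast
      then have "pathl V E ((?as @ [F 0]) @ a # rs)"
        unfolding pathl_append[of V E "?as @ [F 0]" "a # rs"] eq
        using z \<open>z = a\<close> E0 aF by (auto simp del: upt_Suc)
      moreover have "n \<le> length rs" using z(4) q(2) by simp
      ultimately show ?thesis using z(3) by (intro exI[of _ ?as] exI[of _ rs]) simp
    qed
    from ray_limit[OF this] obtain g where g: "inj g" "range g \<subseteq> V" "g 0 = F 0" "g 1 = a"
      "\<forall>i. g (i + 2) \<in> V - ?A" "\<forall>i. E (g i) (g (Suc i))"
      "\<forall>i w. E (g (Suc i)) w \<longrightarrow> w = g i \<or> w = g (Suc (Suc i))" by blast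
    \<comment> \<open>Since \<open>g 0 = F 0\<close> and \<open>g 1 = a\<close>, the two rays
      overlap in \<open>F 0\<close> only and are joined there.\<close>
    define h where "h = (\<lambda>s :: int. if 0 \<le> s then F (nat s) else g (nat (- s)))"
    have hF: "h (int i) = F i" and hg: "h (- int (Suc i)) = g (Suc i)" for i by (simp_all add: h_def del: of_nat_Suc)
    have hg0: "h (- int i) = g i" for i using hg[of "i - 1"] g(3) hF[of 0] by (cases i) simp_all
    have gF: "g (Suc i) \<notin> range F" for i
    proof (cases i)
      case 0
      then show ?thesis using g(4) aF by auto
    next
      case (Suc j)
      then show ?thesis using g(5)[rule_format, of j] by simp
    qed
    have injh: "inj h"
    proof (rule injI)
      fix s t assume st: "h s = h t"
      show "s = t"
      proof (cases s rule: int_cases; cases t rule: int_cases)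
        fix i j assume ij: "s = int i" "t = int j"
        then show ?thesis using st F(1) by (simp add: hF inj_eq)
      next
        fix i j assume ij: "s = int i" "t = - int (Suc j)"
        then have "F i = g (Suc j)" using st hF[of i] hg[of j] by metis
        then show ?thesis using gF[of j] by (metis rangeI)
      next
        fix i j assume ij: "s = - int (Suc i)" "t = int j"
        then have "g (Suc i) = F j" using st hF[of j] hg[of i] by metis
        then show ?thesis using gF[of i] by (metis rangeI)
      next
        fix i j assume ij: "s = - int (Suc i)" "t = - int (Suc j)"
        then have "g (Suc i) = g (Suc j)" using st hg[of i] hg[of j] by metis
        then show ?thesis using g(1) ij by (simp add: inj_eq)
      qed
    qed
    have step: "E (h s) (h (s + 1))" for s
    proof (cases s rule: int_cases)
      case (nonneg i)
      then show ?thesis using F(3)[of i] hF[of i] hF[of "Suc i"] by (simp add: add.commute)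
    next
      case (neg i)
      have "h (s + 1) = g i" using hg0[of i] neg by simp
      then show ?thesis using sym[OF g(6)[rule_format, of i]] hg[of i] neg by simp
    qed
    have nbh: "w = h (s - 1) \<or> w = h (s + 1)" if w: "E (h s) w" for s w
    proof (cases s rule: int_cases)
      case (nonneg i)
      have 1: "h (s + 1) = F (Suc i)" using hF[of "Suc i"] nonneg by (simp add: add.commute)
      have 2: "E (F i) w" using w hF[of i] nonneg by simp
      show ?thesis
      proof (cases i)
        case 0
        then have "h (s - 1) = a" using hg[of 0] g(4) nonneg by simp
        then show ?thesis using nb0[of w] 1 2 0 by auto
      next
        case (Suc j)
        then have "h (s - 1) = F j" using hF[of j] nonneg by simp
        then show ?thesis using nbS[of j w] 1 2 Suc by auto
      qed
    next
      case (neg i)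
      have "h (s + 1) = g i" using hg0[of i] neg by simp
      moreover have "s - 1 = - int (Suc (Suc i))" using neg by simp
      then have "h (s - 1) = g (Suc (Suc i))" using hg[of "Suc i"] by (simp only:)
      moreover have "E (g (Suc i)) w" using w hg[of i] neg by simp
      ultimately show ?thesis using g(7) by metis
    qed
    have "range h = V"
    proof (rule connD[OF cn])
      show "range h \<subseteq> V"
      proof
        fix v assume "v \<in> range h"
        then obtain s where "v = h s" by blast
        then show "v \<in> V" using sgrD[OF sg step[of s]] by simp
      qed
      show "v \<in> range h" if "u \<in> range h" "E u v" for u v using that nbh by blast
    qed simp
    moreover have "E (h s) (h t) \<longleftrightarrow> \<bar>s - t\<bar> = 1" for s t
    proof
      assume "E (h s) (h t)"
      from nbh[OF this] show "\<bar>s - t\<bar> = 1" using injh by (auto simp: inj_eq)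
    next
      assume "\<bar>s - t\<bar> = 1"
      then consider "t = s + 1" | "s = t + 1" by linarith
      then show "E (h s) (h t)" using step sym by cases blast+
    qed
    ultimately show ?thesis using injh unfolding bij_betw_def by blast
  qed
qed

text \<open>Either finitely many vertices destroy all long paths, or long paths persist after every
  finite deletion; the latter yields a ray.\<close>

theorem finite_ray_or_line_structure:
  shows "(\<exists>S0 k. finite S0 \<and> S0 \<subseteq> V \<and> tree_depth_le k (V - S0) E) \<or>
      (\<exists>(f :: nat \<Rightarrow> 'a) k a. inj f \<and> range f \<subseteq> V \<and> (\<forall>i j. E (f i) (f j) \<longleftrightarrow> i = Suc j \<or> j = Suc i) \<and>
          (\<forall>v\<in>V - range f. \<forall>i. E (f i) v \<longleftrightarrow> i = 0 \<and> v = a) \<and> tree_depth_le k (V - range f) E) \<or>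
      (\<exists>h :: int \<Rightarrow> 'a. bij_betw h UNIV V \<and> (\<forall>s t. E (h s) (h t) \<longleftrightarrow> \<bar>s - t\<bar> = 1))"
proof (cases "\<exists>S n. finite S \<and> S \<subseteq> V \<and> (\<forall>xs. pathl (V - S) E xs \<longrightarrow> length xs \<le> n)")
  case True
  then obtain S n where S: "finite S" "S \<subseteq> V" "\<And>xs. pathl (V - S) E xs \<Longrightarrow> length xs \<le> n" by blast
  have "tree_depth_le n (V - S) E" using sgr_sym[OF sg] by (intro bounded_tree_depth_le S(3)) blast+
  then show ?thesis using S by blast
next
  case False
  have "\<exists>xs. pathl (V - S) E xs \<and> n \<le> length xs" if "finite S" "S \<subseteq> V" for S n
    using False that by (meson nat_le_linear)
  from ray_if_robust[OF this] obtain g :: "nat \<Rightarrow> 'a" where "inj g" "range g \<subseteq> V" "\<forall>i. E (g i) (g (Suc i))" by blast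
  then show ?thesis using structure_ray[of g] by blast
qed

end

section \<open>Paths and near-paths\<close>

lemma path_free_bounded:
  assumes \<rho>: "inj_on \<rho> VT" "\<rho> ` VT \<subseteq> {..<n}"
    and ET: "\<And>u v. ET u v \<Longrightarrow> u \<in> VT \<and> v \<in> VT \<and> (\<rho> u = Suc (\<rho> v) \<or> \<rho> v = Suc (\<rho> u))"
    and fr: "free VT ET V E" and xs: "pathl V E xs"
  shows "length xs \<le> n"
proof (rule ccontr)
  assume "\<not> length xs \<le> n"
  then have len: "\<rho> u < length xs" if "u \<in> VT" for u using \<rho>(2) that by fastforce
  have sg: "sgr V E" using fr by (simp add: free_def)
  have "emb VT ET V E (\<lambda>u. xs ! \<rho> u)"
    unfolding emb_def
  proof (intro conjI allI impI)
    show "inj_on (\<lambda>u. xs ! \<rho> u) VT"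
    proof (rule inj_onI)
      fix u v assume uv: "u \<in> VT" "v \<in> VT" "xs ! \<rho> u = xs ! \<rho> v"
      then have "\<rho> u = \<rho> v" using pathl_nth(2)[OF xs len[OF uv(1)] len[OF uv(2)]] by simp
      then show "u = v" using inj_onD[OF \<rho>(1)] uv by blast
    qed
    show "(\<lambda>u. xs ! \<rho> u) ` VT \<subseteq> V" using pathl_nth(3)[OF xs len] by blast
    show "E (xs ! \<rho> u) (xs ! \<rho> v)" if "ET u v" for u v
      using ET[OF that] pathl_nth(1)[OF xs, of "\<rho> u"] pathl_nth(1)[OF xs, of "\<rho> v"] len sgr_sym[OF sg] by metis
  qed
  then show False using fr by (auto simp: free_def)
qed

context
  fixes VT :: "'a set" and ET :: "'a \<Rightarrow> 'a \<Rightarrow> bool" and \<rho> :: "'a \<Rightarrow> nat" and n :: nat and v w :: 'a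
  assumes \<rho>: "inj_on \<rho> (VT - {w})" "\<rho> ` (VT - {w}) \<subseteq> {..<n}" and v: "v \<in> VT - {w}"
    and ET: "\<And>a b. ET a b \<Longrightarrow> a \<in> VT - {w} \<and> b \<in> VT - {w} \<and> (\<rho> a = Suc (\<rho> b) \<or> \<rho> b = Suc (\<rho> a)) \<or>
        (a, b) = (v, w) \<or> (a, b) = (w, v)"
begin

text \<open>Here \<open>\<rho>\<close> numbers the path of the near-path and \<open>w\<close> is the
  leaf attached at \<open>v\<close>. With \<open>n\<close> vertices on either side, position
  \<open>k\<close> can play the role of \<open>v\<close>, and \<open>w'\<close> that of the
  leaf.\<close>

lemma near_path_emb:
  assumes fr: "free VT ET V E" and xs: "pathl V E xs" and k: "n \<le> k" "k + n \<le> length xs"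
    and w': "E (xs ! k) w'" "w' \<notin> set xs"
  shows False
proof -
  have sg: "sgr V E" using fr by (simp add: free_def)
  have \<rho>n: "\<rho> u < n" if "u \<in> VT" "u \<noteq> w" for u using \<rho>(2) that by auto
  have vn: "\<rho> v < n" using \<rho>n v by auto
  \<comment> \<open>Shifted so that \<open>v\<close> comes to position \<open>k\<close>; the
    subtraction does not truncate because \<open>\<rho> v < n\<close> and
    \<open>n \<le> k\<close>.\<close>
  define p where "p = (\<lambda>u. k + \<rho> u - \<rho> v)"
  have len: "p u < length xs" if "u \<in> VT" "u \<noteq> w" for u using \<rho>n[OF that] vn k by (simp add: p_def)
  have pinj: "a = b" if "a \<in> VT" "a \<noteq> w" "b \<in> VT" "b \<noteq> w" "xs ! p a = xs ! p b" for a b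
  proof -
    have "p a = p b" using pathl_nth(2)[OF xs len len] that by blast
    then have "\<rho> a = \<rho> b" using k vn by (simp add: p_def)
    then show ?thesis using inj_onD[OF \<rho>(1)] that by auto
  qed
  define f where "f = (\<lambda>u. if u = w then w' else xs ! p u)"
  have out: "xs ! p a \<noteq> w'" if "a \<in> VT" "a \<noteq> w" for a
    using nth_mem[OF len[OF that]] w'(2) by metis
  have "emb VT ET V E f"
    unfolding emb_def
  proof (intro conjI allI impI)
    show "inj_on f VT"
    proof (rule inj_onI)
      fix a b assume ab: "a \<in> VT" "b \<in> VT" "f a = f b"
      then show "a = b"
        using pinj[of a b] out[of a] out[of b] by (cases "a = w"; cases "b = w") (simp_all add: f_def)
    qed
    show "f ` VT \<subseteq> V"
    proof (rule image_subsetI)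
      fix a assume "a \<in> VT"
      then show "f a \<in> V" using pathl_nth(3)[OF xs len, of a] sgrD[OF sg w'(1)] by (simp add: f_def)
    qed
    show "E (f a) (f b)" if ab: "ET a b" for a b
    proof -
      consider "a \<in> VT - {w}" "b \<in> VT - {w}" "\<rho> b = Suc (\<rho> a)" | "a \<in> VT - {w}" "b \<in> VT - {w}" "\<rho> a = Suc (\<rho> b)"
        | "a = v" "b = w" | "a = w" "b = v" using ET[OF ab] by blast
      then show ?thesis
      proof cases
        case 1
        then have "p b = Suc (p a)" using k vn by (simp add: p_def)
        then show ?thesis using pathl_nth(1)[OF xs, of "p a"] len[of b] 1 by (simp add: f_def)
      next
        case 2
        then have "p a = Suc (p b)" using k vn by (simp add: p_def)
        then show ?thesis using pathl_nth(1)[OF xs, of "p b"] len[of a] 2 sgr_sym[OF sg] by (simp add: f_def)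
      next
        case 3
        then show ?thesis using w'(1) v by (simp add: f_def p_def)
      next
        case 4
        then show ?thesis using w'(1) v sgr_sym[OF sg] by (simp add: f_def p_def)
      qed
    qed
  qed
  then show False using fr by (auto simp: free_def)
qed

text \<open>A chord that leads far along the path provides an off-path neighbour once the path is
  cut off behind position \<open>i + n\<close>. A short chord is used as a shortcut, and the vertex
  \<open>xs ! Suc i\<close> that it skips becomes the leaf.\<close>

lemma near_path_chord:
  assumes fr: "free VT ET V E" and xs: "pathl V E xs" and i: "n \<le> i" "i + 2 * n < length xs"
    and m: "i + 2 \<le> m" "m < length xs" and E: "E (xs ! i) (xs ! m)"
  shows False
proof (cases "i + n < m")
  case True
  let ?ys = "take (i + n + 1) xs"
  have ys: "pathl V E ?ys" using xs pathl_append[of V E ?ys "drop (i + n + 1) xs"] by (metis append_take_drop_id)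
  have "xs ! m \<notin> set ?ys"
  proof
    assume "xs ! m \<in> set ?ys"
    then obtain j where "j < length ?ys" "?ys ! j = xs ! m" by (metis in_set_conv_nth)
    then show False using pathl_nth(2)[OF xs, of j m] m True by simp
  qed
  then show False
    using near_path_emb[OF fr ys i(1) _ _, of "xs ! m"] E i by simp
next
  case False
  let ?ys = "take (Suc i) xs @ drop m xs"
  have il: "i < length xs" using i by simp
  have "pathl V E (take (Suc i) xs)" "pathl V E (drop m xs)"
    using xs pathl_append by (metis append_take_drop_id)+
  moreover have "last (take (Suc i) xs) = xs ! i" using take_Suc_conv_app_nth[OF il] by simp
  moreover have "hd (drop m xs) = xs ! m" using m(2) by (rule hd_drop_conv_nth)
  moreover have "set (take (Suc i) xs) \<inter> set (drop m xs) = {}"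
    using xs m(1) by (intro set_take_disj_set_drop_if_distinct) (auto simp: pathl_def)
  ultimately have ys: "pathl V E ?ys" unfolding pathl_append using E by simp
  have nth: "?ys ! i = xs ! i" using il by (simp add: nth_append)
  have out: "xs ! Suc i \<notin> set ?ys"
  proof
    assume "xs ! Suc i \<in> set ?ys"
    then consider "xs ! Suc i \<in> set (take (Suc i) xs)" | "xs ! Suc i \<in> set (drop m xs)" by auto
    then show False
    proof cases
      case 1
      then obtain j where "j < length (take (Suc i) xs)" "take (Suc i) xs ! j = xs ! Suc i" by (metis in_set_conv_nth)
      then show False using pathl_nth(2)[OF xs, of j "Suc i"] i m by simp
    next
      case 2
      then obtain j where "j < length (drop m xs)" "drop m xs ! j = xs ! Suc i" by (metis in_set_conv_nth)
      then show False using pathl_nth(2)[OF xs, of "m + j" "Suc i"] i m by simp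
    qed
  qed
  have "E (?ys ! i) (xs ! Suc i)" using pathl_nth(1)[OF xs, of i] nth i m by simp
  \<comment> \<open>The shortcut skips fewer than \<open>n\<close> vertices, which explains the
    margin of \<open>2 * n\<close> behind position \<open>i\<close>.\<close>
  moreover have "n \<le> length xs - m" using i m False by arith
  then have "i + n \<le> length ?ys" using il by simp
  ultimately show False using near_path_emb[OF fr ys i(1) _ _ out] by blast
qed

text \<open>Any other neighbour is either off the path or the end of a chord. A chord to the left
  becomes one to the right when the path is reversed, so the margin is required on both
  sides.\<close>

lemma near_path_DEG:
  assumes fr: "free VT ET V E" and xs: "pathl V E xs" and i: "2 * n \<le> i" "i + 2 * n < length xs"
    and E: "E (xs ! i) u"
  shows "u = xs ! (i - 1) \<or> u = xs ! Suc i"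
proof (rule ccontr)
  assume no: "\<not> ?thesis"
  have sg: "sgr V E" using fr by (simp add: free_def)
  have "u \<in> set xs"
    using near_path_emb[OF fr xs _ _ E] i by auto
  then obtain m where m: "m < length xs" "xs ! m = u" by (metis in_set_conv_nth)
  have "m \<noteq> i" using E m sgrD[OF sg E] by auto
  moreover have "m \<noteq> Suc i" "m \<noteq> i - 1" using no m by auto
  ultimately consider "i + 2 \<le> m" | "m + 2 \<le> i" by linarith
  then show False
  proof cases
    case 1
    then show False using near_path_chord[OF fr xs _ i(2) 1 m(1)] E m i by simp
  next
    case 2
    let ?r = "\<lambda>j. length xs - Suc j"
    have rxs: "pathl V E (rev xs)" using xs pathl_rev[OF sg] by blast
    have "rev xs ! ?r i = xs ! i" "rev xs ! ?r m = xs ! m" using i m(1) by (simp_all add: rev_nth)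
    then have "E (rev xs ! ?r i) (rev xs ! ?r m)" using E m(2) by simp
    moreover have "n \<le> ?r i" "?r i + 2 * n < length (rev xs)" "?r i + 2 \<le> ?r m" "?r m < length (rev xs)"
      unfolding length_rev using 2 i m(1) by arith+
    ultimately show False using near_path_chord[OF fr rxs] by blast
  qed
qed

theorem near_path_suniv:
  assumes T: "conn VT ET" "sgr VT ET" "finite VT"
  shows "\<exists>U EU. suniv VT ET U EU"
proof (rule suniv_from_structure[OF T(1) _ T(2,3)])
  show "VT \<noteq> {}" using v by blast
  fix V :: "nat set" and E
  assume VE: "V \<noteq> {}" "conn V E" "free VT ET V E"
  have n: "2 * n \<ge> 1" using \<rho>(2) v by fastforce
  have sg: "sgr V E" using VE(3) by (simp add: free_def)
  show "(\<exists>S0 k. finite S0 \<and> S0 \<subseteq> V \<and> tree_depth_le k (V - S0) E) \<or>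
      (\<exists>(f :: nat \<Rightarrow> nat) k a. inj f \<and> range f \<subseteq> V \<and> (\<forall>i j. E (f i) (f j) \<longleftrightarrow> i = Suc j \<or> j = Suc i) \<and>
          (\<forall>v\<in>V - range f. \<forall>i. E (f i) v \<longleftrightarrow> i = 0 \<and> v = a) \<and> tree_depth_le k (V - range f) E) \<or>
      (\<exists>h :: int \<Rightarrow> nat. bij_betw h UNIV V \<and> (\<forall>s t. E (h s) (h t) \<longleftrightarrow> \<bar>s - t\<bar> = 1))"
    by (rule finite_ray_or_line_structure[OF sg VE(2) n near_path_DEG[OF VE(3)]])
qed

end

theorem path_suniv:
  assumes \<rho>: "inj_on \<rho> VT" "\<rho> ` VT \<subseteq> {..<n}"
    and ET: "\<And>u v. ET u v \<Longrightarrow> u \<in> VT \<and> v \<in> VT \<and> (\<rho> u = Suc (\<rho> v) \<or> \<rho> v = Suc (\<rho> u))"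
    and T: "conn VT ET" "VT \<noteq> {}" "sgr VT ET" "finite VT"
  shows "\<exists>U EU. suniv VT ET U EU"
proof (rule suniv_from_structure[OF T], rule disjI1)
  fix V :: "nat set" and E
  assume VE: "free VT ET V E"
  have sg: "sgr V E" using VE by (simp add: free_def)
  have "tree_depth_le n V E"
    using sgr_sym[OF sg] path_free_bounded[OF \<rho> ET VE] by (intro bounded_tree_depth_le) blast+
  then show "\<exists>S0 k. finite S0 \<and> S0 \<subseteq> V \<and> tree_depth_le k (V - S0) E"
    by (intro exI[of _ "{}"] exI[of _ n]) simp
qed

section \<open>Chains of blocks\<close>

text \<open>
  Block \<open>i\<close> of a chain joins the cut vertices \<open>(i, 0)\<close> and \<open>(i + 1, 0)\<close>: if \<open>\<tau> i\<close> holds, by two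
  adjacent vertices, otherwise by three independent ones.
\<close>

definition inner :: "(nat \<Rightarrow> bool) \<Rightarrow> nat \<Rightarrow> nat \<Rightarrow> bool" where
  "inner \<tau> i j \<longleftrightarrow> j = 1 \<or> j = 2 \<or> (j = 3 \<and> \<not> \<tau> i)"

definition chain_verts :: "(nat \<Rightarrow> bool) \<Rightarrow> (nat \<times> nat) set" where
  "chain_verts \<tau> = {(i, j). j = 0 \<or> inner \<tau> i j}"

definition chain_adj :: "(nat \<Rightarrow> bool) \<Rightarrow> nat \<times> nat \<Rightarrow> nat \<times> nat \<Rightarrow> bool" where
  "chain_adj \<tau> p q \<longleftrightarrow> p \<in> chain_verts \<tau> \<and> q \<in> chain_verts \<tau> \<and>
     (snd p = 0 \<and> snd q > 0 \<and> (fst p = fst q \<or> fst p = Suc (fst q)) \<or>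
      snd q = 0 \<and> snd p > 0 \<and> (fst q = fst p \<or> fst q = Suc (fst p)) \<or>
      fst p = fst q \<and> \<tau> (fst p) \<and> (snd p = 1 \<and> snd q = 2 \<or> snd p = 2 \<and> snd q = 1))"

lemma sgr_chain_adj: "sgr (chain_verts \<tau>) (chain_adj \<tau>)"
proof -
  have "chain_adj \<tau> q p \<and> p \<noteq> q" if "chain_adj \<tau> p q" for p q
    using that unfolding chain_adj_def by (metis less_irrefl n_not_Suc_n zero_neq_one one_eq_numeral_iff semiring_norm(85))
  then show ?thesis unfolding sgr_def chain_adj_def by blast
qed

text \<open>An inner vertex of degree three has as neighbours the two cut vertices and its mate, and
  the mate has no neighbours beyond these and the vertex itself. At a cut vertex two of the three
  legs start in the same block; neither can end inside it, so both would end in the cut vertex on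
  its other side.\<close>

lemma chain_adj_no_spider:
  assumes K: "card K = 3" and ab: "inj_on a K" "inj_on b K" "v \<notin> a ` K" "v \<notin> b ` K" "a ` K \<inter> b ` K = {}"
    and E: "\<And>k. k \<in> K \<Longrightarrow> chain_adj \<tau> v (a k)" "\<And>k. k \<in> K \<Longrightarrow> chain_adj \<tau> (a k) (b k)"
  shows False
proof -
  obtain i j where v: "v = (i, j)" by (cases v)
  have fin: "finite K" using K card.infinite by fastforce
  show False
  proof (cases "j = 0")
    case False
    \<comment> \<open>Adjacent inner vertices have the numbers \<open>1\<close> and
      \<open>2\<close>, so the mate of \<open>j\<close> is \<open>3 - j\<close>.\<close>
    let ?N = "{(i, 0), (Suc i, 0), (i, 3 - j)}"
    have \<tau>: "\<tau> i \<and> (j = 1 \<or> j = 2)"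
    proof (rule ccontr)
      assume no: "\<not> ?thesis"
      have "a k \<in> {(i, 0), (Suc i, 0)}" if "k \<in> K" for k
        using E(1)[OF that] False v no by (auto simp: chain_adj_def prod_eq_iff)
      then have "a ` K \<subseteq> {(i, 0), (Suc i, 0)}" by blast
      then have "card (a ` K) \<le> card {(i, 0), (Suc i, 0 :: nat)}" by (rule card_mono[rotated]) simp
      then show False using card_image[OF ab(1)] K by simp
    qed
    have "a ` K \<subseteq> ?N" using E(1) False v by (fastforce simp: chain_adj_def prod_eq_iff)
    moreover have "card ?N \<le> card (a ` K)"
    proof -
      have "card ?N \<le> 3" by (simp add: card_insert_if)
      then show ?thesis using card_image[OF ab(1)] K by simp
    qed
    ultimately have aN: "a ` K = ?N" by (intro card_seteq) auto
    then obtain k where k: "k \<in> K" "a k = (i, 3 - j)" by (metis imageE insertCI)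
    have "chain_adj \<tau> (a k) (b k)" by (rule E(2)[OF k(1)])
    then have "b k \<in> insert v ?N" using k(2) \<tau> v by (auto simp: chain_adj_def prod_eq_iff)
    then have "b k \<in> insert v (a ` K)" unfolding aN .
    moreover have "b k \<in> b ` K" using k(1) by simp
    ultimately show False using ab(4,5) by (metis IntI empty_iff insert_iff)
  next
    case True
    have snda: "snd (a k) > 0 \<and> (fst (a k) = i \<or> Suc (fst (a k)) = i)" if "k \<in> K" for k
      using E(1)[OF that] v True by (auto simp: chain_adj_def)
    have "card ((\<lambda>k. fst (a k)) ` K) < card K"
    proof -
      have "(\<lambda>k. fst (a k)) ` K \<subseteq> {i, i - 1}" using snda by fastforce
      then have "card ((\<lambda>k. fst (a k)) ` K) \<le> card {i, i - 1}" by (intro card_mono) auto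
      also have "\<dots> \<le> 2" by (simp add: card_insert_if)
      finally show ?thesis using K by simp
    qed
    then have "\<not> inj_on (\<lambda>k. fst (a k)) K" using pigeonhole by blast
    then obtain k l where kl: "k \<in> K" "l \<in> K" "k \<noteq> l" "fst (a k) = fst (a l)" unfolding inj_on_def by blast
    have ne: "a k \<noteq> a l" "b k \<noteq> b l" "b k \<noteq> a l" "b l \<noteq> a k" "b k \<noteq> v" "b l \<noteq> v"
      using ab kl by (auto dest: inj_onD)
    have 1: "snd (b m) = 0 \<or> b m = (fst (a m), 3 - snd (a m)) \<and> \<tau> (fst (a m))" if "m \<in> K" for m
      using E(2)[OF that] snda[OF that] by (auto simp: chain_adj_def prod_eq_iff)
    have 2: "snd (b m) = 0 \<longrightarrow> fst (b m) = fst (a m) \<or> fst (b m) = Suc (fst (a m))" if "m \<in> K" for m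
      using E(2)[OF that] snda[OF that] by (auto simp: chain_adj_def)
    have in3: "inner \<tau> (fst (a m)) (snd (a m))" if "m \<in> K" for m
      using E(2)[OF that] snda[OF that] by (auto simp: chain_adj_def chain_verts_def)
    \<comment> \<open>A leg could end at an inner vertex only in a block of two adjacent ones, but
      there the second vertex is the start \<open>a m'\<close> of another leg.\<close>
    have 3: "snd (b m) = 0" if m: "m \<in> K" "m' \<in> K" "fst (a m) = fst (a m')" "a m \<noteq> a m'" "b m \<noteq> a m'" for m m'
    proof (rule ccontr)
      assume "snd (b m) \<noteq> 0"
      then have b: "b m = (fst (a m), 3 - snd (a m))" "\<tau> (fst (a m))" using 1[OF m(1)] by auto
      have "snd (a m') = 3 - snd (a m)"
        using in3[OF m(1)] in3[OF m(2)] b(2) m(3,4) by (auto simp: inner_def prod_eq_iff)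
      then show False using b(1) m(3,5) by (simp add: prod_eq_iff)
    qed
    have "snd (b k) = 0" "snd (b l) = 0" using 3[of k l] 3[of l k] kl ne by auto
    moreover have "fst (b k) \<noteq> i" "fst (b l) \<noteq> i" using calculation ne v True by (auto simp: prod_eq_iff)
    ultimately have "b k = b l" using 2[OF kl(1)] 2[OF kl(2)] snda[OF kl(1)] snda[OF kl(2)] kl(4)
      by (auto simp: prod_eq_iff)
    then show False using ne by simp
  qed
qed

context
  fixes EU :: "'u \<Rightarrow> 'u \<Rightarrow> bool" and N :: nat
begin

definition left_path :: "'u \<Rightarrow> 'u set \<Rightarrow> bool" where
  "left_path p L \<longleftrightarrow> p \<notin> L \<and> (\<exists>l. l 0 = p \<and> inj_on l {..N} \<and> l ` {1..N} \<subseteq> L \<and> (\<forall>i<N. EU (l i) (l (Suc i))))"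

definition ray_avoiding :: "'u \<Rightarrow> 'u set \<Rightarrow> bool" where
  "ray_avoiding q Z \<longleftrightarrow> (\<exists>r :: nat \<Rightarrow> 'u. r 0 = q \<and> inj r \<and> (\<forall>i. EU (r i) (r (Suc i))) \<and> range r \<inter> Z = {})"

text \<open>An embedding need not be induced, so only the edges of the chain are demanded;
  \<open>EU\<close> may have further ones.\<close>

definition chain :: "(nat \<Rightarrow> bool) \<Rightarrow> (nat \<Rightarrow> nat \<Rightarrow> 'u) \<Rightarrow> bool" where
  "chain \<tau> f \<longleftrightarrow> (\<forall>i j i' j'. (j = 0 \<or> inner \<tau> i j) \<longrightarrow> (j' = 0 \<or> inner \<tau> i' j') \<longrightarrow> f i j = f i' j' \<longrightarrow> i = i' \<and> j = j') \<and>
     (\<forall>i j. inner \<tau> i j \<longrightarrow> EU (f i 0) (f i j) \<and> EU (f i j) (f (Suc i) 0)) \<and> (\<forall>i. \<tau> i \<longrightarrow> EU (f i 1) (f i 2))"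

definition right :: "(nat \<Rightarrow> bool) \<Rightarrow> (nat \<Rightarrow> nat \<Rightarrow> 'u) \<Rightarrow> nat \<Rightarrow> 'u set" where
  "right \<tau> f k = {u. \<exists>i j. k \<le> i \<and> (j = 0 \<and> k < i \<or> inner \<tau> i j) \<and> u = f i j}"

definition block :: "(nat \<Rightarrow> bool) \<Rightarrow> (nat \<Rightarrow> nat \<Rightarrow> 'u) \<Rightarrow> nat \<Rightarrow> 'u set" where
  "block \<tau> f k = {f k j |j. inner \<tau> k j}"

definition spine :: "(nat \<Rightarrow> nat \<Rightarrow> 'u) \<Rightarrow> nat \<Rightarrow> 'u set" where
  "spine f m = {f i 0 |i. i < m}"

text \<open>
  Having a long path through \<open>L\<close> ending at the cut vertex \<open>f k 0\<close>, which serves as the leg of length \<open>N\<close>,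
  and the rest of the chain, which serves as another leg, no leg of length 2 can be added at
  \<open>f k 0\<close>. This leaves no freedom for the neighbourhood of the next block.
\<close>

definition stage :: "(nat \<Rightarrow> bool) \<Rightarrow> (nat \<Rightarrow> nat \<Rightarrow> 'u) \<Rightarrow> nat \<Rightarrow> 'u set \<Rightarrow> bool" where
  "stage \<tau> f k L \<longleftrightarrow> chain \<tau> f \<and> left_path (f k 0) L \<and> L \<inter> right \<tau> f k = {}"

lemma chain_inj: "chain \<tau> f \<Longrightarrow> j = 0 \<or> inner \<tau> i j \<Longrightarrow> j' = 0 \<or> inner \<tau> i' j' \<Longrightarrow> f i j = f i' j' \<longleftrightarrow> i = i' \<and> j = j'"
  unfolding chain_def by blast

lemma chain_edge: "chain \<tau> f \<Longrightarrow> inner \<tau> i j \<Longrightarrow> EU (f i 0) (f i j) \<and> EU (f i j) (f (Suc i) 0)"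
  unfolding chain_def by blast

context
  assumes symU: "\<And>u v. EU u v \<Longrightarrow> EU v u"
    and KEY: "\<And>p a b (r :: nat \<Rightarrow> 'u) l. EU p a \<Longrightarrow> EU a b \<Longrightarrow> EU p (r 0) \<Longrightarrow> inj r \<Longrightarrow> (\<And>i. EU (r i) (r (Suc i))) \<Longrightarrow>
       l 0 = p \<Longrightarrow> inj_on l {..N} \<Longrightarrow> (\<And>i. i < N \<Longrightarrow> EU (l i) (l (Suc i))) \<Longrightarrow>
       a \<noteq> b \<Longrightarrow> range r \<inter> insert a (insert b (l ` {..N})) = {} \<Longrightarrow> a \<notin> l ` {..N} \<Longrightarrow> b \<notin> l ` {..N} \<Longrightarrow> False"
begin

text \<open>\<open>KEY\<close> forbids three legs at \<open>p\<close>: a ray behind an edge from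
  \<open>p\<close>, one leg with \<open>N\<close> edges and one with two edges. Here the long leg
  runs inside \<open>L\<close>, so that disjointness becomes avoidance of \<open>L\<close>, and only
  the ray and the short leg \<open>a\<close>, \<open>b\<close> have to be exhibited.\<close>

lemma KEY':
  assumes "left_path p L" "ray_avoiding q (insert p (insert a (insert b L)))" "EU p a" "EU a b" "EU p q"
    "a \<noteq> b" "a \<notin> insert p L" "b \<notin> insert p L"
  shows False
proof -
  obtain l where l: "l 0 = p" "inj_on l {..N}" "l ` {1..N} \<subseteq> L" "\<forall>i<N. EU (l i) (l (Suc i))"
    using assms(1) unfolding left_path_def by blast
  obtain r :: "nat \<Rightarrow> 'u" where r: "r 0 = q" "inj r" "\<forall>i. EU (r i) (r (Suc i))" "range r \<inter> insert p (insert a (insert b L)) = {}"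
    using assms(2) unfolding ray_avoiding_def by blast
  have "l i \<in> insert p L" if "i \<le> N" for i
    using l(1) l(3)[unfolded image_subset_iff, rule_format, of i] that by (cases "i = 0") simp_all
  then have "l ` {..N} \<subseteq> insert p L" by blast
  then show False
    using KEY[of p a b r l] assms l r by blast
qed

lemma ray_avoiding_Cons:
  assumes "ray_avoiding q (insert q' Z)" "EU q' q" "q' \<notin> Z"
  shows "ray_avoiding q' Z"
proof -
  obtain r :: "nat \<Rightarrow> 'u" where r: "r 0 = q" "inj r" "\<forall>i. EU (r i) (r (Suc i))" "range r \<inter> insert q' Z = {}"
    using assms(1) unfolding ray_avoiding_def by blast
  let ?r = "case_nat q' r"
  have "inj ?r" using r(2,4) by (auto simp: inj_def split: nat.splits)
  moreover have "EU (?r i) (?r (Suc i))" for i using r assms(2) by (cases i) auto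
  moreover have "?r i \<notin> Z" for i using r(4) assms(3) by (cases i) (auto simp: disjoint_iff)
  then have "range ?r \<inter> Z = {}" by blast
  ultimately show ?thesis unfolding ray_avoiding_def by (intro exI[of _ ?r]) simp
qed

text \<open>The leg is prolonged in front and shortened at its far end, so its length remains
  \<open>N\<close>.\<close>

lemma left_path_Cons:
  assumes "left_path p L" "EU t p" "t \<notin> insert p L"
  shows "left_path t (insert p L)"
proof -
  obtain l where l: "l 0 = p" "inj_on l {..N}" "l ` {1..N} \<subseteq> L" "\<forall>i<N. EU (l i) (l (Suc i))"
    using assms(1) unfolding left_path_def by blast
  let ?l = "case_nat t l"
  have lL: "l i \<in> insert p L" if "i \<le> N" for i
    using l(1) l(3)[unfolded image_subset_iff, rule_format, of i] that by (cases "i = 0") simp_all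
  have "inj_on ?l {..N}"
  proof (rule inj_onI)
    fix i j assume ij: "i \<in> {..N}" "j \<in> {..N}" "?l i = ?l j"
    show "i = j"
    proof (cases i; cases j)
      fix i' j' assume "i = Suc i'" "j = Suc j'"
      then show ?thesis using ij l(2) by (auto dest: inj_onD)
    next
      fix j' assume "i = 0" "j = Suc j'"
      then show ?thesis using ij lL[of j'] assms(3) by auto
    next
      fix i' assume "i = Suc i'" "j = 0"
      then show ?thesis using ij lL[of i'] assms(3) by auto
    qed simp
  qed
  moreover have "?l ` {1..N} \<subseteq> insert p L"
  proof (rule image_subsetI)
    fix i assume "i \<in> {1..N}"
    then show "?l i \<in> insert p L" using lL[of "i - 1"] by (cases i) auto
  qed
  moreover have "EU (?l i) (?l (Suc i))" if "i < N" for i using that l assms(2) by (cases i) auto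
  ultimately show ?thesis using assms(3) unfolding left_path_def by (intro conjI exI[of _ ?l]) auto
qed

lemma left_path_mono: "left_path p L \<Longrightarrow> L \<subseteq> L' \<Longrightarrow> p \<notin> L' \<Longrightarrow> left_path p L'"
  unfolding left_path_def by blast

text \<open>The ray alternates between the cut vertices and one free inner vertex of each
  block.\<close>

lemma chain_ray:
  assumes f: "chain \<tau> f" and Z: "\<And>i. m \<le> i \<Longrightarrow> f i 0 \<notin> Z" "\<And>i. m \<le> i \<Longrightarrow> \<exists>j. inner \<tau> i j \<and> f i j \<notin> Z"
  shows "ray_avoiding (f m 0) Z"
proof -
  obtain s where s: "\<And>i. m \<le> i \<Longrightarrow> inner \<tau> i (s i)" "\<And>i. m \<le> i \<Longrightarrow> f i (s i) \<notin> Z" using Z(2) by metis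
  let ?d = "\<lambda>i. m + i div 2"
  let ?r = "\<lambda>i. f (?d i) (if even i then 0 else s (?d i))"
  have s0: "s i \<noteq> 0" if "m \<le> i" for i using s(1)[OF that] by (auto simp: inner_def)
  have r1: "inj ?r"
  proof (rule injI)
    fix i j assume ij: "?r i = ?r j"
    have "?d i = ?d j \<and> (if even i then 0 else s (?d i)) = (if even j then 0 else s (?d j))"
      using chain_inj[OF f, of "if even i then 0 else s (?d i)" "?d i" "if even j then 0 else s (?d j)" "?d j"] ij s(1)
      by auto
    then have "i div 2 = j div 2" "even i \<longleftrightarrow> even j" using s0[of "?d i"] s0[of "?d j"] by (auto split: if_splits)
    then show "i = j" by (metis even_two_times_div_two odd_two_times_div_two_succ)
  qed
  have r2: "EU (?r i) (?r (Suc i))" for i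
    using chain_edge[OF f s(1), of "?d i"] by (cases "even i") auto
  have "?r i \<notin> Z" for i using Z(1)[of "?d i"] s(2)[of "?d i"] by simp
  then have r3: "range ?r \<inter> Z = {}" by blast
  have r4: "?r 0 = f m 0" by simp
  show ?thesis
    unfolding ray_avoiding_def by (rule exI[of _ ?r], intro conjI allI r4 r1 r3 r2)
qed

lemma spineI: "i < m \<Longrightarrow> f i 0 \<in> spine f m"
  unfolding spine_def by blast

lemma Int_insert_sub: "Z \<inter> R \<subseteq> W \<Longrightarrow> insert a Z \<inter> R \<subseteq> insert a W"
  by blast

lemma insert_Int_out: "a \<notin> R \<Longrightarrow> insert a Z \<inter> R \<subseteq> Z \<inter> R"
  by blast

text \<open>Each block has at least two inner vertices, so besides block \<open>k\<close> and the
  cut vertices before \<open>m\<close> a single further obstacle \<open>z\<close> can be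
  bypassed.\<close>

lemma chain_ray':
  assumes f: "chain \<tau> f" and Z: "Z \<inter> right \<tau> f k \<subseteq> block \<tau> f k \<union> spine f m \<union> {z}"
    and m: "k < m" and z: "\<And>i. m \<le> i \<Longrightarrow> z \<noteq> f i 0"
  shows "ray_avoiding (f m 0) Z"
proof (rule chain_ray[OF f])
  fix i assume i: "m \<le> i"
  have mem: "f i j \<in> right \<tau> f k" if "j = 0 \<or> inner \<tau> i j" for j
    using that i m unfolding right_def by (intro CollectI exI[of _ i] exI[of _ j]) auto
  have nb: "f i j \<notin> block \<tau> f k" "f i j \<notin> spine f m" if "j = 0 \<or> inner \<tau> i j" for j
  proof -
    have neq: "f i j \<noteq> f i' j'" if "j' = 0 \<or> inner \<tau> i' j'" "i' < i" for i' j'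
      using chain_inj[OF f \<open>j = 0 \<or> inner \<tau> i j\<close> that(1)] that(2) by blast
    show "f i j \<notin> block \<tau> f k"
    proof
      assume "f i j \<in> block \<tau> f k"
      then obtain j' where "inner \<tau> k j'" "f i j = f k j'" unfolding block_def by blast
      then show False using neq[of j' k] i m by simp
    qed
    show "f i j \<notin> spine f m"
    proof
      assume "f i j \<in> spine f m"
      then obtain i' where "i' < m" "f i j = f i' 0" unfolding spine_def by blast
      then show False using neq[of 0 i'] i by simp
    qed
  qed
  show "f i 0 \<notin> Z" using Z mem[of 0] nb[of 0] z[OF i] by auto
  have 12: "inner \<tau> i 1" "inner \<tau> i 2" by (auto simp: inner_def)
  have "f i 1 \<noteq> f i 2" using chain_inj[OF f, of 1 i 2 i] 12 by simp
  then have "f i 1 \<noteq> z \<or> f i 2 \<noteq> z" by metis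
  then show "\<exists>j. inner \<tau> i j \<and> f i j \<notin> Z"
    using Z mem[of 1] mem[of 2] nb[of 1] nb[of 2] 12 by blast
qed

lemma inner12: "inner \<tau> i 1" "inner \<tau> i 2"
  by (auto simp: inner_def)

lemma rightI: "k \<le> i \<Longrightarrow> inner \<tau> i j \<Longrightarrow> f i j \<in> right \<tau> f k" "k < i \<Longrightarrow> f i 0 \<in> right \<tau> f k"
  unfolding right_def by (blast intro: less_imp_le)+

lemma inner_pos: "inner \<tau> i j \<Longrightarrow> j \<noteq> 0"
  by (auto simp: inner_def)

lemma right_cases:
  assumes "u \<in> right \<tau> f k"
  obtains (block) "u \<in> block \<tau> f k" | (t) "u = f (Suc k) 0"
    | (spine) i where "Suc k < i" "u = f i 0" | (inner) i j where "k < i" "inner \<tau> i j" "u = f i j"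
proof -
  obtain i j where ij: "k \<le> i" "j = 0 \<and> k < i \<or> inner \<tau> i j" "u = f i j" using assms unfolding right_def by blast
  show thesis
  proof (cases "inner \<tau> i j")
    case True
    show ?thesis
    proof (cases "i = k")
      case True
      then have "u \<in> block \<tau> f k" using \<open>inner \<tau> i j\<close> ij(3) unfolding block_def by blast
      then show ?thesis by (rule that(1))
    next
      case False
      then have "k < i" using ij(1) by simp
      then show ?thesis using \<open>inner \<tau> i j\<close> ij(3) by (rule that(4))
    qed
  next
    case False
    then have "Suc k = i \<or> Suc k < i" "u = f i 0" using ij by auto
    then show ?thesis using that(2) that(3)[of i] by blast
  qed
qed

lemma stage_facts:
  assumes "stage \<tau> f k L"
  shows "chain \<tau> f" "left_path (f k 0) L" "\<And>u. u \<in> right \<tau> f k \<Longrightarrow> u \<notin> insert (f k 0) L"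
    and "\<And>u. u \<in> block \<tau> f k \<Longrightarrow> u \<in> right \<tau> f k \<and> u \<noteq> f i 0 \<and> EU (f k 0) u \<and> EU u (f (Suc k) 0)"
    and "f (Suc k) 0 \<in> right \<tau> f k"
    and "f k 1 \<in> block \<tau> f k" "f k 2 \<in> block \<tau> f k" "f k 1 \<noteq> f k 2"
proof -
  show ch: "chain \<tau> f" and lp: "left_path (f k 0) L" using assms by (auto simp: stage_def)
  show "u \<notin> insert (f k 0) L" if u: "u \<in> right \<tau> f k" for u
  proof -
    obtain i j where ij: "k \<le> i" "j = 0 \<and> k < i \<or> inner \<tau> i j" "u = f i j" using u unfolding right_def by blast
    then have "u \<noteq> f k 0" using chain_inj[OF ch, of j i 0 k] inner_pos[of \<tau> i j] by auto
    then show ?thesis using assms u unfolding stage_def by blast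
  qed
  show "u \<in> right \<tau> f k \<and> u \<noteq> f i 0 \<and> EU (f k 0) u \<and> EU u (f (Suc k) 0)" if u: "u \<in> block \<tau> f k" for u
  proof -
    obtain j where j: "inner \<tau> k j" "u = f k j" using u unfolding block_def by blast
    then show ?thesis
      using rightI(1)[of k k] chain_inj[OF ch, of j k 0 i] inner_pos[OF j(1)] chain_edge[OF ch j(1)] by auto
  qed
  show "f (Suc k) 0 \<in> right \<tau> f k" by (rule rightI(2)) simp
  show "f k 1 \<in> block \<tau> f k" "f k 2 \<in> block \<tau> f k" using inner12 unfolding block_def by blast+
  show "f k 1 \<noteq> f k 2" using chain_inj[OF ch, of 1 k 2 k] inner12 by simp
qed

text \<open>From a further neighbour \<open>a\<close> on the chain a ray leads away to the right,
  while \<open>f k 1\<close> and the next cut vertex form a leg with two edges.\<close>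

lemma nbr_right:
  assumes st: "stage \<tau> f k L" and a: "EU (f k 0) a" "a \<in> right \<tau> f k"
  shows "a \<in> insert (f (Suc k) 0) (block \<tau> f k)"
proof (rule ccontr)
  assume no: "\<not> ?thesis"
  note F = stage_facts[OF st]
  let ?Z = "insert (f k 0) (insert (f k 1) (insert (f (Suc k) 0) L))"
  have x: "f k 1 \<noteq> f (Suc k) 0" "EU (f k 0) (f k 1)" "EU (f k 1) (f (Suc k) 0)" "f k 1 \<in> right \<tau> f k"
    using F(4)[OF F(6)] by blast+
  have Z: "?Z \<inter> right \<tau> f k \<subseteq> {f k 1, f (Suc k) 0}" using F(3) by blast
  have "ray_avoiding a ?Z"
    using a(2)
  proof (cases rule: right_cases)
    case (spine i)
    have "ray_avoiding (f i 0) ?Z"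
    proof (rule chain_ray'[OF F(1), where k = k and z = "f k 1"])
      show "?Z \<inter> right \<tau> f k \<subseteq> block \<tau> f k \<union> spine f i \<union> {f k 1}"
        using spine(1) by (intro order_trans[OF Z]) (simp add: spineI)
      show "f k 1 \<noteq> f i' 0" for i' using F(4)[OF F(6)] by blast
    qed (use spine in simp)
    then show ?thesis using spine by simp
  next
    case (inner i j)
    have "ray_avoiding (f (Suc i) 0) (insert a ?Z)"
    proof (rule chain_ray'[OF F(1), where k = k and z = a])
      show "insert a ?Z \<inter> right \<tau> f k \<subseteq> block \<tau> f k \<union> spine f (Suc i) \<union> {a}"
        using inner(1) F(6) by (intro order_trans[OF Int_insert_sub[OF Z]]) (simp add: spineI)
      show "a \<noteq> f i' 0" for i' using chain_inj[OF F(1), of j i 0 i'] inner inner_pos[OF inner(2)] by simp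
    qed (use inner in simp)
    moreover have "EU a (f (Suc i) 0)" using chain_edge[OF F(1) inner(2)] inner(3) by simp
    moreover have "a \<notin> ?Z" using no F(3)[OF a(2)] F(6) by blast
    ultimately show ?thesis by (rule ray_avoiding_Cons)
  qed (use no in blast)+
  then show False
    using KEY'[OF F(2), of a "f k 1" "f (Suc k) 0"] x a(1) F(3)[OF x(4)] F(3)[OF F(5)] by blast
qed

text \<open>For most \<open>b\<close> the edge from \<open>a\<close> to \<open>b\<close> completes
  the short leg and the ray starts in the block; if \<open>b\<close> lies further right on the
  chain, the ray starts with \<open>a\<close>, \<open>b\<close> instead. The next cut vertex is the
  exception, since the short leg and the ray would both have to use it.\<close>

lemma nbr_outside:
  assumes st: "stage \<tau> f k L" and a: "EU (f k 0) a" "a \<notin> right \<tau> f k" "a \<notin> insert (f k 0) L"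
    and b: "EU a b" "b \<notin> insert (f k 0) L" "a \<noteq> b"
  shows "b = f (Suc k) 0"
proof (rule ccontr)
  assume no: "\<not> ?thesis"
  note F = stage_facts[OF st]
  let ?t = "f (Suc k) 0"
  let ?Z = "insert (f k 0) (insert (f k 1) (insert ?t L))"
  have x: "f k 1 \<noteq> ?t" "EU (f k 0) (f k 1)" "EU (f k 1) ?t" "f k 1 \<in> right \<tau> f k"
    using F(4)[OF F(6)] by blast+
  have Z: "?Z \<inter> right \<tau> f k \<subseteq> {f k 1, ?t}" using F(3) by blast
  have aZ: "a \<notin> ?Z" using a(2,3) x(4) F(5) by blast
  have ab: False if y: "y \<in> block \<tau> f k" "y \<noteq> b" and bb: "b \<in> block \<tau> f k \<or> b \<notin> right \<tau> f k" for y
  proof -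
    let ?Y = "insert (f k 0) (insert a (insert b L))"
    have "ray_avoiding ?t (insert y ?Y)"
    proof (rule chain_ray'[OF F(1), where k = k and z = y])
      show "insert y ?Y \<inter> right \<tau> f k \<subseteq> block \<tau> f k \<union> spine f (Suc k) \<union> {y}"
        using a(2) bb y F(3) by blast
      show "y \<noteq> f i 0" for i using F(4)[OF y(1)] by blast
    qed simp
    moreover have "EU y ?t" using F(4)[OF y(1)] by blast
    moreover have "y \<notin> ?Y" using y(2) F(4)[OF y(1)] F(3)[of y] a(2) by blast
    ultimately have "ray_avoiding y ?Y" by (rule ray_avoiding_Cons)
    then show False
      using KEY'[OF F(2), of y a b] a b F(4)[OF y(1)] by blast
  qed
  have via_a: False if "ray_avoiding b (insert a ?Z)"
  proof -
    have "ray_avoiding a ?Z" using that b(1) aZ by (rule ray_avoiding_Cons)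
    then show False
      using KEY'[OF F(2), of a "f k 1" ?t] x a(1) F(3)[OF x(4)] F(3)[OF F(5)] by blast
  qed
  show False
  proof (cases "b \<in> right \<tau> f k")
    case False
    then show ?thesis using ab[of "f k 1"] F(6) x(4) by blast
  next
    case True
    then show ?thesis
    proof (cases rule: right_cases)
      case block
      then show ?thesis using ab[of "f k 1"] ab[of "f k 2"] F(6,7,8) by metis
    next
      case t
      then show ?thesis using no by simp
    next
      case (spine i)
      have "ray_avoiding (f i 0) (insert a ?Z)"
      proof (rule chain_ray'[OF F(1), where k = k and z = "f k 1"])
        show "insert a ?Z \<inter> right \<tau> f k \<subseteq> block \<tau> f k \<union> spine f i \<union> {f k 1}"
          using spine(1) by (intro order_trans[OF order_trans[OF insert_Int_out[OF a(2)] Z]]) (simp add: spineI)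
        show "f k 1 \<noteq> f i' 0" for i' using F(4)[OF F(6)] by blast
      qed (use spine in simp)
      then show ?thesis using via_a spine by simp
    next
      case (inner i j)
      have "ray_avoiding (f (Suc i) 0) (insert b (insert a ?Z))"
      proof (rule chain_ray'[OF F(1), where k = k and z = b])
        show "insert b (insert a ?Z) \<inter> right \<tau> f k \<subseteq> block \<tau> f k \<union> spine f (Suc i) \<union> {b}"
          using inner(1) F(6)
          by (intro order_trans[OF Int_insert_sub[OF order_trans[OF insert_Int_out[OF a(2)] Z]]]) (simp add: spineI)
        show "b \<noteq> f i' 0" for i' using chain_inj[OF F(1), of j i 0 i'] inner inner_pos[OF inner(2)] by simp
      qed (use inner in simp)
      moreover have "EU b (f (Suc i) 0)" using chain_edge[OF F(1) inner(2)] inner(3) by simp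
      moreover have "b \<noteq> f k 1" using chain_inj[OF F(1), of j i 1 k] inner inner12 by simp
      then have "b \<notin> insert a ?Z" using no b(2,3) by blast
      ultimately have "ray_avoiding b (insert a ?Z)" by (rule ray_avoiding_Cons)
      then show ?thesis by (rule via_a)
    qed
  qed
qed

context
  fixes \<tau> \<tau>' f f' k L
  assumes st: "stage \<tau> f k L" and st': "stage \<tau>' f' k L" and p: "f' k 0 = f k 0"
begin

text \<open>By \<open>nbr_right\<close> such a vertex \<open>x\<close> lies off the right part of
  the first chain, and by \<open>nbr_outside\<close> its only neighbour on the right part of the
  second chain is the next cut vertex of the first. This must be the end of the second block as
  well, and \<open>x\<close> has no inner neighbour.\<close>

lemma new_inner:
  assumes x: "x \<in> block \<tau>' f' k" "x \<notin> insert (f (Suc k) 0) (block \<tau> f k)"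
  shows "f' (Suc k) 0 = f (Suc k) 0 \<and> \<not> \<tau>' k \<and> x \<notin> right \<tau> f k"
proof -
  note F = stage_facts[OF st] and F' = stage_facts[OF st', unfolded p]
  have x': "x \<in> right \<tau>' f' k" "EU (f k 0) x" "EU x (f' (Suc k) 0)" "\<And>i. x \<noteq> f' i 0"
    using F'(4)[OF x(1)] by blast+
  have xr: "x \<notin> right \<tau> f k" using nbr_right[OF st x'(2)] x(2) by blast
  have out: "b = f (Suc k) 0" if "EU x b" "b \<in> right \<tau>' f' k" "x \<noteq> b" for b
    using nbr_outside[OF st x'(2) xr _ that(1) _ that(3)] F'(3)[OF x'(1)] F'(3)[OF that(2)] by blast
  have t: "f' (Suc k) 0 = f (Suc k) 0" using out[OF x'(3) F'(5)] x'(4) by blast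
  have "\<not> \<tau>' k"
  proof
    assume A: "\<tau>' k"
    have e: "EU (f' k 1) (f' k 2)" using F'(1) A unfolding chain_def by blast
    obtain j where j: "inner \<tau>' k j" "x = f' k j" using x(1) unfolding block_def by blast
    then have "j = 1 \<or> j = 2" using A by (auto simp: inner_def)
    then have "\<exists>y\<in>block \<tau>' f' k. EU x y \<and> x \<noteq> y" using e symU[OF e] F'(6,7,8) j(2) by metis
    then obtain y where y: "y \<in> block \<tau>' f' k" "EU x y" "x \<noteq> y" by blast
    then have "y = f (Suc k) 0" using out F'(4)[OF y(1)] by blast
    then show False using F'(4)[OF y(1)] t by metis
  qed
  then show ?thesis using t xr by blast
qed

text \<open>The inner vertices \<open>f' k 1\<close> and \<open>f' k 2\<close> are adjacent to both
  ends. If the ends differ, one of these vertices starts the ray through one end, and the other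
  forms the short leg with the other end.\<close>

lemma same_block_end:
  assumes "block \<tau>' f' k \<subseteq> block \<tau> f k"
  shows "f' (Suc k) 0 = f (Suc k) 0"
proof (rule ccontr)
  assume no: "\<not> ?thesis"
  note F = stage_facts[OF st] and F' = stage_facts[OF st', unfolded p]
  let ?t = "f (Suc k) 0" and ?t' = "f' (Suc k) 0" and ?x = "f' k 1" and ?y = "f' k 2"
  have xb: "?x \<in> block \<tau> f k" "?y \<in> block \<tau> f k" using assms F'(6,7) by blast+
  note X = F(4)[OF xb(1)] F'(4)[OF F'(6)] and Y = F(4)[OF xb(2)] F'(4)[OF F'(7)]
  have xL: "?x \<notin> insert (f k 0) L" "?y \<notin> insert (f k 0) L" using X Y F(3) by blast+
  have tL: "?t \<notin> insert (f k 0) L" "?t' \<notin> insert (f k 0) L" using F(3,5) F'(3,5) by blast+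
  show False
  \<comment> \<open>If \<open>?t'\<close> is a later cut vertex of the first chain, the ray
    continues from there; otherwise it continues from \<open>?t\<close>, and \<open>?t'\<close> is a
    single obstacle.\<close>
  proof (cases "\<exists>i. Suc k < i \<and> ?t' = f i 0")
    case True
    then obtain i where i: "Suc k < i" "?t' = f i 0" by blast
    let ?Z = "insert (f k 0) (insert ?y (insert ?t L))"
    have "ray_avoiding (f i 0) (insert ?x ?Z)"
    proof (rule chain_ray'[OF F(1), where k = k and z = ?x])
      show "insert ?x ?Z \<inter> right \<tau> f k \<subseteq> block \<tau> f k \<union> spine f i \<union> {?x}"
        using F(3) xb spineI[OF i(1), of f] by blast
      show "?x \<noteq> f i' 0" for i' using F(4)[OF xb(1)] by blast
    qed (use i in simp)
    moreover have "EU ?x (f i 0)" using X(2) i(2) by simp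
    moreover have "?x \<notin> ?Z" using xL F'(8) F(4)[OF xb(1)] by blast
    ultimately have "ray_avoiding ?x ?Z" by (rule ray_avoiding_Cons)
    then show False using KEY'[OF F(2), of ?x ?y ?t] X(1) F(4)[OF xb(2)] xL tL by blast
  next
    case False
    let ?Z = "insert (f k 0) (insert ?y (insert ?t' L))"
    have "ray_avoiding ?t (insert ?x ?Z)"
    proof (rule chain_ray'[OF F(1), where k = k and z = ?t'])
      show "insert ?x ?Z \<inter> right \<tau> f k \<subseteq> block \<tau> f k \<union> spine f (Suc k) \<union> {?t'}"
        using F(3) xb by blast
      show "?t' \<noteq> f i 0" if "Suc k \<le> i" for i using False no that by (cases "i = Suc k") auto
    qed simp
    moreover have "EU ?x ?t" using X(1) by blast
    moreover have "?x \<notin> ?Z" using xL F'(8) F'(4)[OF F'(6)] by blast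
    ultimately have "ray_avoiding ?x ?Z" by (rule ray_avoiding_Cons)
    then show False using KEY'[OF F(2), of ?x ?y ?t'] X(1) F'(4)[OF F'(7)] xL tL by blast
  qed
qed

end

text \<open>If the ends differed, \<open>new_inner\<close> and \<open>same_block_end\<close> would
  make each end an inner vertex of the other block. Then the ray could start with the edge to
  \<open>?t\<close>, while a common inner vertex and \<open>?t'\<close> form the short leg.\<close>

lemma same_end:
  assumes st: "stage \<tau> f k L" and st': "stage \<tau>' f' k L" and p: "f' k 0 = f k 0"
  shows "f' (Suc k) 0 = f (Suc k) 0"
proof (rule ccontr)
  assume no: "\<not> ?thesis"
  note F = stage_facts[OF st] and F' = stage_facts[OF st', unfolded p]
  let ?t = "f (Suc k) 0" and ?t' = "f' (Suc k) 0"
  have s1: "block \<tau>' f' k \<subseteq> insert ?t (block \<tau> f k)" using new_inner[OF st st' p] no by blast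
  have s2: "block \<tau> f k \<subseteq> insert ?t' (block \<tau>' f' k)" using new_inner[OF st' st p[symmetric]] not_sym[OF no] by blast
  have t1: "?t \<in> block \<tau>' f' k" using same_block_end[OF st st' p] s1 no by blast
  have t2: "?t' \<in> block \<tau> f k" using same_block_end[OF st' st p[symmetric]] s2 not_sym[OF no] by blast
  obtain y where y: "y \<in> block \<tau> f k" "y \<noteq> ?t'" using F(6,7,8) by metis
  then have y': "y \<in> block \<tau>' f' k" using s2 by blast
  have yt: "EU (f k 0) y" "EU y ?t'" using F(4)[OF y(1)] F'(4)[OF y'] by blast+
  let ?Z = "insert (f k 0) (insert y (insert ?t' L))"
  have "ray_avoiding ?t ?Z"
  proof (rule chain_ray'[OF F(1), where k = k and z = ?t'])
    show "?Z \<inter> right \<tau> f k \<subseteq> block \<tau> f k \<union> spine f (Suc k) \<union> {?t'}" using F(3) y(1) by blast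
    show "?t' \<noteq> f i 0" for i using F(4)[OF t2] by blast
  qed simp
  moreover have "EU (f k 0) ?t" using F'(4)[OF t1] by blast
  moreover have "y \<notin> insert (f k 0) L" "?t' \<notin> insert (f k 0) L" using F(3) F(4)[OF y(1)] F'(3,5) by blast+
  ultimately show False using KEY'[OF F(2), of ?t y ?t'] yt y(2) by blast
qed

text \<open>Two adjacent inner vertices form a short leg without using the next cut vertex, and the
  additional inner vertex of the other chain opens a way to it for the ray.\<close>

lemma same_type:
  assumes st: "stage \<tau> f k L" and st': "stage \<tau>' f' k L" and p: "f' k 0 = f k 0"
  shows "\<tau> k \<Longrightarrow> \<tau>' k"
proof (rule ccontr)
  assume A: "\<tau> k" "\<not> \<tau>' k"
  note F = stage_facts[OF st] and F' = stage_facts[OF st', unfolded p]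
  note t = same_end[OF st st' p]
  have i3: "inner \<tau>' k 3" using A(2) by (simp add: inner_def)
  have "f' k 3 \<in> block \<tau>' f' k" using i3 unfolding block_def by blast
  moreover have "f' k 3 \<noteq> f' k 1" "f' k 3 \<noteq> f' k 2"
    using chain_inj[OF F'(1), of 3 k 1 k] chain_inj[OF F'(1), of 3 k 2 k] i3 inner12 by simp_all
  moreover have "block \<tau> f k = {f k 1, f k 2}" using A(1) by (auto simp: block_def inner_def)
  ultimately obtain x where x: "x \<in> block \<tau>' f' k" "x \<notin> block \<tau> f k" using F'(6,7,8) by (metis insertE singletonD)
  have x': "EU (f k 0) x" "EU x (f (Suc k) 0)" "x \<in> right \<tau>' f' k" "x \<noteq> f (Suc k) 0"
    using F'(4)[OF x(1)] t by metis+
  have xr: "x \<notin> right \<tau> f k" using nbr_right[OF st x'(1)] x(2) x'(4) by blast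
  let ?Z = "insert (f k 0) (insert (f k 1) (insert (f k 2) L))"
  have "ray_avoiding (f (Suc k) 0) (insert x ?Z)"
  proof (rule chain_ray'[OF F(1), where k = k and z = "f k 1"])
    show "insert x ?Z \<inter> right \<tau> f k \<subseteq> block \<tau> f k \<union> spine f (Suc k) \<union> {f k 1}" using F(3,6,7) xr by blast
    show "f k 1 \<noteq> f i 0" for i using F(4)[OF F(6)] by blast
  qed simp
  moreover have "x \<notin> ?Z" using F'(3)[OF x'(3)] x(2) F(6,7) by blast
  ultimately have "ray_avoiding x ?Z" using x'(2) ray_avoiding_Cons by blast
  moreover have "EU (f k 1) (f k 2)" using F(1) A(1) unfolding chain_def by blast
  moreover have "f k 1 \<notin> insert (f k 0) L" "f k 2 \<notin> insert (f k 0) L" using F(3,4,6,7) by blast+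
  ultimately show False using KEY'[OF F(2), of x "f k 1" "f k 2"] x'(1) F(4)[OF F(6)] F(8) by blast
qed

lemma right_Suc:
  assumes "chain \<tau> f" "u \<in> right \<tau> f (Suc k)"
  shows "u \<in> right \<tau> f k" "u \<notin> insert (f (Suc k) 0) (block \<tau> f k)"
proof -
  obtain i j where ij: "Suc k \<le> i" "j = 0 \<and> Suc k < i \<or> inner \<tau> i j" "u = f i j"
    using assms(2) unfolding right_def by blast
  then show "u \<in> right \<tau> f k" unfolding right_def by (intro CollectI exI[of _ i] exI[of _ j]) auto
  have "u \<noteq> f (Suc k) 0" using chain_inj[OF assms(1), of j i 0 "Suc k"] ij inner_pos[of \<tau> i j] by auto
  moreover have "u \<noteq> f k j'" if "inner \<tau> k j'" for j' using chain_inj[OF assms(1), of j i j' k] ij that by auto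
  ultimately show "u \<notin> insert (f (Suc k) 0) (block \<tau> f k)" unfolding block_def by blast
qed

text \<open>The leg is prolonged through \<open>f k 1\<close> to the next cut vertex. The blocks of
  both chains are put into \<open>L\<close>, so that the two chains continue with the same
  \<open>L\<close>; \<open>nbr_right\<close> shows that the block of the second chain does not meet
  the right part of the first.\<close>

lemma stage_Suc:
  assumes st: "stage \<tau> f k L" and st': "stage \<tau>' f' k L" and p: "f' k 0 = f k 0"
  shows "stage \<tau> f (Suc k) (insert (f k 0) (L \<union> block \<tau> f k \<union> block \<tau>' f' k))"
proof -
  note F = stage_facts[OF st] and F' = stage_facts[OF st', unfolded p]
  note t = same_end[OF st st' p]
  let ?t = "f (Suc k) 0" and ?L = "insert (f k 0) (L \<union> block \<tau> f k \<union> block \<tau>' f' k)"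
  have x: "f k 1 \<notin> insert (f k 0) L" "EU (f k 1) (f k 0)" "EU ?t (f k 1)" "?t \<noteq> f k 1"
    using F(3) F(4)[OF F(6)] symU by metis+
  have tL: "?t \<notin> insert (f k 0) L" using F(3,5) by blast
  have 1: "left_path (f k 1) (insert (f k 0) L)" by (rule left_path_Cons[OF F(2) x(2,1)])
  have "?t \<notin> insert (f k 1) (insert (f k 0) L)" using tL x(4) by blast
  note lp = left_path_Cons[OF 1 x(3) this]
  have "?t \<notin> block \<tau> f k" "?t \<notin> block \<tau>' f' k" using F(4) F'(4) t by metis+
  then have nt: "?t \<notin> ?L" using tL by blast
  have sub: "insert (f k 1) (insert (f k 0) L) \<subseteq> ?L" using F(6) by blast
  have "left_path ?t ?L" by (rule left_path_mono[OF lp sub nt])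
  moreover have "u \<notin> right \<tau> f (Suc k)" if "u \<in> ?L" for u
  proof
    assume u: "u \<in> right \<tau> f (Suc k)"
    note r = right_Suc[OF F(1) u]
    have "u \<in> block \<tau>' f' k" using that F(3)[OF r(1)] r(2) by blast
    then have "EU (f k 0) u" using F'(4) by blast
    from nbr_right[OF st this r(1)] show False using r(2) by blast
  qed
  ultimately show ?thesis using F(1) unfolding stage_def by blast
qed

theorem chains_agree:
  assumes "stage \<tau> f k0 L" "stage \<tau>' f' k0 L" "f' k0 0 = f k0 0"
  shows "\<tau> (k0 + m) \<longleftrightarrow> \<tau>' (k0 + m)"
proof -
  have "\<exists>L. stage \<tau> f (k0 + m) L \<and> stage \<tau>' f' (k0 + m) L \<and> f' (k0 + m) 0 = f (k0 + m) 0"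
  proof (induction m)
    case 0
    then show ?case using assms by auto
  next
    case (Suc m)
    then obtain L where L: "stage \<tau> f (k0 + m) L" "stage \<tau>' f' (k0 + m) L" "f' (k0 + m) 0 = f (k0 + m) 0" by blast
    have 2: "stage \<tau>' f' (Suc (k0 + m)) (insert (f (k0 + m) 0) (L \<union> block \<tau> f (k0 + m) \<union> block \<tau>' f' (k0 + m)))"
      using stage_Suc[OF L(2,1) L(3)[symmetric]] L(3) by (simp add: Un_ac)
    show ?case using stage_Suc[OF L] 2 same_end[OF L] by auto
  qed
  then show ?thesis using same_type by metis
qed

end

end

section \<open>Trees with three legs, and the count of chains\<close>

lemma no_inj_nat_set:
  fixes g :: "nat set \<Rightarrow> 'b::countable"
  shows "\<not> inj g"
proof
  assume "inj g"
  then have "inj (\<lambda>S. to_nat (g S))" by (auto simp: inj_def)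
  then have "surj (inv (\<lambda>S. to_nat (g S)))" by (rule inj_imp_surj_inv)
  then show False using Cantors_theorem[of "UNIV :: nat set"] by auto
qed

text \<open>For \<open>z\<close> other than the root this is the neighbour of the root below which
  \<open>z\<close> lies. When all other vertices have degree at most two, \<open>branch\<close> and
  depth are coordinates on the tree.\<close>

definition branch :: "('a \<Rightarrow> 'a) \<Rightarrow> ('a \<Rightarrow> nat) \<Rightarrow> 'a \<Rightarrow> 'a" where
  "branch par dp z = (par ^^ (dp z - 1)) z"

lemma branch_simps:
  assumes T: "rtree V E x par dp" and z: "z \<in> V" "z \<noteq> x"
  shows "par z = x \<Longrightarrow> branch par dp z = z \<and> dp z = 1" "par z \<noteq> x \<Longrightarrow> branch par dp z = branch par dp (par z) \<and> dp z \<ge> 2"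
proof -
  note P = rtreeD(6)[OF T z]
  show "branch par dp z = z \<and> dp z = 1" if "par z = x"
    using P that rtreeD(4)[OF T] by (simp add: branch_def)
  show "branch par dp z = branch par dp (par z) \<and> dp z \<ge> 2" if "par z \<noteq> x"
  proof -
    have "dp (par z) \<noteq> 0" using rtreeD(5)[OF T] P that by simp
    then obtain n where n: "dp (par z) = Suc n" by (metis not0_implies_Suc)
    then have "branch par dp z = (par ^^ Suc n) z" using P by (simp add: branch_def)
    also have "\<dots> = branch par dp (par z)" using n by (simp add: branch_def funpow_swap1)
    finally show ?thesis using P n by simp
  qed
qed

lemma branch_nbr:
  assumes T: "rtree V E x par dp" and z: "z \<in> V" "z \<noteq> x"
  shows "E x (branch par dp z)"
proof -
  have "z \<noteq> x \<longrightarrow> E x (branch par dp z)"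
    using T z(1)
  proof (induction rule: rtree_induct)
    case (step z)
    note P = rtreeD(6)[OF T step(1,2)]
    show ?case
    proof (cases "par z = x")
      case True
      then show ?thesis using branch_simps(1)[OF T step(1,2)] P by simp
    next
      case False
      then show ?thesis using branch_simps(2)[OF T step(1,2)] step(3) by simp
    qed
  qed simp
  then show ?thesis using z by simp
qed

lemma child_unique:
  assumes T: "rtree V E x par dp" and d: "deg E (par z) \<le> 2" and z: "z \<in> V" "z \<noteq> x" "w \<in> V" "w \<noteq> x"
    and eq: "par z = par w" "par z \<noteq> x"
  shows "z = w"
proof -
  let ?C = "{u \<in> V. u \<noteq> x \<and> par u = par z}"
  have "par z \<in> V" using rtreeD(6)[OF T z(1,2)] by simp
  then have C: "card ?C \<le> Suc 0" using rtree_deg_nonroot(2)[OF T _ eq(2)] d by simp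
  have fin: "finite ?C" using rtreeD(1)[OF T] by simp
  have "\<forall>a\<in>?C. \<forall>b\<in>?C. a = b" by (rule iffD1[OF card_le_Suc0_iff_eq[OF fin] C])
  moreover have "z \<in> ?C" "w \<in> ?C" using z eq by auto
  ultimately show ?thesis by blast
qed

lemma branch_dp_unique:
  assumes T: "rtree V E x par dp" and d: "\<And>z. z \<in> V \<Longrightarrow> z \<noteq> x \<Longrightarrow> deg E z \<le> 2"
  shows "z \<in> V \<Longrightarrow> w \<in> V \<Longrightarrow> z \<noteq> x \<Longrightarrow> w \<noteq> x \<Longrightarrow> branch par dp z = branch par dp w \<Longrightarrow> dp z = dp w \<Longrightarrow> z = w"
proof (induction "dp z" arbitrary: z w)
  case 0
  then show ?case using rtreeD(5)[OF T] by metis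
next
  case (Suc n)
  note Pz = rtreeD(6)[OF T Suc(3,5)] and Pw = rtreeD(6)[OF T Suc(4,6)]
  note bz = branch_simps[OF T Suc(3,5)] and bw = branch_simps[OF T Suc(4,6)]
  show ?case
  proof (cases "par z = x")
    case True
    then have pw: "par w = x" using bz(1) bw(2) Suc(8) by (cases "par w = x") simp_all
    show ?thesis using conjunct1[OF bz(1)[OF True]] conjunct1[OF bw(1)[OF pw]] Suc(7) by metis
  next
    case False
    then have w: "par w \<noteq> x" using bz(2) bw(1) Suc(8) by (cases "par w = x") simp_all
    have "par z = par w"
    proof (rule Suc(1))
      show "n = dp (par z)" using Pz Suc(2) by simp
      show "par z \<in> V" "par w \<in> V" using Pz Pw by blast+
      show "branch par dp (par z) = branch par dp (par w)"
        using conjunct1[OF bz(2)[OF False]] conjunct1[OF bw(2)[OF w]] Suc(7) by metis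
      show "dp (par z) = dp (par w)" using Pz Pw Suc(8) by simp
    qed (rule False w)+
    then show ?thesis using child_unique[OF T d Suc(3,5,4,6)] Pz False by blast
  qed
qed

context
  fixes VT :: "'a set" and ET x par dp k1 c1
  assumes T: "rtree VT ET x par dp" and d3: "deg ET x = 3"
    and d2: "\<And>z. z \<in> VT \<Longrightarrow> z \<noteq> x \<Longrightarrow> deg ET z \<le> 2"
    and nl: "\<And>w. ET x w \<Longrightarrow> deg ET w \<noteq> 1"
    and k1: "ET x k1" "c1 \<in> VT" "c1 \<noteq> x" "par c1 = k1" "deg ET c1 = 1"
begin

lemma leg1_short:
  assumes z: "z \<in> VT" "z \<noteq> x" "branch par dp z = k1"
  shows "dp z \<le> 2"
proof -
  have k1x: "k1 \<noteq> x" "k1 \<in> VT" "par k1 = x" using rtree_root_nbrs[OF T] k1(1) by blast+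
  have c1: "branch par dp c1 = k1" "dp c1 = 2"
    using branch_simps(2)[OF T k1(2,3)] branch_simps(1)[OF T k1x(2,1,3)] k1(4) k1x(1) rtreeD(6)[OF T k1(2,3)] by auto
  have "z \<noteq> x \<longrightarrow> branch par dp z = k1 \<longrightarrow> dp z \<le> 2"
    using T z(1)
  proof (induction rule: rtree_induct)
    case (step z)
    note P = rtreeD(6)[OF T step(1,2)]
    show ?case
    proof (intro impI)
      assume b: "branch par dp z = k1"
      show "dp z \<le> 2"
      proof (cases "par z = x")
        case True
        then show ?thesis using branch_simps(1)[OF T step(1,2)] by simp
      next
        case False
        then have b': "branch par dp (par z) = k1" using branch_simps(2)[OF T step(1,2)] b by simp
        then have "dp (par z) \<le> 2" using step(3) False by simp
        moreover have "dp (par z) \<noteq> 2"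
        proof
          assume "dp (par z) = 2"
          then have "par z = c1" using branch_dp_unique[OF T d2, of "par z" c1] P False k1 c1 b' by simp
          then have "card {u \<in> VT. u \<noteq> x \<and> par u = c1} > 0"
            using step(1,2) rtreeD(1)[OF T] by (auto simp: card_gt_0_iff)
          then show False using rtree_deg_nonroot(2)[OF T k1(2,3)] k1(5) by simp
        qed
        ultimately show ?thesis using P by simp
      qed
    qed
  qed simp
  then show ?thesis using z by simp
qed

text \<open>The branch of \<open>k1\<close> has two vertices and goes to \<open>a\<close>,
  \<open>b\<close>; a second branch follows the ray and the third follows \<open>l\<close>, which is
  long enough since \<open>N\<close> bounds all depths.\<close>

lemma big_spider_free:
  assumes fr: "free VT ET U EU" and N: "\<And>z. z \<in> VT \<Longrightarrow> dp z \<le> N"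
    and E: "EU p a" "EU a b" "EU p (r 0)" "inj r" "\<And>i. EU (r i) (r (Suc i))"
      "l 0 = p" "inj_on l {..N}" "\<And>i. i < N \<Longrightarrow> EU (l i) (l (Suc i))"
      "a \<noteq> b" "range r \<inter> insert a (insert b (l ` {..N})) = {}" "a \<notin> l ` {..N}" "b \<notin> l ` {..N}"
  shows False
proof -
  have sg: "sgr U EU" using fr by (simp add: free_def)
  have "card ({w. ET x w} - {k1}) = 2" using d3 k1(1) by (simp add: deg_def)
  then obtain k2 where k2: "ET x k2" "k2 \<noteq> k1" by (metis card_eq_0_iff ex_in_conv Diff_iff insertI1 mem_Collect_eq zero_neq_numeral)
  let ?b = "branch par dp"
  define f where "f = (\<lambda>z. if z = x then p else if ?b z = k1 then (if dp z = 1 then a else b)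
      else if ?b z = k2 then r (dp z - 1) else l (dp z))"
  have dp1: "dp z \<ge> 1" if "z \<in> VT" "z \<noteq> x" for z using rtreeD(6)[OF T that] by simp
  have rng: "r i \<noteq> a" "r i \<noteq> b" "j \<le> N \<Longrightarrow> r i \<noteq> l j" "j \<le> N \<Longrightarrow> a \<noteq> l j" "j \<le> N \<Longrightarrow> b \<noteq> l j" for i j
  proof -
    have "r i \<notin> insert a (insert b (l ` {..N}))" using E(10) by blast
    then show "r i \<noteq> a" "r i \<noteq> b" "j \<le> N \<Longrightarrow> r i \<noteq> l j" by auto
    show "j \<le> N \<Longrightarrow> a \<noteq> l j" "j \<le> N \<Longrightarrow> b \<noteq> l j" using E(11,12) by auto
  qed
  have linj: "l i = l j \<longleftrightarrow> i = j" if "i \<le> N" "j \<le> N" for i j using E(7) that by (auto dest: inj_onD)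
  \<comment> \<open>\<open>h\<close> names the part of the tree to which a vertex belongs; the
    images of different parts are disjoint, and within a part the depth decides.\<close>
  define h where "h = (\<lambda>z. if z = x then (0::nat) else if ?b z = k1 then 1 else if ?b z = k2 then 2 else 3)"
  have inj: "inj_on f VT"
  proof (rule inj_onI)
    fix z w assume zw: "z \<in> VT" "w \<in> VT" "f z = f w"
    have key: "z = w" if "z \<noteq> x" "w \<noteq> x" "dp z = dp w" "?b z = ?b w"
      using branch_dp_unique[OF T d2 zw(1,2)] that by blast
    have third: "?b z = ?b w" if "z \<noteq> x" "w \<noteq> x" "?b z \<noteq> k1" "?b w \<noteq> k1" "?b z \<noteq> k2" "?b w \<noteq> k2"
    proof -
      let ?K = "{w. ET x w}"
      have "finite ?K" using d3 card.infinite by (fastforce simp: deg_def)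
      then have "card (?K - {k1, k2}) = 1" using d3 k1(1) k2 by (simp add: deg_def card_Diff_subset)
      then obtain k where "?K - {k1, k2} = {k}" by (meson card_1_singletonE)
      moreover have "?b z \<in> ?K - {k1, k2}" "?b w \<in> ?K - {k1, k2}"
        using branch_nbr[OF T zw(1)] branch_nbr[OF T zw(2)] that by simp_all
      ultimately show ?thesis by simp
    qed
    have d12: "dp z = 1 \<or> dp z = 2" if "z \<noteq> x" "?b z = k1" using leg1_short[OF zw(1) that] dp1[OF zw(1) that(1)] by linarith
    have d12': "dp w = 1 \<or> dp w = 2" if "w \<noteq> x" "?b w = k1" using leg1_short[OF zw(2) that] dp1[OF zw(2) that(1)] by linarith
    have rl: "p = l 0" using E(6) by simp
    note dz = N[OF zw(1)] dp1[OF zw(1)] and dw = N[OF zw(2)] dp1[OF zw(2)]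
    consider "h z = 0" | "h z = 1" | "h z = 2" | "h z = 3" unfolding h_def by presburger
    note cz = this
    consider "h w = 0" | "h w = 1" | "h w = 2" | "h w = 3" unfolding h_def by presburger
    note cw = this
    have pl: "p \<noteq> a" "p \<noteq> b" "r i \<noteq> p" for i using rng(3,4,5)[of 0] rl by auto
    have H0: "z = x" "f z = p" if "h z = 0" using that by (auto simp: h_def f_def split: if_splits)
    have H0': "w = x" "f w = p" if "h w = 0" using that by (auto simp: h_def f_def split: if_splits)
    have H1: "z \<noteq> x" "?b z = k1" "f z = (if dp z = 1 then a else b)" if "h z = 1" using that by (auto simp: h_def f_def split: if_splits)
    have H1': "w \<noteq> x" "?b w = k1" "f w = (if dp w = 1 then a else b)" if "h w = 1" using that by (auto simp: h_def f_def split: if_splits)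
    have H2: "z \<noteq> x" "?b z = k2" "f z = r (dp z - 1)" if "h z = 2" using that k2(2) by (auto simp: h_def f_def split: if_splits)
    have H2': "w \<noteq> x" "?b w = k2" "f w = r (dp w - 1)" if "h w = 2" using that k2(2) by (auto simp: h_def f_def split: if_splits)
    have H3: "z \<noteq> x" "?b z \<noteq> k1" "?b z \<noteq> k2" "f z = l (dp z)" if "h z = 3" using that by (auto simp: h_def f_def split: if_splits)
    have H3': "w \<noteq> x" "?b w \<noteq> k1" "?b w \<noteq> k2" "f w = l (dp w)" if "h w = 3" using that by (auto simp: h_def f_def split: if_splits)
    have hh: "h z = h w"
    proof (rule ccontr)
      assume ne: "h z \<noteq> h w"
      have lp: "l (dp z) \<noteq> p" if "z \<noteq> x" using linj[of "dp z" 0] dz that rl by auto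
      have lp': "l (dp w) \<noteq> p" if "w \<noteq> x" using linj[of "dp w" 0] dw that rl by auto
      have ra: "a \<noteq> l (dp z)" "b \<noteq> l (dp z)" "r i \<noteq> l (dp z)" "a \<noteq> l (dp w)" "b \<noteq> l (dp w)" "r i \<noteq> l (dp w)" for i
        using rng dz(1) dw(1) by blast+
      show False
        using cz
      proof cases
        case 1
        from cw show False using ne 1 H0[OF 1] H1' H2' H3' zw(3) pl lp' by cases (metis+)
      next
        case 2
        from cw show False using ne 2 H1[OF 2] H0' H2' H3' zw(3) pl rng ra by cases (metis+)
      next
        case 3
        from cw show False using ne 3 H2[OF 3] H0' H1' H3' zw(3) pl rng ra by cases (metis+)
      next
        case 4
        from cw show False using ne 4 H3[OF 4] H0' H1' H2' zw(3) lp rng ra by cases (metis+)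
      qed
    qed
    show "z = w"
      using cz
    proof cases
      case 1
      then show ?thesis using H0 H0' hh by simp
    next
      case 2
      then have w2: "h w = 1" using hh by simp
      have "dp z = dp w" using H1[OF 2] H1'[OF w2] d12 d12' zw(3) E(9) by (auto split: if_splits)
      then show ?thesis using key H1[OF 2] H1'[OF w2] by simp
    next
      case 3
      then have w3: "h w = 2" using hh by simp
      have "dp z - 1 = dp w - 1" using H2[OF 3] H2'[OF w3] zw(3) E(4) by (auto dest: injD)
      then have "dp z = dp w" using dz(2) dw(2) H2(1)[OF 3] H2'(1)[OF w3] by simp
      then show ?thesis using key H2[OF 3] H2'[OF w3] by simp
    next
      case 4
      then have w4: "h w = 3" using hh by simp
      have "dp z = dp w" using H3(4)[OF 4] H3'(4)[OF w4] zw(3) linj[OF dz(1) dw(1)] by simp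
      then show ?thesis using key third H3[OF 4] H3'[OF w4] by simp
    qed
  qed
  have par: "EU (f (par z)) (f z)" if z: "z \<in> VT" "z \<noteq> x" for z
  proof (cases "par z = x")
    case True
    have "f z = a \<or> f z = r 0 \<or> f z = l 1" using branch_simps(1)[OF T z True] z(2) by (auto simp: f_def)
    moreover have "EU p (l 1)" using E(8)[of 0] E(6) N[OF z(1)] dp1[OF z] by simp
    ultimately show ?thesis using True E(1,3) by (auto simp: f_def)
  next
    case False
    note b = branch_simps(2)[OF T z False] and P = rtreeD(6)[OF T z]
    have pN: "dp (par z) < N" using P N[OF z(1)] by simp
    consider "?b z = k1" | "?b z \<noteq> k1" "?b z = k2" | "?b z \<noteq> k1" "?b z \<noteq> k2" by blast
    then show ?thesis
    proof cases
      case 1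
      then have "dp z = 2" using leg1_short[OF z] b by simp
      then show ?thesis using 1 b False z(2) E(2) P by (simp add: f_def)
    next
      case 2
      have "dp z - 1 = Suc (dp (par z) - 1)" using b P by simp
      then show ?thesis using 2 b False z(2) E(5)[of "dp (par z) - 1"] by (simp add: f_def)
    next
      case 3
      then show ?thesis using b False z(2) E(8)[OF pN] P by (simp add: f_def)
    qed
  qed
  have "emb VT ET U EU f"
    unfolding emb_def
  proof (intro conjI allI impI inj)
    show e: "EU (f z) (f w)" if "ET z w" for z w
      using rtreeD(7)[OF T that] par[of z] par[of w] sgr_sym[OF sg] sgrD[OF rtreeD(2)[OF T] that] by metis
    show "f ` VT \<subseteq> U"
    proof (rule image_subsetI)
      fix z assume z: "z \<in> VT"
      show "f z \<in> U"
      proof (cases "z = x")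
        case True
        then show ?thesis using sgrD[OF sg E(1)] by (simp add: f_def)
      next
        case False
        then show ?thesis using sgrD[OF sg par[OF z False]] by simp
      qed
    qed
  qed
  then show False using fr by (auto simp: free_def)
qed

text \<open>No neighbour of the root is a leaf, so each has a child; these are the three legs
  excluded by \<open>chain_adj_no_spider\<close>.\<close>

lemma chain_graph_free: "free VT ET (chain_verts \<tau>) (chain_adj \<tau>)"
proof -
  have "\<not> emb VT ET (chain_verts \<tau>) (chain_adj \<tau>) f" for f
  proof
    assume f: "emb VT ET (chain_verts \<tau>) (chain_adj \<tau>) f"
    let ?K = "{w. ET x w}"
    have "\<exists>c. c \<in> VT \<and> c \<noteq> x \<and> par c = k" if "k \<in> ?K" for k
    proof -
      have k: "k \<in> VT" "k \<noteq> x" using rtree_root_nbrs[OF T] that by blast+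
      have "card {u \<in> VT. u \<noteq> x \<and> par u = k} \<noteq> 0" using nl[of k] that rtree_deg_nonroot(2)[OF T k] by auto
      then have "{u \<in> VT. u \<noteq> x \<and> par u = k} \<noteq> {}" by (metis card.empty)
      then show ?thesis by blast
    qed
    then obtain c where c: "\<And>k. k \<in> ?K \<Longrightarrow> c k \<in> VT \<and> c k \<noteq> x \<and> par (c k) = k" by metis
    have kV: "k \<in> VT \<and> k \<noteq> x \<and> par k = x \<and> dp k = 1" if "k \<in> ?K" for k
      using rtree_root_nbrs[OF T] that rtree_dp1[OF T, of k] by auto
    have cd: "dp (c k) = 2" if "k \<in> ?K" for k
      using c[OF that] kV[OF that] rtreeD(6)[OF T, of "c k"] by simp
    have xV: "x \<in> VT" "dp x = 0" using rtreeD(3,4)[OF T] by blast+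
    have fi: "f u = f w \<longleftrightarrow> u = w" if "u \<in> VT" "w \<in> VT" for u w using f that by (auto simp: emb_def dest: inj_onD)
    have fE: "chain_adj \<tau> (f u) (f w)" if "ET u w" for u w using f that by (simp add: emb_def)
    show False
    proof (rule chain_adj_no_spider[of ?K f "f \<circ> c" "f x" \<tau>])
      show "card ?K = 3" using d3 by (simp add: deg_def)
      show "inj_on f ?K" using fi kV by (auto simp: inj_on_def)
      show "inj_on (f \<circ> c) ?K"
      proof (rule inj_onI)
        fix k k' assume k: "k \<in> ?K" "k' \<in> ?K" "(f \<circ> c) k = (f \<circ> c) k'"
        then have "c k = c k'" using fi[of "c k" "c k'"] c by simp
        then show "k = k'" using c[OF k(1)] c[OF k(2)] by metis
      qed
      show "f x \<notin> f ` ?K"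
      proof
        assume "f x \<in> f ` ?K"
        then obtain k where "k \<in> ?K" "f x = f k" by blast
        then show False using fi[OF xV(1)] kV by blast
      qed
      show "f x \<notin> (f \<circ> c) ` ?K"
      proof
        assume "f x \<in> (f \<circ> c) ` ?K"
        then obtain k where "k \<in> ?K" "f x = f (c k)" by auto
        then show False using fi[OF xV(1)] c by metis
      qed
      show "f ` ?K \<inter> (f \<circ> c) ` ?K = {}"
      proof (rule ccontr)
        assume "\<not> ?thesis"
        then obtain k k' where k: "k \<in> ?K" "k' \<in> ?K" "f k = (f \<circ> c) k'" by blast
        then have "k = c k'" using fi[of k "c k'"] kV[OF k(1)] c[OF k(2)] by simp
        then show False using kV[OF k(1)] cd[OF k(2)] by simp
      qed
      show "chain_adj \<tau> (f x) (f k)" if "k \<in> ?K" for k using fE that by blast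
      show "chain_adj \<tau> (f k) ((f \<circ> c) k)" if "k \<in> ?K" for k
        using fE[of k "c k"] c[OF that] rtreeD(6)[OF T, of "c k"] by simp
    qed
  qed
  then show ?thesis using sgr_chain_adj unfolding free_def by blast
qed

text \<open>The set \<open>S\<close> is written into the types of the blocks from number
  \<open>N\<close> on. The images of the initial segment form a list over \<open>nat\<close>, and by
  \<open>chains_agree\<close> this list determines all later types, hence \<open>S\<close>.\<close>

theorem chain_no_wuniv: "\<not> wuniv VT ET U EU"
proof
  assume U: "wuniv VT ET U EU"
  then have fr: "free VT ET U EU" by (simp add: wuniv_def)
  then have sg: "sgr U EU" by (simp add: free_def)
  define N where "N = Max (dp ` VT)"
  have N: "dp z \<le> N" if "z \<in> VT" for z unfolding N_def using rtreeD(1)[OF T] that by (intro Max_ge) auto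
  have symU: "EU v u" if "EU u v" for u v using sgr_sym[OF sg] that by blast
  have big: False if "EU p a" "EU a b" "EU p (r 0)" "inj r" "\<And>i. EU (r i) (r (Suc i))"
      "l 0 = p" "inj_on l {..N}" "\<And>i. i < N \<Longrightarrow> EU (l i) (l (Suc i))"
      "a \<noteq> b" "range r \<inter> insert a (insert b (l ` {..N})) = {}" "a \<notin> l ` {..N}" "b \<notin> l ` {..N}"
    for p a b and r l :: "nat \<Rightarrow> nat"
    using big_spider_free[OF fr N that] by blast
  \<comment> \<open>The first \<open>N\<close> blocks have the same type for every \<open>S\<close>,
    so that the same list of vertices can be compared for two sets; they contain the leg of length
    \<open>N\<close>.\<close>
  define \<tau> where "\<tau> = (\<lambda>S i. N \<le> i \<and> i - N \<in> S)"
  have "\<forall>S. \<exists>f. emb (chain_verts (\<tau> S)) (chain_adj (\<tau> S)) U EU f" using wuniv_any[OF U chain_graph_free] by metis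
  from choice[OF this] obtain F where F: "\<forall>S. emb (chain_verts (\<tau> S)) (chain_adj (\<tau> S)) U EU (F S)" by (rule exE)
  let ?F = "\<lambda>S i j. F S (i, j)"
  have ch: "chain EU (\<tau> S) (?F S)" for S
  proof -
    have e: "emb (chain_verts (\<tau> S)) (chain_adj (\<tau> S)) U EU (F S)" using F by blast
    have inj: "i = i' \<and> j = j'" if "j = 0 \<or> inner (\<tau> S) i j" "j' = 0 \<or> inner (\<tau> S) i' j'" "F S (i, j) = F S (i', j')" for i j i' j'
    proof -
      have "(i, j) \<in> chain_verts (\<tau> S)" "(i', j') \<in> chain_verts (\<tau> S)" using that by (auto simp: chain_verts_def)
      then have "(i, j) = (i', j')" using e that(3) unfolding emb_def by (blast dest: inj_onD)
      then show ?thesis by simp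
    qed
    have E: "EU (F S p) (F S q)" if "chain_adj (\<tau> S) p q" for p q using e that unfolding emb_def by blast
    have e1: "EU (F S (i, 0)) (F S (i, j)) \<and> EU (F S (i, j)) (F S (Suc i, 0))" if "inner (\<tau> S) i j" for i j
    proof -
      have "j > 0" using that by (auto simp: inner_def)
      then show ?thesis using that by (intro conjI E) (auto simp: chain_adj_def chain_verts_def)
    qed
    have e2: "EU (F S (i, 1)) (F S (i, 2))" if "\<tau> S i" for i
      using that by (intro E) (auto simp: chain_adj_def chain_verts_def inner_def)
    show ?thesis unfolding chain_def
    proof (intro conjI allI impI)
      fix i j i' j'
      assume "j = 0 \<or> inner (\<tau> S) i j" "j' = 0 \<or> inner (\<tau> S) i' j'" "F S (i, j) = F S (i', j')"
      from inj[OF this] show "i = i'" "j = j'" by blast+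
    next
      fix i j assume "inner (\<tau> S) i j"
      from e1[OF this] show "EU (F S (i, 0)) (F S (i, j))" "EU (F S (i, j)) (F S (Suc i, 0))" by blast+
    qed (rule e2)
  qed
  define al where "al = (N, 0) # List.product [0..<N] [0..<(4::nat)]"
  have "inj (\<lambda>S. map (F S) al)"
  proof (rule injI)
    fix S S' assume eq: "map (F S) al = map (F S') al"
    have agree: "F S (i, j) = F S' (i, j)" if "i < N \<and> j < 4 \<or> i = N \<and> j = 0" for i j
    proof -
      have "(i, j) \<in> set al" using that by (auto simp: al_def)
      then show ?thesis using eq by (simp only: map_eq_conv)
    qed
    let ?A = "{(i, j). i < N \<and> j < (4::nat)}"
    have inA: "inner (\<tau> R) i j \<longleftrightarrow> 0 < j \<and> j < 4" if "i < N" for R i j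
      using that by (auto simp: inner_def \<tau>_def)
    have st: "stage EU N (\<tau> R) (?F R) N (F R ` ?A)" for R
    proof -
      \<comment> \<open>The leg runs back from cut vertex \<open>N\<close>, alternating between cut
        vertices and inner vertices \<open>1\<close>; it enters about half of the initial
        blocks.\<close>
      let ?l = "\<lambda>m. F R (N - (m + 1) div 2, if even m then 0 else 1)"
      note ci = chain_inj[OF ch[of R]]
      have ok: "(if even m then 0 else 1::nat) = 0 \<or> inner (\<tau> R) i (if even m then 0 else 1)" for m :: nat and i
        by (simp add: inner_def)
      have nA: "F R (i, j) \<notin> F R ` ?A" if "N \<le> i" "j = 0 \<or> inner (\<tau> R) i j" for i j
      proof
        assume "F R (i, j) \<in> F R ` ?A"
        then obtain i' j' where ij: "i' < N" "j' < 4" "F R (i, j) = F R (i', j')" by auto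
        then have "j' = 0 \<or> inner (\<tau> R) i' j'" using inA by auto
        then show False using ci[OF that(2), of j' i'] ij that(1) by simp
      qed
      have l1: "inj_on ?l {..N}"
      proof (rule inj_onI)
        fix m m' assume m: "m \<in> {..N}" "m' \<in> {..N}" "?l m = ?l m'"
        have q: "N - (m + 1) div 2 = N - (m' + 1) div 2 \<and> (if even m then 0 else 1::nat) = (if even m' then 0 else 1)"
          by (rule iffD1[OF ci[OF ok ok] m(3)])
        have "(m + 1) div 2 \<le> N" "(m' + 1) div 2 \<le> N" using m(1,2) by auto
        then have "(m + 1) div 2 = (m' + 1) div 2" using conjunct1[OF q] by linarith
        moreover have "even m \<longleftrightarrow> even m'" using conjunct2[OF q] by (cases "even m"; cases "even m'") simp_all
        ultimately show "m = m'" by presburger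
      qed
      have l2: "?l ` {1..N} \<subseteq> F R ` ?A"
      proof (rule image_subsetI)
        fix m assume "m \<in> {1..N}"
        then have "N - (m + 1) div 2 < N" by auto
        then show "?l m \<in> F R ` ?A" by (intro imageI) auto
      qed
      have l3: "EU (?l m) (?l (Suc m))" if m: "m < N" for m
      proof -
        let ?i = "N - (Suc m + 1) div 2"
        have e: "EU (F R (?i, 0)) (F R (?i, 1)) \<and> EU (F R (?i, 1)) (F R (Suc ?i, 0))"
          using chain_edge[OF ch[of R], of ?i 1] by (simp add: inner_def)
        show ?thesis
        proof (cases "even m")
          case True
          then have "N - (m + 1) div 2 = Suc ?i" using m by presburger
          then show ?thesis using e symU True by simp
        next
          case False
          then have "N - (m + 1) div 2 = ?i" by presburger
          then show ?thesis using e symU False by simp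
        qed
      qed
      have l4: "?l 0 = F R (N, 0)" by simp
      have l5: "F R (N, 0) \<notin> F R ` ?A" by (rule nA) auto
      have lp: "left_path EU N (F R (N, 0)) (F R ` ?A)"
        unfolding left_path_def by (rule conjI[OF l5], rule exI[of _ ?l], intro conjI allI impI l4 l1 l2, rule l3)
      have "F R ` ?A \<inter> right (\<tau> R) (?F R) N = {}"
      proof (rule ccontr)
        assume "\<not> ?thesis"
        then obtain u where u: "u \<in> F R ` ?A" "u \<in> right (\<tau> R) (?F R) N" by blast
        then obtain i j where ij: "N \<le> i" "j = 0 \<and> N < i \<or> inner (\<tau> R) i j" "u = F R (i, j)"
          unfolding right_def by blast
        then show False using nA[OF ij(1), of j] u(1) by blast
      qed
      then show ?thesis unfolding stage_def by (intro conjI ch lp)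
    qed
    have "F S ` ?A = F S' ` ?A" using agree by (intro image_cong) auto
    then have st': "stage EU N (\<tau> S') (?F S') N (F S ` ?A)" using st[of S'] by simp
    have "?F S' N 0 = ?F S N 0" using agree[of N 0] by simp
    have "\<tau> S (N + m) = \<tau> S' (N + m)" for m
      by (rule chains_agree[OF symU big st st']) (assumption | fact)+
    then have "m \<in> S \<longleftrightarrow> m \<in> S'" for m by (simp add: \<tau>_def)
    then show "S = S'" by blast
  qed
  then show False using no_inj_nat_set by blast
qed

end

section \<open>Regular graphs of large girth\<close>

text \<open>Large girth forces the two ends of such a walk to differ. Unlike paths, these walks are
  easily concatenated: only the junction has to be checked.\<close>

fun nonbacktracking :: "('a \<Rightarrow> 'a \<Rightarrow> bool) \<Rightarrow> 'a list \<Rightarrow> bool" where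
  "nonbacktracking E [] \<longleftrightarrow> True"
| "nonbacktracking E [a] \<longleftrightarrow> True"
| "nonbacktracking E [a, b] \<longleftrightarrow> E a b"
| "nonbacktracking E (a # b # c # xs) \<longleftrightarrow> E a b \<and> a \<noteq> c \<and> nonbacktracking E (b # c # xs)"

lemma nonbacktracking_append: "nonbacktracking E (xs @ a # b # ys) \<longleftrightarrow> nonbacktracking E (xs @ [a, b]) \<and> nonbacktracking E (a # b # ys)"
proof (induction xs rule: induct_list012)
  case 1
  then show ?case by (cases ys) auto
next
  case (2 x)
  then show ?case by (cases ys) auto
next
  case (3 x y zs)
  then show ?case by (cases zs) auto
qed

lemma nonbacktracking_join:
  assumes "nonbacktracking E (xs @ [a, u])" "nonbacktracking E (u # b # ys)" "a \<noteq> b"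
  shows "nonbacktracking E (xs @ a # u # b # ys)"
proof -
  have "E a u" using nonbacktracking_append[of E xs a u "[]"] assms(1) by simp
  then show ?thesis using assms nonbacktracking_append[of E xs a u "b # ys"] by simp
qed

lemma nonbacktracking_snoc: "nonbacktracking E (xs @ [a, b]) \<longleftrightarrow> nonbacktracking E (xs @ [a]) \<and> E a b \<and> (xs = [] \<or> last xs \<noteq> b)"
proof (induction xs rule: induct_list012)
  case (3 x y zs)
  then show ?case by (cases zs) auto
qed auto

lemma nonbacktracking_rev:
  assumes sym: "\<And>a b. E a b \<Longrightarrow> E b a"
  shows "nonbacktracking E xs \<Longrightarrow> nonbacktracking E (rev xs)"
proof (induction xs rule: induct_list012)
  case (3 x y zs)
  show ?case
  proof (cases zs)
    case Nil
    then show ?thesis using 3(3) sym by simp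
  next
    case (Cons z zs')
    then have "nonbacktracking E (rev (y # z # zs'))" using 3 by simp
    then have "nonbacktracking E ((rev zs' @ [z]) @ [y, x])" unfolding nonbacktracking_snoc using 3(3) Cons sym by auto
    then show ?thesis using Cons by simp
  qed
qed auto

lemma nonbacktracking_appendD: "nonbacktracking E (xs @ ys) \<Longrightarrow> nonbacktracking E xs \<and> nonbacktracking E ys"
proof (induction xs rule: induct_list012)
  case (2 x)
  then show ?case by (cases ys; cases "tl ys") auto
next
  case (3 x y zs)
  then show ?case by (cases zs; cases ys) auto
qed auto

text \<open>
  The function \<open>\<phi>\<close> witnesses that \<open>u\<close> and \<open>v\<close> have distance at least \<open>n\<close> after deletion of the edge
  \<open>uv\<close>; such witnesses are easy to write down and to pull back along homomorphisms.
\<close>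

definition long_detour :: "('a \<Rightarrow> 'a \<Rightarrow> bool) \<Rightarrow> 'a \<Rightarrow> 'a \<Rightarrow> nat \<Rightarrow> bool" where
  "long_detour E u v n \<longleftrightarrow> (\<exists>\<phi> :: 'a \<Rightarrow> int. (\<forall>a b. E a b \<longrightarrow> {a, b} \<noteq> {u, v} \<longrightarrow> \<bar>\<phi> a - \<phi> b\<bar> \<le> 1) \<and> int n \<le> \<bar>\<phi> u - \<phi> v\<bar>)"

lemma nonbacktracking_nth:
  assumes "nonbacktracking E xs"
  shows "Suc i < length xs \<Longrightarrow> E (xs ! i) (xs ! Suc i)" "Suc (Suc i) < length xs \<Longrightarrow> xs ! i \<noteq> xs ! Suc (Suc i)"
  using assms
proof (induction E xs arbitrary: i rule: nonbacktracking.induct)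
  case (4 E a b c xs)
  { case 1
    then show ?case using 4(1)[of "i - 1"] by (cases i) auto
  next
    case 2
    then show ?case using 4(2)[of "i - 1"] by (cases i) auto }
qed auto

text \<open>By induction the proper segments are not closed, so a closed \<open>xs\<close> would be
  a cycle. The witness for its first edge changes by at most one along each of the remaining edges,
  which are fewer than \<open>M\<close>.\<close>

lemma nonbacktracking_girth:
  assumes irr: "\<And>a. \<not> E a a" and g: "\<And>u v. E u v \<Longrightarrow> long_detour E u v M"
  shows "nonbacktracking E xs \<Longrightarrow> 2 \<le> length xs \<Longrightarrow> length xs \<le> M \<Longrightarrow> hd xs \<noteq> last xs"
proof (induction "length xs" arbitrary: xs rule: less_induct)
  case less
  show ?case
  proof
    assume eq: "hd xs = last xs"
    define n where "n = length xs - 1"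
    have n: "length xs = Suc n" "n \<ge> 1" using less(3) by (simp_all add: n_def)
    have e0: "xs ! 0 = xs ! n" using eq n hd_conv_nth[of xs] last_conv_nth[of xs] by (cases "xs = []") auto
    have dist: "xs ! i \<noteq> xs ! j" if ij: "i < j" "j \<le> n" "(i, j) \<noteq> (0, n)" for i j
    proof -
      let ?ys = "take (j - i + 1) (drop i xs)"
      have len: "length ?ys = j - i + 1" using ij n by simp
      have "xs = take i xs @ ?ys @ drop (j - i + 1) (drop i xs)" by (simp only: append_take_drop_id)
      then have "nonbacktracking E ?ys" using less(2) nonbacktracking_appendD by metis
      moreover have "j - i + 1 < length xs" using ij n by (cases i) auto
      ultimately have "hd ?ys \<noteq> last ?ys" using less(4) ij by (intro less(1)) (simp_all only: len)
      moreover have "hd ?ys = xs ! i" using ij n by (simp add: hd_take hd_drop_conv_nth)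
      moreover have "last ?ys = xs ! j"
      proof -
        have "?ys \<noteq> []" using len by auto
        then have "last ?ys = ?ys ! (j - i)" using len by (simp add: last_conv_nth)
        then show ?thesis using ij n by simp
      qed
      ultimately show ?thesis by simp
    qed
    have E: "E (xs ! i) (xs ! Suc i)" if "i < n" for i using nonbacktracking_nth(1)[OF less(2)] that n by simp
    have n1: "n \<noteq> 1" using E[of 0] e0 irr by (metis One_nat_def lessI)
    have n2: "n \<noteq> 2" using nonbacktracking_nth(2)[OF less(2), of 0] e0 n by (auto simp: numeral_2_eq_2)
    have n3: "n \<ge> 3" using n1 n2 n by simp
    let ?u = "xs ! 0" and ?v = "xs ! 1"
    have "E ?u ?v" using E[of 0] n by simp
    from g[OF this] obtain \<phi> :: "'a \<Rightarrow> int" where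
      \<phi>: "\<And>a b. E a b \<Longrightarrow> {a, b} \<noteq> {?u, ?v} \<Longrightarrow> \<bar>\<phi> a - \<phi> b\<bar> \<le> 1" "int M \<le> \<bar>\<phi> ?u - \<phi> ?v\<bar>"
      unfolding long_detour_def by blast
    have step: "\<bar>\<phi> (xs ! i) - \<phi> (xs ! Suc i)\<bar> \<le> 1" if i: "1 \<le> i" "i < n" for i
    proof (rule \<phi>(1)[OF E[OF i(2)]])
      have "xs ! i \<noteq> ?u" using dist[of 0 i] i by auto
      moreover have "xs ! i = ?v \<Longrightarrow> xs ! Suc i \<noteq> ?u"
      proof -
        assume "xs ! i = ?v"
        then have "i = 1" using dist[of 1 i] i by (cases "i = 1") auto
        then show ?thesis using dist[of 0 2] n3 by (auto simp: numeral_2_eq_2)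
      qed
      ultimately show "{xs ! i, xs ! Suc i} \<noteq> {?u, ?v}" by (auto simp: doubleton_eq_iff)
    qed
    have "j \<le> n - 1 \<Longrightarrow> \<bar>\<phi> ?v - \<phi> (xs ! (1 + j))\<bar> \<le> int j" for j
    proof (induction j)
      case (Suc j)
      have "\<bar>\<phi> (xs ! (1 + j)) - \<phi> (xs ! Suc (1 + j))\<bar> \<le> 1" using Suc(2) by (intro step) auto
      then show ?case using Suc by simp
    qed simp
    from this[of "n - 1"] have "\<bar>\<phi> ?v - \<phi> (xs ! n)\<bar> \<le> int (n - 1)" using n3 by simp
    then show False using \<phi>(2) e0 less(4) n n3 by simp
  qed
qed

lemma rtree_path:
  assumes T: "rtree V E x par dp" and q: "q \<in> V" "r \<in> V"
  shows "\<exists>xs. pathl V E xs \<and> xs \<noteq> [] \<and> hd xs = q \<and> last xs = r"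
proof -
  note sg = rtreeD(2)[OF T]
  have up: "E\<^sup>*\<^sup>* z x" if "z \<in> V" for z
    using T that
  proof (induction rule: rtree_induct)
    case (step z)
    then show ?case using rtreeD(6)[OF T step(1,2)] by (meson converse_rtranclp_into_rtranclp)
  qed simp
  have down: "E\<^sup>*\<^sup>* x z" if "z \<in> V" for z
    using T that
  proof (induction rule: rtree_induct)
    case (step z)
    then show ?case using rtreeD(6)[OF T step(1,2)] by (meson rtranclp.rtrancl_into_rtrancl)
  qed simp
  have "E\<^sup>*\<^sup>* q r" using up[OF q(1)] down[OF q(2)] by (rule rtranclp_trans)
  then show ?thesis
  proof induction
    case base
    then show ?case using q(1) by (intro exI[of _ "[q]"]) (auto simp: pathl_def)
  next
    case (step y z)
    then obtain xs where xs: "pathl V E xs" "xs \<noteq> []" "hd xs = q" "last xs = y" by blast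
    show ?case
    proof (cases "z \<in> set xs")
      case True
      then obtain as bs where ab: "xs = as @ z # bs" by (meson split_list)
      have "pathl V E ((as @ [z]) @ bs)" using xs(1) ab by simp
      then have "pathl V E (as @ [z])" unfolding pathl_append by blast
      moreover have "hd (as @ [z]) = q" using xs(3) ab by (cases as) auto
      ultimately show ?thesis by (intro exI[of _ "as @ [z]"]) simp
    next
      case False
      then have "pathl V E (xs @ [z])"
        unfolding pathl_append using xs step(2) sgrD[OF sg step(2)] by (auto simp: pathl_def)
      then show ?thesis using xs by (intro exI[of _ "xs @ [z]"]) simp
    qed
  qed
qed

text \<open>The tree is mapped from the root downwards. The children of a vertex go to distinct
  neighbours of its image other than \<open>fb\<close>, and a vertex of degree at most
  \<open>k\<close> has at most \<open>k - 1\<close> children. Usually \<open>fb\<close> is the image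
  of the parent; for the neighbours of the root it is prescribed by \<open>f0\<close>. A neighbour
  of the root may leave \<open>C\<close> if it is a leaf.\<close>

lemma local_hom:
  assumes T: "rtree V E x par dp"
    and dg: "\<And>z. z \<in> V \<Longrightarrow> z \<noteq> x \<Longrightarrow> deg E z \<le> k"
    and C: "\<And>b. b \<in> C \<Longrightarrow> card {a. E' b a} = k" "\<And>a b. E' a b \<Longrightarrow> b \<in> C" and k: "k \<ge> 2"
    and g0: "\<And>z. E x z \<Longrightarrow> g0 z \<in> C \<or> deg E z = 1"
  shows "\<exists>g fb. g x = u \<and> (\<forall>z. E x z \<longrightarrow> g z = g0 z \<and> fb z = f0 z) \<and>
    (\<forall>z\<in>V. z \<noteq> x \<longrightarrow> par z \<noteq> x \<longrightarrow> E' (g (par z)) (g z) \<and> g z \<noteq> fb (par z) \<and> fb z = g (par z)) \<and>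
    (\<forall>z\<in>V. \<forall>w\<in>V. z \<noteq> x \<longrightarrow> w \<noteq> x \<longrightarrow> par z = par w \<longrightarrow> par z \<noteq> x \<longrightarrow> z \<noteq> w \<longrightarrow> g z \<noteq> g w)"
proof -
  define ch where "ch = (\<lambda>q. {w \<in> V. w \<noteq> x \<and> par w = q})"
  have chfin: "finite (ch q)" for q using rtreeD(1)[OF T] by (simp add: ch_def)
  define ok where "ok = (\<lambda>q b. b \<in> C \<or> ch q = {})"
  have ex: "\<exists>\<iota>. inj_on \<iota> (ch q) \<and> \<iota> ` ch q \<subseteq> {a. E' b a} - {c}" if q: "q \<in> V" "q \<noteq> x" "ok q b" for q b c
  proof (cases "ch q = {}")
    case False
    then have b: "b \<in> C" using q(3) by (simp add: ok_def)
    have "finite {a. E' b a}" using C(1)[OF b] k card.infinite by fastforce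
    then have "card ({a. E' b a} - {c}) \<ge> k - 1" "finite ({a. E' b a} - {c})"
      using C(1)[OF b] by (auto simp: card_Diff_singleton_if)
    moreover have "card (ch q) \<le> k - 1"
      using rtree_deg_nonroot(2)[OF T q(1,2)] dg[OF q(1,2)] by (simp add: ch_def)
    ultimately show ?thesis using card_le_inj[OF chfin] by (meson le_trans)
  qed auto
  define I where "I = (\<lambda>q b c. SOME \<iota>. inj_on \<iota> (ch q) \<and> \<iota> ` ch q \<subseteq> {a. E' b a} - {c})"
  have I: "inj_on (I q b c) (ch q) \<and> I q b c ` ch q \<subseteq> {a. E' b a} - {c}" if "q \<in> V" "q \<noteq> x" "ok q b" for q b c
    unfolding I_def by (rule someI_ex[OF ex[OF that]])
  \<comment> \<open>Recursion over the depth, which computes the image together with the forbidden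
    vertex. The value at the root is a default, which \<open>g\<close> overrides.\<close>
  define G where "G = rec_nat (\<lambda>z. (g0 z, f0 z)) (\<lambda>n H z. if dp z \<le> 1 then (g0 z, f0 z)
      else (I (par z) (fst (H (par z))) (snd (H (par z))) z, fst (H (par z))))"
  have GS: "G (Suc n) z = (if dp z \<le> 1 then (g0 z, f0 z)
      else (I (par z) (fst (G n (par z))) (snd (G n (par z))) z, fst (G n (par z))))" for n z
    by (simp add: G_def)
  define g where "g = (\<lambda>z. if z = x then u else fst (G (dp z) z))"
  define fb where "fb = (\<lambda>z. snd (G (dp z) z))"
  have base: "g z = g0 z \<and> fb z = f0 z" if "E x z" for z
  proof -
    have "z \<in> V" "z \<noteq> x" using sgrD[OF rtreeD(2)[OF T] that] by auto
    moreover have "dp z = 1" using rtree_dp1[OF T \<open>z \<in> V\<close>] that by simp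
    ultimately show ?thesis using GS[of 0 z] by (simp add: g_def fb_def)
  qed
  have stp: "g z = I (par z) (g (par z)) (fb (par z)) z \<and> fb z = g (par z)" if z: "z \<in> V" "z \<noteq> x" "par z \<noteq> x" for z
  proof -
    note P = rtreeD(6)[OF T z(1,2)]
    have "dp (par z) \<noteq> 0" using rtreeD(5)[OF T] P z(3) by simp
    then show ?thesis using GS[of "dp (par z)" z] P z by (simp add: g_def fb_def)
  qed
  have okg: "z \<noteq> x \<longrightarrow> ok z (g z)" if "z \<in> V" for z
    using T that
  proof (induction rule: rtree_induct)
    case (step z)
    note P = rtreeD(6)[OF T step(1,2)]
    show ?case
    proof (cases "par z = x")
      case True
      then have xz: "E x z" using P by simp
      have "ch z = {}" if "deg E z = 1"
        using rtree_deg_nonroot(2)[OF T step(1,2)] that chfin[of z] by (simp add: ch_def)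
      then show ?thesis using g0[OF xz] base[OF xz] by (auto simp: ok_def)
    next
      case False
      then have "ok (par z) (g (par z))" using step(3) by simp
      from I[OF _ False this, of "fb (par z)"] have "E' (g (par z)) (g z)"
        using stp[OF step(1,2) False] P step(1,2) by (auto simp: ch_def)
      then show ?thesis using C(2) by (auto simp: ok_def)
    qed
  qed simp
  have Iz: "inj_on (I (par z) (g (par z)) (fb (par z))) (ch (par z)) \<and>
      I (par z) (g (par z)) (fb (par z)) ` ch (par z) \<subseteq> {a. E' (g (par z)) a} - {fb (par z)}"
    if z: "z \<in> V" "z \<noteq> x" "par z \<noteq> x" for z
    using I[of "par z" "g (par z)" "fb (par z)"] okg[of "par z"] rtreeD(6)[OF T z(1,2)] z(3) by blast
  have lev: "E' (g (par z)) (g z) \<and> g z \<noteq> fb (par z) \<and> fb z = g (par z)" if z: "z \<in> V" "z \<noteq> x" "par z \<noteq> x" for z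
  proof -
    have "z \<in> ch (par z)" using z by (simp add: ch_def)
    then have "I (par z) (g (par z)) (fb (par z)) z \<in> {a. E' (g (par z)) a} - {fb (par z)}" using Iz[OF z] by blast
    then show ?thesis using stp[OF z] by simp
  qed
  have sib: "g z \<noteq> g w" if z: "z \<in> V" "w \<in> V" "z \<noteq> x" "w \<noteq> x" "par z = par w" "par z \<noteq> x" "z \<noteq> w" for z w
    proof -
      have "z \<in> ch (par z)" "w \<in> ch (par z)" using z by (simp_all add: ch_def)
      then have "I (par z) (g (par z)) (fb (par z)) z \<noteq> I (par z) (g (par z)) (fb (par z)) w"
        using Iz[OF z(1,3,6)] z(7) by (meson inj_onD)
      then show ?thesis using stp[OF z(1,3,6)] stp[OF z(2,4)] z(5,6) by simp
    qed
  have gx: "g x = u" by (simp add: g_def)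
  show ?thesis
    by (rule exI[of _ g], rule exI[of _ fb]) (use gx base lev sib in blast)
qed

context
  fixes V :: "'a set" and E x par dp and E' :: "'u \<Rightarrow> 'u \<Rightarrow> bool" and C :: "'u set" and k y
  assumes T: "rtree V E x par dp" and dx: "deg E x = Suc k"
    and dg: "\<And>z. z \<in> V \<Longrightarrow> z \<noteq> x \<Longrightarrow> deg E z \<le> k" and k: "k \<ge> 2"
    and y: "E x y" "deg E y = 1"
    and sE: "sgr C E'" and C: "\<And>b. b \<in> C \<Longrightarrow> card {a. E' b a} = k"
    and girth: "\<And>xs. nonbacktracking E' xs \<Longrightarrow> 2 \<le> length xs \<Longrightarrow> length xs \<le> 3 * card V + 5 \<Longrightarrow> hd xs \<noteq> last xs"
begin

text \<open>
  If \<open>w\<close> is not close to \<open>u\<close> in the regular graph, then the leaf \<open>y\<close> is mapped to \<open>w\<close>. Otherwise \<open>y\<close> is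
  mapped to the first vertex of a short path from \<open>u\<close> to \<open>w\<close>, so that nothing else uses this path, and
  another neighbour of the root is mapped to \<open>w\<close>. The rest of the tree is mapped without backtracking,
  and the girth makes the map injective.
\<close>

lemma hom_exists:
  assumes u: "u \<in> C" and w: "u \<noteq> w" "\<not> E' u w"
  obtains g where "inj_on g V" "g x = u" "\<And>a b. E a b \<Longrightarrow> E' (g a) (g b) \<or> {g a, g b} = {u, w}"
proof -
  let ?K = "{z. E x z}"
  let ?N = "{a. E' u a}"
  have symE: "E' b a" if "E' a b" for a b using sgrD[OF sE that] by simp
  have symT: "E b a" if "E a b" for a b using sgrD[OF rtreeD(2)[OF T] that] by simp
  have finK: "finite ?K" using dx by (intro card_ge_0_finite) (simp add: deg_def)
  have finN: "finite ?N" using C[OF u] k by (intro card_ge_0_finite) simp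
  have yV: "y \<in> V" "y \<noteq> x" using sgrD[OF rtreeD(2)[OF T] y(1)] by auto
  have cK: "card (?K - {e}) = card ?N" if "e \<in> ?K" for e
    using dx C[OF u] that by (simp add: deg_def)
  have len: "length xs \<le> card V" if "pathl V E xs" for xs
    using that distinct_card[of xs] card_mono[OF rtreeD(1)[OF T], of "set xs"] by (simp add: pathl_def)

  note result = that
  \<comment> \<open>Both cases of the construction send one neighbour \<open>e\<close> of the root
    to \<open>w\<close> and the others by \<open>\<beta>\<close> onto the neighbours of
    \<open>u\<close>. They differ in \<open>exc\<close>, which separates the branch of
    \<open>e\<close> from the root and from the other branches.\<close>
  have main: thesis if e: "e \<in> ?K" and bij: "bij_betw \<beta> (?K - {e}) ?N" and oke: "w \<in> C \<or> deg E e = 1"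
    and exc: "\<And>g fb r as a'. g e = w \<Longrightarrow> fb e = fe \<Longrightarrow> (\<And>z. z \<in> ?K - {e} \<Longrightarrow> g z = \<beta> z) \<Longrightarrow>
        pathl V E (as @ [e]) \<Longrightarrow> x \<notin> set as \<Longrightarrow> nonbacktracking E' (map g (as @ [e])) \<Longrightarrow>
        (as \<noteq> [] \<Longrightarrow> g (last as) \<noteq> fe \<and> deg E e \<noteq> 1) \<Longrightarrow>
        (\<exists>vs. nonbacktracking E' (g r # vs @ [u]) \<and> length vs \<le> card V \<and> last (g r # vs) = \<beta> a' \<and> a' \<in> ?K - {e} \<and>
            (a' = y \<longrightarrow> r = y)) \<or> g r = u \<Longrightarrow>
        g (hd (as @ [e])) \<noteq> g r" for e \<beta> fe
  proof -
    have Kd: "z \<in> V \<and> z \<noteq> x \<and> par z = x" if "E x z" for z using rtree_root_nbrs[OF T] that by blast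
    define g0 where "g0 = (\<lambda>z. if z = e then w else \<beta> z)"
    define f0 where "f0 = (\<lambda>z. if z = e then fe else u)"
    have \<beta>N: "E' u (\<beta> z)" if "z \<in> ?K - {e}" for z using bij that by (auto simp: bij_betw_def)
    have g0C: "g0 z \<in> C \<or> deg E z = 1" if "E x z" for z
      using \<beta>N[of z] that oke sgrD[OF sE, of u "\<beta> z"] by (auto simp: g0_def)
    have Cc: "b \<in> C" if "E' a b" for a b using sgrD[OF sE that] by blast
    have "\<exists>g fb. g x = u \<and> (\<forall>z. E x z \<longrightarrow> g z = g0 z \<and> fb z = f0 z) \<and>
      (\<forall>z\<in>V. z \<noteq> x \<longrightarrow> par z \<noteq> x \<longrightarrow> E' (g (par z)) (g z) \<and> g z \<noteq> fb (par z) \<and> fb z = g (par z)) \<and>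
      (\<forall>z\<in>V. \<forall>w\<in>V. z \<noteq> x \<longrightarrow> w \<noteq> x \<longrightarrow> par z = par w \<longrightarrow> par z \<noteq> x \<longrightarrow> z \<noteq> w \<longrightarrow> g z \<noteq> g w)"
      by (rule local_hom[OF T, where C = C and k = k]) (fact dg C Cc k g0C)+
    then obtain g fb where g1: "g x = u" and g2: "\<forall>z. E x z \<longrightarrow> g z = g0 z \<and> fb z = f0 z"
      and g3: "\<forall>z\<in>V. z \<noteq> x \<longrightarrow> par z \<noteq> x \<longrightarrow> E' (g (par z)) (g z) \<and> g z \<noteq> fb (par z) \<and> fb z = g (par z)"
      and g4: "\<forall>z\<in>V. \<forall>w\<in>V. z \<noteq> x \<longrightarrow> w \<noteq> x \<longrightarrow> par z = par w \<longrightarrow> par z \<noteq> x \<longrightarrow> z \<noteq> w \<longrightarrow> g z \<noteq> g w"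
      by (elim exE conjE) (rule that)
    have gl: "E' (g (par z)) (g z) \<and> g z \<noteq> fb (par z) \<and> fb z = g (par z)" if "z \<in> V" "z \<noteq> x" "par z \<noteq> x" for z
      using g3 that by blast
    have gs: "g z \<noteq> g w" if "z \<in> V" "w \<in> V" "z \<noteq> x" "w \<noteq> x" "par z = par w" "par z \<noteq> x" "z \<noteq> w" for z w
      using g4 that by blast
    note g = g1 g2[rule_format] gl gs
    have ge: "g e = w" "fb e = fe" using g(2)[of e] e by (simp_all add: g0_def f0_def)
    have gn: "g z = \<beta> z" "fb z = u" if "z \<in> ?K - {e}" for z using g(2)[of z] that by (simp_all add: g0_def f0_def)
    have edge: "E' (g a) (g b)" if "E a b" "a \<noteq> x" "b \<noteq> x" for a b
      using rtreeD(7)[OF T that(1)] sgrD[OF rtreeD(2)[OF T] that(1)] g(3)[of a] g(3)[of b] that symE by auto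
    have tri: "g a \<noteq> g c" if abc: "E a b" "E b c" "a \<noteq> c" "a \<noteq> x" "b \<noteq> x" "c \<noteq> x" for a b c
    proof -
      have V: "a \<in> V" "b \<in> V" "c \<in> V" using sgrD[OF rtreeD(2)[OF T]] abc(1,2) by blast+
      consider "b = par a" "b = par c" | "b = par a" "c = par b" | "a = par b" "b = par c"
        using rtreeD(7)[OF T abc(1)] rtreeD(7)[OF T abc(2)] abc(3) by blast
      then show ?thesis
      proof cases
        case 1
        then show ?thesis using g(4)[of a c] V abc by metis
      next
        case 2
        then show ?thesis using g(3)[of a] g(3)[of b] V abc by metis
      next
        case 3
        then show ?thesis using g(3)[of c] g(3)[of b] V abc by metis
      qed
    qed
    have A: "nonbacktracking E' (map g zs)" if "pathl V E zs" "x \<notin> set zs" for zs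
      using that
    proof (induction zs rule: induct_list012)
      case (3 a b zs)
      then have "nonbacktracking E' (map g (b # zs))" by (simp add: pathl_def successively_Cons)
      then show ?case using 3(3,4) edge[of a b] tri[of a b "hd zs"] by (cases zs) (auto simp: pathl_def)
    qed auto
    have B: "g z \<noteq> fb a'" if "pathl V E (zs @ [z, a'])" "x \<notin> set (zs @ [z, a'])" "E x a'" for zs z a'
    proof -
      have "E z a'" using that(1) by (auto simp: pathl_def successively_append_iff)
      then have "par z = a'" "z \<in> V" "z \<noteq> x" using rtreeD(7)[OF T, of z a'] Kd[OF that(3)] that(2) sgrD[OF rtreeD(2)[OF T]] by auto
      moreover have "a' \<noteq> x" using that(2) by auto
      ultimately show ?thesis using g(3)[of z] by metis
    qed
    have Wn: "nonbacktracking E' (map g (zs @ [a']) @ [u])" if "pathl V E (zs @ [a'])" "x \<notin> set (zs @ [a'])" "a' \<in> ?K - {e}" for zs a'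
    proof -
      have a: "E' (g a') u" "fb a' = u" using gn[OF that(3)] \<beta>N[OF that(3)] symE by simp_all
      have "nonbacktracking E' (map g zs @ [g a'])" using A[OF that(1,2)] by simp
      moreover have "map g zs = [] \<or> last (map g zs) \<noteq> u"
      proof (cases zs rule: rev_cases)
        case (snoc zs' z)
        then show ?thesis using B[of zs' z a'] that a(2) by simp
      qed simp
      ultimately show ?thesis using a(1) nonbacktracking_snoc[of E' "map g zs" "g a'" u] by simp
    qed
    have yend: "zs = []" if "pathl V E (zs @ [y])" "x \<notin> set zs" for zs
    proof (cases zs rule: rev_cases)
      case (snoc zs' z)
      then have "E z y" using that(1) by (auto simp: pathl_def successively_append_iff)
      moreover have "z \<noteq> x" using snoc that(2) by auto
      ultimately have "par z = y \<and> z \<in> V" using rtreeD(7)[OF T, of z y] Kd[OF y(1)] sgrD[OF rtreeD(2)[OF T]] by auto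
      then have "z \<in> {w \<in> V. w \<noteq> x \<and> par w = y}" using \<open>z \<noteq> x\<close> by simp
      moreover have "card {w \<in> V. w \<noteq> x \<and> par w = y} = 0"
        using rtree_deg_nonroot(2)[OF T yV] y(2) by simp
      ultimately have False using rtreeD(1)[OF T] by (simp, blast)
      then show ?thesis ..
    qed
    \<comment> \<open>From the image of a vertex in another branch a short walk leads to
      \<open>u\<close> whose last step starts at \<open>\<beta> b\<close>; this step tells the
      branches apart.\<close>
    have half: "(\<exists>vs. nonbacktracking E' (g r # vs @ [u]) \<and> length vs \<le> card V \<and> last (g r # vs) = \<beta> b \<and> b \<in> ?K - {e} \<and>
            (b = y \<longrightarrow> r = y))"
      if bs: "pathl V E (zs @ [b])" "x \<notin> set (zs @ [b])" "b \<in> ?K - {e}" "hd (zs @ [b]) = r" for zs b r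
    proof -
      have eqm: "g r # tl (map g (zs @ [b])) = map g (zs @ [b])" using bs(4) by (cases zs) auto
      have "nonbacktracking E' (map g (zs @ [b]) @ [u])" by (rule Wn[OF bs(1-3)])
      then have "nonbacktracking E' ((g r # tl (map g (zs @ [b]))) @ [u])" unfolding eqm .
      moreover have "last (g r # tl (map g (zs @ [b]))) = g b" unfolding eqm by simp
      ultimately have 1: "nonbacktracking E' (g r # tl (map g (zs @ [b])) @ [u])" "last (g r # tl (map g (zs @ [b]))) = g b"
        by simp_all
      have "length (tl (map g (zs @ [b]))) \<le> card V" using len[OF bs(1)] by simp
      moreover have "b = y \<longrightarrow> r = y" using yend[of zs] bs by auto
      ultimately show ?thesis using 1 gn[OF bs(3)] bs(3) by (intro exI[of _ "tl (map g (zs @ [b]))"]) simp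
    qed
    have last_child: "E x a \<and> a \<noteq> x" if "pathl V E (as @ [a] @ x # bs)" for as a bs
    proof -
      have "E a x" using that by (auto simp: pathl_def successively_append_iff)
      from sgrD[OF rtreeD(2)[OF T] this] show ?thesis by blast
    qed
    have ne: "g q \<noteq> g r" if q: "q \<in> V" "r \<in> V" "q \<noteq> r" for q r
    proof -
      obtain xs where xs: "pathl V E xs" "xs \<noteq> []" "hd xs = q" "last xs = r" using rtree_path[OF T q(1,2)] by blast
      \<comment> \<open>For two vertices separated by the root, the walks to \<open>u\<close> are
        joined there, and distinct last steps prevent backtracking; if the branch of
        \<open>e\<close> is involved, \<open>exc\<close> decides.\<close>
      have sides: "g q \<noteq> g r" if xs: "pathl V E ((as @ [a]) @ x # bs)" "hd (as @ [a]) = q" "last (x # bs) = r" for as a bs q r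
      proof -
        have xo: "x \<notin> set (as @ [a])" "x \<notin> set bs" using xs(1) by (auto simp: pathl_def)
        have pa: "pathl V E (as @ [a])" "pathl V E bs" using xs(1) unfolding pathl_append by (auto simp: pathl_def successively_Cons)
        have aK: "a \<in> ?K" using last_child[of as a bs] xs(1) by simp
        have rr: "r = x \<and> bs = [] \<or> (\<exists>b zs. bs = b # rev zs \<and> hd (zs @ [b]) = r \<and> b \<in> ?K \<and> pathl V E (zs @ [b]) \<and> x \<notin> set (zs @ [b]))"
        proof (cases bs)
          case (Cons b cs)
          have "pathl V E (rev (b # cs))" using pa(2) Cons pathl_rev[OF rtreeD(2)[OF T]] by blast
          moreover have "hd (rev cs @ [b]) = r" using xs(3) Cons by (cases "cs = []") (simp_all add: hd_append hd_rev)
          moreover have "E x b" using xs(1) Cons by (auto simp: pathl_def successively_append_iff)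
          ultimately show ?thesis using xo(2) Cons by (intro disjI2 exI[of _ b] exI[of _ "rev cs"]) simp
        qed (use xs in simp)
        have rside: "(\<exists>vs b. nonbacktracking E' (g r # vs @ [u]) \<and> length vs \<le> card V \<and> last (g r # vs) = \<beta> b \<and> b \<in> ?K - {e} \<and> (b = y \<longrightarrow> r = y)) \<or> g r = u
            \<or> (\<exists>zs. bs = e # rev zs \<and> hd (zs @ [e]) = r \<and> pathl V E (zs @ [e]) \<and> x \<notin> set (zs @ [e]))"
          using rr half g(1) by blast
        have qside: "a \<noteq> e \<Longrightarrow> \<exists>vs. nonbacktracking E' (g q # vs @ [u]) \<and> length vs \<le> card V \<and> last (g q # vs) = \<beta> a \<and> a \<in> ?K - {e} \<and> (a = y \<longrightarrow> q = y)"
          using half[OF pa(1) xo(1) _ xs(2)] aK by blast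
        have excl: "g (hd (zs @ [e])) \<noteq> g r'" if "pathl V E (zs @ [e])" "x \<notin> set (zs @ [e])"
          "(\<exists>vs. nonbacktracking E' (g r' # vs @ [u]) \<and> length vs \<le> card V \<and> last (g r' # vs) = \<beta> b \<and> b \<in> ?K - {e} \<and> (b = y \<longrightarrow> r' = y)) \<or> g r' = u" for zs r' b
        proof (rule exc[of g fb zs r' b, OF ge gn(1) that(1) _ A[OF that(1,2)] _ that(3)])
          show "x \<notin> set zs" using that(2) by simp
          assume z: "zs \<noteq> []"
          then obtain zs' z where zz: "zs = zs' @ [z]" by (metis rev_exhaust)
          have "g z \<noteq> fe" using B[of zs' z e] that zz e ge by simp
          moreover have "deg E e \<noteq> 1"
          proof
            assume "deg E e = 1"
            have ez: "E z e" using that(1) zz by (auto simp: pathl_def successively_append_iff)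
            have eV: "e \<in> V" "e \<noteq> x" using Kd e by auto
            have "par z = e \<and> z \<in> V" "z \<noteq> x"
              using rtreeD(7)[OF T ez] Kd[of e] e that(2) zz sgrD[OF rtreeD(2)[OF T] ez] by auto
            then have "z \<in> {w \<in> V. w \<noteq> x \<and> par w = e}" by simp
            moreover have "card {w \<in> V. w \<noteq> x \<and> par w = e} = 0"
              using rtree_deg_nonroot(2)[OF T eV] \<open>deg E e = 1\<close> by simp
            ultimately show False using rtreeD(1)[OF T] by (simp, blast)
          qed
          ultimately show "g (last zs) \<noteq> fe \<and> deg E e \<noteq> 1" using zz by simp
        qed
        show ?thesis
        proof (cases "a = e")
          case True
          have "\<not> (\<exists>zs. bs = e # rev zs)" using xs(1) True by (auto simp: pathl_def)
          then show ?thesis using rside excl[of as r] pa(1) xo(1) xs(2) True g(1) by blast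
        next
          case False
          obtain vs where vs: "nonbacktracking E' (g q # vs @ [u])" "length vs \<le> card V" "last (g q # vs) = \<beta> a" "a \<in> ?K - {e}" "a = y \<longrightarrow> q = y"
            using qside[OF False] by blast
          from rside show ?thesis
          proof (elim disjE exE conjE)
            assume "g r = u"
            moreover have "g q \<noteq> u" using girth[OF vs(1)] vs(2) by simp
            ultimately show ?thesis by simp
          next
            fix zs assume zs: "bs = e # rev zs" "hd (zs @ [e]) = r" "pathl V E (zs @ [e])" "x \<notin> set (zs @ [e])"
            have "g (hd (zs @ [e])) \<noteq> g q" using excl[OF zs(3,4), of q a] vs by blast
            then show ?thesis using zs(2) by metis
          next
            fix vs' b assume b: "nonbacktracking E' (g r # vs' @ [u])" "length vs' \<le> card V" "last (g r # vs') = \<beta> b" "b \<in> ?K - {e}"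
            show ?thesis
            proof (cases "r = x")
              case True
              then show ?thesis using g(1) girth[OF vs(1)] vs(2) by auto
            next
              case rx: False
              obtain b' zs where bz: "bs = b' # rev zs" "hd (zs @ [b']) = r" "b' \<in> ?K" "pathl V E (zs @ [b'])" "x \<notin> set (zs @ [b'])"
                using rr rx by blast
              show ?thesis
              proof (cases "b' = e")
                case True
                have "g (hd (zs @ [b'])) \<noteq> g q" using excl[of zs q a] bz vs True by blast
                then show ?thesis using bz(2) by metis
              next
                case False
                obtain ws where ws: "nonbacktracking E' (g r # ws @ [u])" "length ws \<le> card V" "last (g r # ws) = \<beta> b'"
                  using half[OF bz(4,5) _ bz(2)] bz(3) False by blast
                have "a \<noteq> b'" using xs(1) bz(1) by (auto simp: pathl_def)
                then have \<beta>ne: "\<beta> a \<noteq> \<beta> b'" using bij vs(4) bz(3) False by (auto simp: bij_betw_def dest: inj_onD)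
                have r1: "nonbacktracking E' (rev (g r # ws @ [u]))" by (rule nonbacktracking_rev[OF symE ws(1)])
                have r2: "rev (g r # ws @ [u]) = u # \<beta> b' # tl (rev (g r # ws))"
                  using ws(3) by (metis hd_Cons_tl hd_rev list.distinct(1) rev.simps(2) rev_append rev_is_Nil_conv rev_rev_ident append_Cons append_Nil rev_singleton_conv)
                define Q where "Q = g q # vs"
                define R where "R = tl (rev (g r # ws))"
                have q2: "Q = butlast Q @ [\<beta> a]"
                  using vs(3) append_butlast_last_id[of Q] by (simp add: Q_def)
                have QP: "nonbacktracking E' (Q @ [u])" using vs(1) by (simp add: Q_def)
                have "nonbacktracking E' (butlast Q @ \<beta> a # u # \<beta> b' # R)"
                proof (rule nonbacktracking_join)
                  have "nonbacktracking E' ((butlast Q @ [\<beta> a]) @ [u])" using QP q2 by metis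
                  then show "nonbacktracking E' (butlast Q @ [\<beta> a, u])" by simp
                  show "nonbacktracking E' (u # \<beta> b' # R)" using r1 r2 unfolding R_def by metis
                qed (rule \<beta>ne)
                moreover have "butlast Q @ \<beta> a # u # \<beta> b' # R = Q @ rev (g r # ws @ [u])"
                  unfolding R_def using q2 r2 by (metis append.assoc append_Cons append_Nil)
                ultimately have J: "nonbacktracking E' (Q @ rev (g r # ws @ [u]))" by metis
                have "hd (Q @ rev (g r # ws @ [u])) \<noteq> last (Q @ rev (g r # ws @ [u]))"
                  using vs(2) ws(2) by (intro girth[OF J]) (simp_all add: Q_def)
                then have "g q \<noteq> g r" by (simp add: Q_def)
                then show ?thesis by simp
              qed
            qed
          qed
        qed
      qed
      show ?thesis
      proof (cases "x \<in> set xs")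
        case False
        have "length xs \<ge> 2" using xs q(3) by (cases xs; cases "tl xs") auto
        then have "hd (map g xs) \<noteq> last (map g xs)" using girth[OF A[OF xs(1) False]] len[OF xs(1)] by simp
        then show ?thesis using xs by (simp add: hd_map last_map)
      next
        case True
        then obtain as bs where ab: "xs = as @ x # bs" by (meson split_list)
        show ?thesis
        proof (cases as rule: rev_cases)
          case (snoc as' a)
          have "hd (as' @ [a]) = q" using xs(3) ab snoc by (cases as') auto
          then show ?thesis using sides[of as' a bs q r] xs ab snoc by simp
        next
          case Nil
          then have "q = x" using xs(3) ab by simp
          then have "bs \<noteq> []" using q(3) xs(4) ab Nil by auto
          then obtain bs' b where b: "bs = b # bs'" by (cases bs) auto
          have "pathl V E (rev xs)" using pathl_rev[OF rtreeD(2)[OF T]] xs(1) by blast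
          then have "pathl V E ((rev bs' @ [b]) @ x # [])" using ab Nil b by simp
          moreover have "hd (rev bs' @ [b]) = r" using xs(4) ab b by (cases "bs' = []") (simp_all add: hd_append hd_rev)
          ultimately show ?thesis using sides[of "rev bs'" b "[]" r x] \<open>q = x\<close> by (metis last.simps)
        qed
      qed
    qed
    show thesis
    proof (rule result)
      show "inj_on g V" using ne by (auto simp: inj_on_def)
      show "g x = u" by (rule g(1))
      have xz: "E' u (g z) \<or> g z = w" if "E x z" for z
        using that gn[of z] \<beta>N[of z] ge by (cases "z = e") auto
      show "E' (g a) (g b) \<or> {g a, g b} = {u, w}" if "E a b" for a b
      proof -
        have ab: "a \<noteq> b" using sgrD[OF rtreeD(2)[OF T] that] by blast
        consider "a = x" | "b = x" "a \<noteq> x" | "a \<noteq> x" "b \<noteq> x" by blast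
        then show ?thesis
        proof cases
          case 1
          then show ?thesis using xz[of b] that g(1) by auto
        next
          case 2
          then show ?thesis using xz[of a] symT[OF that] g(1) symE[of u "g a"] by auto
        next
          case 3
          then show ?thesis using edge[OF that] by blast
        qed
      qed
    qed
  qed
  show thesis
  proof (cases "\<exists>cs. nonbacktracking E' (u # cs @ [w]) \<and> length cs \<le> card V")
    case False
    \<comment> \<open>No short walk joins \<open>u\<close> and \<open>w\<close>, so \<open>w\<close>
      cannot be the image of another vertex. As \<open>y\<close> has no children, the value
      \<open>u\<close> for the vertex forbidden to them is a default.\<close>
    obtain \<beta> where \<beta>: "bij_betw \<beta> (?K - {y}) ?N"
      using cK[of y] y(1) finK finN finite_same_card_bij[of "?K - {y}" ?N] by auto
    show thesis
    proof (rule main[of y \<beta> u])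
      show "y \<in> ?K" using y(1) by simp
      show "bij_betw \<beta> (?K - {y}) ?N" by (rule \<beta>)
      show "w \<in> C \<or> deg E y = 1" using y(2) by simp
      fix g :: "'a \<Rightarrow> 'u" and r as a'
      assume g: "g y = w" "as \<noteq> [] \<Longrightarrow> g (last as) \<noteq> u \<and> deg E y \<noteq> 1"
        and r: "(\<exists>vs. nonbacktracking E' (g r # vs @ [u]) \<and> length vs \<le> card V \<and> last (g r # vs) = \<beta> a' \<and> a' \<in> ?K - {y} \<and>
            (a' = y \<longrightarrow> r = y)) \<or> g r = u"
      have as: "as = []" using g(2) y(2) by blast
      show "g (hd (as @ [y])) \<noteq> g r"
      proof
        assume "g (hd (as @ [y])) = g r"
        then have gr: "g r = w" using as g(1) by simp
        then obtain vs where vs: "nonbacktracking E' (g r # vs @ [u])" "length vs \<le> card V" using r w(1) by metis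
        have "nonbacktracking E' (rev (g r # vs @ [u]))" by (rule nonbacktracking_rev[OF symE vs(1)])
        then have "nonbacktracking E' (u # rev vs @ [w])" using gr by simp
        then show False using False vs(2) by (metis length_rev)
      qed
    qed
  next
    case True
    then obtain cs where cs: "nonbacktracking E' (u # cs @ [w])" "length cs \<le> card V" by blast
    have cne: "cs \<noteq> []" using cs(1) w(2) by auto
    have "nonbacktracking E' (rev (u # cs @ [w]))" by (rule nonbacktracking_rev[OF symE cs(1)])
    then have wc: "nonbacktracking E' (w # rev cs @ [u])" by simp
    have c1: "E' u (hd cs)" using cs(1) cne by (cases cs) (auto split: list.splits elim: nonbacktracking.elims)
    have cl: "E' w (last cs)"
    proof -
      have "rev cs = last cs # tl (rev cs)" using cne by (simp add: hd_rev[symmetric])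
      then have "nonbacktracking E' ([] @ w # last cs # (tl (rev cs) @ [u]))" using wc by (metis append_Cons append_Nil)
      then show ?thesis using nonbacktracking_append[of E' "[]" w "last cs" "tl (rev cs) @ [u]"] by simp
    qed
    have wC: "w \<in> C" using sgrD[OF sE cl] by simp
    have "card (?K - {y}) \<noteq> 0" using cK[of y] y(1) C[OF u] k by simp
    then obtain e where e: "e \<in> ?K" "e \<noteq> y" by (metis Diff_iff all_not_in_conv card.empty insertI1)
    obtain \<beta>0 where \<beta>0: "bij_betw \<beta>0 (?K - {e}) ?N"
      using cK[OF e(1)] finK finN finite_same_card_bij[of "?K - {e}" ?N] by auto
    \<comment> \<open>A transposition of the domain turns \<open>\<beta>0\<close> into a bijection
      that sends \<open>y\<close> to the first vertex of the short walk.\<close>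
    have "\<exists>\<beta>. bij_betw \<beta> (?K - {e}) ?N \<and> \<beta> y = hd cs"
    proof -
      have "hd cs \<in> \<beta>0 ` (?K - {e})" using \<beta>0 c1 by (auto simp: bij_betw_def)
      then obtain t where t: "t \<in> ?K - {e}" "hd cs = \<beta>0 t" by blast
      have yK: "y \<in> ?K - {e}" using y(1) e(2) by simp
      let ?s = "\<lambda>z. if z = y then t else if z = t then y else z"
      have "bij_betw ?s (?K - {e}) (?K - {e})"
        by (rule bij_betwI[of _ _ _ ?s]) (use t yK in auto)
      then have "bij_betw (\<beta>0 \<circ> ?s) (?K - {e}) ?N" using \<beta>0 by (rule bij_betw_trans)
      moreover have "(\<beta>0 \<circ> ?s) y = hd cs" using t by simp
      ultimately show ?thesis by blast
    qed
    then obtain \<beta> where \<beta>: "bij_betw \<beta> (?K - {e}) ?N" "\<beta> y = hd cs" by blast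
    show thesis
    \<comment> \<open>Children of \<open>e\<close> must not use \<open>last cs\<close>, so that a
      walk coming up that branch to \<open>w\<close> can continue backwards along \<open>cs\<close>
      to \<open>u\<close>.\<close>
    proof (rule main[of e \<beta> "last cs"])
      show "e \<in> ?K" by (rule e(1))
      show "bij_betw \<beta> (?K - {e}) ?N" by (rule \<beta>(1))
      show "w \<in> C \<or> deg E e = 1" using wC by simp
      fix g :: "'a \<Rightarrow> 'u" and r as a'
      assume g: "g e = w" "\<And>z. z \<in> ?K - {e} \<Longrightarrow> g z = \<beta> z" "pathl V E (as @ [e])" "nonbacktracking E' (map g (as @ [e]))"
        "as \<noteq> [] \<Longrightarrow> g (last as) \<noteq> last cs \<and> deg E e \<noteq> 1"
        and r: "(\<exists>vs. nonbacktracking E' (g r # vs @ [u]) \<and> length vs \<le> card V \<and> last (g r # vs) = \<beta> a' \<and> a' \<in> ?K - {e} \<and>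
            (a' = y \<longrightarrow> r = y)) \<or> g r = u"
      have yK: "y \<in> ?K - {e}" using y(1) e(2) by simp
      have la: "length as \<le> card V" using len[OF g(3)] by simp
      have 1: "nonbacktracking E' (map g as @ [w, last cs])"
      proof -
        have "map g as = [] \<or> last (map g as) \<noteq> last cs" using g(5) by (auto simp: last_map)
        then show ?thesis using g(1,4) cl nonbacktracking_snoc[of E' "map g as" w "last cs"] by simp
      qed
      have rc: "rev cs = last cs # tl (rev cs)" using cne by (simp add: hd_rev[symmetric])
      have "w # rev cs @ [u] = w # last cs # (tl (rev cs) @ [u])" using rc by (metis append_Cons)
      then have wc': "nonbacktracking E' (w # last cs # (tl (rev cs) @ [u]))" using wc by metis
      have 2: "nonbacktracking E' (map g as @ w # last cs # (tl (rev cs) @ [u]))"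
        by (rule iffD2[OF nonbacktracking_append conjI[OF 1 wc']])
      define q where "q = hd (as @ [e])"
      have full: "map g as @ w # last cs # (tl (rev cs) @ [u]) = (map g as @ w # rev cs) @ [u]" using rc by (metis append.assoc append_Cons)
      \<comment> \<open>The branch of \<open>e\<close>, the walk \<open>cs\<close> and the branch of
        \<open>r\<close> contribute at most \<open>card V\<close> vertices each, with a few more in
        between; this is the origin of \<open>3 * card V + 5\<close>.\<close>
      have lc: "length (map g as @ w # rev cs) \<le> 2 * card V + 1" using la cs(2) by simp
      have hq: "hd (map g as @ w # rev cs) = g q" using g(1) by (cases as) (auto simp: q_def)
      have P: "nonbacktracking E' ((map g as @ w # rev cs) @ [u])" using 2 full by simp
      have lst: "last (map g as @ w # rev cs) = hd cs" using cne by (simp add: last_rev)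
      have hne: "g q \<noteq> u"
      proof -
        have "hd ((map g as @ w # rev cs) @ [u]) \<noteq> last ((map g as @ w # rev cs) @ [u])"
          using lc by (intro girth[OF P]) auto
        then show ?thesis using hq by (cases as) auto
      qed
      have "g q \<noteq> g r"
        using r
      proof
        assume "g r = u"
        then show ?thesis using hne by simp
      next
        assume "\<exists>vs. nonbacktracking E' (g r # vs @ [u]) \<and> length vs \<le> card V \<and> last (g r # vs) = \<beta> a' \<and> a' \<in> ?K - {e} \<and> (a' = y \<longrightarrow> r = y)"
        then obtain vs where vs: "nonbacktracking E' (g r # vs @ [u])" "length vs \<le> card V" "last (g r # vs) = \<beta> a'" "a' \<in> ?K - {e}" "a' = y \<longrightarrow> r = y" by blast
        show ?thesis
        proof (cases "a' = y")
          \<comment> \<open>The branch of the leaf \<open>y\<close> consists of \<open>y\<close>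
            alone, whose image is the first vertex of \<open>cs\<close>; the walk would already be
            closed before it reaches \<open>u\<close>.\<close>
          case True
          then have gr: "g r = hd cs" using vs(5) g(2)[OF yK] \<beta>(2) by simp
          have "nonbacktracking E' (map g as @ w # rev cs)" using P nonbacktracking_appendD by blast
          moreover have "2 \<le> length (map g as @ w # rev cs)" using cne by (cases cs) auto
          ultimately have "hd (map g as @ w # rev cs) \<noteq> last (map g as @ w # rev cs)" using lc by (intro girth) auto
          then show ?thesis using hq lst gr by simp
        next
          case False
          have "\<beta> a' \<noteq> hd cs"
            using inj_onD[OF bij_betw_imp_inj_on[OF \<beta>(1)], of a' y] \<beta>(2) vs(4) yK False by metis
          note \<beta>ne = this
          have r1: "nonbacktracking E' (rev (g r # vs @ [u]))" by (rule nonbacktracking_rev[OF symE vs(1)])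
          have r2: "rev (g r # vs @ [u]) = u # \<beta> a' # tl (rev (g r # vs))"
          proof -
            have "rev (g r # vs) \<noteq> []" by simp
            then have "rev (g r # vs) = hd (rev (g r # vs)) # tl (rev (g r # vs))" by (metis hd_Cons_tl)
            then have "rev (g r # vs) = \<beta> a' # tl (rev (g r # vs))" using vs(3) by (simp only: hd_rev)
            moreover have "rev (g r # vs @ [u]) = u # rev (g r # vs)" by simp
            ultimately show ?thesis by metis
          qed
          let ?B = "butlast (map g as @ w # rev cs)"
          have q2: "map g as @ w # rev cs = ?B @ [hd cs]"
            using append_butlast_last_id[of "map g as @ w # rev cs"] lst by simp
          have "nonbacktracking E' (?B @ hd cs # u # \<beta> a' # tl (rev (g r # vs)))"
          proof (rule nonbacktracking_join)
            have "nonbacktracking E' ((?B @ [hd cs]) @ [u])" using P q2 by metis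
            then show "nonbacktracking E' (?B @ [hd cs, u])" by simp
            show "nonbacktracking E' (u # \<beta> a' # tl (rev (g r # vs)))" using r1 r2 by metis
            show "hd cs \<noteq> \<beta> a'" using \<beta>ne by simp
          qed
          moreover have "?B @ hd cs # u # \<beta> a' # tl (rev (g r # vs)) = (map g as @ w # rev cs) @ rev (g r # vs @ [u])"
            using q2 r2 by (metis append.assoc append_Cons append_Nil)
          ultimately have J: "nonbacktracking E' ((map g as @ w # rev cs) @ rev (g r # vs @ [u]))" by metis
          have "hd ((map g as @ w # rev cs) @ rev (g r # vs @ [u])) \<noteq> last ((map g as @ w # rev cs) @ rev (g r # vs @ [u]))"
            using lc vs(2) by (intro girth[OF J]) auto
          then show ?thesis using hq by (cases as) auto
        qed
      qed
      then show "g (hd (as @ [e])) \<noteq> g r" by (simp add: q_def)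
    qed
  qed
qed

end

section \<open>Detours in combs and in regular graphs\<close>

lemma long_detour_mono: "long_detour E u v n \<Longrightarrow> m \<le> n \<Longrightarrow> long_detour E u v m"
  unfolding long_detour_def by (meson le_trans of_nat_le_iff order_trans)

lemma long_detour_sym: "long_detour E u v n \<longleftrightarrow> long_detour E v u n"
  unfolding long_detour_def by (simp add: insert_commute abs_minus_commute)

text \<open>A witness is pulled back by composition with \<open>h\<close>; the last assumption
  ensures that only the exempt edge is mapped to the exempt edge.\<close>

lemma long_detour_transfer:
  assumes "long_detour E (h u) (h v) n" "\<And>a b. E' a b \<Longrightarrow> E (h a) (h b)"
    and "\<And>a b. E' a b \<Longrightarrow> {h a, h b} = {h u, h v} \<Longrightarrow> {a, b} = {u, v}"
  shows "long_detour E' u v n"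
proof -
  obtain \<phi> :: "'a \<Rightarrow> int" where \<phi>: "\<And>a b. E a b \<Longrightarrow> {a, b} \<noteq> {h u, h v} \<Longrightarrow> \<bar>\<phi> a - \<phi> b\<bar> \<le> 1"
    "int n \<le> \<bar>\<phi> (h u) - \<phi> (h v)\<bar>"
    using assms(1) unfolding long_detour_def by blast
  have "\<bar>\<phi> (h a) - \<phi> (h b)\<bar> \<le> 1" if "E' a b" "{a, b} \<noteq> {u, v}" for a b
    using \<phi>(1)[OF assms(2)[OF that(1)]] assms(3)[OF that(1)] that(2) by blast
  then show ?thesis unfolding long_detour_def using \<phi>(2) by (intro exI[of _ "\<lambda>a. \<phi> (h a)"]) blast
qed

context
  fixes H :: "'h \<Rightarrow> 'h \<Rightarrow> bool" and k :: nat
begin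

text \<open>
  The graph \<open>H\<close> is made \<open>k\<close>-regular by hanging trees at its vertices: \<open>(h, xs)\<close> is the vertex of the
  tree at \<open>h\<close> with address \<open>xs\<close>, read from the last entry to the first.
\<close>

fun valid :: "'h \<Rightarrow> nat list \<Rightarrow> bool" where
  "valid h [] \<longleftrightarrow> True"
| "valid h [i] \<longleftrightarrow> i < k - card {h'. H h h'}"
| "valid h (j # i # xs) \<longleftrightarrow> j < k - 1 \<and> valid h (i # xs)"

definition reg_verts :: "('h \<times> nat list) set" where
  "reg_verts = {p. valid (fst p) (snd p)}"

definition reg_adj :: "'h \<times> nat list \<Rightarrow> 'h \<times> nat list \<Rightarrow> bool" where
  "reg_adj p q \<longleftrightarrow> p \<in> reg_verts \<and> q \<in> reg_verts \<and> ((snd p = [] \<and> snd q = [] \<and> H (fst p) (fst q)) \<or>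
     (fst p = fst q \<and> ((\<exists>j. snd q = j # snd p) \<or> (\<exists>j. snd p = j # snd q))))"

lemma valid_tl: "valid h (j # xs) \<Longrightarrow> valid h xs"
  by (cases xs) auto

lemma reg_adj_cases:
  assumes "reg_adj p q"
  obtains (base) a b where "p = (a, [])" "q = (b, [])" "H a b"
    | (up) h j xs where "p = (h, xs)" "q = (h, j # xs)" "valid h (j # xs)"
    | (down) h j xs where "q = (h, xs)" "p = (h, j # xs)" "valid h (j # xs)"
  using assms unfolding reg_adj_def reg_verts_def by (cases p; cases q) auto

lemma sgr_reg_adj:
  assumes "\<And>a b. H a b \<Longrightarrow> H b a" "\<And>a. \<not> H a a"
  shows "sgr reg_verts reg_adj"
proof -
  have "q \<noteq> p \<and> reg_adj q p" if "reg_adj p q" for p q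
    using that
  proof (cases rule: reg_adj_cases)
    case (base a b)
    then show ?thesis using assms by (auto simp: reg_adj_def reg_verts_def)
  next
    case (up h j xs)
    then show ?thesis using valid_tl[OF up(3)] by (auto simp: reg_adj_def reg_verts_def)
  next
    case (down h j xs)
    then show ?thesis using valid_tl[OF down(3)] by (auto simp: reg_adj_def reg_verts_def)
  qed
  then show ?thesis unfolding sgr_def by (metis reg_adj_def)
qed

lemma reg_adj_card:
  assumes fin: "finite {h'. H (fst p) h'}" and d: "card {h'. H (fst p) h'} \<le> k" and k: "k \<ge> 1" and p: "p \<in> reg_verts"
  shows "card {q. reg_adj p q} = k"
proof (cases p)
  case (Pair h xs)
  show ?thesis
  proof (cases xs)
    case Nil
    let ?A = "(\<lambda>h'. (h', [] :: nat list)) ` {h'. H h h'}" and ?B = "(\<lambda>i. (h, [i])) ` {..<k - card {h'. H h h'}}"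
    have "{q. reg_adj p q} = ?A \<union> ?B"
      using Pair Nil by (auto simp: reg_adj_def reg_verts_def image_iff)
    moreover have "card (?A \<union> ?B) = card ?A + card ?B"
    proof (rule card_Un_disjoint)
      have "finite {h'. H h h'}" using fin Pair by simp
      then show "finite ?A" by (rule finite_imageI)
    qed auto
    moreover have "card ?A = card {h'. H h h'}" by (intro card_image) (auto simp: inj_on_def)
    moreover have "card ?B = k - card {h'. H h h'}" by (subst card_image) (auto simp: inj_on_def)
    ultimately show ?thesis using d Pair by simp
  next
    case (Cons j ys)
    let ?B = "(\<lambda>i. (h, i # j # ys)) ` {..<k - 1}"
    have v: "valid h (j # ys)" "valid h ys" using p Pair Cons valid_tl by (auto simp: reg_verts_def)
    have "{q. reg_adj p q} = insert (h, ys) ?B"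
    proof (intro equalityI subsetI)
      fix q assume "q \<in> {q. reg_adj p q}"
      then have "reg_adj p q" by simp
      then show "q \<in> insert (h, ys) ?B" using Pair Cons by (cases q) (auto simp: reg_adj_def reg_verts_def)
    next
      fix q assume "q \<in> insert (h, ys) ?B"
      then show "q \<in> {q. reg_adj p q}" using Pair Cons v by (auto simp: reg_adj_def reg_verts_def)
    qed
    moreover have "card ?B = k - 1" by (subst card_image) (auto simp: inj_on_def)
    moreover have "(h, ys) \<notin> ?B" by auto
    ultimately show ?thesis using k by simp
  qed
qed

lemma reg_adj_conn:
  assumes "conn UNIV H"
  shows "conn reg_verts reg_adj"
  unfolding conn_def
proof (intro allI impI)
  fix X assume X: "X \<subseteq> reg_verts" "X \<noteq> {}" "\<forall>u\<in>X. \<forall>v. reg_adj u v \<longrightarrow> v \<in> X"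
  have down: "(h, xs) \<in> X \<Longrightarrow> (h, []) \<in> X" for h xs
  proof (induction xs)
    case (Cons j xs)
    then have "valid h (j # xs)" using X(1) by (auto simp: reg_verts_def)
    then have "reg_adj (h, j # xs) (h, xs)" using valid_tl[of h j xs] by (auto simp: reg_adj_def reg_verts_def)
    then show ?case using Cons X(3) by blast
  qed simp
  have "{h. (h, []) \<in> X} = UNIV"
  proof (rule connD[OF assms])
    show "{h. (h, []) \<in> X} \<noteq> {}" using X(2) down by auto
    show "v \<in> {h. (h, []) \<in> X}" if "u \<in> {h. (h, []) \<in> X}" "H u v" for u v
    proof -
      have "reg_adj (u, []) (v, [])" using that(2) by (simp add: reg_adj_def reg_verts_def)
      then show ?thesis using X(3) that(1) by blast
    qed
  qed simp
  then have base: "(h, []) \<in> X" for h by blast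
  have "valid h xs \<Longrightarrow> (h, xs) \<in> X" for h xs
  proof (induction xs)
    case (Cons j xs)
    then have "(h, xs) \<in> X" "reg_adj (h, xs) (h, j # xs)" using valid_tl[of h j xs] by (auto simp: reg_adj_def reg_verts_def)
    then show ?case using X(3) by blast
  qed (simp add: base)
  then show "X = reg_verts" using X(1) by (auto simp: reg_verts_def)
qed

text \<open>The edge is a bridge: the indicator of the subtree behind it, scaled by
  \<open>n\<close>, changes nowhere else.\<close>

lemma long_detour_tree_edge: "long_detour reg_adj (h, xs) (h, j # xs) n"
proof -
  let ?in = "\<lambda>p. fst p = h \<and> (\<exists>zs. snd p = zs @ j # xs)"
  define \<phi> where "\<phi> = (\<lambda>p. if ?in p then int n else 0)"
  have tree: "?in (h', ys) \<longleftrightarrow> ?in (h', i # ys)" if "{(h', ys), (h', i # ys)} \<noteq> {(h, xs), (h, j # xs)}" for h' ys i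
  proof
    assume "?in (h', ys)"
    then obtain zs where "h' = h" "ys = zs @ j # xs" by auto
    then show "?in (h', i # ys)" by (auto intro: exI[of _ "i # zs"])
  next
    assume "?in (h', i # ys)"
    then obtain zs where z: "h' = h" "i # ys = zs @ j # xs" by auto
    then show "?in (h', ys)" using that by (cases zs) auto
  qed
  have eq: "\<phi> p = \<phi> q" if pq: "reg_adj p q" "{p, q} \<noteq> {(h, xs), (h, j # xs)}" for p q
    using pq(1)
  proof (cases rule: reg_adj_cases)
    case (base a b)
    then show ?thesis by (simp add: \<phi>_def)
  next
    case (up h' i ys)
    then show ?thesis using tree[of h' ys i] pq(2) unfolding \<phi>_def by presburger
  next
    case (down h' i ys)
    have "{(h', ys), (h', i # ys)} \<noteq> {(h, xs), (h, j # xs)}" using pq(2) down by (simp add: insert_commute)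
    then show ?thesis using tree[of h' ys i] down unfolding \<phi>_def by presburger
  qed
  have "\<phi> (h, xs) = 0" by (simp add: \<phi>_def)
  moreover have "\<phi> (h, j # xs) = int n" by (auto simp: \<phi>_def)
  ultimately show ?thesis unfolding long_detour_def using eq by (intro exI[of _ \<phi>]) simp
qed

text \<open>The hanging trees lie on no cycle; a witness extends to them by its value at the base
  vertex.\<close>

lemma long_detour_base_edge: "long_detour reg_adj (a, []) (b, []) n \<longleftrightarrow> long_detour H a b n"
proof
  assume "long_detour reg_adj (a, []) (b, []) n"
  then show "long_detour H a b n"
    by (rule long_detour_transfer[where h = "\<lambda>h. (h, [])"]) (auto simp: reg_adj_def reg_verts_def doubleton_eq_iff)
next
  assume "long_detour H a b n"
  then obtain \<phi> :: "'h \<Rightarrow> int" where \<phi>: "\<And>c d. H c d \<Longrightarrow> {c, d} \<noteq> {a, b} \<Longrightarrow> \<bar>\<phi> c - \<phi> d\<bar> \<le> 1"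
    "int n \<le> \<bar>\<phi> a - \<phi> b\<bar>" unfolding long_detour_def by blast
  have "\<bar>\<phi> (fst p) - \<phi> (fst q)\<bar> \<le> 1" if pq: "reg_adj p q" "{p, q} \<noteq> {(a, []), (b, [])}" for p q
    using pq(1)
  proof (cases rule: reg_adj_cases)
    case (base c d)
    then show ?thesis using \<phi>(1)[OF base(3)] pq(2) by (auto simp: doubleton_eq_iff)
  qed auto
  then show "long_detour reg_adj (a, []) (b, []) n" unfolding long_detour_def using \<phi>(2) by (intro exI[of _ "\<lambda>p. \<phi> (fst p)"]) simp
qed

end

text \<open>
  A comb with rows indexed by the first coordinate. If \<open>n \<in> S\<close>, then row \<open>n\<close> gets a chord that closes a
  cycle of length \<open>cycle_length M n\<close>; these lengths are distinct and exceed \<open>M\<close>.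
\<close>

definition cycle_length :: "nat \<Rightarrow> nat \<Rightarrow> nat" where
  "cycle_length M n = M + n + 3"

definition comb_adj :: "nat \<Rightarrow> nat set \<Rightarrow> nat \<times> nat \<Rightarrow> nat \<times> nat \<Rightarrow> bool" where
  "comb_adj M S p q \<longleftrightarrow> (fst p = fst q \<and> (snd q = Suc (snd p) \<or> snd p = Suc (snd q))) \<or>
     (snd p = 0 \<and> snd q = 0 \<and> (fst q = Suc (fst p) \<or> fst p = Suc (fst q))) \<or>
     (fst p = fst q \<and> fst p \<in> S \<and> (snd p = 1 \<and> snd q = cycle_length M (fst p) \<or> snd q = 1 \<and> snd p = cycle_length M (fst p)))"

lemma comb_adj_sym: "comb_adj M S a b \<Longrightarrow> comb_adj M S b a"
  unfolding comb_adj_def by auto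

lemma comb_adj_irr: "\<not> comb_adj M S a a"
  unfolding comb_adj_def cycle_length_def by auto

lemma comb_adj_deg: "finite {q. comb_adj M S p q} \<and> card {q. comb_adj M S p q} \<le> 3"
proof -
  obtain n i where p: "p = (n, i)" by (cases p)
  have "\<exists>x y z. {q. comb_adj M S p q} \<subseteq> {x, y, z}"
  proof (cases "i = 0")
    case True
    then have "{q. comb_adj M S p q} \<subseteq> {(n, 1), (Suc n, 0), (n - 1, 0)}" using p by (auto simp: comb_adj_def cycle_length_def)
    then show ?thesis by blast
  next
    case False
    show ?thesis
    proof (cases "i = 1")
      case True
      then have "{q. comb_adj M S p q} \<subseteq> {(n, 0), (n, 2), (n, cycle_length M n)}" using p by (auto simp: comb_adj_def cycle_length_def)
      then show ?thesis by blast
    next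
      case F: False
      then have "{q. comb_adj M S p q} \<subseteq> {(n, i - 1), (n, Suc i), (n, 1)}" using p False by (auto simp: comb_adj_def)
      then show ?thesis by blast
    qed
  qed
  then obtain x y z where s: "{q. comb_adj M S p q} \<subseteq> {x, y, z}" by blast
  have "card {x, y, z} \<le> 3" by (simp add: card_insert_if)
  then show ?thesis using card_mono[OF _ s] finite_subset[OF s] by auto
qed

lemma comb_adj_conn: "conn UNIV (comb_adj M S)"
  unfolding conn_def
proof (intro allI impI)
  fix X assume X: "X \<subseteq> UNIV" "X \<noteq> {}" "\<forall>u\<in>X. \<forall>v. comb_adj M S u v \<longrightarrow> v \<in> X"
  have st: "(n, i) \<in> X \<longleftrightarrow> (n, Suc i) \<in> X" for n i
    using X(3)[rule_format, of "(n, i)" "(n, Suc i)"] X(3)[rule_format, of "(n, Suc i)" "(n, i)"] by (auto simp: comb_adj_def)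
  have row: "(n, i) \<in> X \<longleftrightarrow> (n, 0) \<in> X" for n i by (induction i) (simp_all add: st[symmetric])
  have sp: "(n, 0) \<in> X \<longleftrightarrow> (Suc n, 0) \<in> X" for n
    using X(3)[rule_format, of "(n, 0)" "(Suc n, 0)"] X(3)[rule_format, of "(Suc n, 0)" "(n, 0)"] by (auto simp: comb_adj_def)
  have col: "(n, 0) \<in> X \<longleftrightarrow> (0, 0) \<in> X" for n by (induction n) (simp_all add: sp[symmetric])
  obtain n i where "(n, i) \<in> X" using X(2) by auto
  then have 00: "(0, 0) \<in> X" using row[of n i] col[of n] by simp
  have "p \<in> X" for p using row[of "fst p" "snd p"] col[of "fst p"] 00 by simp
  then show "X = UNIV" by blast
qed

lemma comb_adj_potI:
  fixes \<phi> :: "nat \<times> nat \<Rightarrow> int"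
  assumes "\<And>n i. {(n, i), (n, Suc i)} \<noteq> {u, v} \<Longrightarrow> \<bar>\<phi> (n, i) - \<phi> (n, Suc i)\<bar> \<le> 1"
    "\<And>n. {(n, 0), (Suc n, 0)} \<noteq> {u, v} \<Longrightarrow> \<bar>\<phi> (n, 0) - \<phi> (Suc n, 0)\<bar> \<le> 1"
    "\<And>n. n \<in> S \<Longrightarrow> {(n, 1), (n, cycle_length M n)} \<noteq> {u, v} \<Longrightarrow> \<bar>\<phi> (n, 1) - \<phi> (n, cycle_length M n)\<bar> \<le> 1"
    "int N \<le> \<bar>\<phi> u - \<phi> v\<bar>"
  shows "long_detour (comb_adj M S) u v N"
  unfolding long_detour_def
proof (intro exI[of _ \<phi>] conjI allI impI)
  fix a b assume ab: "comb_adj M S a b" "{a, b} \<noteq> {u, v}"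
  obtain n i m j where p: "a = (n, i)" "b = (m, j)" by (cases a; cases b)
  have sw: "{b, a} \<noteq> {u, v}" using ab(2) by (simp add: insert_commute)
  have "n = m \<and> j = Suc i \<or> n = m \<and> i = Suc j \<or> i = 0 \<and> j = 0 \<and> m = Suc n \<or> i = 0 \<and> j = 0 \<and> n = Suc m \<or>
      n = m \<and> n \<in> S \<and> i = 1 \<and> j = cycle_length M n \<or> n = m \<and> n \<in> S \<and> j = 1 \<and> i = cycle_length M n"
    using ab(1) p by (auto simp: comb_adj_def)
  then have "\<bar>\<phi> a - \<phi> b\<bar> \<le> 1 \<or> \<bar>\<phi> b - \<phi> a\<bar> \<le> 1"
  proof (elim disjE conjE)
    assume "n = m" "j = Suc i"
    then show ?thesis using assms(1)[of n i] ab(2) p by simp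
  next
    assume "n = m" "i = Suc j"
    then show ?thesis using assms(1)[of n j] sw p by simp
  next
    assume "i = 0" "j = 0" "m = Suc n"
    then show ?thesis using assms(2)[of n] ab(2) p by simp
  next
    assume "i = 0" "j = 0" "n = Suc m"
    then show ?thesis using assms(2)[of m] sw p by simp
  next
    assume "n = m" "n \<in> S" "i = 1" "j = cycle_length M n"
    then show ?thesis using assms(3)[of n] ab(2) p by simp
  next
    assume "n = m" "n \<in> S" "j = 1" "i = cycle_length M n"
    then show ?thesis using assms(3)[of n] sw p by simp
  qed
  then show "\<bar>\<phi> a - \<phi> b\<bar> \<le> 1" by (simp add: abs_minus_commute)
qed (rule assms(4))

lemma segment_bound:
  fixes \<phi> :: "nat \<times> nat \<Rightarrow> int"
  assumes "s \<le> t" "\<And>a. s \<le> a \<Longrightarrow> a < t \<Longrightarrow> \<bar>\<phi> (n, a) - \<phi> (n, Suc a)\<bar> \<le> 1"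
  shows "\<bar>\<phi> (n, s) - \<phi> (n, t)\<bar> \<le> int (t - s)"
  using assms
proof (induction t rule: dec_induct)
  case (step t)
  have "\<bar>\<phi> (n, s) - \<phi> (n, t)\<bar> \<le> int (t - s)" using step by simp
  moreover have "\<bar>\<phi> (n, t) - \<phi> (n, Suc t)\<bar> \<le> 1" using step by simp
  ultimately show ?case using step(1) by (simp add: Suc_diff_le)
qed simp

lemma comb_adj_row: "comb_adj M S (n, i) (n, Suc i)"
  by (simp add: comb_adj_def)

lemma comb_adj_chord: "n \<in> S \<Longrightarrow> comb_adj M S (n, 1) (n, cycle_length M n)"
  by (simp add: comb_adj_def)

text \<open>Without the chord its ends are joined by the row, at distance
  \<open>cycle_length M n - 1\<close>; the position in the row, capped at the end of the chord, is
  the witness.\<close>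

lemma chord_long_detour:
  assumes "n \<in> S"
  shows "long_detour (comb_adj M S) (n, 1) (n, cycle_length M n) (cycle_length M n - 1) \<and> \<not> long_detour (comb_adj M S) (n, 1) (n, cycle_length M n) (cycle_length M n)"
proof
  let ?L = "cycle_length M n"
  have L: "?L \<ge> 3" by (simp add: cycle_length_def)
  let ?\<phi> = "\<lambda>p. if fst p = n then int (min (snd p) ?L) else 0"
  show "long_detour (comb_adj M S) (n, 1) (n, ?L) (?L - 1)"
    by (rule comb_adj_potI[of _ _ ?\<phi>]) (use L in \<open>auto simp: min_def split: if_splits\<close>)
  show "\<not> long_detour (comb_adj M S) (n, 1) (n, ?L) ?L"
  proof
    assume "long_detour (comb_adj M S) (n, 1) (n, ?L) ?L"
    then obtain \<phi> :: "nat \<times> nat \<Rightarrow> int" where \<phi>: "\<And>a b. comb_adj M S a b \<Longrightarrow> {a, b} \<noteq> {(n, 1), (n, ?L)} \<Longrightarrow> \<bar>\<phi> a - \<phi> b\<bar> \<le> 1"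
      "int ?L \<le> \<bar>\<phi> (n, 1) - \<phi> (n, ?L)\<bar>" unfolding long_detour_def by blast
    have "\<bar>\<phi> (n, 1) - \<phi> (n, ?L)\<bar> \<le> int (?L - 1)"
      using L by (intro segment_bound \<phi>(1) comb_adj_row) (auto simp: doubleton_eq_iff)
    then show False using \<phi>(2) L by simp
  qed
qed

lemma row_long_detour_cycle:
  assumes n: "n \<in> S" and i: "1 \<le> i" "i < cycle_length M n"
  shows "long_detour (comb_adj M S) (n, i) (n, Suc i) (cycle_length M n - 1) \<and> \<not> long_detour (comb_adj M S) (n, i) (n, Suc i) (cycle_length M n)"
proof
  let ?L = "cycle_length M n"
  \<comment> \<open>The distance from \<open>(n, Suc i)\<close> along the cycle without the exempt
    edge: up to the chord, across it to \<open>(n, 1)\<close>, and on to \<open>(n, i)\<close>. The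
    rest of the comb takes the value at the vertex where it is attached to the cycle.\<close>
  let ?\<phi> = "\<lambda>p. if fst p = n \<and> snd p \<noteq> 0 then (if snd p \<le> i then int ?L - int i + int (snd p) - 1
      else int (min (snd p) ?L) - int i - 1) else int ?L - int i"
  show "long_detour (comb_adj M S) (n, i) (n, Suc i) (?L - 1)"
  proof (rule comb_adj_potI[of _ _ ?\<phi>])
    show "\<bar>?\<phi> (m, j) - ?\<phi> (m, Suc j)\<bar> \<le> 1" if "{(m, j), (m, Suc j)} \<noteq> {(n, i), (n, Suc i)}" for m j
      using that i by (auto simp: min_def)
    show "\<bar>?\<phi> (m, 0) - ?\<phi> (Suc m, 0)\<bar> \<le> 1" for m by simp
    show "\<bar>?\<phi> (m, 1) - ?\<phi> (m, cycle_length M m)\<bar> \<le> 1" for m using i by (auto simp: cycle_length_def)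
    show "int (?L - 1) \<le> \<bar>?\<phi> (n, i) - ?\<phi> (n, Suc i)\<bar>" using i by (auto simp: min_def)
  qed
  show "\<not> long_detour (comb_adj M S) (n, i) (n, Suc i) ?L"
  proof
    assume "long_detour (comb_adj M S) (n, i) (n, Suc i) ?L"
    then obtain \<phi> :: "nat \<times> nat \<Rightarrow> int" where \<phi>: "\<And>a b. comb_adj M S a b \<Longrightarrow> {a, b} \<noteq> {(n, i), (n, Suc i)} \<Longrightarrow> \<bar>\<phi> a - \<phi> b\<bar> \<le> 1"
      "int ?L \<le> \<bar>\<phi> (n, i) - \<phi> (n, Suc i)\<bar>" unfolding long_detour_def by blast
    have L3: "?L \<ge> 3" by (simp add: cycle_length_def)
    have "\<bar>\<phi> (n, 1) - \<phi> (n, i)\<bar> \<le> int (i - 1)"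
      using i by (intro segment_bound \<phi>(1) comb_adj_row) (auto simp: doubleton_eq_iff)
    moreover have "\<bar>\<phi> (n, Suc i) - \<phi> (n, ?L)\<bar> \<le> int (?L - Suc i)"
      using i by (intro segment_bound \<phi>(1) comb_adj_row) (auto simp: doubleton_eq_iff)
    moreover have "\<bar>\<phi> (n, 1) - \<phi> (n, ?L)\<bar> \<le> 1"
      using n i L3 by (intro \<phi>(1) comb_adj_chord) (auto simp: doubleton_eq_iff)
    ultimately show False using \<phi>(2) i by linarith
  qed
qed

lemma row_long_detour_bridge:
  assumes "n \<notin> S \<or> i = 0 \<or> cycle_length M n \<le> i"
  shows "long_detour (comb_adj M S) (n, i) (n, Suc i) N"
proof (rule comb_adj_potI[of _ _ "\<lambda>p. if fst p = n \<and> Suc i \<le> snd p then int N else 0"])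
  show "\<bar>(if fst (m, 1) = n \<and> Suc i \<le> snd (m, 1) then int N else 0) -
      (if fst (m, cycle_length M m) = n \<and> Suc i \<le> snd (m, cycle_length M m) then int N else 0)\<bar> \<le> 1" if "m \<in> S" for m
    using that assms by (auto simp: cycle_length_def)
qed (auto simp: doubleton_eq_iff)

lemma spine_long_detour: "long_detour (comb_adj M S) (n, 0) (Suc n, 0) N"
  by (rule comb_adj_potI[of _ _ "\<lambda>p. if Suc n \<le> fst p then int N else 0"]) (auto simp: doubleton_eq_iff)

text \<open>Every edge is a bridge or lies on exactly one cycle, that of its row, and then the
  length of the detour reveals the length of the cycle.\<close>

lemma comb_adj_edge_long_detour:
  assumes "comb_adj M S u v"
  shows "(\<forall>N. long_detour (comb_adj M S) u v N) \<or> (\<exists>m\<in>S. long_detour (comb_adj M S) u v (cycle_length M m - 1) \<and> \<not> long_detour (comb_adj M S) u v (cycle_length M m))"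
proof -
  let ?P = "\<lambda>u v. (\<forall>N. long_detour (comb_adj M S) u v N) \<or> (\<exists>m\<in>S. long_detour (comb_adj M S) u v (cycle_length M m - 1) \<and> \<not> long_detour (comb_adj M S) u v (cycle_length M m))"
  have sym: "?P u v \<longleftrightarrow> ?P v u" for u v by (simp add: long_detour_sym[of "comb_adj M S" u v])
  have row: "?P (n, i) (n, Suc i)" for n i
    using row_long_detour_cycle[of n S i M] row_long_detour_bridge[of n S i M] by (cases "n \<in> S \<and> 1 \<le> i \<and> i < cycle_length M n") (auto simp: not_le)
  have spine: "?P (n, 0) (Suc n, 0)" for n using spine_long_detour by blast
  have chord: "?P (n, 1) (n, cycle_length M n)" if "n \<in> S" for n using chord_long_detour[OF that] that by blast
  obtain n i m j where p: "u = (n, i)" "v = (m, j)" by (cases u; cases v)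
  have "n = m \<and> j = Suc i \<or> n = m \<and> i = Suc j \<or> i = 0 \<and> j = 0 \<and> m = Suc n \<or> i = 0 \<and> j = 0 \<and> n = Suc m \<or>
      n = m \<and> n \<in> S \<and> i = 1 \<and> j = cycle_length M n \<or> n = m \<and> n \<in> S \<and> j = 1 \<and> i = cycle_length M n"
    using assms p by (auto simp: comb_adj_def)
  then have "?P (n, i) (m, j)"
  proof (elim disjE conjE)
    assume "n = m" "j = Suc i"
    then show "?P (n, i) (m, j)" using row[of n i] by simp
  next
    assume "n = m" "i = Suc j"
    then show "?P (n, i) (m, j)" using row[of n j] sym by simp
  next
    assume "i = 0" "j = 0" "m = Suc n"
    then show "?P (n, i) (m, j)" using spine[of n] by simp
  next
    assume "i = 0" "j = 0" "n = Suc m"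
    then show "?P (n, i) (m, j)" using spine[of m] sym by simp
  next
    assume "n = m" "n \<in> S" "i = 1" "j = cycle_length M n"
    then show "?P (n, i) (m, j)" using chord[of n] by simp
  next
    assume "n = m" "n \<in> S" "j = 1" "i = cycle_length M n"
    then show "?P (n, i) (m, j)" using chord[of n] sym by simp
  qed
  then show ?thesis unfolding p .
qed

lemma reg_adj_edge_long_detour:
  assumes "reg_adj (comb_adj M S) k p q"
  shows "(\<forall>N. long_detour (reg_adj (comb_adj M S) k) p q N) \<or>
    (\<exists>m\<in>S. long_detour (reg_adj (comb_adj M S) k) p q (cycle_length M m - 1) \<and> \<not> long_detour (reg_adj (comb_adj M S) k) p q (cycle_length M m))"
  using assms
proof (cases rule: reg_adj_cases)
  case (base a b)
  then show ?thesis using comb_adj_edge_long_detour[OF base(3)] by (simp add: long_detour_base_edge)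
next
  case (up h j xs)
  then show ?thesis using long_detour_tree_edge[of "comb_adj M S" k h xs j] by simp
next
  case (down h j xs)
  then show ?thesis
    using long_detour_tree_edge[of "comb_adj M S" k h xs j] long_detour_sym[of "reg_adj (comb_adj M S) k" "(h, xs)" "(h, j # xs)"] by simp
qed

lemma reg_adj_girth: "reg_adj (comb_adj M S) k p q \<Longrightarrow> long_detour (reg_adj (comb_adj M S) k) p q M"
  using reg_adj_edge_long_detour[of M S k p q] long_detour_mono[of "reg_adj (comb_adj M S) k" p q _ M] by (fastforce simp: cycle_length_def)

text \<open>The condition on the right is invariant under isomorphism, and the lengths are distinct.
  So an unlabelled copy of the graph still determines \<open>S\<close>.\<close>

lemma reg_adj_decode:
  "n \<in> S \<longleftrightarrow> (\<exists>p q. reg_adj (comb_adj M S) k p q \<and> long_detour (reg_adj (comb_adj M S) k) p q (cycle_length M n - 1) \<and> \<not> long_detour (reg_adj (comb_adj M S) k) p q (cycle_length M n))"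
proof
  assume n: "n \<in> S"
  have "reg_adj (comb_adj M S) k ((n, 1), []) ((n, cycle_length M n), [])" using comb_adj_chord[OF n] by (simp add: reg_adj_def reg_verts_def)
  then show "\<exists>p q. reg_adj (comb_adj M S) k p q \<and> long_detour (reg_adj (comb_adj M S) k) p q (cycle_length M n - 1) \<and> \<not> long_detour (reg_adj (comb_adj M S) k) p q (cycle_length M n)"
    using chord_long_detour[OF n, of M] by (intro exI[of _ "((n, 1), [])"] exI[of _ "((n, cycle_length M n), [])"]) (simp add: long_detour_base_edge)
next
  assume "\<exists>p q. reg_adj (comb_adj M S) k p q \<and> long_detour (reg_adj (comb_adj M S) k) p q (cycle_length M n - 1) \<and> \<not> long_detour (reg_adj (comb_adj M S) k) p q (cycle_length M n)"
  then obtain p q where pq: "reg_adj (comb_adj M S) k p q" "long_detour (reg_adj (comb_adj M S) k) p q (cycle_length M n - 1)" "\<not> long_detour (reg_adj (comb_adj M S) k) p q (cycle_length M n)"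
    by blast
  then obtain m where m: "m \<in> S" "long_detour (reg_adj (comb_adj M S) k) p q (cycle_length M m - 1)" "\<not> long_detour (reg_adj (comb_adj M S) k) p q (cycle_length M m)"
    using reg_adj_edge_long_detour[OF pq(1)] by blast
  have "\<not> cycle_length M n \<le> cycle_length M m - 1" using long_detour_mono[OF m(2)] pq(3) by blast
  moreover have "\<not> cycle_length M m \<le> cycle_length M n - 1" using long_detour_mono[OF pq(2)] m(3) by blast
  ultimately have "m = n" by (auto simp: cycle_length_def)
  then show "n \<in> S" using m(1) by simp
qed

section \<open>Regular graphs as components of a universal graph\<close>

context
  fixes V :: "'a set" and E x par dp k y
  assumes T: "rtree V E x par dp" and dx: "deg E x = Suc k"
    and dg: "\<And>z. z \<in> V \<Longrightarrow> z \<noteq> x \<Longrightarrow> deg E z \<le> k" and k: "k \<ge> 3"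
    and y: "E x y" "deg E y = 1"
begin

lemma reg_card:
  assumes "p \<in> reg_verts (comb_adj M S) k"
  shows "card {q. reg_adj (comb_adj M S) k p q} = k"
proof (rule reg_adj_card)
  show "finite {h'. comb_adj M S (fst p) h'}" using comb_adj_deg by blast
  show "card {h'. comb_adj M S (fst p) h'} \<le> k" using comb_adj_deg[of M S "fst p"] k by linarith
qed (use k assms in auto)

lemma reg_free: "free V E (reg_verts (comb_adj M S) k) (reg_adj (comb_adj M S) k)"
proof -
  have "\<not> emb V E (reg_verts (comb_adj M S) k) (reg_adj (comb_adj M S) k) f" for f
  proof
    assume f: "emb V E (reg_verts (comb_adj M S) k) (reg_adj (comb_adj M S) k) f"
    have xV: "x \<in> V" by (rule rtreeD(3)[OF T])
    have fx: "f x \<in> reg_verts (comb_adj M S) k" using f xV by (auto simp: emb_def)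
    have sub: "f ` {w. E x w} \<subseteq> {q. reg_adj (comb_adj M S) k (f x) q}" using f by (auto simp: emb_def)
    have "{w. E x w} \<subseteq> V" using sgrD[OF rtreeD(2)[OF T]] by blast
    then have "inj_on f {w. E x w}" using f unfolding emb_def by (meson inj_on_subset)
    then have "card (f ` {w. E x w}) = Suc k" using dx by (simp add: card_image deg_def)
    moreover have "finite {q. reg_adj (comb_adj M S) k (f x) q}" using reg_card[OF fx] k by (intro card_ge_0_finite) simp
    ultimately have "Suc k \<le> k" using card_mono[OF _ sub] reg_card[OF fx] by simp
    then show False by simp
  qed
  then show ?thesis using sgr_reg_adj[of "comb_adj M S" k, OF comb_adj_sym comb_adj_irr] unfolding free_def by blast
qed

text \<open>Otherwise \<open>w\<close> is not adjacent to \<open>f p\<close> in the embedded regular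
  graph, whether or not it belongs to it, and \<open>hom_exists\<close> uses the edge from
  \<open>f p\<close> to \<open>w\<close> as the extra edge at the root of degree
  \<open>k + 1\<close>.\<close>

lemma reg_component:
  assumes fr: "free V E U EU" and M: "M = 3 * card V + 5"
    and f: "emb (reg_verts (comb_adj M S) k) (reg_adj (comb_adj M S) k) U EU f"
    and p: "p \<in> reg_verts (comb_adj M S) k" and w: "EU (f p) w"
  shows "\<exists>q. reg_adj (comb_adj M S) k p q \<and> w = f q"
proof (rule ccontr)
  assume no: "\<not> ?thesis"
  let ?R = "reg_adj (comb_adj M S) k" and ?reg_verts = "reg_verts (comb_adj M S) k"
  have sU: "sgr U EU" using fr by (simp add: free_def)
  have sR: "sgr ?reg_verts ?R" by (rule sgr_reg_adj[OF comb_adj_sym comb_adj_irr])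
  have inj: "inj_on f ?reg_verts" and fE: "\<And>a b. ?R a b \<Longrightarrow> EU (f a) (f b)" using f unfolding emb_def by blast+
  define C where "C = f ` ?reg_verts"
  define E' where "E' = (\<lambda>a b. \<exists>p q. ?R p q \<and> a = f p \<and> b = f q)"
  have fi: "a = b" if "a \<in> ?reg_verts" "b \<in> ?reg_verts" "f a = f b" for a b using inj that by (meson inj_onD)
  have E'f: "E' (f a) b \<longleftrightarrow> (\<exists>q. ?R a q \<and> b = f q)" if "a \<in> ?reg_verts" for a b
    unfolding E'_def using fi[OF that] sgrD[OF sR] by metis
  have sE: "sgr C E'"
    unfolding sgr_def
  proof (intro allI impI)
    fix a b assume "E' a b"
    then obtain p q where pq: "?R p q" "a = f p" "b = f q" unfolding E'_def by blast
    note s = sgrD[OF sR pq(1)]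
    have "f p \<noteq> f q" using fi[of p q] s by blast
    moreover have "E' b a" unfolding E'_def using pq s by blast
    ultimately show "a \<in> C \<and> b \<in> C \<and> a \<noteq> b \<and> E' b a" unfolding C_def using pq s by blast
  qed
  have C: "card {a. E' b a} = k" if b: "b \<in> C" for b
  proof -
    obtain p where p: "p \<in> ?reg_verts" "b = f p" using b unfolding C_def by blast
    have "{a. E' b a} = f ` {q. ?R p q}" unfolding p(2) using E'f[OF p(1)] by blast
    moreover have "inj_on f {q. ?R p q}" using inj_on_subset[OF inj, of "{q. ?R p q}"] sgrD[OF sR] by blast
    ultimately show ?thesis using reg_card[OF p(1)] by (simp add: card_image)
  qed
  have potE: "long_detour E' u v M" if uv: "E' u v" for u v
  proof -
    let ?h = "inv_into ?reg_verts f"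
    have hh: "?h (f p) = p" if "p \<in> ?reg_verts" for p using inv_into_f_f[OF inj that] .
    have hE: "?R (?h a) (?h b) \<and> f (?h a) = a \<and> f (?h b) = b" if "E' a b" for a b
      using that hh sgrD[OF sR] unfolding E'_def by metis
    show ?thesis
    proof (rule long_detour_transfer[where E = ?R and h = ?h])
      show "long_detour ?R (?h u) (?h v) M" using reg_adj_girth hE[OF uv] by blast
      show "?R (?h a) (?h b)" if "E' a b" for a b using hE[OF that] by blast
      show "{a, b} = {u, v}" if ab: "E' a b" "{?h a, ?h b} = {?h u, ?h v}" for a b
      proof -
        have "f ` {?h a, ?h b} = f ` {?h u, ?h v}" using ab(2) by (rule arg_cong)
        then show ?thesis using hE[OF ab(1)] hE[OF uv] by simp
      qed
    qed
  qed
  have girth: "hd xs \<noteq> last xs" if "nonbacktracking E' xs" "2 \<le> length xs" "length xs \<le> 3 * card V + 5" for xs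
  proof (rule nonbacktracking_girth[of E' M])
    show "\<not> E' a a" for a using sgrD[OF sE] by blast
  qed (use potE that M in auto)
  have u: "f p \<in> C" using p by (simp add: C_def)
  have uw: "f p \<noteq> w" using sgrD[OF sU w] by blast
  have nw: "\<not> E' (f p) w" using E'f[OF p] no by blast
  have k2: "k \<ge> 2" using k by simp
  have "\<exists>g. inj_on g V \<and> g x = f p \<and> (\<forall>a b. E a b \<longrightarrow> E' (g a) (g b) \<or> {g a, g b} = {f p, w})"
    by (rule hom_exists[where E' = E' and C = C and k = k and w = w and u = "f p" and y = y, OF T dx])
      (fact dg k2 y sE C girth u uw nw | blast)+
  then obtain g where g0: "inj_on g V" "g x = f p" "\<forall>a b. E a b \<longrightarrow> E' (g a) (g b) \<or> {g a, g b} = {f p, w}" by blast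
  note g = g0(1,2) g0(3)[rule_format]
  have gE: "EU (g a) (g b)" if ab: "E a b" for a b
    using g(3)[OF ab]
  proof
    assume "E' (g a) (g b)"
    then obtain p' q' where "reg_adj (comb_adj M S) k p' q'" "g a = f p'" "g b = f q'" unfolding E'_def by blast
    then show ?thesis using fE[of p' q'] by simp
  next
    assume "{g a, g b} = {f p, w}"
    then have "g a = f p \<and> g b = w \<or> g a = w \<and> g b = f p" by (simp add: doubleton_eq_iff)
    then show ?thesis using w sgrD[OF sU w] by auto
  qed
  have "g ` V \<subseteq> U"
  proof (rule image_subsetI)
    fix z assume z: "z \<in> V"
    show "g z \<in> U"
    proof (cases "z = x")
      case True
      then show ?thesis using g(2) sgrD[OF sU w] by simp
    next
      case False
      then have "E z (par z)" using rtreeD(6)[OF T z] by blast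
      from sgrD[OF sU gE[OF this]] show ?thesis by blast
    qed
  qed
  then have "emb V E U EU g" using g(1) gE unfolding emb_def by blast
  then show False using fr unfolding free_def by blast
qed

text \<open>By \<open>reg_component\<close> every image is closed under adjacency and has no
  additional edges. Two images that share the image of the base vertex are therefore equal and give
  isomorphic graphs. So the image of the base vertex determines the set, which
  \<open>no_inj_nat_set\<close> excludes.\<close>

theorem reg_no_wuniv: "\<not> wuniv V E U EU"
proof
  assume U: "wuniv V E U EU"
  then have fr: "free V E U EU" by (simp add: wuniv_def)
  define M where "M = 3 * card V + 5"
  let ?reg_verts = "\<lambda>S. reg_verts (comb_adj M S) k" and ?R = "\<lambda>S. reg_adj (comb_adj M S) k"
  have "\<forall>S. \<exists>f. emb (?reg_verts S) (?R S) U EU f" using wuniv_any[OF U reg_free] by metis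
  from choice[OF this] obtain F where F: "\<forall>S. emb (?reg_verts S) (?R S) U EU (F S)" by (rule exE)
  have inj: "inj_on (F S) (?reg_verts S)" for S using F by (simp add: emb_def)
  have fE: "EU (F S a) (F S b)" if "?R S a b" for S a b using F that unfolding emb_def by blast
  have cl: "\<exists>q. ?R S p q \<and> w = F S q" if "p \<in> ?reg_verts S" "EU (F S p) w" for S p w
    using reg_component[OF fr M_def spec[OF F, of S] that] .
  have sR: "sgr (?reg_verts S) (?R S)" for S by (rule sgr_reg_adj[OF comb_adj_sym comb_adj_irr])
  let ?r = "((0, 0), []) :: (nat \<times> nat) \<times> nat list"
  have r: "?r \<in> ?reg_verts S" for S by (simp add: reg_verts_def)
  have img: "F S ` ?reg_verts S \<subseteq> F S' ` ?reg_verts S'" if eq: "F S ?r = F S' ?r" for S S'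
  proof -
    have "{p \<in> ?reg_verts S. F S p \<in> F S' ` ?reg_verts S'} = ?reg_verts S"
    proof (rule connD[OF reg_adj_conn[OF comb_adj_conn]])
      have "F S ?r \<in> F S' ` ?reg_verts S'" unfolding eq using r by (rule imageI)
      then show "{p \<in> ?reg_verts S. F S p \<in> F S' ` ?reg_verts S'} \<noteq> {}" using r by blast
      show "v \<in> {p \<in> ?reg_verts S. F S p \<in> F S' ` ?reg_verts S'}" if uv: "u \<in> {p \<in> ?reg_verts S. F S p \<in> F S' ` ?reg_verts S'}" "?R S u v" for u v
      proof -
        obtain p' where p': "p' \<in> ?reg_verts S'" "F S u = F S' p'" using uv(1) by blast
        have "EU (F S' p') (F S v)" using fE[OF uv(2)] p'(2) by simp
        from cl[OF p'(1) this] obtain q where "?R S' p' q" "F S v = F S' q" by blast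
        then show ?thesis using sgrD[OF sR] uv(2) by blast
      qed
    qed blast
    then show ?thesis by blast
  qed
  have sub: "S \<subseteq> S'" if eq: "F S ?r = F S' ?r" for S S'
  proof
    fix n assume "n \<in> S"
    then obtain u v where uv: "?R S u v" "long_detour (?R S) u v (cycle_length M n - 1)" "\<not> long_detour (?R S) u v (cycle_length M n)"
      using reg_adj_decode[of n S M k] by blast
    \<comment> \<open>\<open>\<theta>\<close> and \<open>\<theta>'\<close> turn out to be mutually
      inverse isomorphisms between the two regular graphs, through which detour lengths are
      transported.\<close>
    define \<theta> where "\<theta> = (\<lambda>p. inv_into (?reg_verts S') (F S') (F S p))"
    define \<theta>' where "\<theta>' = (\<lambda>p. inv_into (?reg_verts S) (F S) (F S' p))"
    have \<theta>: "\<theta> p \<in> ?reg_verts S' \<and> F S' (\<theta> p) = F S p" if "p \<in> ?reg_verts S" for p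
      unfolding \<theta>_def using img[OF eq] that by (meson f_inv_into_f imageI inv_into_into subsetD)
    have \<theta>': "\<theta>' p \<in> ?reg_verts S \<and> F S (\<theta>' p) = F S' p" if "p \<in> ?reg_verts S'" for p
      unfolding \<theta>'_def using img[OF eq[symmetric]] that by (meson f_inv_into_f imageI inv_into_into subsetD)
    have \<theta>\<theta>: "\<theta>' (\<theta> p) = p" if "p \<in> ?reg_verts S" for p
      using \<theta>[OF that] \<theta>'[of "\<theta> p"] inj_onD[OF inj[of S], of "\<theta>' (\<theta> p)" p] that by metis
    have \<theta>\<theta>': "\<theta> (\<theta>' p) = p" if "p \<in> ?reg_verts S'" for p
      using \<theta>'[OF that] \<theta>[of "\<theta>' p"] inj_onD[OF inj[of S'], of "\<theta> (\<theta>' p)" p] that by metis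
    have pres: "?R S' (\<theta> a) (\<theta> b)" if ab: "?R S a b" for a b
    proof -
      have V: "a \<in> ?reg_verts S" "b \<in> ?reg_verts S" using sgrD[OF sR ab] by blast+
      have "EU (F S' (\<theta> a)) (F S' (\<theta> b))" using fE[OF ab] \<theta>[OF V(1)] \<theta>[OF V(2)] by simp
      from cl[OF _ this] \<theta>[OF V(1)] obtain q where q: "?R S' (\<theta> a) q" "F S' (\<theta> b) = F S' q" by blast
      have "\<theta> b = q" using inj_onD[OF inj q(2)] \<theta>[OF V(2)] sgrD[OF sR q(1)] by blast
      then show ?thesis using q(1) by simp
    qed
    have pres': "?R S (\<theta>' a) (\<theta>' b)" if ab: "?R S' a b" for a b
    proof -
      have V: "a \<in> ?reg_verts S'" "b \<in> ?reg_verts S'" using sgrD[OF sR ab] by blast+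
      have "EU (F S (\<theta>' a)) (F S (\<theta>' b))" using fE[OF ab] \<theta>'[OF V(1)] \<theta>'[OF V(2)] by simp
      from cl[OF _ this] \<theta>'[OF V(1)] obtain q where q: "?R S (\<theta>' a) q" "F S (\<theta>' b) = F S q" by blast
      have "\<theta>' b = q" using inj_onD[OF inj q(2)] \<theta>'[OF V(2)] sgrD[OF sR q(1)] by blast
      then show ?thesis using q(1) by simp
    qed
    have V: "u \<in> ?reg_verts S" "v \<in> ?reg_verts S" using sgrD[OF sR uv(1)] by blast+
    have 1: "?R S' (\<theta> u) (\<theta> v)" by (rule pres[OF uv(1)])
    have 2: "long_detour (?R S') (\<theta> u) (\<theta> v) (cycle_length M n - 1)"
    proof (rule long_detour_transfer[where E = "?R S" and h = \<theta>'])
      show "long_detour (?R S) (\<theta>' (\<theta> u)) (\<theta>' (\<theta> v)) (cycle_length M n - 1)" using uv(2) \<theta>\<theta>[OF V(1)] \<theta>\<theta>[OF V(2)] by simp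
      show "?R S (\<theta>' a) (\<theta>' b)" if "?R S' a b" for a b by (rule pres'[OF that])
      show "{a, b} = {\<theta> u, \<theta> v}" if ab: "?R S' a b" "{\<theta>' a, \<theta>' b} = {\<theta>' (\<theta> u), \<theta>' (\<theta> v)}" for a b
      proof -
        have "\<theta> ` {\<theta>' a, \<theta>' b} = \<theta> ` {\<theta>' (\<theta> u), \<theta>' (\<theta> v)}" using ab(2) by (rule arg_cong)
        then show ?thesis using \<theta>\<theta>' sgrD[OF sR ab(1)] \<theta>[OF V(1)] \<theta>[OF V(2)] by simp
      qed
    qed
    have 3: "\<not> long_detour (?R S') (\<theta> u) (\<theta> v) (cycle_length M n)"
    proof
      assume a: "long_detour (?R S') (\<theta> u) (\<theta> v) (cycle_length M n)"
      have "long_detour (?R S) u v (cycle_length M n)"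
      proof (rule long_detour_transfer[where E = "?R S'" and h = \<theta>, OF a])
        show "?R S' (\<theta> a) (\<theta> b)" if "?R S a b" for a b by (rule pres[OF that])
        show "{a, b} = {u, v}" if ab: "?R S a b" "{\<theta> a, \<theta> b} = {\<theta> u, \<theta> v}" for a b
        proof -
          have "\<theta>' ` {\<theta> a, \<theta> b} = \<theta>' ` {\<theta> u, \<theta> v}" using ab(2) by (rule arg_cong)
          then show ?thesis using \<theta>\<theta> sgrD[OF sR ab(1)] V by simp
        qed
      qed
      then show False using uv(3) by blast
    qed
    show "n \<in> S'" using reg_adj_decode[of n S' M k] 1 2 3 by blast
  qed
  have "inj (\<lambda>S. F S ?r)" using sub by (intro injI subset_antisym) metis+
  then show False using no_inj_nat_set by blast
qed

end

text \<open>Without a leaf at the root, deletion of the leaves keeps all neighbours of the root and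
  cannot raise a degree, so the assumptions persist until a leaf appears there.\<close>

theorem no_wuniv_high_degree:
  assumes "rtree V E x par dp" "deg E x = Suc k" "k \<ge> 3" "\<And>z. z \<in> V \<Longrightarrow> z \<noteq> x \<Longrightarrow> deg E z \<le> k"
  shows "\<not> wuniv V E U EU"
  using assms
proof (induction "card V" arbitrary: V E U EU rule: less_induct)
  case less
  note T = less(2)
  show ?case
  proof (cases "\<exists>y. E x y \<and> deg E y = 1")
    case True
    then obtain y where y: "E x y" "deg E y = 1" by blast
    show ?thesis by (rule reg_no_wuniv[OF T less(3) less(5) less(4) y])
  next
    case False
    let ?V = "V - leaves V E" and ?E = "prune V E"
    have d2: "deg E x \<ge> 2" using less(3,4) by simp
    note T' = rtree_prune[OF T d2]
    have nl: "z \<notin> leaves V E" if "E x z" for z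
    proof
      assume z: "z \<in> leaves V E"
      have "z \<in> V" "E z x" using sgrD[OF rtreeD(2)[OF T] that] by blast+
      then have "deg E z \<noteq> 0"
        using sgr_finite_nbrs[OF rtreeD(2,1)[OF T], of z] by (auto simp: deg_def)
      then show False using z False that by (auto simp: leaves_def)
    qed
    have xl: "x \<notin> leaves V E" using d2 by (auto simp: leaves_def)
    have dx: "deg ?E x = Suc k"
    proof -
      have "{w. ?E x w} = {w. E x w}" using nl xl by (auto simp: prune_def)
      then show ?thesis using less(3) by (simp add: deg_def)
    qed
    have dz: "deg ?E z \<le> k" if "z \<in> ?V" "z \<noteq> x" for z
    proof -
      have "deg ?E z \<le> deg E z"
        unfolding deg_def using sgr_finite_nbrs[OF rtreeD(2,1)[OF T], of z] by (intro card_mono) (auto simp: prune_def)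
      then show ?thesis using less(5)[of z] that by fastforce
    qed
    \<comment> \<open>A vertex of maximal depth is a leaf, so the tree really shrinks.\<close>
    have lne: "leaves V E \<noteq> {}"
    proof -
      let ?D = "Max (dp ` V)"
      have "?D \<in> dp ` V" using rtreeD(1,3)[OF T] by (intro Max_in) auto
      then obtain z where z: "z \<in> V" "dp z = ?D" by auto
      have mx: "dp w \<le> ?D" if "w \<in> V" for w using rtreeD(1)[OF T] that by (intro Max_ge) auto
      obtain v where v: "E x v" using d2 by (metis card.empty deg_def empty_Collect_eq not_numeral_le_zero)
      have vV: "v \<in> V" using sgrD[OF rtreeD(2)[OF T] v] by blast
      then have "dp v = 1" using rtree_dp1[OF T vV] v by blast
      then have "z \<noteq> x" using mx[OF vV] z rtreeD(4)[OF T] by auto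
      moreover have "\<not> (\<exists>w\<in>V. w \<noteq> x \<and> par w = z)"
      proof
        assume "\<exists>w\<in>V. w \<noteq> x \<and> par w = z"
        then obtain w where w: "w \<in> V" "w \<noteq> x" "par w = z" by blast
        then show False using rtreeD(6)[OF T w(1,2)] mx[OF w(1)] z(2) by simp
      qed
      ultimately have "z \<in> leaves V E" using leaves_iff[OF T d2 z(1)] by blast
      then show ?thesis by blast
    qed
    have "card ?V < card V"
      using lne rtreeD(1)[OF T] by (intro psubset_card_mono) (auto simp: leaves_def)
    then have nw: "\<not> wuniv ?V ?E U' EU'" for U' EU' using less(1)[OF _ T' dx less(4) dz] by blast
    show ?thesis using prune_wuniv[OF T d2] nw by blast
  qed
qed

text \<open>Deletion of leaves shortens every leg by one. It is repeated as long as all legs have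
  length at least three; then no neighbour of the root becomes a leaf.\<close>

theorem no_wuniv_spider:
  assumes "rtree V E x par dp" "deg E x = 3" "\<And>z. z \<in> V \<Longrightarrow> z \<noteq> x \<Longrightarrow> deg E z \<le> 2"
    "\<And>z. E x z \<Longrightarrow> deg E z \<noteq> 1"
  shows "\<not> wuniv V E U EU"
  using assms
proof (induction "card V" arbitrary: V E U EU rule: less_induct)
  case less
  note T = less(2)
  have d2: "deg E x \<ge> 2" using less(3) by simp
  show ?case
  proof (cases "\<exists>k1 c1. E x k1 \<and> c1 \<in> V \<and> c1 \<noteq> x \<and> par c1 = k1 \<and> deg E c1 = 1")
    case True
    then obtain k1 c1 where c: "E x k1" "c1 \<in> V" "c1 \<noteq> x" "par c1 = k1" "deg E c1 = 1" by blast
    show ?thesis by (rule chain_no_wuniv[OF T less(3) less(4,5) c])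
  next
    case False
    let ?V = "V - leaves V E" and ?E = "prune V E"
    note T' = rtree_prune[OF T d2]
    have finn: "finite {w. E z w}" for z by (rule sgr_finite_nbrs[OF rtreeD(2,1)[OF T]])
    have symE: "E b a \<and> a \<in> V \<and> b \<in> V" if "E a b" for a b using sgrD[OF rtreeD(2)[OF T] that] by blast
    have pos: "deg E z \<noteq> 0" if "E z w" for z w using finn[of z] that by (auto simp: deg_def)
    have nl: "z \<notin> leaves V E" if "E x z" for z
      using less(5)[OF that] pos[of z x] symE[OF that] by (auto simp: leaves_def)
    have xl: "x \<notin> leaves V E" using d2 by (auto simp: leaves_def)
    have nl2: "z \<notin> leaves V E" if "z \<in> V" "z \<noteq> x" "E x (par z)" for z
    proof
      assume "z \<in> leaves V E"
      moreover have "deg E z \<noteq> 1" using False that by blast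
      moreover have "deg E z \<noteq> 0" using pos[of z "par z"] rtreeD(6)[OF T that(1,2)] by blast
      ultimately show False by (auto simp: leaves_def)
    qed
    have dx: "deg ?E x = 3"
    proof -
      have "{w. ?E x w} = {w. E x w}" using nl xl by (auto simp: prune_def)
      then show ?thesis using less(3) by (simp add: deg_def)
    qed
    have dz: "deg ?E z \<le> 2" if "z \<in> ?V" "z \<noteq> x" for z
    proof -
      have "deg ?E z \<le> deg E z" unfolding deg_def using finn[of z] by (intro card_mono) (auto simp: prune_def)
      then show ?thesis using less(4)[of z] that by fastforce
    qed
    have nb: "deg ?E z \<noteq> 1" if "?E x z" for z
    proof -
      have xz: "E x z" using that by (simp add: prune_def)
      have zV: "z \<in> V" "z \<noteq> x" using rtree_root_nbrs[OF T] xz by blast+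
      have "{w. ?E z w} = {w. E z w}"
      proof -
        have "w \<notin> leaves V E" if zw: "E z w" for w
        proof (cases "w = x")
          case False
          have "w = par z \<or> par w = z" using rtreeD(7)[OF T zw] by blast
          moreover have "par z = x" using rtree_root_nbrs[OF T] xz by blast
          ultimately have "par w = z" using False by blast
          then show ?thesis using nl2[of w] False symE[OF zw] xz by simp
        qed (use xl in simp)
        then show ?thesis using nl[OF xz] by (auto simp: prune_def)
      qed
      then show ?thesis using less(5)[OF xz] by (simp add: deg_def)
    qed
    have lne: "leaves V E \<noteq> {}"
    proof -
      let ?D = "Max (dp ` V)"
      have "?D \<in> dp ` V" using rtreeD(1,3)[OF T] by (intro Max_in) auto
      then obtain z where z: "z \<in> V" "dp z = ?D" by auto
      have mx: "dp w \<le> ?D" if "w \<in> V" for w using rtreeD(1)[OF T] that by (intro Max_ge) auto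
      obtain v where v: "E x v" using d2 by (metis card.empty deg_def empty_Collect_eq not_numeral_le_zero)
      have vV: "v \<in> V" using sgrD[OF rtreeD(2)[OF T] v] by blast
      then have "dp v = 1" using rtree_dp1[OF T vV] v by blast
      then have "z \<noteq> x" using mx[OF vV] z rtreeD(4)[OF T] by auto
      moreover have "\<not> (\<exists>w\<in>V. w \<noteq> x \<and> par w = z)"
      proof
        assume "\<exists>w\<in>V. w \<noteq> x \<and> par w = z"
        then obtain w where w: "w \<in> V" "w \<noteq> x" "par w = z" by blast
        then show False using rtreeD(6)[OF T w(1,2)] mx[OF w(1)] z(2) by simp
      qed
      ultimately have "z \<in> leaves V E" using leaves_iff[OF T d2 z(1)] by blast
      then show ?thesis by blast
    qed
    have "card ?V < card V"
      using lne rtreeD(1)[OF T] by (intro psubset_card_mono) (auto simp: leaves_def)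
    then have nw: "\<not> wuniv ?V ?E U' EU'" for U' EU' using less(1)[OF _ T' dx dz nb] by blast
    show ?thesis using prune_wuniv[OF T d2] nw by blast
  qed
qed

section \<open>The theorem for digraphs\<close>

definition arcE :: "'a pair_pre_digraph \<Rightarrow> 'a \<Rightarrow> 'a \<Rightarrow> bool" where
  "arcE G u v \<longleftrightarrow> (u, v) \<in> parcs G"

definition mkG :: "'a set \<Rightarrow> ('a \<Rightarrow> 'a \<Rightarrow> bool) \<Rightarrow> 'a pair_pre_digraph" where
  "mkG V E = \<lparr>pverts = V, parcs = {(u, v). E u v}\<rparr>"

lemma mkG_simps [simp]: "pverts (mkG V E) = V" "arcE (mkG V E) = E"
  by (auto simp: mkG_def arcE_def fun_eq_iff)

lemma bidirected_iff: "pair_bidirected_digraph G \<longleftrightarrow> sgr (pverts G) (arcE G)"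
proof
  assume G: "pair_bidirected_digraph G"
  then have wf: "pair_wf_digraph G" and s: "sym (parcs G)" and l: "\<And>u. (u, u) \<notin> parcs G"
    by (auto simp: pair_bidirected_digraph_def pair_sym_digraph_def pair_sym_digraph_axioms_def symmetric_def
        pair_loopfree_digraph_def pair_loopfree_digraph_axioms_def)
  show "sgr (pverts G) (arcE G)"
    unfolding sgr_def arcE_def using pair_wf_digraph.wellformed'[OF wf] s l by (meson symD)
next
  assume G: "sgr (pverts G) (arcE G)"
  have e: "u \<in> pverts G \<and> v \<in> pverts G \<and> u \<noteq> v \<and> (v, u) \<in> parcs G" if "(u, v) \<in> parcs G" for u v
    using sgrD[OF G, of u v] that by (simp add: arcE_def)
  have "pair_wf_digraph G" using e by unfold_locales auto
  moreover have "sym (parcs G)" using e by (auto intro: symI)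
  moreover have "fst a \<noteq> snd a" if "a \<in> parcs G" for a using e[of "fst a" "snd a"] that by simp
  ultimately show "pair_bidirected_digraph G"
    by (simp add: pair_bidirected_digraph_def pair_sym_digraph_def pair_sym_digraph_axioms_def symmetric_def
        pair_loopfree_digraph_def pair_loopfree_digraph_axioms_def)
qed

lemma countable_graph_iff: "countable_graph (G :: nat pair_pre_digraph) \<longleftrightarrow> sgr (pverts G) (arcE G)"
  by (simp add: countable_graph_def bidirected_iff)

lemma sgr_wf: "sgr (pverts G) (arcE G) \<Longrightarrow> pair_wf_digraph G"
  by (simp add: bidirected_iff[symmetric] pair_bidirected_digraph_def pair_sym_digraph_def)

lemma embeds_iff:
  assumes "sgr (pverts H) (arcE H)" "sgr (pverts G) (arcE G)"
  shows "embeds H G \<longleftrightarrow> (\<exists>f. emb (pverts H) (arcE H) (pverts G) (arcE G) f)"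
    and "induced_embeds H G \<longleftrightarrow> (\<exists>f. iemb (pverts H) (arcE H) (pverts G) (arcE G) f)"
  by (simp_all add: embeds_iff_map[OF sgr_wf[OF assms(1)] sgr_wf[OF assms(2)]]
      induced_embeds_iff_map[OF sgr_wf[OF assms(1)] sgr_wf[OF assms(2)]] emb_def iemb_def arcE_def)

lemma countable_free_iff:
  fixes G :: "nat pair_pre_digraph"
  assumes "sgr (pverts T) (arcE T)"
  shows "countable_free T G \<longleftrightarrow> free (pverts T) (arcE T) (pverts G) (arcE G)"
  using embeds_iff(1)[OF assms, of G] by (auto simp: countable_free_def countable_graph_iff free_def)

lemma weakly_universal_iff:
  assumes T: "sgr (pverts T) (arcE T)"
  shows "(\<exists>U :: nat pair_pre_digraph. weakly_universal T U) \<longleftrightarrow> (\<exists>U EU. wuniv (pverts T) (arcE T) U EU)"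
proof
  assume "\<exists>U :: nat pair_pre_digraph. weakly_universal T U"
  then obtain U :: "nat pair_pre_digraph" where U: "weakly_universal T U" by blast
  have fr: "free (pverts T) (arcE T) (pverts U) (arcE U)"
    using U countable_free_iff[OF T] by (simp add: weakly_universal_def)
  have "\<exists>f. emb V' E' (pverts U) (arcE U) f" if f: "free (pverts T) (arcE T) V' E'" for V' :: "nat set" and E'
  proof -
    have "countable_free T (mkG V' E')" using countable_free_iff[OF T, of "mkG V' E'"] f by simp
    then have "embeds (mkG V' E') U" using U by (simp add: weakly_universal_def)
    then show ?thesis using embeds_iff(1)[of "mkG V' E'" U] f fr by (simp add: free_def)
  qed
  then have "wuniv (pverts T) (arcE T) (pverts U) (arcE U)" using fr by (simp add: wuniv_def)
  then show "\<exists>U EU. wuniv (pverts T) (arcE T) U EU" by blast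
next
  assume "\<exists>U EU. wuniv (pverts T) (arcE T) U EU"
  then obtain U EU where U: "wuniv (pverts T) (arcE T) U EU" by blast
  have fr: "free (pverts T) (arcE T) U EU" using U by (simp add: wuniv_def)
  have "embeds G (mkG U EU)" if "countable_free T G" for G :: "nat pair_pre_digraph"
  proof -
    have f: "free (pverts T) (arcE T) (pverts G) (arcE G)" using countable_free_iff[OF T] that by blast
    then have "\<exists>f. emb (pverts G) (arcE G) U EU f" using U by (simp add: wuniv_def)
    then show ?thesis using embeds_iff(1)[of G "mkG U EU"] f fr by (simp add: free_def)
  qed
  then have "weakly_universal T (mkG U EU)"
    using fr countable_free_iff[OF T, of "mkG U EU"] by (simp add: weakly_universal_def)
  then show "\<exists>U :: nat pair_pre_digraph. weakly_universal T U" by blast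
qed

lemma strongly_universal_if:
  assumes T: "sgr (pverts T) (arcE T)" and "\<exists>U EU. suniv (pverts T) (arcE T) U EU"
  shows "\<exists>U :: nat pair_pre_digraph. strongly_universal T U"
proof -
  obtain U EU where U: "suniv (pverts T) (arcE T) U EU" using assms(2) by blast
  have fr: "free (pverts T) (arcE T) U EU" using U by (simp add: suniv_def)
  have "induced_embeds G (mkG U EU)" if "countable_free T G" for G :: "nat pair_pre_digraph"
  proof -
    have f: "free (pverts T) (arcE T) (pverts G) (arcE G)" using countable_free_iff[OF T] that by blast
    then have "\<exists>f. iemb (pverts G) (arcE G) U EU f" using U by (simp add: suniv_def)
    then show ?thesis using embeds_iff(2)[of G "mkG U EU"] f fr by (simp add: free_def)
  qed
  then have "strongly_universal T (mkG U EU)"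
    using fr countable_free_iff[OF T, of "mkG U EU"] by (simp add: strongly_universal_def)
  then show ?thesis by blast
qed

lemma strong_imp_weak:
  assumes T: "sgr (pverts T) (arcE T)" and U: "strongly_universal T (U :: nat pair_pre_digraph)"
  shows "weakly_universal T U"
proof -
  have fr: "free (pverts T) (arcE T) (pverts U) (arcE U)"
    using U countable_free_iff[OF T] by (simp add: strongly_universal_def)
  have "embeds G U" if "countable_free T G" for G :: "nat pair_pre_digraph"
  proof -
    have sG: "sgr (pverts G) (arcE G)" using countable_free_iff[OF T] that by (simp add: free_def)
    have sU: "sgr (pverts U) (arcE U)" using fr by (simp add: free_def)
    have "induced_embeds G U" using U that by (simp add: strongly_universal_def)
    then show ?thesis using embeds_iff[OF sG sU] iemb_imp_emb[OF sG] by blast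
  qed
  then show ?thesis using U by (simp add: weakly_universal_def strongly_universal_def)
qed

section \<open>Finite trees, paths and near-paths as digraphs\<close>

lemma reach_path:
  assumes "R\<^sup>*\<^sup>* u v"
  shows "\<exists>xs. xs \<noteq> [] \<and> hd xs = u \<and> last xs = v \<and> distinct xs \<and> successively R xs"
  using assms
proof induction
  case base
  then show ?case by (intro exI[of _ "[u]"]) simp
next
  case (step y z)
  then obtain xs where xs: "xs \<noteq> []" "hd xs = u" "last xs = y" "distinct xs" "successively R xs" by blast
  show ?case
  proof (cases "z \<in> set xs")
    case True
    then obtain as bs where ab: "xs = as @ z # bs" by (meson split_list)
    have "successively R ((as @ [z]) @ bs)" using xs(5) ab by simp
    then have "successively R (as @ [z])" unfolding successively_append_iff by blast
    moreover have "hd (as @ [z]) = u" using xs(2) ab by (cases as) auto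
    ultimately show ?thesis using xs(4) ab by (intro exI[of _ "as @ [z]"]) simp
  next
    case False
    have "successively R (xs @ [z])" unfolding successively_append_iff using xs step(2) by simp
    then show ?thesis using xs False by (intro exI[of _ "xs @ [z]"]) simp
  qed
qed

lemma awalk_of_list:
  assumes "successively (arcE G) (u # xs)"
  shows "pre_digraph.cas (with_proj G) u (zip (u # xs) xs) (last (u # xs)) \<and>
    pre_digraph.awalk_verts (with_proj G) u (zip (u # xs) xs) = u # xs \<and> set (zip (u # xs) xs) \<subseteq> parcs G"
  using assms
proof (induction xs arbitrary: u)
  case Nil
  then show ?case by (simp add: pre_digraph.cas.simps pre_digraph.awalk_verts.simps)
next
  case (Cons v xs)
  then have "successively (arcE G) (v # xs)" "(u, v) \<in> parcs G" by (simp_all add: arcE_def)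
  then show ?case using Cons.IH[of v] by (simp add: pre_digraph.cas.simps pre_digraph.awalk_verts.simps)
qed

lemma finite_tree_sgr: "finite_tree T \<Longrightarrow> sgr (pverts T) (arcE T) \<and> finite (pverts T)"
  unfolding bidirected_iff[symmetric] finite_tree_def
  by (auto intro: pair_graph.axioms pair_fin_digraph.pair_finite_verts simp: pair_graph_def pair_digraph_def
      pair_pseudo_graph_def pair_bidirected_digraph_def)

text \<open>The list is closed up by its first vertex, and the arcs between consecutive entries form
  a directed cycle with as many arcs as \<open>xs\<close> has vertices.\<close>

lemma finite_tree_no_cycle:
  assumes T: "finite_tree T" and xs: "pathl (pverts T) (arcE T) xs" "3 \<le> length xs"
  shows "\<not> arcE T (last xs) (hd xs)"
proof
  assume c: "arcE T (last xs) (hd xs)"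
  have ne: "xs \<noteq> []" using xs(2) by auto
  let ?vs = "tl xs @ [hd xs]" and ?u = "hd xs"
  let ?p = "zip (?u # ?vs) ?vs"
  have eq: "?u # ?vs = xs @ [?u]" using ne by simp
  have "successively (arcE T) (?u # ?vs)"
    unfolding eq successively_append_iff using xs(1) c by (simp add: pathl_def)
  note A = awalk_of_list[OF this]
  have "?u \<in> pverts T" using xs(1) ne by (auto simp: pathl_def)
  moreover have "last (?u # ?vs) = ?u" by simp
  ultimately have "pre_digraph.awalk (with_proj T) ?u ?p ?u"
    using A by (simp add: pre_digraph.awalk_def)
  moreover have "distinct (tl (pre_digraph.awalk_verts (with_proj T) ?u ?p))"
  proof -
    have "distinct (hd xs # tl xs)" using xs(1) ne by (simp add: pathl_def)
    then show ?thesis using A by simp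
  qed
  moreover have len: "length ?p = length xs" using ne by simp
  then have "?p \<noteq> []" using xs(2) by (metis length_0_conv not_numeral_le_zero)
  ultimately have "pre_digraph.cycle (with_proj T) ?p" unfolding pre_digraph.cycle_def by blast
  moreover have "3 \<le> length ?p" using len xs(2) by simp
  ultimately show False using T unfolding finite_tree_def by blast
qed

text \<open>\<open>connected\<close> speaks of the symmetric closure, which for a symmetric digraph
  has no new arcs.\<close>

lemma finite_tree_reach:
  assumes T: "finite_tree T"
  shows "pverts T \<noteq> {}" and "u \<in> pverts T \<Longrightarrow> v \<in> pverts T \<Longrightarrow> (arcE T)\<^sup>*\<^sup>* u v"
proof -
  have sg: "sgr (pverts T) (arcE T)" using finite_tree_sgr[OF T] by blast
  have c: "strongly_connected (with_proj (mk_symmetric (with_proj T)))" using T by (simp add: finite_tree_def connected_def)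
  have V: "pverts (mk_symmetric (with_proj T)) = pverts T" by (simp add: mk_symmetric_def)
  have A: "(a, b) \<in> parcs (mk_symmetric (with_proj T)) \<Longrightarrow> arcE T a b" for a b
    using sgrD[OF sg] by (auto simp: mk_symmetric_def arcE_def)
  show "pverts T \<noteq> {}" using c V by (simp add: strongly_connected_def)
  assume uv: "u \<in> pverts T" "v \<in> pverts T"
  then have "u \<rightarrow>\<^sup>*\<^bsub>with_proj (mk_symmetric (with_proj T))\<^esub> v" using c V by (simp add: strongly_connected_def)
  then have "(u, v) \<in> (arcs_ends (with_proj (mk_symmetric (with_proj T))))\<^sup>*" by (rule reachable_rtranclI)
  then have "(u, v) \<in> (parcs (mk_symmetric (with_proj T)))\<^sup>*" by simp
  then show "(arcE T)\<^sup>*\<^sup>* u v"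
    by (induction rule: rtrancl_induct) (auto intro: rtranclp.rtrancl_into_rtrancl dest: A)
qed

lemma finite_tree_conn:
  assumes T: "finite_tree T"
  shows "conn (pverts T) (arcE T)"
  unfolding conn_def
proof (intro allI impI)
  fix X assume X: "X \<subseteq> pverts T" "X \<noteq> {}" "\<forall>u\<in>X. \<forall>v. arcE T u v \<longrightarrow> v \<in> X"
  obtain u where u: "u \<in> X" using X by blast
  have "v \<in> X" if "(arcE T)\<^sup>*\<^sup>* u v" for v using that u by induction (use X(3) in auto)
  then show "X = pverts T" using finite_tree_reach(2)[OF T] u X(1) by blast
qed

text \<open>Depth is the distance to the root and the parent is a neighbour closer to it. An edge
  that joins no vertex to its parent could be bypassed by climbing from both of its ends to the
  root; this closes a cycle of length at least three.\<close>

lemma finite_tree_rtree: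
  assumes T: "finite_tree T" and x: "x \<in> pverts T"
  obtains par dp where "rtree (pverts T) (arcE T) x par dp"
proof -
  let ?E = "arcE T" and ?V = "pverts T"
  have sg: "sgr ?V ?E" and fin: "finite ?V" using finite_tree_sgr[OF T] by blast+
  define dp where "dp = (\<lambda>z. LEAST n. (?E ^^ n) z x)"
  have ex: "\<exists>n. (?E ^^ n) z x" if "z \<in> ?V" for z
    using finite_tree_reach(2)[OF T that x] by (simp add: rtranclp_power)
  have dpI: "(?E ^^ dp z) z x" if "z \<in> ?V" for z unfolding dp_def using ex[OF that] by (rule LeastI_ex)
  have dpL: "dp z \<le> n" if "(?E ^^ n) z x" for z n unfolding dp_def using that by (rule Least_le)
  have dp0: "dp z = 0 \<longleftrightarrow> z = x" if "z \<in> ?V" for z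
    using dpI[OF that] dpL[of 0 z] by auto
  have "\<exists>y. ?E z y \<and> dp z = Suc (dp y)" if z: "z \<in> ?V" "z \<noteq> x" for z
  proof -
    obtain m where m: "dp z = Suc m" using dp0[OF z(1)] z(2) by (metis not0_implies_Suc)
    then obtain y where y: "?E z y" "(?E ^^ m) y x" using dpI[OF z(1)] relpowp_Suc_D2 by metis
    have yV: "y \<in> ?V" using sgrD[OF sg y(1)] by blast
    have "(?E ^^ Suc (dp y)) z x" using y(1) dpI[OF yV] by (rule relpowp_Suc_I2)
    then have "dp z \<le> Suc (dp y)" by (rule dpL)
    then show ?thesis using y(1) dpL[OF y(2)] m by (intro exI[of _ y]) simp
  qed
  then obtain par where par: "\<And>z. z \<in> ?V \<Longrightarrow> z \<noteq> x \<Longrightarrow> ?E z (par z) \<and> dp z = Suc (dp (par z))" by metis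
  have edge: "(z \<noteq> x \<and> w = par z) \<or> (w \<noteq> x \<and> z = par w)" if zw: "?E z w" for z w
  proof (rule ccontr)
    assume no: "\<not> ?thesis"
    let ?R = "\<lambda>a b. ?E a b \<and> {a, b} \<noteq> {z, w}"
    have zwV: "z \<in> ?V" "w \<in> ?V" "z \<noteq> w" "?E w z" using sgrD[OF sg zw] by blast+
    have up: "v \<in> ?V \<Longrightarrow> ?R\<^sup>*\<^sup>* v x" for v
    proof (induction "dp v" arbitrary: v)
      case 0
      then show ?case using dp0[of v] by simp
    next
      case (Suc n)
      then have "v \<noteq> x" using dp0[of v] by auto
      note P = par[OF Suc(3) this]
      have "{v, par v} \<noteq> {z, w}" using no \<open>v \<noteq> x\<close> by (auto simp: doubleton_eq_iff)
      moreover have "?R\<^sup>*\<^sup>* (par v) x" using Suc(1)[of "par v"] Suc(2) P sgrD[OF sg] by (metis nat.inject)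
      ultimately show ?case using P by (intro converse_rtranclp_into_rtranclp[of ?R v "par v"]) auto
    qed
    have "?R\<^sup>*\<^sup>* a b \<Longrightarrow> ?R\<^sup>*\<^sup>* b a" for a b
    proof (induction rule: rtranclp_induct)
      case (step y y')
      then have "?R y' y" using sgrD[OF sg, of y y'] by (simp add: insert_commute)
      then show ?case using step(3) by (rule converse_rtranclp_into_rtranclp)
    qed simp
    then have "?R\<^sup>*\<^sup>* z w" using up[OF zwV(1)] up[OF zwV(2)] by (meson rtranclp_trans)
    from reach_path[OF this] obtain xs where xs: "xs \<noteq> []" "hd xs = z" "last xs = w" "distinct xs" "successively ?R xs" by blast
    have "successively ?E xs" using xs(5) by (rule successively_mono) blast
    moreover have "set xs \<subseteq> ?V"
    proof
      fix a assume "a \<in> set xs"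
      then obtain as bs where ab: "xs = as @ a # bs" by (meson split_list)
      show "a \<in> ?V"
      proof (cases bs)
        case Nil
        then show ?thesis using xs(3) ab zwV by simp
      next
        case (Cons b bs')
        then have "?E a b" using \<open>successively ?E xs\<close> ab by (simp add: successively_append_iff)
        from sgrD[OF sg this] show ?thesis by blast
      qed
    qed
    ultimately have p: "pathl ?V ?E xs" using xs(4) by (simp add: pathl_def)
    have "3 \<le> length xs"
    proof (rule ccontr)
      assume "\<not> 3 \<le> length xs"
      then consider a where "xs = [a]" | a b where "xs = [a, b]"
        using xs(1) by (cases xs; cases "tl xs"; cases "tl (tl xs)") auto
      then show False using xs(2,3,5) zwV(3) by cases auto
    qed
    from finite_tree_no_cycle[OF T p this] show False using xs(2,3) zwV(4) by simp
  qed
  have 1: "\<forall>z\<in>?V. dp z = 0 \<longleftrightarrow> z = x" by (intro ballI dp0)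
  have 2: "\<forall>z\<in>?V - {x}. ?E z (par z) \<and> dp z = Suc (dp (par z))" by (intro ballI par) auto
  have 3: "\<forall>z w. ?E z w \<longrightarrow> z \<noteq> x \<and> w = par z \<or> w \<noteq> x \<and> z = par w" by (intro allI impI edge)
  have "rtree ?V ?E x par dp"
    unfolding rtree_def by (intro conjI fin sg x 1 2 3)
  then show thesis by (rule that)
qed

text \<open>The path is unrolled at \<open>x\<close>: vertices receive their depth as position,
  negative in the branch of \<open>k1\<close>. The positions are closed under steps towards
  \<open>0\<close>, hence fill an interval of integers, which is then shifted to start at
  \<open>0\<close>.\<close>

lemma path_numbering:
  assumes T: "rtree V E x par dp" and d: "\<And>z. z \<in> V \<Longrightarrow> deg E z \<le> 2"
  obtains \<rho> n where "bij_betw \<rho> V {..<n}" "\<And>u v. u \<in> V \<Longrightarrow> v \<in> V \<Longrightarrow> E u v \<longleftrightarrow> \<rho> u = Suc (\<rho> v) \<or> \<rho> v = Suc (\<rho> u)"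
proof -
  let ?K = "{w. E x w}"
  let ?b = "branch par dp"
  have finK: "finite ?K" by (rule sgr_finite_nbrs[OF rtreeD(2,1)[OF T]])
  have K2: "card ?K \<le> 2" using d[OF rtreeD(3)[OF T]] by (simp add: deg_def)
  have "\<exists>k1. \<forall>a\<in>?K - {k1}. \<forall>b\<in>?K - {k1}. a = b"
  proof (cases "?K = {}")
    case False
    then obtain k1 where "k1 \<in> ?K" by blast
    then have "card (?K - {k1}) \<le> Suc 0" using K2 finK by simp
    then have "\<forall>a\<in>?K - {k1}. \<forall>b\<in>?K - {k1}. a = b"
      using card_le_Suc0_iff_eq[of "?K - {k1}"] finK by (metis finite_Diff)
    then show ?thesis by blast
  qed simp
  then obtain k1 where k1: "\<And>a b. E x a \<Longrightarrow> E x b \<Longrightarrow> a \<noteq> k1 \<Longrightarrow> b \<noteq> k1 \<Longrightarrow> a = b" by blast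
  define pos where "pos = (\<lambda>z. if z = x then 0 else if ?b z = k1 then - int (dp z) else int (dp z))"
  have dp1: "dp z \<ge> 1" if "z \<in> V" "z \<noteq> x" for z using rtreeD(6)[OF T that] by simp
  have d': "deg E z \<le> 2" if "z \<in> V" "z \<noteq> x" for z using d that by blast
  have inj: "z = w" if zw: "z \<in> V" "w \<in> V" "pos z = pos w" for z w
  proof -
    consider "z = x" | "w = x" | "z \<noteq> x" "w \<noteq> x" by blast
    then show ?thesis
    proof cases
      case 1
      then show ?thesis using zw dp1[of w] by (auto simp: pos_def split: if_splits)
    next
      case 2
      then show ?thesis using zw dp1[of z] by (auto simp: pos_def split: if_splits)
    next
      case 3
      have "dp z = dp w \<and> (?b z = k1 \<longleftrightarrow> ?b w = k1)"
        using zw 3 dp1[OF zw(1) 3(1)] dp1[OF zw(2) 3(2)] by (auto simp: pos_def split: if_splits)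
      moreover have "?b z = ?b w"
        using calculation k1[OF branch_nbr[OF T zw(1) 3(1)] branch_nbr[OF T zw(2) 3(2)]] by metis
      ultimately show ?thesis using branch_dp_unique[OF T d' zw(1,2) 3] by blast
    qed
  qed
  have pp: "pos (par z) = pos z - sgn (pos z) \<and> pos z \<noteq> 0" if z: "z \<in> V" "z \<noteq> x" for z
  proof (cases "par z = x")
    case True
    then show ?thesis using branch_simps(1)[OF T z True] z(2) by (auto simp: pos_def)
  next
    case False
    note b = branch_simps(2)[OF T z False] and P = rtreeD(6)[OF T z]
    have "int (dp z) = int (dp (par z)) + 1" "int (dp z) > 0" using P by simp_all
    then show ?thesis using b False z(2) by (auto simp: pos_def)
  qed
  have E1: "E u v \<longleftrightarrow> \<bar>pos u - pos v\<bar> = 1" if uv: "u \<in> V" "v \<in> V" for u v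
  proof
    have e: "\<bar>pos z - pos (par z)\<bar> = 1" if "z \<in> V" "z \<noteq> x" for z using pp[OF that] by (auto simp: sgn_if)
    assume "E u v"
    then show "\<bar>pos u - pos v\<bar> = 1" using rtreeD(7)[OF T \<open>E u v\<close>] e[of u] e[of v] uv by (auto simp: abs_minus_commute)
  next
    assume a: "\<bar>pos u - pos v\<bar> = 1"
    have x0: "pos x = 0" by (simp add: pos_def)
    have par_eq: "par z = w" if "z \<in> V" "w \<in> V" "z \<noteq> x" "pos w = pos z - sgn (pos z)" for z w
      using inj[of "par z" w] pp[OF that(1,3)] rtreeD(6)[OF T that(1,3)] that by simp
    have nx: "z \<noteq> x" if "pos z \<noteq> 0" for z using that x0 by auto
    have "(pos u \<noteq> 0 \<and> pos v = pos u - sgn (pos u)) \<or> (pos v \<noteq> 0 \<and> pos u = pos v - sgn (pos v))"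
      using a by (auto simp: sgn_if)
    then show "E u v"
    proof
      assume b: "pos u \<noteq> 0 \<and> pos v = pos u - sgn (pos u)"
      then have "par u = v" using par_eq[OF uv(1,2)] nx by blast
      then show ?thesis using rtreeD(6)[OF T uv(1)] nx b by blast
    next
      assume b: "pos v \<noteq> 0 \<and> pos u = pos v - sgn (pos v)"
      then have "par v = u" using par_eq[OF uv(2,1)] nx by blast
      then show ?thesis using rtreeD(6)[OF T uv(2)] nx b by blast
    qed
  qed
  let ?I = "pos ` V"
  have xV: "x \<in> V" by (rule rtreeD(3)[OF T])
  have I0: "0 \<in> ?I" using xV by (auto simp: pos_def image_iff intro!: bexI[of _ x])
  have fI: "finite ?I" using rtreeD(1)[OF T] by simp
  have step: "i - sgn i \<in> ?I" if i: "i \<in> ?I" "i \<noteq> 0" for i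
  proof -
    obtain z where z: "z \<in> V" "i = pos z" using i(1) by blast
    have "z \<noteq> x" using i(2) z(2) by (auto simp: pos_def)
    from pp[OF z(1) this] rtreeD(6)[OF T z(1) this] z(2) show ?thesis by (metis imageI)
  qed
  have posI: "int j \<in> ?I \<Longrightarrow> i \<le> j \<Longrightarrow> int i \<in> ?I" for i j
  proof (induction j)
    case (Suc j)
    then show ?case using step[of "int (Suc j)"] by (cases "i = Suc j") auto
  qed simp
  have negI: "- int j \<in> ?I \<Longrightarrow> i \<le> j \<Longrightarrow> - int i \<in> ?I" for i j
  proof (induction j)
    case (Suc j)
    then show ?case using step[of "- int (Suc j)"] by (cases "i = Suc j") auto
  qed simp
  have I: "?I = {Min ?I..Max ?I}"
  proof
    show "?I \<subseteq> {Min ?I..Max ?I}" using fI by auto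
    show "{Min ?I..Max ?I} \<subseteq> ?I"
    proof
      fix i assume i: "i \<in> {Min ?I..Max ?I}"
      have i': "Min ?I \<le> i" "i \<le> Max ?I" using i by (simp_all only: atLeastAtMost_iff)
      have M: "Max ?I \<in> ?I" "Min ?I \<in> ?I" using fI I0 by (auto intro: Max_in Min_in)
      show "i \<in> ?I"
      proof (cases "0 \<le> i")
        case True
        have e: "int (nat (Max ?I)) = Max ?I" "int (nat i) = i" using True i' by linarith+
        have "int (nat (Max ?I)) \<in> ?I" unfolding e(1) by (rule M(1))
        from posI[OF this nat_mono[OF i'(2)]] show ?thesis unfolding e(2) .
      next
        case False
        have e: "- int (nat (- Min ?I)) = Min ?I" "- int (nat (- i)) = i" using False i' by linarith+
        have "- int (nat (- Min ?I)) \<in> ?I" unfolding e(1) by (rule M(2))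
        moreover have "nat (- i) \<le> nat (- Min ?I)" using i'(1) by linarith
        ultimately show ?thesis using negI[of "nat (- Min ?I)" "nat (- i)"] unfolding e(2) by blast
      qed
    qed
  qed
  define m where "m = Min ?I"
  define n where "n = nat (Max ?I - m + 1)"
  define \<rho> where "\<rho> = (\<lambda>z. nat (pos z - m))"
  have ge: "m \<le> pos z" if "z \<in> V" for z unfolding m_def using fI that by simp
  have bij: "bij_betw \<rho> V {..<n}"
    unfolding bij_betw_def
  proof
    show "inj_on \<rho> V"
    proof (rule inj_onI)
      fix z w assume zw: "z \<in> V" "w \<in> V" "\<rho> z = \<rho> w"
      then have "pos z = pos w" using ge[of z] ge[of w] by (simp add: \<rho>_def)
      then show "z = w" using inj zw by blast
    qed
    have "\<rho> ` V = (\<lambda>i. nat (i - m)) ` ?I" by (simp add: \<rho>_def image_image)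
    also have "\<dots> = (\<lambda>i. nat (i - m)) ` {m..Max ?I}" using I by (simp add: m_def)
    also have "\<dots> = {..<n}"
    proof
      show "(\<lambda>i. nat (i - m)) ` {m..Max ?I} \<subseteq> {..<n}" by (auto simp: n_def)
      show "{..<n} \<subseteq> (\<lambda>i. nat (i - m)) ` {m..Max ?I}"
      proof
        fix j assume "j \<in> {..<n}"
        then show "j \<in> (\<lambda>i. nat (i - m)) ` {m..Max ?I}" by (intro image_eqI[of _ _ "m + int j"]) (auto simp: n_def)
      qed
    qed
    finally show "\<rho> ` V = {..<n}" .
  qed
  have "E u v \<longleftrightarrow> \<rho> u = Suc (\<rho> v) \<or> \<rho> v = Suc (\<rho> u)" if uv: "u \<in> V" "v \<in> V" for u v
    using E1[OF uv] ge[OF uv(1)] ge[OF uv(2)] by (auto simp: \<rho>_def)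
  then show thesis using that[OF bij] by blast
qed

lemma is_path_if_numbering:
  assumes wf: "pair_wf_digraph P" and ne: "pverts P \<noteq> {}" and bij: "bij_betw \<rho> (pverts P) {..<n}"
    and E: "\<And>u v. u \<in> pverts P \<Longrightarrow> v \<in> pverts P \<Longrightarrow> arcE P u v \<longleftrightarrow> \<rho> u = Suc (\<rho> v) \<or> \<rho> v = Suc (\<rho> u)"
  shows "is_path P"
proof -
  have inj: "inj_on \<rho> (pverts P)" and img: "\<rho> ` pverts P = {..<n}" using bij by (auto simp: bij_betw_def)
  have "{(i, j). i < n \<and> j < n \<and> (j = Suc i \<or> i = Suc j)} = map_prod \<rho> \<rho> ` parcs P" (is "?L = ?R")
  proof (intro equalityI subsetI)
    fix e assume "e \<in> ?L"
    then obtain i j where e: "e = (i, j)" "i < n" "j < n" "j = Suc i \<or> i = Suc j" by auto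
    have "i \<in> \<rho> ` pverts P" "j \<in> \<rho> ` pverts P" using e(2,3) img by auto
    then obtain u v where uv: "u \<in> pverts P" "v \<in> pverts P" "i = \<rho> u" "j = \<rho> v" by blast
    then have "(u, v) \<in> parcs P" using E[OF uv(1,2)] e(4) by (auto simp: arcE_def)
    then show "e \<in> ?R" using e(1) uv by (intro image_eqI[of _ _ "(u, v)"]) simp_all
  next
    fix e assume "e \<in> ?R"
    then obtain u v where uv: "(u, v) \<in> parcs P" "e = (\<rho> u, \<rho> v)" by auto
    have V: "u \<in> pverts P" "v \<in> pverts P" using pair_wf_digraph.wellformed'[OF wf uv(1)] by auto
    then have "\<rho> u < n" "\<rho> v < n" using img by auto
    moreover have "\<rho> u = Suc (\<rho> v) \<or> \<rho> v = Suc (\<rho> u)" using E[OF V] uv(1) by (simp add: arcE_def)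
    ultimately show "e \<in> ?L" using uv(2) by auto
  qed
  then have "digraph_iso P (standard_path n)"
    unfolding digraph_iso_iff_map[OF wf] standard_path_def using inj img by (intro exI[of _ \<rho>]) simp
  moreover have "n \<ge> 1" using img ne by (cases n) auto
  ultimately show ?thesis unfolding is_path_def by blast
qed

lemma is_path_numbering:
  assumes "is_path P"
  obtains \<rho> n where "inj_on \<rho> (pverts P)" "\<rho> ` pverts P \<subseteq> {..<n}"
    "\<And>u v. arcE P u v \<Longrightarrow> u \<in> pverts P \<and> v \<in> pverts P \<and> (\<rho> u = Suc (\<rho> v) \<or> \<rho> v = Suc (\<rho> u))"
proof -
  obtain n where iso: "digraph_iso P (standard_path n)" using assms unfolding is_path_def by blast
  then have wf: "pair_wf_digraph P"
    by (auto simp: digraph_iso_def pre_digraph.digraph_isomorphism_def wf_digraph_wp_iff)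
  obtain \<rho> where \<rho>: "inj_on \<rho> (pverts P)" "standard_path n = \<lparr>pverts = \<rho> ` pverts P, parcs = map_prod \<rho> \<rho> ` parcs P\<rparr>"
    using iso unfolding digraph_iso_iff_map[OF wf] by blast
  have img: "\<rho> ` pverts P = {..<n}" and arcs: "map_prod \<rho> \<rho> ` parcs P = {(i, j). i < n \<and> j < n \<and> (j = Suc i \<or> i = Suc j)}"
    using \<rho>(2) by (simp_all add: standard_path_def)
  show thesis
  proof (rule that[OF \<rho>(1)])
    show "\<rho> ` pverts P \<subseteq> {..<n}" using img by simp
    fix u v assume uv: "arcE P u v"
    then have "(\<rho> u, \<rho> v) \<in> map_prod \<rho> \<rho> ` parcs P" by (force simp: arcE_def)
    then have "\<rho> u = Suc (\<rho> v) \<or> \<rho> v = Suc (\<rho> u)" unfolding arcs by auto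
    then show "u \<in> pverts P \<and> v \<in> pverts P \<and> (\<rho> u = Suc (\<rho> v) \<or> \<rho> v = Suc (\<rho> u))"
      using pair_wf_digraph.wellformed'[OF wf, of u v] uv by (simp add: arcE_def)
  qed
qed

lemma is_path_deg:
  assumes "is_path P" "x \<in> pverts P"
  shows "deg (arcE P) x \<le> 2"
proof -
  obtain \<rho> n where \<rho>: "inj_on \<rho> (pverts P)"
    "\<And>u v. arcE P u v \<Longrightarrow> u \<in> pverts P \<and> v \<in> pverts P \<and> (\<rho> u = Suc (\<rho> v) \<or> \<rho> v = Suc (\<rho> u))"
    using is_path_numbering[OF assms(1)] by metis
  have "\<rho> ` {w. arcE P x w} \<subseteq> {Suc (\<rho> x), \<rho> x - 1}" using \<rho>(2) by fastforce
  then have "card (\<rho> ` {w. arcE P x w}) \<le> card {Suc (\<rho> x), \<rho> x - 1}" by (intro card_mono) auto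
  also have "\<dots> \<le> 2" by (simp add: card_insert_if)
  finally have "card (\<rho> ` {w. arcE P x w}) \<le> 2" .
  moreover have "inj_on \<rho> {w. arcE P x w}" using \<rho> by (meson inj_on_subset mem_Collect_eq subsetI)
  ultimately show ?thesis by (simp add: deg_def card_image)
qed

lemma out_degree_deg: "out_degree (with_proj T) v = deg (arcE T) v"
proof -
  have "out_arcs (with_proj T) v = Pair v ` {w. arcE T v w}" by (auto simp: out_arcs_def arcE_def)
  then show ?thesis by (simp add: out_degree_def deg_def card_image inj_on_def)
qed

lemma path_or_near_path_suniv:
  assumes T: "finite_tree T" and p: "is_path T \<or> is_near_path T"
  shows "\<exists>U EU. suniv (pverts T) (arcE T) U EU"
proof -
  have sg: "sgr (pverts T) (arcE T)" and fin: "finite (pverts T)" using finite_tree_sgr[OF T] by blast+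
  note cn = finite_tree_conn[OF T] and ne = finite_tree_reach(1)[OF T]
  from p show ?thesis
  proof
    assume "is_path T"
    then obtain \<rho> n where "inj_on \<rho> (pverts T)" "\<rho> ` pverts T \<subseteq> {..<n}"
      "\<And>u v. arcE T u v \<Longrightarrow> u \<in> pverts T \<and> v \<in> pverts T \<and> (\<rho> u = Suc (\<rho> v) \<or> \<rho> v = Suc (\<rho> u))"
      by (rule is_path_numbering) blast
    then show ?thesis by (rule path_suniv) (assumption | fact cn ne sg fin)+
  next
    assume "is_near_path T"
    then obtain P v w where P: "is_path P" "v \<in> pverts P" "w \<notin> pverts P" "T = attach_leaf P v w"
      unfolding is_near_path_def by blast
    obtain \<rho> n where \<rho>: "inj_on \<rho> (pverts P)" "\<rho> ` pverts P \<subseteq> {..<n}"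
      "\<And>u v. arcE P u v \<Longrightarrow> u \<in> pverts P \<and> v \<in> pverts P \<and> (\<rho> u = Suc (\<rho> v) \<or> \<rho> v = Suc (\<rho> u))"
      using P(1) by (rule is_path_numbering) blast
    have VT: "pverts T - {w} = pverts P" using P(3,4) by (simp add: attach_leaf_def)
    have ET: "a \<in> pverts T - {w} \<and> b \<in> pverts T - {w} \<and> (\<rho> a = Suc (\<rho> b) \<or> \<rho> b = Suc (\<rho> a)) \<or>
        (a, b) = (v, w) \<or> (a, b) = (w, v)" if "arcE T a b" for a b
      unfolding VT using that \<rho>(3)[of a b] P(4) by (auto simp: attach_leaf_def arcE_def)
    show ?thesis
    proof (rule near_path_suniv[where v = v and w = w and n = n and \<rho> = \<rho>])
      show "inj_on \<rho> (pverts T - {w})" "\<rho> ` (pverts T - {w}) \<subseteq> {..<n}" "v \<in> pverts T - {w}"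
        unfolding VT using \<rho>(1,2) P(2) by blast+
    qed (fact ET cn sg fin)+
  qed
qed

text \<open>The degree of the unique vertex of maximal degree decides. Up to two, the tree is a
  path; from four on there is no universal graph; for three, only a tree with a leaf at the root
  remains, and without this leaf all degrees are at most two.\<close>

lemma wuniv_path_or_near_path:
  assumes T: "finite_tree T" and x: "\<exists>!v. max_degree_vertex T v" and U: "wuniv (pverts T) (arcE T) U EU"
  shows "is_path T \<or> is_near_path T"
proof -
  let ?V = "pverts T" and ?E = "arcE T"
  have sg: "sgr ?V ?E" and fin: "finite ?V" using finite_tree_sgr[OF T] by blast+
  obtain x where mx: "max_degree_vertex T x" "\<And>v. max_degree_vertex T v \<Longrightarrow> v = x" using x by blast
  have xV: "x \<in> ?V" and le: "\<And>w. w \<in> ?V \<Longrightarrow> deg ?E w \<le> deg ?E x"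
    using mx(1) by (simp_all add: max_degree_vertex_def out_degree_deg)
  have lt: "deg ?E w < deg ?E x" if w: "w \<in> ?V" "w \<noteq> x" for w
  proof (rule ccontr)
    assume "\<not> ?thesis"
    then have "max_degree_vertex T w" using le w by (fastforce simp: max_degree_vertex_def out_degree_deg)
    then show False using mx(2) w(2) by blast
  qed
  obtain par dp where R: "rtree ?V ?E x par dp" by (rule finite_tree_rtree[OF T xV])
  consider "deg ?E x \<le> 2" | "deg ?E x = 3" | "deg ?E x \<ge> 4" by linarith
  then show ?thesis
  proof cases
    case 1
    have d: "deg ?E z \<le> 2" if "z \<in> ?V" for z using le[OF that] 1 by simp
    obtain \<rho> n where \<rho>: "bij_betw \<rho> ?V {..<n}"
      "\<And>u v. u \<in> ?V \<Longrightarrow> v \<in> ?V \<Longrightarrow> ?E u v \<longleftrightarrow> \<rho> u = Suc (\<rho> v) \<or> \<rho> v = Suc (\<rho> u)"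
      using path_numbering[OF R d] by metis
    have "is_path T" by (rule is_path_if_numbering[OF sgr_wf[OF sg] _ \<rho>]) (use xV in auto)
    then show ?thesis ..
  next
    case 3
    then obtain k where k: "deg ?E x = Suc k" "k \<ge> 3" by (cases "deg ?E x") auto
    have "deg ?E z \<le> k" if "z \<in> ?V" "z \<noteq> x" for z using lt[OF that] k(1) by simp
    then show ?thesis using no_wuniv_high_degree[OF R k] U by blast
  next
    case 2
    have d2: "deg ?E z \<le> 2" if "z \<in> ?V" "z \<noteq> x" for z using lt[OF that] 2 by simp
    have "\<exists>y. ?E x y \<and> deg ?E y = 1"
    proof (rule ccontr)
      assume "\<not> ?thesis"
      then have "deg ?E z \<noteq> 1" if "?E x z" for z using that by blast
      then show False using no_wuniv_spider[OF R 2 d2] U by blast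
    qed
    then obtain y where y: "?E x y" "deg ?E y = 1" by blast
    have yV: "y \<in> ?V" "y \<noteq> x" "?E y x" using sgrD[OF sg y(1)] by blast+
    have ynb: "w = x" if "?E y w" for w
    proof -
      have "{w. ?E y w} = {x}" using y(2) yV(3) unfolding deg_def by (metis card_1_singletonE mem_Collect_eq singletonD)
      then show ?thesis using that by blast
    qed
    let ?P = "mkG (?V - {y}) (\<lambda>a b. ?E a b \<and> a \<noteq> y \<and> b \<noteq> y)"
    let ?EP = "\<lambda>a b. ?E a b \<and> a \<noteq> y \<and> b \<noteq> y"
    have sP: "sgr (?V - {y}) ?EP" using sg by (auto simp: sgr_def)
    have pary: "par z \<noteq> y" if "z \<in> ?V" "z \<noteq> x" for z using rtreeD(6)[OF R that] ynb that(2) by metis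
    have RP: "rtree (?V - {y}) ?EP x par dp"
      unfolding rtree_def using sP fin xV yV(2) rtreeD[OF R] pary by auto
    have dP: "deg ?EP z \<le> 2" if z: "z \<in> ?V - {y}" for z
    proof (cases "z = x")
      case True
      have "{w. ?EP x w} = {w. ?E x w} - {y}" using yV(2) by auto
      then show ?thesis using True 2 y(1) by (simp add: deg_def)
    next
      case False
      have "deg ?EP z \<le> deg ?E z" unfolding deg_def using sgr_finite_nbrs[OF sg fin] by (intro card_mono) auto
      then show ?thesis using d2[of z] z False by simp
    qed
    obtain \<rho> n where \<rho>: "bij_betw \<rho> (?V - {y}) {..<n}"
      "\<And>u v. u \<in> ?V - {y} \<Longrightarrow> v \<in> ?V - {y} \<Longrightarrow> ?EP u v \<longleftrightarrow> \<rho> u = Suc (\<rho> v) \<or> \<rho> v = Suc (\<rho> u)"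
      using path_numbering[OF RP dP] by metis
    have "is_path ?P"
    proof (rule is_path_if_numbering)
      show "pair_wf_digraph ?P" using sP by (intro sgr_wf) simp
      show "pverts ?P \<noteq> {}" using xV yV(2) by auto
      show "bij_betw \<rho> (pverts ?P) {..<n}" using \<rho>(1) by simp
      show "arcE ?P u v \<longleftrightarrow> \<rho> u = Suc (\<rho> v) \<or> \<rho> v = Suc (\<rho> u)" if "u \<in> pverts ?P" "v \<in> pverts ?P" for u v
        using \<rho>(2)[of u v] that by simp
    qed
    moreover have "T = attach_leaf ?P x y"
    proof -
      have "pverts T = insert y (?V - {y})" using yV(1) by blast
      moreover have "parcs T = {(a, b). ?EP a b} \<union> {(x, y), (y, x)}"
      proof (intro equalityI subrelI)
        fix a b assume "(a, b) \<in> parcs T"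
        then have ab: "?E a b" by (simp add: arcE_def)
        then have "?E b a" using sgrD[OF sg ab] by blast
        then show "(a, b) \<in> {(a, b). ?EP a b} \<union> {(x, y), (y, x)}" using ab ynb by blast
      next
        fix a b assume "(a, b) \<in> {(a, b). ?EP a b} \<union> {(x, y), (y, x)}"
        then show "(a, b) \<in> parcs T" using y(1) yV(3) by (auto simp: arcE_def)
      qed
      ultimately show ?thesis by (simp add: attach_leaf_def mkG_def)
    qed
    moreover have "x \<in> pverts ?P" "y \<notin> pverts ?P" using xV yV(2) by auto
    moreover have "\<not> is_path T" using is_path_deg[OF _ xV] 2 by fastforce
    ultimately have "is_near_path T" using T unfolding is_near_path_def by blast
    then show ?thesis ..
  qed
qed

theorem theorem2:
  fixes T :: "'a pair_pre_digraph"
  assumes "finite_tree T"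
    and "\<exists>!v. max_degree_vertex T v"
  shows "((\<exists>U :: nat pair_pre_digraph. strongly_universal T U) \<longleftrightarrow>
          (\<exists>U :: nat pair_pre_digraph. weakly_universal T U)) \<and>
         ((\<exists>U :: nat pair_pre_digraph. weakly_universal T U) \<longleftrightarrow>
          is_path T \<or> is_near_path T)"
proof -
  have sg: "sgr (pverts T) (arcE T)" using finite_tree_sgr[OF assms(1)] by blast
  have 1: "\<exists>U :: nat pair_pre_digraph. weakly_universal T U"
    if "\<exists>U :: nat pair_pre_digraph. strongly_universal T U"
    using that strong_imp_weak[OF sg] by blast
  have 2: "is_path T \<or> is_near_path T" if "\<exists>U :: nat pair_pre_digraph. weakly_universal T U"
    using that wuniv_path_or_near_path[OF assms] unfolding weakly_universal_iff[OF sg] by blast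
  have 3: "\<exists>U :: nat pair_pre_digraph. strongly_universal T U" if "is_path T \<or> is_near_path T"
    using strongly_universal_if[OF sg path_or_near_path_suniv[OF assms(1) that]] .
  show ?thesis using 1 2 3 by blast
qed

end
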